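(* Let $\lambda>0$ and, for $N\in\mathbb{N}$, let $H_N$ be the stationary solution of the regularised AKPZ equation on $\mathbb{T}_N^2$ (started from the invariant measure). For any compactly supported test function $\varphi$ on $\mathbb{R}^2$ there exists $c_\varphi>0$ such that, for every $t>0$, $$\limsup_{N\to\infty}\ \mathbf{E}\big[(H_N(t)[\varphi]-H_N(0)[\varphi])^2\big]\le c_\varphi(1+\lambda^2)\max(\log t,1).$$
   Context: Test functions are real-valued, at least $C^1$ and of compact support. For $N\in\mathbb{N}$, $\mathbb{T}_N^2$ is the two-dimensional torus of side length $2\pi N$ (identified with $[-\pi N,\pi N)^2$; for $N$ large a compactly supported $\varphi$ is regarded as a function on $\mathbb{T}_N^2$), and $\mathbb{Z}_N=\mathbb{Z}/N$. The Fourier transform on $\mathbb{T}_N^2$ is $\hat w(k)=\int_{\mathbb{T}_N^2}w(x)e_{-k}(x)\,dx$ for $k\in\mathbb{Z}_N^2$, with $e_k(x)=\frac1{2\pi}e^{ik\cdot x}$. For $M>0$, $\Pi_M$ is the Fourier cut-off $\widehat{\Pi_Mw}(k)=\hat w(k)\mathbf 1_{|k|\le M}$, with $|\cdot|$ the Euclidean norm. The regularised AKPZ equation on $\mathbb{T}_N^2$ is $$\partial_tH_N=\tfrac12\Delta H_N+\lambda\,\tilde{\mathcal N}[H_N]+\xi,\qquad H_N(0)=\tilde\eta,\qquad \tilde{\mathcal N}[H_N]=\Pi_1\big((\Pi_1\partial_1H_N)^2-(\Pi_1\partial_2H_N)^2\big),$$ where $\xi$ is a space-time white noise on $\mathbb{R}_+\times\mathbb{T}_N^2$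 and $\tilde\eta$ is an independent Gaussian free field on $\mathbb{T}_N^2$ with zero $0$-th Fourier mode, i.e. a centred Gaussian field with $\mathbb{E}[\tilde\eta(\varphi)\tilde\eta(\psi)]=\langle(-\Delta)^{-1}\varphi,\psi\rangle_{L^2(\mathbb{T}_N^2)}$ for zero-mean $\varphi,\psi$. The Gaussian free field is stationary for (the non-zero Fourier modes of) this equation. $\mathbf{E}$ is expectation with respect to the law of the space-time process $H_N$, and $H_N(t)[\varphi]$ is the pairing of the distribution $H_N(t)$ with $\varphi$. *)

theory Defs
  imports "HOL-Probability.Probability"
begin

type_synonym plane = "real^2"

section \<open>Test functions\<close>

definition partial :: "2 \<Rightarrow> (plane \<Rightarrow> real) \<Rightarrow> plane \<Rightarrow> real" where
  "partial i f x = frechet_derivative f (at x) (axis i 1)"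

definition laplacian :: "(plane \<Rightarrow> real) \<Rightarrow> plane \<Rightarrow> real" where
  "laplacian f x = (\<Sum>i\<in>UNIV. partial i (partial i f) x)"

text \<open>\<open>Ck n f\<close>: the function \<open>f\<close> is of class \<open>C^n\<close> on the plane.\<close>

primrec Ck :: "nat \<Rightarrow> (plane \<Rightarrow> real) \<Rightarrow> bool" where
  "Ck 0 f \<longleftrightarrow> continuous_on UNIV f"
| "Ck (Suc n) f \<longleftrightarrow> f differentiable_on UNIV \<and> (\<forall>i. Ck n (partial i f))"

definition test_function :: "(plane \<Rightarrow> real) \<Rightarrow> bool" where
  "test_function f \<longleftrightarrow> Ck 1 f \<and> compact (closure {x. f x \<noteq> 0})"

section \<open>The torus of side length \<open>2 \<pi> N\<close>\<close>

text \<open>Functions on the torus are functions on the plane that are \<open>2 \<pi> N\<close>-periodic in both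
  variables; integrals over the torus are integrals over the fundamental domain.\<close>

definition torus_box :: "nat \<Rightarrow> plane set" where
  "torus_box N = {x. \<forall>i. - (pi * real N) \<le> x $ i \<and> x $ i < pi * real N}"

definition torus_Ck :: "nat \<Rightarrow> nat \<Rightarrow> (plane \<Rightarrow> real) set" where
  "torus_Ck N n = {f. Ck n f \<and> (\<forall>x i. f (x + axis i (2 * pi * real N)) = f x)}"

definition torus_integral :: "nat \<Rightarrow> (plane \<Rightarrow> real) \<Rightarrow> real" where
  "torus_integral N f = (LINT x:torus_box N|lborel. f x)"

definition zero_mean :: "nat \<Rightarrow> (plane \<Rightarrow> real) \<Rightarrow> bool" where
  "zero_mean N f \<longleftrightarrow> torus_integral N f = 0"

text \<open>A compactly supported function seen on the torus: restrict it to the fundamental domain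
  and extend periodically. If the support lies in the interior of the fundamental domain (that is,
  for all large \<open>N\<close>), regularity is preserved.\<close>

definition to_torus :: "nat \<Rightarrow> (plane \<Rightarrow> real) \<Rightarrow> plane \<Rightarrow> real" where
  "to_torus N f x =
     f (\<chi> i. x $ i - 2 * pi * real N * of_int \<lfloor>(x $ i + pi * real N) / (2 * pi * real N)\<rfloor>)"

section \<open>Distributions on the torus\<close>

text \<open>Distributions are continuous linear functionals on the \<open>C^1\<close> functions of the torus, so
  that they can be paired with test functions that are merely \<open>C^1\<close>.\<close>

type_synonym distribution = "(plane \<Rightarrow> real) \<Rightarrow> real"

definition is_distribution :: "nat \<Rightarrow> distribution \<Rightarrow> bool" where
  "is_distribution N w \<longleftrightarrow>
     (\<forall>f\<in>torus_Ck N 1. \<forall>g\<in>torus_Ck N 1. \<forall>a b. w (\<lambda>x. a * f x + b * g x) = a * w f + b * w g) \<and>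
     (\<exists>C. \<forall>f\<in>torus_Ck N 1. \<forall>B. (\<forall>x. \<bar>f x\<bar> \<le> B \<and> (\<forall>i. \<bar>partial i f x\<bar> \<le> B)) \<longrightarrow> \<bar>w f\<bar> \<le> C * B)"

definition distribution_of :: "nat \<Rightarrow> (plane \<Rightarrow> real) \<Rightarrow> distribution" where
  "distribution_of N g f = torus_integral N (\<lambda>x. g x * f x)"

definition dist_partial :: "2 \<Rightarrow> distribution \<Rightarrow> distribution" where
  "dist_partial i w f = - w (partial i f)"

section \<open>Fourier transform and Fourier cut-off\<close>

definition ZN2 :: "nat \<Rightarrow> plane set" where
  "ZN2 N = {k. \<forall>i. \<exists>m::int. k $ i = of_int m / real N}"

definition fmode :: "plane \<Rightarrow> plane \<Rightarrow> complex" where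
  "fmode k x = complex_of_real (1 / (2 * pi)) * exp (\<i> * complex_of_real (k \<bullet> x))"

definition fourier :: "distribution \<Rightarrow> plane \<Rightarrow> complex" where
  "fourier w k = complex_of_real (w (\<lambda>x. Re (fmode (- k) x)))
                 + \<i> * complex_of_real (w (\<lambda>x. Im (fmode (- k) x)))"

text \<open>The cut-off \<open>w \<mapsto> \<Pi>\<^sub>M w\<close>, with Fourier transform \<open>fourier w k\<close> for \<open>norm k \<le> M\<close> and \<open>0\<close>
  otherwise. As \<open>fmode k\<close> has squared \<open>L\<^sup>2\<close> norm \<open>(2 \<pi> N)\<^sup>2 / (2 \<pi>)\<^sup>2 = N\<^sup>2\<close> on the torus, Fourier
  inversion carries the factor \<open>1 / N\<^sup>2\<close>. The sum is real since \<open>fourier w (- k)\<close> is the complex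
  conjugate of \<open>fourier w k\<close>.\<close>

definition fourier_cutoff :: "nat \<Rightarrow> real \<Rightarrow> distribution \<Rightarrow> plane \<Rightarrow> real" where
  "fourier_cutoff N M w x =
     Re (\<Sum>k\<in>{k \<in> ZN2 N. norm k \<le> M}. fourier w k * fmode k x) / (real N)\<^sup>2"

definition akpz_nonlinearity :: "nat \<Rightarrow> distribution \<Rightarrow> plane \<Rightarrow> real" where
  "akpz_nonlinearity N w =
     fourier_cutoff N 1 (distribution_of N (\<lambda>x.
       (fourier_cutoff N 1 (dist_partial 1 w) x)\<^sup>2 - (fourier_cutoff N 1 (dist_partial 2 w) x)\<^sup>2))"

section \<open>Gaussian fields\<close>

text \<open>Degenerate (almost surely zero) variables are Gaussian.\<close>

definition centred_gaussian :: "'a measure \<Rightarrow> ('a \<Rightarrow> real) \<Rightarrow> bool" where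
  "centred_gaussian M X \<longleftrightarrow> X \<in> borel_measurable M \<and>
     ((AE \<omega> in M. X \<omega> = 0) \<or> (\<exists>\<sigma>>0. distributed M lborel X (normal_density 0 \<sigma>)))"

definition centred_gaussian_family :: "'a measure \<Rightarrow> 'i set \<Rightarrow> ('i \<Rightarrow> 'a \<Rightarrow> real) \<Rightarrow> bool" where
  "centred_gaussian_family M I X \<longleftrightarrow>
     (\<forall>J a. finite J \<and> J \<subseteq> I \<longrightarrow> centred_gaussian M (\<lambda>\<omega>. \<Sum>j\<in>J. a j * X j \<omega>))"

definition generated_events :: "'a measure \<Rightarrow> 'i set \<Rightarrow> ('i \<Rightarrow> 'a \<Rightarrow> real) \<Rightarrow> 'a set set" where
  "generated_events M I X =
     sets (vimage_algebra (space M) (\<lambda>\<omega>. \<lambda>i\<in>I. X i \<omega>) (Pi\<^sub>M I (\<lambda>_. borel)))"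

definition space_time :: "nat \<Rightarrow> (real \<times> plane) set" where
  "space_time N = {0..} \<times> torus_box N"

definition space_time_L2 :: "nat \<Rightarrow> (real \<times> plane \<Rightarrow> real) set" where
  "space_time_L2 N =
     {f \<in> borel_measurable borel. set_integrable lborel (space_time N) (\<lambda>z. (f z)\<^sup>2)}"

definition space_time_white_noise ::
  "nat \<Rightarrow> 'a measure \<Rightarrow> ((real \<times> plane \<Rightarrow> real) \<Rightarrow> 'a \<Rightarrow> real) \<Rightarrow> bool" where
  "space_time_white_noise N M \<xi> \<longleftrightarrow>
     centred_gaussian_family M (space_time_L2 N) \<xi> \<and>
     (\<forall>f\<in>space_time_L2 N. \<forall>g\<in>space_time_L2 N.
        (LINT \<omega>|M. \<xi> f \<omega> * \<xi> g \<omega>) = (LINT z:space_time N|lborel. f z * g z))"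

text \<open>\<open>inv_neg_laplacian N f u\<close>: \<open>u = (-\<Delta>)\<^sup>-\<^sup>1 f\<close> on the torus, that is, \<open>u\<close> is the zero-mean
  solution of \<open>-\<Delta> u = f\<close>, which exists (uniquely) for every zero-mean \<open>f\<close> of class \<open>C^1\<close>.\<close>

definition inv_neg_laplacian :: "nat \<Rightarrow> (plane \<Rightarrow> real) \<Rightarrow> (plane \<Rightarrow> real) \<Rightarrow> bool" where
  "inv_neg_laplacian N f u \<longleftrightarrow> u \<in> torus_Ck N 2 \<and> zero_mean N u \<and> (\<forall>x. - laplacian u x = f x)"

text \<open>Gaussian free field. The covariance only concerns zero-mean functions; linearity and the
  vanishing zeroth Fourier mode then determine the law of the whole field.\<close>

definition gaussian_free_field ::
  "nat \<Rightarrow> 'a measure \<Rightarrow> ((plane \<Rightarrow> real) \<Rightarrow> 'a \<Rightarrow> real) \<Rightarrow> bool" where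
  "gaussian_free_field N M \<eta> \<longleftrightarrow>
     centred_gaussian_family M (torus_Ck N 1) \<eta> \<and>
     (\<forall>f\<in>torus_Ck N 1. \<forall>g\<in>torus_Ck N 1. \<forall>a b.
        AE \<omega> in M. \<eta> (\<lambda>x. a * f x + b * g x) \<omega> = a * \<eta> f \<omega> + b * \<eta> g \<omega>) \<and>
     (AE \<omega> in M. fourier (\<lambda>f. \<eta> f \<omega>) 0 = 0) \<and>
     (\<forall>f\<in>torus_Ck N 1. \<forall>g\<in>torus_Ck N 1. \<forall>u. zero_mean N f \<and> zero_mean N g \<and>
        inv_neg_laplacian N f u \<longrightarrow>
        (LINT \<omega>|M. \<eta> f \<omega> * \<eta> g \<omega>) = torus_integral N (\<lambda>x. u x * g x))"

section \<open>The stationary regularised AKPZ equation\<close>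

text \<open>\<open>H t f \<omega>\<close> is the pairing of the random distribution \<open>H t\<close> with \<open>f\<close>. The equation is
  understood weakly: it is tested against \<open>C^3\<close> functions (whose Laplacian is \<open>C^1\<close>) and integrated
  in time, the noise contributing \<open>\<xi>\<close> evaluated at \<open>1\<^bsub>[0,t]\<^esub> \<otimes> f\<close>.\<close>

definition stationary_akpz_solution ::
  "real \<Rightarrow> nat \<Rightarrow> 'a measure \<Rightarrow> ((real \<times> plane \<Rightarrow> real) \<Rightarrow> 'a \<Rightarrow> real) \<Rightarrow>
   ((plane \<Rightarrow> real) \<Rightarrow> 'a \<Rightarrow> real) \<Rightarrow> (real \<Rightarrow> (plane \<Rightarrow> real) \<Rightarrow> 'a \<Rightarrow> real) \<Rightarrow> bool" where
  "stationary_akpz_solution lam N M \<xi> \<eta> H \<longleftrightarrow>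
     prob_space M \<and>
     space_time_white_noise N M \<xi> \<and>
     gaussian_free_field N M \<eta> \<and>
     prob_space.indep_set M (generated_events M (space_time_L2 N) \<xi>)
       (generated_events M (torus_Ck N 1) \<eta>) \<and>
     (\<forall>t\<ge>0. \<forall>f\<in>torus_Ck N 1. H t f \<in> borel_measurable M) \<and>
     (AE \<omega> in M. \<forall>t\<ge>0. is_distribution N (\<lambda>f. H t f \<omega>)) \<and>
     (AE \<omega> in M. \<forall>f\<in>torus_Ck N 1. continuous_on {0..} (\<lambda>t. H t f \<omega>)) \<and>
     (\<forall>f\<in>torus_Ck N 1. AE \<omega> in M. H 0 f \<omega> = \<eta> f \<omega>) \<and>
     (\<forall>f\<in>torus_Ck N 3. \<forall>t\<ge>0. AE \<omega> in M.
        H t f \<omega> = \<eta> f \<omega>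
          + integral {0..t} (\<lambda>s. 1 / 2 * H s (laplacian f) \<omega>
              + lam * distribution_of N (akpz_nonlinearity N (\<lambda>h. H s h \<omega>)) f)
          + \<xi> (\<lambda>(s, x). indicator {0..t} s * f x) \<omega>)"

end

theory Submission
  imports Defs
begin

text \<open>In the Hartley modes normalised to unit variance, the equation restricted to finitely many Fourier
  modes is a stochastic differential equation whose drift is an Ornstein-Uhlenbeck term plus a quadratic
  field that is divergence free and tangent to spheres. Such a field is a sum of fields, each the infinitesimal
  generator of planar rotations whose angle depends on the other coordinates only; a splitting scheme made of these rotations
  and exact Ornstein-Uhlenbeck steps preserves the standard Gaussian measure and converges pathwise to
  the solution. By Fatou's lemma \<open>E q(H\<^sub>t)\<close> is at most the Gaussian integral of \<open>q\<close> for every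
  nonnegative continuous \<open>q\<close>, which is all that is used of stationarity.

  With \<open>R = max t 1\<close>, the modes of \<open>\<phi>\<close> with wave number below \<open>1/R\<close> are treated through the equation: by
  Cauchy-Schwarz in time the drift contributes \<open>t\<^sup>2\<close> times a second moment of order \<open>(1 + \<lambda>\<^sup>2)/R\<^sup>2\<close>, and
  the noise a term of order \<open>t/R\<^sup>2\<close>. For the remaining modes the increment is bounded by the two one-time
  variances, a sum of \<open>1/|k|\<^sup>2\<close> over \<open>1/R \<le> |k| \<le> 1\<close>, of order \<open>log (2 R)\<close>, plus a bounded tail. A general
  \<open>\<phi>\<close> is reached by approximation with trigonometric polynomials in the \<open>C\<^sup>1\<close> norm.\<close>

section \<open>Characterisation of Gaussian vectors\<close>

text \<open>The rotations exist because in unit-variance modes the interaction coefficients sum to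
  zero over cyclic permutations of their indices, so triples of distinct indices decompose at once.
  The obstacle is a repeated index: a term in the square of one coordinate is not a rotation whose
  angle ignores the rotated plane. The symmetry i -> -i resolves it, since the terms of i and -i are
  opposite and together form a triad seen in coordinates turned by \<pi>/4.

  Convergence of the scheme concerns single paths: a continuous path is bounded on [0,T], so local
  Lipschitz constants suffice although the drift is quadratic.

  The threshold 1/R balances the two regimes. About (N/R)^2 modes lie below it, each coefficient of
  the test function is of order 1/N^2, so the area times the sum of the squared coefficients is of
  order 1/R^2; this pays for the t^2 lost by the crude bound in time. The quadratic form given by
  the tested nonlinearity has trace zero, hence Gaussian mean zero, and its second moment is
  controlled by the sum of its squared coefficients, with no divergent constant to subtract.\<close>

lemma distr_eq_std_normal:
  assumes "prob_space M" and [measurable]: "X \<in> borel_measurable M"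
    and c: "\<And>s. (LINT \<omega>|M. cos (s * X \<omega>)) = exp (- s\<^sup>2 / 2)"
    and s: "\<And>s. (LINT \<omega>|M. sin (s * X \<omega>)) = 0"
  shows "distr M borel X = std_normal_distribution"
proof -
  interpret prob_space M by fact
  have rd: "real_distribution (distr M borel X)"
    by (simp add: real_distribution_distr)
  have "char (distr M borel X) = char std_normal_distribution"
  proof
    fix t :: real
    have int: "integrable M (\<lambda>\<omega>. iexp (t * X \<omega>))"
      by (rule integrable_const_bound[where B=1]) auto
    have "char (distr M borel X) t = (CLINT \<omega>|M. iexp (t * X \<omega>))"
      unfolding char_def by (subst integral_distr) auto
    also have "\<dots> = complex_of_real (exp (- t\<^sup>2 / 2))"
    proof (rule complex_eqI)
      have "Re (CLINT \<omega>|M. iexp (t * X \<omega>)) = (LINT \<omega>|M. Re (iexp (t * X \<omega>)))"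
        using int by simp
      also have "\<dots> = exp (- t\<^sup>2 / 2)" by (simp only: Re_exp) (simp add: c)
      finally show "Re (CLINT \<omega>|M. iexp (t * X \<omega>)) = Re (complex_of_real (exp (- t\<^sup>2 / 2)))" by simp
      have "Im (CLINT \<omega>|M. iexp (t * X \<omega>)) = (LINT \<omega>|M. Im (iexp (t * X \<omega>)))"
        using int by simp
      also have "\<dots> = 0" by (simp only: Im_exp) (simp add: s)
      finally show "Im (CLINT \<omega>|M. iexp (t * X \<omega>)) = Im (complex_of_real (exp (- t\<^sup>2 / 2)))" by simp
    qed
    finally show "char (distr M borel X) t = char std_normal_distribution t"
      by (simp add: char_std_normal_distribution)
  qed
  then show ?thesis
    by (intro Levy_uniqueness rd real_dist_normal_dist)
qed

text \<open>Reweighting \<open>M\<close> by 2 + cos(V + c), normalised, leaves \<open>X\<close>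
  standard normal, because the hypotheses factorise the expectations involving V + s X. Removing the
  contribution of the constant 2 isolates the cosine. The result plays the part of independence
  between the event X \<in> B and the phase V, and it uses only uniqueness of characteristic
  functions on the line.\<close>

lemma integral_mult_weighted_char:
  assumes "prob_space M" and [measurable]: "X \<in> borel_measurable M" "V \<in> borel_measurable M"
    and X: "\<And>s. (LINT \<omega>|M. cos (s * X \<omega>)) = exp (- s\<^sup>2 / 2)" "\<And>s. (LINT \<omega>|M. sin (s * X \<omega>)) = 0"
    and V: "\<And>s. (LINT \<omega>|M. cos (V \<omega> + s * X \<omega>)) = e * exp (- s\<^sup>2 / 2)"
      "\<And>s. (LINT \<omega>|M. sin (V \<omega> + s * X \<omega>)) = 0"
    and [measurable]: "B \<in> sets borel"
  shows "(LINT \<omega>|M. indicator B (X \<omega>) * cos (V \<omega> + c)) = measure std_normal_distribution B * (e * cos c)"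
proof -
  interpret prob_space M by fact
  have ib: "integrable M f" if "f \<in> borel_measurable M" "\<And>\<omega>. \<bar>f \<omega>\<bar> \<le> 5" for f :: "'a \<Rightarrow> real"
    by (rule integrable_const_bound[where B=5]) (use that in auto)
  have iC: "integrable M (\<lambda>\<omega>. cos (f \<omega>))" "integrable M (\<lambda>\<omega>. sin (f \<omega>))" if "f \<in> borel_measurable M" for f :: "'a \<Rightarrow> real"
    using that by (auto intro!: ib order_trans[OF abs_cos_le_one] order_trans[OF abs_sin_le_one])
  \<comment> \<open>The constant 2 keeps the weight between 1 and 3, so division by its mean
    \<open>m\<close> turns it into a probability density.\<close>
  define w where "w \<omega> = 2 + cos (V \<omega> + c)" for \<omega>
  have [measurable]: "w \<in> borel_measurable M" unfolding w_def by measurable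
  have w1: "1 \<le> w \<omega>" "w \<omega> \<le> 3" for \<omega> unfolding w_def using cos_ge_minus_one[of "V \<omega> + c"] cos_le_one[of "V \<omega> + c"] by linarith+
  have Vc: "(LINT \<omega>|M. cos (V \<omega> + c + s * X \<omega>)) = e * cos c * exp (- s\<^sup>2 / 2)" for s
  proof -
    have "(LINT \<omega>|M. cos (V \<omega> + c + s * X \<omega>)) = (LINT \<omega>|M. cos c * cos (V \<omega> + s * X \<omega>) - sin c * sin (V \<omega> + s * X \<omega>))"
      by (rule Bochner_Integration.integral_cong) (simp_all add: cos_add sin_add algebra_simps)
    also have "\<dots> = cos c * (LINT \<omega>|M. cos (V \<omega> + s * X \<omega>)) - sin c * (LINT \<omega>|M. sin (V \<omega> + s * X \<omega>))"
      by (subst Bochner_Integration.integral_diff) (auto intro!: ib order_trans[OF abs_cos_le_one] order_trans[OF abs_sin_le_one])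
    finally show ?thesis by (simp add: V)
  qed
  have Vs: "(LINT \<omega>|M. sin (V \<omega> + c + s * X \<omega>)) = e * sin c * exp (- s\<^sup>2 / 2)" for s
  proof -
    have "(LINT \<omega>|M. sin (V \<omega> + c + s * X \<omega>)) = (LINT \<omega>|M. sin c * cos (V \<omega> + s * X \<omega>) + cos c * sin (V \<omega> + s * X \<omega>))"
      by (rule Bochner_Integration.integral_cong) (simp_all add: cos_add sin_add algebra_simps)
    also have "\<dots> = sin c * (LINT \<omega>|M. cos (V \<omega> + s * X \<omega>)) + cos c * (LINT \<omega>|M. sin (V \<omega> + s * X \<omega>))"
      by (subst Bochner_Integration.integral_add) (auto intro!: ib order_trans[OF abs_cos_le_one] order_trans[OF abs_sin_le_one])
    finally show ?thesis by (simp add: V)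
  qed
  define m where "m = 2 + e * cos c"
  have mw: "(LINT \<omega>|M. w \<omega>) = m"
    using Vc[of 0] unfolding w_def m_def
    by (subst Bochner_Integration.integral_add) (auto intro!: ib simp: prob_space intro!: order_trans[OF abs_cos_le_one])
  have iw: "integrable M w"
  proof (rule ib)
    show "\<bar>w \<omega>\<bar> \<le> 5" for \<omega> using w1[of \<omega>] by linarith
  qed simp
  have "1 = (LINT \<omega>|M. (1::real))" by (simp add: prob_space)
  also have "\<dots> \<le> (LINT \<omega>|M. w \<omega>)"
    by (rule integral_mono) (use w1 iw in auto)
  finally have m1: "1 \<le> m" using mw by simp
  define M' where "M' = density M (\<lambda>\<omega>. ennreal (w \<omega> / m))"
  have wnn: "0 \<le> w \<omega> / m" for \<omega> using w1[of \<omega>] m1 by simp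
  have intM': "(LINT \<omega>|M'. f \<omega>) = (LINT \<omega>|M. w \<omega> * f \<omega>) / m" if [measurable]: "f \<in> borel_measurable M" for f :: "'a \<Rightarrow> real"
    unfolding M'_def by (subst integral_density) (auto simp: wnn)
  have "emeasure M' (space M') = 1"
  proof -
    have "emeasure M' (space M') = (\<integral>\<^sup>+ \<omega>. ennreal (w \<omega> / m) \<partial>M)"
      unfolding M'_def by (simp add: emeasure_density cong: nn_integral_cong)
    also have "\<dots> = ennreal (LINT \<omega>|M. w \<omega> / m)"
      by (rule nn_integral_eq_integral) (use iw wnn in auto)
    also have "(LINT \<omega>|M. w \<omega> / m) = 1" using mw m1 by simp
    finally show ?thesis by simp
  qed
  then have pM': "prob_space M'" by (rule prob_spaceI)
  have [measurable]: "X \<in> borel_measurable M'" unfolding M'_def by simp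
  have cosM: "(LINT \<omega>|M. w \<omega> * cos (s * X \<omega>)) = m * exp (- s\<^sup>2 / 2)" for s
  proof -
    \<comment> \<open>Product to sum: the weighted cosine involves V + c with the frequencies s and
      -s of X, both evaluated by \<open>Vc\<close>; the two halves add up because the Gaussian
      factor is even in s.\<close>
    have "(LINT \<omega>|M. w \<omega> * cos (s * X \<omega>)) = (LINT \<omega>|M. 2 * cos (s * X \<omega>) + (1/2) * cos (V \<omega> + c + s * X \<omega>) + (1/2) * cos (V \<omega> + c + (-s) * X \<omega>))"
      by (rule Bochner_Integration.integral_cong) (simp_all add: w_def cos_add sin_add cos_diff sin_diff algebra_simps)
    also have "\<dots> = 2 * (LINT \<omega>|M. cos (s * X \<omega>)) + (1/2) * (LINT \<omega>|M. cos (V \<omega> + c + s * X \<omega>)) + (1/2) * (LINT \<omega>|M. cos (V \<omega> + c + (-s) * X \<omega>))"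
      by (simp add: iC del: mult_minus_left)
    finally show ?thesis unfolding Vc X m_def by (simp add: algebra_simps)
  qed
  have sinM: "(LINT \<omega>|M. w \<omega> * sin (s * X \<omega>)) = 0" for s
  proof -
    have "(LINT \<omega>|M. w \<omega> * sin (s * X \<omega>)) = (LINT \<omega>|M. 2 * sin (s * X \<omega>) + ((1/2) * sin (V \<omega> + c + s * X \<omega>) - (1/2) * sin (V \<omega> + c + (-s) * X \<omega>)))"
      by (rule Bochner_Integration.integral_cong) (simp_all add: w_def cos_add sin_add cos_diff sin_diff algebra_simps)
    also have "\<dots> = 2 * (LINT \<omega>|M. sin (s * X \<omega>)) + ((1/2) * (LINT \<omega>|M. sin (V \<omega> + c + s * X \<omega>)) - (1/2) * (LINT \<omega>|M. sin (V \<omega> + c + (-s) * X \<omega>)))"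
      by (simp add: iC del: mult_minus_left)
    finally show ?thesis unfolding Vs X by simp
  qed
  have "distr M' borel X = std_normal_distribution"
    by (rule distr_eq_std_normal[OF pM']) (use m1 in \<open>auto simp: intM' cosM sinM\<close>)
  then have 1: "measure M' (X -` B \<inter> space M') = measure std_normal_distribution B"
    by (metis \<open>B \<in> sets borel\<close> \<open>X \<in> borel_measurable M'\<close> measure_distr)
  have "distr M borel X = std_normal_distribution"
    by (rule distr_eq_std_normal) (use X in \<open>auto simp: assms(1)\<close>)
  then have 2: "measure M (X -` B \<inter> space M) = measure std_normal_distribution B"
    by (metis \<open>B \<in> sets borel\<close> \<open>X \<in> borel_measurable M\<close> measure_distr)
  have iB: "(LINT \<omega>|M. indicator B (X \<omega>)) = measure std_normal_distribution B"
  proof -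
    have "(LINT \<omega>|M. indicator B (X \<omega>)) = (LINT \<omega>|M. indicator (X -` B \<inter> space M) \<omega> :: real)"
      by (rule Bochner_Integration.integral_cong) (auto simp: indicator_def)
    then show ?thesis by (simp add: 2)
  qed
  have "measure M' (X -` B \<inter> space M') = (LINT \<omega>|M'. indicator (X -` B \<inter> space M') \<omega>)"
    by simp
  also have "\<dots> = (LINT \<omega>|M'. indicator B (X \<omega>))"
    by (rule Bochner_Integration.integral_cong) (auto simp: indicator_def)
  also have "\<dots> = (LINT \<omega>|M. w \<omega> * indicator B (X \<omega>)) / m" by (rule intM') simp
  finally have "(LINT \<omega>|M. w \<omega> * indicator B (X \<omega>)) = m * measure std_normal_distribution B"
    using 1 m1 by (simp add: field_simps)
  moreover have "(LINT \<omega>|M. w \<omega> * indicator B (X \<omega>)) = (LINT \<omega>|M. 2 * indicator B (X \<omega>) + indicator B (X \<omega>) * cos (V \<omega> + c))"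
    by (rule Bochner_Integration.integral_cong) (simp_all add: w_def algebra_simps)
  moreover have "\<dots> = 2 * (LINT \<omega>|M. indicator B (X \<omega>)) + (LINT \<omega>|M. indicator B (X \<omega>) * cos (V \<omega> + c))"
    by (subst Bochner_Integration.integral_add) (auto intro!: ib order_trans[OF abs_cos_le_one] simp: indicator_def)
  ultimately show ?thesis unfolding iB m_def by (simp add: algebra_simps)
qed

definition std_gauss_char :: "'a measure \<Rightarrow> 'i set \<Rightarrow> ('i \<Rightarrow> 'a \<Rightarrow> real) \<Rightarrow> bool" where
  "std_gauss_char M J X \<longleftrightarrow> (\<forall>a.
     (LINT \<omega>|M. cos (\<Sum>j\<in>J. a j * X j \<omega>)) = exp (- (\<Sum>j\<in>J. (a j)\<^sup>2) / 2) \<and>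
     (LINT \<omega>|M. sin (\<Sum>j\<in>J. a j * X j \<omega>)) = 0)"

lemma integral_uniform_measure:
  fixes f :: "'a \<Rightarrow> real"
  assumes "prob_space M" and [measurable]: "A \<in> sets M" "f \<in> borel_measurable M" and "measure M A \<noteq> 0"
  shows "(LINT \<omega>|uniform_measure M A. f \<omega>) = (LINT \<omega>|M. indicator A \<omega> * f \<omega>) / measure M A"
proof -
  interpret prob_space M by fact
  have "uniform_measure M A = density M (\<lambda>\<omega>. ennreal (indicator A \<omega> / measure M A))"
    unfolding uniform_measure_def
    by (rule density_cong) (use assms in \<open>auto simp: emeasure_eq_measure indicator_def divide_ennreal[symmetric] zero_less_measure_iff intro!: AE_I2\<close>)
  then show ?thesis
    by (simp add: integral_density)
qed

text \<open>Conditioning on one coordinate at a time reduces the multivariate uniqueness theorem to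
  the one-dimensional one: under the measure conditioned on X k \<in> B k, the other coordinates
  satisfy the same identities by \<open>integral_mult_weighted_char\<close>, so the induction
  hypothesis applies to a different measure. This is why \<open>M\<close> is generalised.\<close>

lemma std_gauss_char_prob:
  assumes "finite J" "prob_space M" "\<And>j. j \<in> J \<Longrightarrow> X j \<in> borel_measurable M"
    and "std_gauss_char M J X" "\<And>j. j \<in> J \<Longrightarrow> B j \<in> sets borel"
  shows "measure M {\<omega>\<in>space M. \<forall>j\<in>J. X j \<omega> \<in> B j} = (\<Prod>j\<in>J. measure std_normal_distribution (B j))"
  using assms
proof (induction J arbitrary: M rule: finite_induct)
  case empty
  then show ?case by (simp add: prob_space.prob_space)
next
  case (insert k J)
  interpret prob_space M by fact
  have [measurable]: "X k \<in> borel_measurable M" "\<And>j. j \<in> J \<Longrightarrow> X j \<in> borel_measurable M"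
     "B k \<in> sets borel" using insert by auto
  note sg = insert.prems(3)[unfolded std_gauss_char_def, rule_format]
  define A where "A = {\<omega>\<in>space M. X k \<omega> \<in> B k}"
  have [measurable]: "A \<in> sets M" unfolding A_def by measurable
  have Xk: "(LINT \<omega>|M. cos (s * X k \<omega>)) = exp (- s\<^sup>2 / 2)" "(LINT \<omega>|M. sin (s * X k \<omega>)) = 0" for s
  proof -
    have *: "(\<Sum>j\<in>insert k J. (if j = k then s else 0) * X j \<omega>) = s * X k \<omega>"
      "(\<Sum>j\<in>insert k J. (if j = k then s else 0)\<^sup>2) = s\<^sup>2" for \<omega>
      using insert(1,2) by (auto intro!: sum.neutral)
    show "(LINT \<omega>|M. cos (s * X k \<omega>)) = exp (- s\<^sup>2 / 2)" "(LINT \<omega>|M. sin (s * X k \<omega>)) = 0"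
      using sg[of "\<lambda>j. if j = k then s else 0"] unfolding * by auto
  qed
  have VX: "(LINT \<omega>|M. cos ((\<Sum>j\<in>J. a j * X j \<omega>) + s * X k \<omega>)) = exp (- (\<Sum>j\<in>J. (a j)\<^sup>2) / 2) * exp (- s\<^sup>2 / 2)"
     "(LINT \<omega>|M. sin ((\<Sum>j\<in>J. a j * X j \<omega>) + s * X k \<omega>)) = 0" for a s
  proof -
    have 1: "(\<Sum>j\<in>J. (a(k := s)) j * X j \<omega>) = (\<Sum>j\<in>J. a j * X j \<omega>)" for \<omega>
      by (rule sum.cong) (use insert(2) in auto)
    have 2: "(\<Sum>j\<in>J. ((a(k := s)) j)\<^sup>2) = (\<Sum>j\<in>J. (a j)\<^sup>2)"
      by (rule sum.cong) (use insert(2) in auto)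
    have *: "(\<Sum>j\<in>insert k J. (a(k := s)) j * X j \<omega>) = (\<Sum>j\<in>J. a j * X j \<omega>) + s * X k \<omega>"
      "(\<Sum>j\<in>insert k J. ((a(k := s)) j)\<^sup>2) = (\<Sum>j\<in>J. (a j)\<^sup>2) + s\<^sup>2" for \<omega>
      unfolding sum.insert[OF insert(1,2)] 1 2 by auto
    show "(LINT \<omega>|M. cos ((\<Sum>j\<in>J. a j * X j \<omega>) + s * X k \<omega>)) = exp (- (\<Sum>j\<in>J. (a j)\<^sup>2) / 2) * exp (- s\<^sup>2 / 2)"
     "(LINT \<omega>|M. sin ((\<Sum>j\<in>J. a j * X j \<omega>) + s * X k \<omega>)) = 0"
      using sg[of "a(k := s)"] unfolding * by (auto simp: exp_add[symmetric] add_divide_distrib)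
  qed
  have main: "(LINT \<omega>|M. indicator (B k) (X k \<omega>) * cos ((\<Sum>j\<in>J. a j * X j \<omega>) + c)) = measure std_normal_distribution (B k) * (exp (- (\<Sum>j\<in>J. (a j)\<^sup>2) / 2) * cos c)" for a c
    by (rule integral_mult_weighted_char) (use Xk VX in \<open>auto simp: insert\<close>)
  have PA: "prob A = measure std_normal_distribution (B k)"
  proof -
    have "prob A = (LINT \<omega>|M. indicator A \<omega>)" by simp
    also have "\<dots> = (LINT \<omega>|M. indicator (B k) (X k \<omega>))"
      by (rule Bochner_Integration.integral_cong) (auto simp: indicator_def A_def)
    finally show ?thesis using main[of "\<lambda>_. 0" 0] by simp
  qed
  have split: "{\<omega>\<in>space M. \<forall>j\<in>insert k J. X j \<omega> \<in> B j} = A \<inter> {\<omega>\<in>space M. \<forall>j\<in>J. X j \<omega> \<in> B j}"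
    by (auto simp: A_def)
  have S[measurable]: "{\<omega>\<in>space M. \<forall>j\<in>J. X j \<omega> \<in> B j} \<in> sets M"
    using insert by (intro sets.sets_Collect_finite_All) auto
  show ?case
  proof (cases "prob A = 0")
    case True
    have "prob (A \<inter> {\<omega>\<in>space M. \<forall>j\<in>J. X j \<omega> \<in> B j}) \<le> prob A"
      by (rule finite_measure_mono) auto
    then show ?thesis unfolding split using True PA insert(1,2) by (simp add: measure_le_0_iff)
  next
    case False
    define M' where "M' = uniform_measure M A"
    have A0: "emeasure M A \<noteq> 0" "emeasure M A \<noteq> \<infinity>" using False by (auto simp: emeasure_eq_measure)
    have pM': "prob_space M'" unfolding M'_def by (rule prob_space_uniform_measure[OF A0])
    have i: "(LINT \<omega>|M. indicator A \<omega> * f \<omega>) = (LINT \<omega>|M. indicator (B k) (X k \<omega>) * f \<omega>)" for f :: "_ \<Rightarrow> real"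
      by (rule Bochner_Integration.integral_cong) (auto simp: A_def indicator_def)
    have "std_gauss_char M' J X"
      unfolding std_gauss_char_def
    proof (intro allI conjI)
      fix a
      show "(LINT \<omega>|M'. cos (\<Sum>j\<in>J. a j * X j \<omega>)) = exp (- (\<Sum>j\<in>J. (a j)\<^sup>2) / 2)"
        unfolding M'_def using False PA main[of a 0]
        by (subst integral_uniform_measure) (auto simp: i insert)
      \<comment> \<open>The free phase of \<open>main\<close> yields the sine identity from the
        cosine one.\<close>
      have "cos (z + - (pi/2)) = sin z" for z :: real by (simp add: cos_diff)
      then show "(LINT \<omega>|M'. sin (\<Sum>j\<in>J. a j * X j \<omega>)) = 0"
        unfolding M'_def using False PA main[of a "- (pi/2)"]
        by (subst integral_uniform_measure) (auto simp: i insert)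
    qed
    then have "measure M' {\<omega>\<in>space M'. \<forall>j\<in>J. X j \<omega> \<in> B j} = (\<Prod>j\<in>J. measure std_normal_distribution (B j))"
      using insert.prems by (intro insert.IH[OF pM']) (auto simp: M'_def)
    moreover have "space M' = space M" by (simp add: M'_def)
    ultimately have "prob (A \<inter> {\<omega>\<in>space M. \<forall>j\<in>J. X j \<omega> \<in> B j}) = prob A * (\<Prod>j\<in>J. measure std_normal_distribution (B j))"
      using False by (simp add: M'_def A0 S field_simps)
    then show ?thesis unfolding split using insert(1,2) by (simp add: PA)
  qed
qed

section \<open>The standard Gaussian product measure and its characteristic function\<close>

abbreviation std_gauss :: "'i set \<Rightarrow> ('i \<Rightarrow> real) measure" where
  "std_gauss J \<equiv> PiM J (\<lambda>_. std_normal_distribution)"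

lemma prob_space_std_normal: "prob_space std_normal_distribution"
  using real_dist_normal_dist by (simp add: real_distribution_def)

lemma product_prob_space_std_normal: "product_prob_space (\<lambda>_. std_normal_distribution)"
  by (intro product_prob_space.intro product_prob_space_axioms.intro product_sigma_finite.intro
      prob_space_std_normal prob_space_imp_sigma_finite)

lemma prob_space_std_gauss: "prob_space (std_gauss J)"
  by (rule prob_space_PiM) (rule prob_space_std_normal)

lemma sets_std_gauss [measurable_cong]: "sets (std_gauss J) = sets (PiM J (\<lambda>_. borel))"
  by (rule sets_PiM_cong) auto

lemma space_std_gauss: "space (std_gauss J) = (J \<rightarrow>\<^sub>E UNIV)"
  by (simp add: space_PiM)

lemma distr_eq_std_gauss:
  assumes "finite J" "prob_space M" and X: "\<And>j. j \<in> J \<Longrightarrow> X j \<in> borel_measurable M"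
    and "std_gauss_char M J X"
  shows "distr M (PiM J (\<lambda>_. borel)) (\<lambda>\<omega>. \<lambda>j\<in>J. X j \<omega>) = std_gauss J"
proof -
  interpret Q: prob_space M by fact
  interpret product_prob_space "\<lambda>_. std_normal_distribution" by (rule product_prob_space_std_normal)
  show ?thesis
  proof (rule PiM_eqI[OF \<open>finite J\<close>])
    fix A assume A: "\<And>i. i \<in> J \<Longrightarrow> A i \<in> sets std_normal_distribution"
    have [measurable]: "(\<lambda>\<omega>. \<lambda>j\<in>J. X j \<omega>) \<in> measurable M (PiM J (\<lambda>_. borel))"
      using X by (intro measurable_restrict) auto
    have "emeasure (distr M (PiM J (\<lambda>_. borel)) (\<lambda>\<omega>. \<lambda>j\<in>J. X j \<omega>)) (Pi\<^sub>E J A)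
      = emeasure M ((\<lambda>\<omega>. \<lambda>j\<in>J. X j \<omega>) -` (Pi\<^sub>E J A) \<inter> space M)"
      using A by (intro emeasure_distr) (auto intro!: sets_PiM_I_finite assms)
    also have "(\<lambda>\<omega>. \<lambda>j\<in>J. X j \<omega>) -` (Pi\<^sub>E J A) \<inter> space M = {\<omega>\<in>space M. \<forall>j\<in>J. X j \<omega> \<in> A j}"
      by auto
    also have "emeasure M \<dots> = ennreal (\<Prod>j\<in>J. measure std_normal_distribution (A j))"
      unfolding Q.emeasure_eq_measure
      using A by (subst std_gauss_char_prob[OF assms(1,2) X assms(4)]) auto
    also have "\<dots> = (\<Prod>i\<in>J. emeasure std_normal_distribution (A i))"
      by (simp add: M.emeasure_eq_measure prod_ennreal)
    finally show "emeasure (distr M (PiM J (\<lambda>_. borel)) (\<lambda>\<omega>. \<lambda>j\<in>J. X j \<omega>)) (Pi\<^sub>E J A) = (\<Prod>i\<in>J. emeasure std_normal_distribution (A i))" .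
  qed (simp add: sets_std_gauss)
qed

lemma std_normal_char:
  "(LINT y|std_normal_distribution. cos (t * y)) = exp (- t\<^sup>2 / 2)"
  "(LINT y|std_normal_distribution. sin (t * y)) = 0"
proof -
  interpret prob_space std_normal_distribution by (rule prob_space_std_normal)
  have int: "integrable std_normal_distribution (\<lambda>y. iexp (t * y))"
    by (rule integrable_const_bound[where B=1]) auto
  have c: "(CLINT y|std_normal_distribution. iexp (t * y)) = complex_of_real (exp (- t\<^sup>2 / 2))"
    using fun_cong[OF char_std_normal_distribution, of t] unfolding char_def by simp
  have "(LINT y|std_normal_distribution. Re (iexp (t * y))) = exp (- t\<^sup>2 / 2)"
    using int by (simp only: integral_Re c) simp
  then show "(LINT y|std_normal_distribution. cos (t * y)) = exp (- t\<^sup>2 / 2)"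
    by (simp only: Re_exp) simp
  have "(LINT y|std_normal_distribution. Im (iexp (t * y))) = 0"
    using int by (simp only: integral_Im c) simp
  then show "(LINT y|std_normal_distribution. sin (t * y)) = 0"
    by (simp only: Im_exp) simp
qed

text \<open>The phase \<open>c\<close> stands for everything that does not involve the integrated
  coordinate; with c = -\<pi>/2 the same identity covers sines.\<close>

lemma std_normal_char_shift:
  "(LINT y|std_normal_distribution. cos (t * y + c)) = cos c * exp (- t\<^sup>2 / 2)"
proof -
  interpret prob_space std_normal_distribution by (rule prob_space_std_normal)
  have ib: "integrable std_normal_distribution f" if "f \<in> borel_measurable borel" "\<And>\<omega>. \<bar>f \<omega>\<bar> \<le> 1" for f :: "real \<Rightarrow> real"
    by (rule integrable_const_bound[where B=1]) (use that in auto)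
  have "(LINT y|std_normal_distribution. cos (t * y + c)) = (LINT y|std_normal_distribution. cos c * cos (t * y) - sin c * sin (t * y))"
    by (rule Bochner_Integration.integral_cong) (auto simp: cos_add)
  also have "\<dots> = cos c * (LINT y|std_normal_distribution. cos (t * y)) - sin c * (LINT y|std_normal_distribution. sin (t * y))"
    by (subst Bochner_Integration.integral_diff) (auto intro!: ib)
  finally show ?thesis by (simp add: std_normal_char)
qed

text \<open>Fubini followed by the one-dimensional characteristic function. The coefficient
  \<open>\<alpha>\<close> of the integrated coordinate may depend on all the others, which is what
  rotations with a state-dependent angle require.\<close>

lemma std_gauss_integrate_coordinate:
  assumes I: "finite I" "p \<notin> I"
    and m: "g \<in> borel_measurable (PiM (insert p I) (\<lambda>_. borel))" "\<alpha> \<in> borel_measurable (PiM (insert p I) (\<lambda>_. borel))"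
      "r \<in> borel_measurable (PiM (insert p I) (\<lambda>_. borel))"
    and inv: "\<And>z y. g (z(p := y)) = g z" "\<And>z y. \<alpha> (z(p := y)) = \<alpha> z" "\<And>z y. r (z(p := y)) = r z"
    and g: "\<And>z. \<bar>g z\<bar> \<le> 1"
  shows "(LINT z|std_gauss (insert p I). g z * cos (\<alpha> z * z p + r z))
    = (LINT z|std_gauss I. g z * exp (- (\<alpha> z)\<^sup>2 / 2) * cos (r z))"
proof -
  interpret product_prob_space "\<lambda>_. std_normal_distribution" by (rule product_prob_space_std_normal)
  interpret Q: prob_space "std_gauss (insert p I)" by (rule prob_space_std_gauss)
  have [measurable]: "g \<in> borel_measurable (std_gauss (insert p I))" "\<alpha> \<in> borel_measurable (std_gauss (insert p I))"
    "r \<in> borel_measurable (std_gauss (insert p I))"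
    using m by (simp_all cong: measurable_cong_sets add: sets_std_gauss)
  have gg: "\<bar>g z * cos t\<bar> \<le> 1" for z t
    using mult_mono[OF g[of z] abs_cos_le_one[of t]] by (simp add: abs_mult)
  have int: "integrable (std_gauss (insert p I)) (\<lambda>z. g z * cos (\<alpha> z * z p + r z))"
    by (rule Q.integrable_const_bound[where B=1]) (auto simp: gg)
  show ?thesis
    unfolding product_integral_insert[OF I int] inv
    by (intro Bochner_Integration.integral_cong refl) (simp add: std_normal_char_shift)
qed

lemma std_gauss_char_id:
  assumes "finite J"
  shows "(LINT z|std_gauss J. cos ((\<Sum>j\<in>J. a j * z j) + c)) = cos c * exp (- (\<Sum>j\<in>J. (a j)\<^sup>2) / 2)"
  using assms
proof (induction J)
  case empty
  show ?case by (simp add: prob_space.prob_space[OF prob_space_std_gauss])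
next
  case (insert p J)
  interpret Q: prob_space "std_gauss J" by (rule prob_space_std_gauss)
  have s: "(\<Sum>j\<in>J. a j * (z(p := y)) j) = (\<Sum>j\<in>J. a j * z j)" for z y
    by (rule sum.cong) (use insert in auto)
  have "(LINT z|std_gauss (insert p J). cos ((\<Sum>j\<in>insert p J. a j * z j) + c))
     = (LINT z|std_gauss (insert p J). 1 * cos (a p * z p + ((\<Sum>j\<in>J. a j * z j) + c)))"
    using insert by (simp add: add.assoc)
  also have "\<dots> = (LINT z|std_gauss J. 1 * exp (- (a p)\<^sup>2 / 2) * cos ((\<Sum>j\<in>J. a j * z j) + c))"
    by (rule std_gauss_integrate_coordinate[OF insert(1,2)]) (auto simp: s simp del: fun_upd_apply)
  also have "\<dots> = exp (- (a p)\<^sup>2 / 2) * (LINT z|std_gauss J. cos ((\<Sum>j\<in>J. a j * z j) + c))"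
    by simp
  finally show ?case using insert by (simp add: insert.IH exp_add[symmetric] add_divide_distrib)
qed

section \<open>Rotations preserving the Gaussian measure\<close>

definition rot :: "'j \<Rightarrow> 'j \<Rightarrow> real \<Rightarrow> ('j \<Rightarrow> real) \<Rightarrow> 'j \<Rightarrow> real" where
  "rot p q t z = z(p := cos t * z p - sin t * z q, q := sin t * z p + cos t * z q)"

definition gauss_preserving :: "'j set \<Rightarrow> (('j \<Rightarrow> real) \<Rightarrow> 'j \<Rightarrow> real) \<Rightarrow> bool" where
  "gauss_preserving J F \<longleftrightarrow> F \<in> measurable (PiM J (\<lambda>_. borel)) (PiM J (\<lambda>_. borel)) \<and>
     distr (std_gauss J) (PiM J (\<lambda>_. borel)) F = std_gauss J"

lemma gauss_preserving_comp:
  assumes "gauss_preserving J F" "gauss_preserving J G"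
  shows "gauss_preserving J (\<lambda>z. F (G z))"
proof -
  have [measurable]: "F \<in> measurable (PiM J (\<lambda>_. borel)) (PiM J (\<lambda>_. borel))" "G \<in> measurable (PiM J (\<lambda>_. borel)) (PiM J (\<lambda>_. borel))"
    using assms by (auto simp: gauss_preserving_def)
  have "distr (std_gauss J) (PiM J (\<lambda>_. borel)) (\<lambda>z. F (G z)) = distr (distr (std_gauss J) (PiM J (\<lambda>_. borel)) G) (PiM J (\<lambda>_. borel)) F"
    by (subst distr_distr) (auto simp: comp_def)
  then show ?thesis using assms by (simp add: gauss_preserving_def)
qed

text \<open>Given the remaining coordinates the angle is a constant, and a plane rotation only turns
  the frequency vector (a p, a q) without changing its length. Integrating out \<open>p\<close> and
  then \<open>q\<close> therefore produces a factor that no longer depends on the angle.\<close>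

lemma gauss_preserving_rot:
  assumes J: "finite J" "p \<in> J" "q \<in> J" "p \<noteq> q"
    and \<theta>[measurable]: "\<theta> \<in> borel_measurable (PiM J (\<lambda>_. borel))"
    and inv: "\<And>z a b. \<theta> (z(p := a, q := b)) = \<theta> z"
  shows "gauss_preserving J (\<lambda>z. rot p q (\<theta> z) z)"
proof -
  define K where "K = J - {p, q}"
  have K: "finite K" "p \<notin> insert q K" "q \<notin> K" "J = insert p (insert q K)" using J by (auto simp: K_def)
  have inv1: "\<theta> (z(p := a)) = \<theta> z" "\<theta> (z(q := a)) = \<theta> z" for z a
    using inv[of z a "z q"] inv[of z "z p" a] J(4)
    by (metis fun_upd_triv fun_upd_twist)+
  have [measurable]: "(\<lambda>z. z p) \<in> borel_measurable (PiM J (\<lambda>_. borel))" "(\<lambda>z. z q) \<in> borel_measurable (PiM J (\<lambda>_. borel))"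
    using J by auto
  have meas: "(\<lambda>z. rot p q (\<theta> z) z) \<in> measurable (PiM J (\<lambda>_. borel)) (PiM J (\<lambda>_. borel))"
  proof (rule measurable_PiM_single')
    show "(\<lambda>z. rot p q (\<theta> z) z i) \<in> borel_measurable (PiM J (\<lambda>_. borel))" if "i \<in> J" for i
      using that J unfolding rot_def
      by (cases "i = q"; cases "i = p") (auto intro!: measurable_component_singleton)
    show "(\<lambda>z. rot p q (\<theta> z) z) \<in> space (Pi\<^sub>M J (\<lambda>_. borel)) \<rightarrow> J \<rightarrow>\<^sub>E space borel"
      using J by (auto simp: space_PiM rot_def PiE_def extensional_def)
  qed
  have \<theta>q[measurable]: "\<theta> \<in> borel_measurable (PiM (insert q K) (\<lambda>_. borel))"
  proof -
    \<comment> \<open>As \<open>\<theta>\<close> ignores coordinate \<open>p\<close>, filling that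
      slot with 0 transports its measurability to the product without \<open>p\<close>.\<close>
    have "(\<lambda>z. z(p := 0)) \<in> measurable (PiM (insert q K) (\<lambda>_. borel)) (PiM J (\<lambda>_. borel :: real measure))"
      unfolding K(4) by (rule measurable_fun_upd[where J="insert q K"]) auto
    from measurable_compose[OF this \<theta>] show ?thesis by (simp add: inv1)
  qed
  have \<theta>p[measurable]: "\<theta> \<in> borel_measurable (PiM (insert p (insert q K)) (\<lambda>_. borel))"
    using \<theta> K(4) by simp
  have char: "(LINT z|std_gauss J. cos ((\<Sum>j\<in>J. a j * rot p q (\<theta> z) z j) + c)) = cos c * exp (- (\<Sum>j\<in>J. (a j)\<^sup>2) / 2)" for a c
  proof -
    \<comment> \<open>\<open>\<alpha>\<close> and \<open>\<beta>\<close> are the coefficients of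
      \<open>z p\<close> and \<open>z q\<close> after the rotation, that is, (a p, a q) turned by
      the opposite angle.\<close>
    define \<alpha> where "\<alpha> z = a p * cos (\<theta> z) + a q * sin (\<theta> z)" for z
    define \<beta> where "\<beta> z = a q * cos (\<theta> z) - a p * sin (\<theta> z)" for z
    have ab: "(\<alpha> z)\<^sup>2 + (\<beta> z)\<^sup>2 = (a p)\<^sup>2 + (a q)\<^sup>2" for z
    proof -
      have "(\<alpha> z)\<^sup>2 + (\<beta> z)\<^sup>2 = ((a p)\<^sup>2 + (a q)\<^sup>2) * ((sin (\<theta> z))\<^sup>2 + (cos (\<theta> z))\<^sup>2)"
        unfolding \<alpha>_def \<beta>_def by algebra
      then show ?thesis by simp
    qed
    have [measurable]: "\<alpha> \<in> borel_measurable (PiM (insert q K) (\<lambda>_. borel))" "\<beta> \<in> borel_measurable (PiM (insert q K) (\<lambda>_. borel))"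
       "\<alpha> \<in> borel_measurable (PiM (insert p (insert q K)) (\<lambda>_. borel))" "\<beta> \<in> borel_measurable (PiM (insert p (insert q K)) (\<lambda>_. borel))"
      unfolding \<alpha>_def \<beta>_def by measurable
    have ai: "\<alpha> (z(p := y)) = \<alpha> z" "\<alpha> (z(q := y)) = \<alpha> z" "\<beta> (z(p := y)) = \<beta> z" "\<beta> (z(q := y)) = \<beta> z" for z y
      unfolding \<alpha>_def \<beta>_def inv1 by simp_all
    have s: "(\<Sum>j\<in>K. a j * (z(p := y)) j) = (\<Sum>j\<in>K. a j * z j)" "(\<Sum>j\<in>K. a j * (z(q := y)) j) = (\<Sum>j\<in>K. a j * z j)" for z y
      using K by (auto intro!: sum.cong)
    have u: "(z(p := y)) q = z q" for z :: "'a \<Rightarrow> real" and y using J by simp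
    have sK: "(\<Sum>j\<in>K. a j * rot p q (\<theta> z) z j) = (\<Sum>j\<in>K. a j * z j)" for z
      by (rule sum.cong) (use K in \<open>auto simp: rot_def\<close>)
    have "(LINT z|std_gauss J. cos ((\<Sum>j\<in>J. a j * rot p q (\<theta> z) z j) + c))
       = (LINT z|std_gauss (insert p (insert q K)). 1 * cos (\<alpha> z * z p + (\<beta> z * z q + ((\<Sum>j\<in>K. a j * z j) + c))))"
      unfolding K(4)
    proof (rule Bochner_Integration.integral_cong[OF refl])
      fix z :: "'a \<Rightarrow> real"
      have "(\<Sum>j\<in>insert p (insert q K). a j * rot p q (\<theta> z) z j) = a p * rot p q (\<theta> z) z p + (a q * rot p q (\<theta> z) z q + (\<Sum>j\<in>K. a j * z j))"
        using K J(4) by (simp add: sK)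
      also have "\<dots> = \<alpha> z * z p + (\<beta> z * z q + (\<Sum>j\<in>K. a j * z j))"
        using J(4) by (simp add: rot_def \<alpha>_def \<beta>_def algebra_simps)
      finally show "cos ((\<Sum>j\<in>insert p (insert q K). a j * rot p q (\<theta> z) z j) + c) = 1 * cos (\<alpha> z * z p + (\<beta> z * z q + ((\<Sum>j\<in>K. a j * z j) + c)))"
        by (simp add: add.assoc)
    qed
    also have "\<dots> = (LINT z|std_gauss (insert q K). 1 * exp (- (\<alpha> z)\<^sup>2 / 2) * cos (\<beta> z * z q + ((\<Sum>j\<in>K. a j * z j) + c)))"
      by (rule std_gauss_integrate_coordinate) (use K in \<open>auto simp: ai s u simp del: fun_upd_apply\<close>)
    also have "\<dots> = (LINT z|std_gauss K. 1 * exp (- (\<alpha> z)\<^sup>2 / 2) * exp (- (\<beta> z)\<^sup>2 / 2) * cos ((\<Sum>j\<in>K. a j * z j) + c))"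
      by (rule std_gauss_integrate_coordinate) (use K in \<open>auto simp: ai s u simp del: fun_upd_apply\<close>)
    also have "\<dots> = (LINT z|std_gauss K. exp (- ((a p)\<^sup>2 + (a q)\<^sup>2) / 2) * cos ((\<Sum>j\<in>K. a j * z j) + c))"
    proof (rule Bochner_Integration.integral_cong[OF refl])
      fix z
      have "exp (- (\<alpha> z)\<^sup>2 / 2) * exp (- (\<beta> z)\<^sup>2 / 2) = exp (- ((\<alpha> z)\<^sup>2 + (\<beta> z)\<^sup>2) / 2)"
        by (simp add: exp_add[symmetric] add_divide_distrib)
      then show "1 * exp (- (\<alpha> z)\<^sup>2 / 2) * exp (- (\<beta> z)\<^sup>2 / 2) * cos ((\<Sum>j\<in>K. a j * z j) + c) = exp (- ((a p)\<^sup>2 + (a q)\<^sup>2) / 2) * cos ((\<Sum>j\<in>K. a j * z j) + c)"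
        by (simp add: ab)
    qed
    also have "\<dots> = exp (- ((a p)\<^sup>2 + (a q)\<^sup>2) / 2) * (cos c * exp (- (\<Sum>j\<in>K. (a j)\<^sup>2) / 2))"
      by (simp add: std_gauss_char_id K)
    also have "\<dots> = cos c * exp (- (\<Sum>j\<in>J. (a j)\<^sup>2) / 2)"
      using K J(4) by (simp add: exp_add[symmetric] add_divide_distrib diff_divide_distrib add_ac)
    finally show ?thesis .
  qed
  have "std_gauss_char (std_gauss J) J (\<lambda>j z. rot p q (\<theta> z) z j)"
    unfolding std_gauss_char_def
  proof (intro allI conjI)
    fix a
    show "(LINT z|std_gauss J. cos (\<Sum>j\<in>J. a j * rot p q (\<theta> z) z j)) = exp (- (\<Sum>j\<in>J. (a j)\<^sup>2) / 2)"
      using char[of a 0] by simp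
    show "(LINT z|std_gauss J. sin (\<Sum>j\<in>J. a j * rot p q (\<theta> z) z j)) = 0"
      using char[of a "- (pi/2)"] by (simp add: cos_diff)
  qed
  then have "distr (std_gauss J) (PiM J (\<lambda>_. borel)) (\<lambda>z. \<lambda>j\<in>J. rot p q (\<theta> z) z j) = std_gauss J"
    using measurable_compose[OF meas measurable_component_singleton]
    by (intro distr_eq_std_gauss J prob_space_std_gauss) (auto cong: measurable_cong_sets simp: sets_std_gauss)
  moreover have "distr (std_gauss J) (PiM J (\<lambda>_. borel)) (\<lambda>z. \<lambda>j\<in>J. rot p q (\<theta> z) z j) = distr (std_gauss J) (PiM J (\<lambda>_. borel)) (\<lambda>z. rot p q (\<theta> z) z)"
  proof (rule distr_cong[OF refl refl])
    fix z assume "z \<in> space (std_gauss J)"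
    then have "z \<in> extensional J" by (simp add: space_std_gauss PiE_def)
    then show "(\<lambda>j\<in>J. rot p q (\<theta> z) z j) = rot p q (\<theta> z) z"
      using J by (auto simp: rot_def extensional_def fun_eq_iff)
  qed
  ultimately show ?thesis using meas by (simp add: gauss_preserving_def)
qed

lemma distr_std_gauss_reindex:
  assumes J: "finite J" and inj: "inj_on \<iota> I" and sub: "\<iota> ` I \<subseteq> J"
  shows "distr (std_gauss J) (PiM I (\<lambda>_. borel)) (\<lambda>z. \<lambda>i\<in>I. z (\<iota> i)) = std_gauss I"
proof (rule distr_eq_std_gauss[OF _ prob_space_std_gauss])
  have fI: "finite I" using J inj sub by (meson finite_imageD finite_subset)
  then show "finite I" .
  show "(\<lambda>z. z (\<iota> j)) \<in> borel_measurable (std_gauss J)" if "j \<in> I" for j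
    using that sub measurable_component_singleton[of "\<iota> j" J "\<lambda>_. std_normal_distribution"] by auto
  have *: "(LINT z|std_gauss J. cos ((\<Sum>j\<in>I. a j * z (\<iota> j)) + c)) = cos c * exp (- (\<Sum>j\<in>I. (a j)\<^sup>2) / 2)" for a c
  proof -
    define b where "b j = (if j \<in> \<iota> ` I then a (the_inv_into I \<iota> j) else 0)" for j
    have b: "b (\<iota> i) = a i" if "i \<in> I" for i using that inj by (auto simp: b_def the_inv_into_f_f)
    have 1: "(\<Sum>j\<in>I. a j * z (\<iota> j)) = (\<Sum>j\<in>J. b j * z j)" for z
    proof -
      have "(\<Sum>j\<in>J. b j * z j) = (\<Sum>j\<in>\<iota> ` I. b j * z j)"
        by (rule sum.mono_neutral_right) (use J sub in \<open>auto simp: b_def\<close>)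
      then show ?thesis by (simp add: sum.reindex[OF inj] b)
    qed
    have 2: "(\<Sum>j\<in>I. (a j)\<^sup>2) = (\<Sum>j\<in>J. (b j)\<^sup>2)"
    proof -
      have "(\<Sum>j\<in>J. (b j)\<^sup>2) = (\<Sum>j\<in>\<iota> ` I. (b j)\<^sup>2)"
        by (rule sum.mono_neutral_right) (use J sub in \<open>auto simp: b_def\<close>)
      then show ?thesis by (simp add: sum.reindex[OF inj] b)
    qed
    show ?thesis unfolding 1 2 by (rule std_gauss_char_id[OF J])
  qed
  show "std_gauss_char (std_gauss J) I (\<lambda>i z. z (\<iota> i))"
    unfolding std_gauss_char_def
  proof (intro allI conjI)
    fix a
    show "(LINT z|std_gauss J. cos (\<Sum>j\<in>I. a j * z (\<iota> j))) = exp (- (\<Sum>j\<in>I. (a j)\<^sup>2) / 2)"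
      using *[of a 0] by simp
    show "(LINT z|std_gauss J. sin (\<Sum>j\<in>I. a j * z (\<iota> j))) = 0"
      using *[of a "- (pi/2)"] by (simp add: cos_diff)
  qed
qed

section \<open>Second moments of polynomials of degree at most two in Gaussian variables\<close>

lemma std_normal_quadratic_moment:
  "(\<integral>\<^sup>+y. ennreal ((a + b * y + c * y\<^sup>2)\<^sup>2) \<partial>std_normal_distribution) = ennreal ((a + c)\<^sup>2 + b\<^sup>2 + 2 * c\<^sup>2)"
proof -
  let ?d = std_normal_density
  have m: "has_bochner_integral lborel (\<lambda>y. ?d y * y ^ 0) 1" "has_bochner_integral lborel (\<lambda>y. ?d y * y ^ 1) 0"
    "has_bochner_integral lborel (\<lambda>y. ?d y * y ^ 2) 1" "has_bochner_integral lborel (\<lambda>y. ?d y * y ^ 3) 0" "has_bochner_integral lborel (\<lambda>y. ?d y * y ^ 4) 3"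
    using std_normal_moment_even[of 0] std_normal_moment_odd[of 0] std_normal_moment_even[of 1] std_normal_moment_odd[of 1] std_normal_moment_even[of 2]
    by (auto simp: fact_numeral)
  have "has_bochner_integral lborel (\<lambda>y. a\<^sup>2 * (?d y * y ^ 0) + 2 * a * b * (?d y * y ^ 1) + (b\<^sup>2 + 2 * a * c) * (?d y * y ^ 2) + 2 * b * c * (?d y * y ^ 3) + c\<^sup>2 * (?d y * y ^ 4))
      (a\<^sup>2 * 1 + 2 * a * b * 0 + (b\<^sup>2 + 2 * a * c) * 1 + 2 * b * c * 0 + c\<^sup>2 * 3)"
    by (intro has_bochner_integral_add has_bochner_integral_mult_right) (use m in simp_all)
  also have "(\<lambda>y. a\<^sup>2 * (?d y * y ^ 0) + 2 * a * b * (?d y * y ^ 1) + (b\<^sup>2 + 2 * a * c) * (?d y * y ^ 2) + 2 * b * c * (?d y * y ^ 3) + c\<^sup>2 * (?d y * y ^ 4)) = (\<lambda>y. ?d y * (a + b * y + c * y\<^sup>2)\<^sup>2)"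
    by (rule ext) (simp add: power2_eq_square algebra_simps eval_nat_numeral)
  also have "(a\<^sup>2 * 1 + 2 * a * b * 0 + (b\<^sup>2 + 2 * a * c) * 1 + 2 * b * c * 0 + c\<^sup>2 * 3) = (a + c)\<^sup>2 + b\<^sup>2 + 2 * c\<^sup>2"
    by (simp add: power2_eq_square algebra_simps)
  finally have h: "has_bochner_integral lborel (\<lambda>y. ?d y * (a + b * y + c * y\<^sup>2)\<^sup>2) ((a + c)\<^sup>2 + b\<^sup>2 + 2 * c\<^sup>2)" .
  have "(\<integral>\<^sup>+y. ennreal ((a + b * y + c * y\<^sup>2)\<^sup>2) \<partial>std_normal_distribution) = (\<integral>\<^sup>+y. ennreal (?d y * (a + b * y + c * y\<^sup>2)\<^sup>2) \<partial>lborel)"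
    by (subst nn_integral_density) (auto simp: ennreal_mult normal_density_nonneg)
  also have "\<dots> = ennreal ((a + c)\<^sup>2 + b\<^sup>2 + 2 * c\<^sup>2)"
    using h by (subst nn_integral_eq_integral) (auto simp: has_bochner_integral_iff)
  finally show ?thesis .
qed

lemma std_gauss_linear_moment:
  assumes "finite J"
  shows "(\<integral>\<^sup>+z. ennreal (((\<Sum>i\<in>J. a i * z i) + c)\<^sup>2) \<partial>std_gauss J) = ennreal ((\<Sum>i\<in>J. (a i)\<^sup>2) + c\<^sup>2)"
  using assms
proof (induction J arbitrary: c)
  case empty
  show ?case by (simp add: prob_space.emeasure_space_1[OF prob_space_std_gauss])
next
  case (insert p J)
  interpret product_prob_space "\<lambda>_. std_normal_distribution" by (rule product_prob_space_std_normal)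
  interpret Q: prob_space "std_gauss J" by (rule prob_space_std_gauss)
  have s: "(\<Sum>i\<in>J. a i * (z(p := y)) i) = (\<Sum>i\<in>J. a i * z i)" for z y
    by (rule sum.cong) (use insert in auto)
  have "(\<integral>\<^sup>+z. ennreal (((\<Sum>i\<in>insert p J. a i * z i) + c)\<^sup>2) \<partial>std_gauss (insert p J))
    = (\<integral>\<^sup>+z. (\<integral>\<^sup>+y. ennreal (((\<Sum>i\<in>insert p J. a i * (z(p := y)) i) + c)\<^sup>2) \<partial>std_normal_distribution) \<partial>std_gauss J)"
    by (rule product_nn_integral_insert) (use insert in auto)
  also have "\<dots> = (\<integral>\<^sup>+z. (\<integral>\<^sup>+y. ennreal ((((\<Sum>i\<in>J. a i * z i) + c) + a p * y + 0 * y\<^sup>2)\<^sup>2) \<partial>std_normal_distribution) \<partial>std_gauss J)"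
    unfolding sum.insert[OF insert(1,2)] s by (simp add: algebra_simps)
  also have "\<dots> = (\<integral>\<^sup>+z. ennreal (((\<Sum>i\<in>J. a i * z i) + c)\<^sup>2) + ennreal ((a p)\<^sup>2) \<partial>std_gauss J)"
    unfolding std_normal_quadratic_moment by (simp add: ennreal_plus[symmetric] del: ennreal_plus)
  also have "\<dots> = ennreal ((\<Sum>i\<in>J. (a i)\<^sup>2) + c\<^sup>2) + ennreal ((a p)\<^sup>2)"
    by (subst nn_integral_add) (auto simp: insert.IH Q.emeasure_space_1)
  also have "\<dots> = ennreal ((\<Sum>i\<in>insert p J. (a i)\<^sup>2) + c\<^sup>2)"
    using insert(1,2) by (subst ennreal_plus[symmetric]) (auto intro!: add_nonneg_nonneg sum_nonneg simp: add_ac)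
  finally show ?case .
qed

text \<open>Wick's formula: squared mean plus twice the squared Hilbert-Schmidt norm. The constant
  \<open>c\<close> is arbitrary in the induction because integrating out a coordinate
  \<open>p\<close> adds its diagonal coefficient \<open>m p p\<close> to it.\<close>

lemma std_gauss_quadratic_moment:
  assumes "finite J" and "\<And>i j. m i j = m j i"
  shows "(\<integral>\<^sup>+z. ennreal (((\<Sum>i\<in>J. \<Sum>j\<in>J. m i j * z i * z j) + c)\<^sup>2) \<partial>std_gauss J)
    = ennreal (((\<Sum>i\<in>J. m i i) + c)\<^sup>2 + 2 * (\<Sum>i\<in>J. \<Sum>j\<in>J. (m i j)\<^sup>2))"
  using assms(1)
proof (induction J arbitrary: c)
  case empty
  show ?case by (simp add: prob_space.emeasure_space_1[OF prob_space_std_gauss])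
next
  case (insert p J)
  interpret product_prob_space "\<lambda>_. std_normal_distribution" by (rule product_prob_space_std_normal)
  interpret Q: prob_space "std_gauss J" by (rule prob_space_std_gauss)
  define Q where "Q z = (\<Sum>i\<in>J. \<Sum>j\<in>J. m i j * z i * z j)" for z
  define l where "l z = (\<Sum>i\<in>J. m p i * z i)" for z
  have Qe: "(\<Sum>i\<in>insert p J. \<Sum>j\<in>insert p J. m i j * z i * z j) = Q z + (2 * l z) * z p + m p p * (z p)\<^sup>2" for z
  proof -
    have "(\<Sum>i\<in>J. m i p * z i * z p) = l z * z p"
      unfolding l_def sum_distrib_right by (rule sum.cong) (auto simp: assms(2))
    moreover have "(\<Sum>j\<in>J. m p j * z p * z j) = l z * z p"
      unfolding l_def sum_distrib_right by (rule sum.cong) auto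
    ultimately show ?thesis using insert(1,2) by (simp add: sum.distrib Q_def power2_eq_square algebra_simps)
  qed
  have s: "Q (z(p := y)) = Q z" "l (z(p := y)) = l z" for z y
    unfolding Q_def l_def by (auto intro!: sum.cong) (use insert in auto)
  have [measurable]: "Q \<in> borel_measurable (std_gauss J)" "l \<in> borel_measurable (std_gauss J)"
    unfolding Q_def l_def by measurable
  have "(\<integral>\<^sup>+z. ennreal (((\<Sum>i\<in>insert p J. \<Sum>j\<in>insert p J. m i j * z i * z j) + c)\<^sup>2) \<partial>std_gauss (insert p J))
    = (\<integral>\<^sup>+z. (\<integral>\<^sup>+y. ennreal (((\<Sum>i\<in>insert p J. \<Sum>j\<in>insert p J. m i j * (z(p := y)) i * (z(p := y)) j) + c)\<^sup>2) \<partial>std_normal_distribution) \<partial>std_gauss J)"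
    by (rule product_nn_integral_insert) (use insert in auto)
  also have "\<dots> = (\<integral>\<^sup>+z. (\<integral>\<^sup>+y. ennreal (((Q z + c) + (2 * l z) * y + m p p * y\<^sup>2)\<^sup>2) \<partial>std_normal_distribution) \<partial>std_gauss J)"
    unfolding Qe s by (simp add: algebra_simps)
  \<comment> \<open>The polynomial in the new coordinate has linear coefficient 2 l(z) by symmetry
    of \<open>m\<close>, hence the factor 4; its leading coefficient \<open>m p p\<close>
    contributes both to the mean and to the variance.\<close>
  also have "\<dots> = (\<integral>\<^sup>+z. ennreal ((Q z + (c + m p p))\<^sup>2) + ennreal 4 * ennreal ((l z + 0)\<^sup>2) + ennreal (2 * (m p p)\<^sup>2) \<partial>std_gauss J)"
    unfolding std_normal_quadratic_moment by (intro nn_integral_cong)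
      (simp add: ennreal_plus[symmetric] ennreal_mult[symmetric] power_mult_distrib add.assoc del: ennreal_plus ennreal_numeral)
  also have "\<dots> = ennreal (((\<Sum>i\<in>J. m i i) + (c + m p p))\<^sup>2 + 2 * (\<Sum>i\<in>J. \<Sum>j\<in>J. (m i j)\<^sup>2)) + ennreal 4 * ennreal ((\<Sum>i\<in>J. (m p i)\<^sup>2) + 0\<^sup>2) + ennreal (2 * (m p p)\<^sup>2)"
  proof -
    have 1: "(\<integral>\<^sup>+z. ennreal ((Q z + (c + m p p))\<^sup>2) \<partial>std_gauss J) = ennreal (((\<Sum>i\<in>J. m i i) + (c + m p p))\<^sup>2 + 2 * (\<Sum>i\<in>J. \<Sum>j\<in>J. (m i j)\<^sup>2))"
      unfolding Q_def by (rule insert.IH)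
    have 2: "(\<integral>\<^sup>+z. ennreal ((l z + 0)\<^sup>2) \<partial>std_gauss J) = ennreal ((\<Sum>i\<in>J. (m p i)\<^sup>2) + 0\<^sup>2)"
      unfolding l_def by (rule std_gauss_linear_moment[OF insert(1)])
    have 3: "(\<integral>\<^sup>+z. ennreal 4 * ennreal ((l z + 0)\<^sup>2) \<partial>std_gauss J) = ennreal 4 * ennreal ((\<Sum>i\<in>J. (m p i)\<^sup>2) + 0\<^sup>2)"
      unfolding 2[symmetric] by (rule nn_integral_cmult) measurable
    have 4: "(\<integral>\<^sup>+z. ennreal (2 * (m p p)\<^sup>2) \<partial>std_gauss J) = ennreal (2 * (m p p)\<^sup>2)"
      by (simp only: nn_integral_const Q.emeasure_space_1 mult_1_right)
    show ?thesis
      by (subst nn_integral_add, measurable)+ (simp only: 1 3 4)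
  qed
  also have "\<dots> = ennreal (((\<Sum>i\<in>J. m i i) + (c + m p p))\<^sup>2 + 2 * (\<Sum>i\<in>J. \<Sum>j\<in>J. (m i j)\<^sup>2) + 4 * (\<Sum>i\<in>J. (m p i)\<^sup>2) + 2 * (m p p)\<^sup>2)"
    by (simp add: ennreal_plus[symmetric] ennreal_mult[symmetric] sum_nonneg del: ennreal_plus ennreal_numeral)
  also have "((\<Sum>i\<in>J. m i i) + (c + m p p))\<^sup>2 + 2 * (\<Sum>i\<in>J. \<Sum>j\<in>J. (m i j)\<^sup>2) + 4 * (\<Sum>i\<in>J. (m p i)\<^sup>2) + 2 * (m p p)\<^sup>2
     = ((\<Sum>i\<in>insert p J. m i i) + c)\<^sup>2 + 2 * (\<Sum>i\<in>insert p J. \<Sum>j\<in>insert p J. (m i j)\<^sup>2)"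
  proof -
    have "(\<Sum>i\<in>J. (m i p)\<^sup>2) = (\<Sum>i\<in>J. (m p i)\<^sup>2)"
      by (rule sum.cong) (auto simp: assms(2))
    then show ?thesis using insert(1,2) by (simp add: sum.distrib add_ac)
  qed
  finally show ?case .
qed

section \<open>Divergence-free quadratic drifts\<close>

text \<open>Points are compared coordinatewise on the cube of half-side \<open>K\<close> over
  \<open>I\<close>, and the field is evaluated at indices of \<open>I\<close>; so the same field can
  be used when the coordinates of \<open>I\<close> sit inside a larger index set.\<close>

definition lip_bound :: "'j set \<Rightarrow> (('j \<Rightarrow> real) \<Rightarrow> 'j \<Rightarrow> real) \<Rightarrow> real \<Rightarrow> real \<Rightarrow> bool" where
  "lip_bound I b K L \<longleftrightarrow> 0 \<le> L \<and> (\<forall>z z' \<delta>.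
     (\<forall>j\<in>I. \<bar>z j\<bar> \<le> K \<and> \<bar>z' j\<bar> \<le> K \<and> \<bar>z j - z' j\<bar> \<le> \<delta>) \<longrightarrow> (\<forall>i\<in>I. \<bar>b z i - b z' i\<bar> \<le> L * \<delta>))"

definition loc_lipschitz :: "'j set \<Rightarrow> (('j \<Rightarrow> real) \<Rightarrow> 'j \<Rightarrow> real) \<Rightarrow> bool" where
  "loc_lipschitz I b \<longleftrightarrow> (\<forall>K. \<exists>L. lip_bound I b K L)"

definition splitting_bound ::
  "'j set \<Rightarrow> (('j \<Rightarrow> real) \<Rightarrow> 'j \<Rightarrow> real) \<Rightarrow> (real \<Rightarrow> ('j \<Rightarrow> real) \<Rightarrow> 'j \<Rightarrow> real) \<Rightarrow> real \<Rightarrow> real \<Rightarrow> bool" where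
  "splitting_bound I b \<Phi> K C \<longleftrightarrow> 0 \<le> C \<and> (\<forall>(h::real) z. 0 \<le> h \<longrightarrow> h \<le> 1 \<longrightarrow> (\<forall>j\<in>I. \<bar>z j\<bar> \<le> K) \<longrightarrow>
        (\<forall>i\<in>I. \<bar>\<Phi> h z i - z i - h * b z i\<bar> \<le> C * h\<^sup>2))"

text \<open>\<open>\<Phi> h\<close> is a one-step approximation of the flow of \<open>b\<close> with
  local error of second order. Invariance is demanded on every finite \<open>J\<close> containing
  \<open>I\<close>, because in the final scheme the same map acts on a state that also carries noise
  coordinates, which it must leave alone.\<close>

definition gauss_splitting ::
  "'j set \<Rightarrow> (('j \<Rightarrow> real) \<Rightarrow> 'j \<Rightarrow> real) \<Rightarrow> (real \<Rightarrow> ('j \<Rightarrow> real) \<Rightarrow> 'j \<Rightarrow> real) \<Rightarrow> bool" where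
  "gauss_splitting I b \<Phi> \<longleftrightarrow>
     (\<forall>h J. finite J \<longrightarrow> I \<subseteq> J \<longrightarrow> gauss_preserving J (\<Phi> h)) \<and>
     (\<forall>h z. \<forall>j. j \<notin> I \<longrightarrow> \<Phi> h z j = z j) \<and>
     (\<forall>K. \<exists>C. splitting_bound I b \<Phi> K C)"

definition admissible :: "'j set \<Rightarrow> (('j \<Rightarrow> real) \<Rightarrow> 'j \<Rightarrow> real) \<Rightarrow> bool" where
  "admissible I b \<longleftrightarrow> loc_lipschitz I b \<and> (\<exists>\<Phi>. gauss_splitting I b \<Phi>)"

lemma lip_boundD:
  assumes "lip_bound I b K L"
  shows "0 \<le> L" "\<And>z z' \<delta> i. (\<And>j. j \<in> I \<Longrightarrow> \<bar>z j\<bar> \<le> K \<and> \<bar>z' j\<bar> \<le> K \<and> \<bar>z j - z' j\<bar> \<le> \<delta>) \<Longrightarrow> i \<in> I \<Longrightarrow> \<bar>b z i - b z' i\<bar> \<le> L * \<delta>"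
  subgoal using assms unfolding lip_bound_def by (rule conjunct1)
  subgoal by (rule assms[unfolded lip_bound_def, THEN conjunct2, rule_format])
  done

lemma splitting_boundD:
  assumes "splitting_bound I b \<Phi> K C"
  shows "0 \<le> C" "\<And>h z i. 0 \<le> h \<Longrightarrow> h \<le> 1 \<Longrightarrow> (\<And>j. j \<in> I \<Longrightarrow> \<bar>z j\<bar> \<le> K) \<Longrightarrow> i \<in> I \<Longrightarrow> \<bar>\<Phi> h z i - z i - h * b z i\<bar> \<le> C * h\<^sup>2"
  subgoal using assms unfolding splitting_bound_def by (rule conjunct1)
  subgoal by (rule assms[unfolded splitting_bound_def, THEN conjunct2, rule_format])
  done

lemma loc_lipschitz_bounded:
  assumes "finite I" "loc_lipschitz I b"
  shows "\<exists>B\<ge>0. \<forall>z. (\<forall>j\<in>I. \<bar>z j\<bar> \<le> K) \<longrightarrow> (\<forall>i\<in>I. \<bar>b z i\<bar> \<le> B)"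
proof -
  obtain L where L0: "lip_bound I b \<bar>K\<bar> L" using assms unfolding loc_lipschitz_def by blast
  note L = lip_boundD[OF L0]
  show ?thesis
  proof (intro exI[of _ "(\<Sum>i\<in>I. \<bar>b (\<lambda>_. 0) i\<bar>) + L * \<bar>K\<bar>"] conjI allI impI ballI)
    show "0 \<le> (\<Sum>i\<in>I. \<bar>b (\<lambda>_. 0) i\<bar>) + L * \<bar>K\<bar>"
      using L(1) by (intro add_nonneg_nonneg sum_nonneg mult_nonneg_nonneg) auto
    fix z i assume z: "\<forall>j\<in>I. \<bar>z j\<bar> \<le> K" and i: "i \<in> I"
    have z': "\<bar>z j\<bar> \<le> \<bar>K\<bar>" if "j \<in> I" for j using z that by fastforce
    have "\<bar>b z i - b (\<lambda>_. 0) i\<bar> \<le> L * \<bar>K\<bar>"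
      by (rule L(2)) (use z' i in auto)
    moreover have "\<bar>b (\<lambda>_. 0) i\<bar> \<le> (\<Sum>i\<in>I. \<bar>b (\<lambda>_. 0) i\<bar>)"
      by (rule member_le_sum) (use i assms in auto)
    ultimately show "\<bar>b z i\<bar> \<le> (\<Sum>i\<in>I. \<bar>b (\<lambda>_. 0) i\<bar>) + L * \<bar>K\<bar>" by linarith
  qed
qed

lemma admissible_cong:
  assumes "\<And>z i. i \<in> I \<Longrightarrow> b z i = b' z i" "admissible I b"
  shows "admissible I b'"
  using assms unfolding admissible_def loc_lipschitz_def lip_bound_def gauss_splitting_def splitting_bound_def by simp

lemma gauss_preserving_id: "gauss_preserving J (\<lambda>z. z)"
  unfolding gauss_preserving_def by (auto intro!: distr_id2 simp: sets_std_gauss)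

lemma admissible_zero: "admissible I (\<lambda>_ _. 0)"
  unfolding admissible_def loc_lipschitz_def lip_bound_def
proof (intro conjI exI[of _ "\<lambda>h z. z"])
  show "gauss_splitting I (\<lambda>_ _. 0) (\<lambda>h z. z)"
    unfolding gauss_splitting_def splitting_bound_def by (auto simp: gauss_preserving_id intro!: exI[of _ 0])
qed (auto intro!: exI[of _ 0])

lemma loc_lipschitz_add:
  assumes "loc_lipschitz I b1" "loc_lipschitz I b2"
  shows "loc_lipschitz I (\<lambda>z i. b1 z i + b2 z i)"
  unfolding loc_lipschitz_def lip_bound_def
proof
  fix K
  obtain L1 where L10: "lip_bound I b1 (K) L1" using assms(1) unfolding loc_lipschitz_def by blast
  note L1 = lip_boundD[OF L10]
  obtain L2 where L20: "lip_bound I b2 (K) L2" using assms(2) unfolding loc_lipschitz_def by blast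
  note L2 = lip_boundD[OF L20]
  show "\<exists>L. 0 \<le> L \<and> (\<forall>z z' \<delta>. (\<forall>j\<in>I. \<bar>z j\<bar> \<le> K \<and> \<bar>z' j\<bar> \<le> K \<and> \<bar>z j - z' j\<bar> \<le> \<delta>) \<longrightarrow>
      (\<forall>i\<in>I. \<bar>(b1 z i + b2 z i) - (b1 z' i + b2 z' i)\<bar> \<le> L * \<delta>))"
  proof (intro exI[of _ "L1 + L2"] conjI allI impI ballI)
    fix z z' \<delta> i assume *: "\<forall>j\<in>I. \<bar>z j\<bar> \<le> K \<and> \<bar>z' j\<bar> \<le> K \<and> \<bar>z j - z' j\<bar> \<le> \<delta>" "i \<in> I"
    have "\<bar>b1 z i - b1 z' i\<bar> \<le> L1 * \<delta>" "\<bar>b2 z i - b2 z' i\<bar> \<le> L2 * \<delta>"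
      using * by (auto intro!: L1 L2)
    then show "\<bar>(b1 z i + b2 z i) - (b1 z' i + b2 z' i)\<bar> \<le> (L1 + L2) * \<delta>"
      by (simp add: algebra_simps)
  qed (use L1(1) L2(1) in auto)
qed

text \<open>Lie splitting: performing the two steps one after the other approximates the flow of the
  sum, the commutator effect being of second order in \<open>h\<close>, while measure preservation
  survives composition exactly.\<close>

lemma gauss_splitting_comp:
  assumes fin: "finite I" and b1: "loc_lipschitz I b1" "gauss_splitting I b1 \<Phi>1" and b2: "loc_lipschitz I b2" "gauss_splitting I b2 \<Phi>2"
  shows "gauss_splitting I (\<lambda>z i. b1 z i + b2 z i) (\<lambda>h z. \<Phi>1 h (\<Phi>2 h z))"
  unfolding gauss_splitting_def splitting_bound_def
proof (intro conjI allI impI)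
  fix h and J :: "'a set" assume "finite J" "I \<subseteq> J"
  then have "gauss_preserving J (\<Phi>1 h)" "gauss_preserving J (\<Phi>2 h)"
    using b1(2) b2(2) unfolding gauss_splitting_def by blast+
  then show "gauss_preserving J (\<lambda>z. \<Phi>1 h (\<Phi>2 h z))" by (rule gauss_preserving_comp)
next
  fix h z j assume "j \<notin> I"
  then have "\<Phi>1 h (\<Phi>2 h z) j = \<Phi>2 h z j" "\<Phi>2 h z j = z j"
    using b1(2) b2(2) unfolding gauss_splitting_def by blast+
  then show "\<Phi>1 h (\<Phi>2 h z) j = z j" by simp
next
  fix K
  obtain B where B0: "B \<ge> 0" "\<forall>z. (\<forall>j\<in>I. \<bar>z j\<bar> \<le> K) \<longrightarrow> (\<forall>i\<in>I. \<bar>b2 z i\<bar> \<le> B)"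
    using loc_lipschitz_bounded[OF fin b2(1), of K] by blast
  have B: "B \<ge> 0" "\<And>z i. (\<And>j. j \<in> I \<Longrightarrow> \<bar>z j\<bar> \<le> K) \<Longrightarrow> i \<in> I \<Longrightarrow> \<bar>b2 z i\<bar> \<le> B"
    subgoal by (rule B0(1))
    subgoal by (rule B0(2)[rule_format])
    done
  obtain C2 where C20: "splitting_bound I b2 \<Phi>2 (K) C2" using b2(2) unfolding gauss_splitting_def by blast
  note C2 = splitting_boundD[OF C20]
  \<comment> \<open>The first substep moves each coordinate by at most h(B + C2) \<le> B + C2, so
    the second one acts inside the cube of half-side \<open>K'\<close>.\<close>
  define K' where "K' = K + B + C2"
  obtain C1 where C10: "splitting_bound I b1 \<Phi>1 (K') C1" using b1(2) unfolding gauss_splitting_def by blast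
  note C1 = splitting_boundD[OF C10]
  obtain L where L0: "lip_bound I b1 (K') L" using b1(1) unfolding loc_lipschitz_def by blast
  note L = lip_boundD[OF L0]
  show "\<exists>C. 0 \<le> C \<and> (\<forall>(h::real) z. 0 \<le> h \<longrightarrow> h \<le> 1 \<longrightarrow> (\<forall>j\<in>I. \<bar>z j\<bar> \<le> K) \<longrightarrow>
        (\<forall>i\<in>I. \<bar>\<Phi>1 h (\<Phi>2 h z) i - z i - h * (b1 z i + b2 z i)\<bar> \<le> C * h\<^sup>2))"
  proof (intro exI[of _ "C1 + C2 + L * (B + C2)"] conjI allI impI ballI)
    show "0 \<le> C1 + C2 + L * (B + C2)" using C1(1) C2(1) L(1) B(1) by simp
    fix h :: real and z i assume h: "0 \<le> h" "h \<le> 1" and z: "\<forall>j\<in>I. \<bar>z j\<bar> \<le> K" and i: "i \<in> I"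
    have h2: "h\<^sup>2 \<le> h" using h by (simp add: power2_eq_square mult_left_le)
    define z' where "z' = \<Phi>2 h z"
    have d: "\<bar>z' j - z j - h * b2 z j\<bar> \<le> C2 * h\<^sup>2" if "j \<in> I" for j
      unfolding z'_def using that h z by (intro C2) auto
    have b: "\<bar>h * b2 z j\<bar> \<le> h * B" if "j \<in> I" for j
      using B0(2)[rule_format, OF z[rule_format] that] h by (simp add: abs_mult mult_left_mono)
    have Ch: "C2 * h\<^sup>2 \<le> h * C2" using mult_left_mono[OF h2 C2(1)] by (simp add: mult.commute)
    have dz: "\<bar>z' j - z j\<bar> \<le> h * (B + C2)" if "j \<in> I" for j
      using d[OF that] b[OF that] Ch by (simp add: algebra_simps)
    have hB: "h * (B + C2) \<le> B + C2" using h B(1) C2(1) by (simp add: mult_left_le_one_le)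
    have z'K: "\<bar>z' j\<bar> \<le> K'" "\<bar>z j\<bar> \<le> K'" if "j \<in> I" for j
      using dz[OF that] hB z[rule_format, OF that] B(1) C2(1) unfolding K'_def by linarith+
    have 1: "\<bar>\<Phi>1 h z' i - z' i - h * b1 z' i\<bar> \<le> C1 * h\<^sup>2"
      by (rule C1) (use h z'K i in auto)
    have "\<bar>b1 z' i - b1 z i\<bar> \<le> L * (h * (B + C2))"
      by (rule L) (use z'K dz i in auto)
    then have 2: "\<bar>h * (b1 z' i - b1 z i)\<bar> \<le> h * (L * (h * (B + C2)))"
      using h by (simp add: abs_mult mult_left_mono)
    have 3: "\<Phi>1 h z' i - z i - h * (b1 z i + b2 z i) = (\<Phi>1 h z' i - z' i - h * b1 z' i) + (z' i - z i - h * b2 z i) + h * (b1 z' i - b1 z i)"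
      by (simp add: algebra_simps)
    show "\<bar>\<Phi>1 h (\<Phi>2 h z) i - z i - h * (b1 z i + b2 z i)\<bar> \<le> (C1 + C2 + L * (B + C2)) * h\<^sup>2"
      unfolding z'_def[symmetric] 3 using 1 2 d[OF i] by (simp add: algebra_simps power2_eq_square)
  qed
qed

lemma admissible_add:
  assumes "finite I" "admissible I b1" "admissible I b2"
  shows "admissible I (\<lambda>z i. b1 z i + b2 z i)"
  using assms loc_lipschitz_add gauss_splitting_comp[OF assms(1)] unfolding admissible_def by blast

lemma admissible_sum:
  assumes "finite I" "\<And>s. s \<in> S \<Longrightarrow> admissible I (b s)"
  shows "admissible I (\<lambda>z i. \<Sum>s\<in>S. b s z i)"
  using assms(2)
proof (induction S rule: infinite_finite_induct)
  case (insert s S)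
  then show ?case using admissible_add[OF assms(1), of "b s" "\<lambda>z i. \<Sum>s\<in>S. b s z i"] by simp
qed (simp_all add: admissible_zero)

section \<open>Conjugation by fixed rotations and the elementary rotation fields\<close>

lemma rot_diff: "rot u v t (\<lambda>j. x j - y j) = (\<lambda>j. rot u v t x j - rot u v t y j)"
  by (auto simp: rot_def fun_eq_iff algebra_simps)

lemma rot_scale: "rot u v t (\<lambda>j. c * x j) = (\<lambda>j. c * rot u v t x j)"
  by (auto simp: rot_def fun_eq_iff algebra_simps)

lemma rot_inverse:
  assumes "u \<noteq> v"
  shows "rot u v (- t) (rot u v t z) = z"
proof -
  have 1: "cos t * (cos t * a - sin t * b) + sin t * (sin t * a + cos t * b) = a" for a b
  proof -
    have "cos t * (cos t * a - sin t * b) + sin t * (sin t * a + cos t * b) = a * ((sin t)\<^sup>2 + (cos t)\<^sup>2)" by algebra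
    then show ?thesis by simp
  qed
  have 2: "- (sin t * (cos t * a - sin t * b)) + cos t * (sin t * a + cos t * b) = b" for a b
  proof -
    have "- (sin t * (cos t * a - sin t * b)) + cos t * (sin t * a + cos t * b) = b * ((sin t)\<^sup>2 + (cos t)\<^sup>2)" by algebra
    then show ?thesis by simp
  qed
  show ?thesis using assms 1 2 by (auto simp: rot_def fun_eq_iff)
qed

text \<open>Rotations are not isometries for the maximum norm; the factor 2 bounds |cos t| + |sin
  t|.\<close>

lemma rot_bound:
  assumes "u \<in> I" "v \<in> I" "\<And>j. j \<in> I \<Longrightarrow> \<bar>x j\<bar> \<le> D" "j \<in> I"
  shows "\<bar>rot u v t x j\<bar> \<le> 2 * D"
proof -
  have D: "0 \<le> D" using assms(3)[OF assms(4)] by linarith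
  have m: "\<bar>c * y\<bar> \<le> D" if "\<bar>c\<bar> \<le> 1" "\<bar>y\<bar> \<le> D" for c y :: real
    using mult_mono[OF that] D by (simp add: abs_mult)
  have "\<bar>cos t * x u\<bar> \<le> D" "\<bar>sin t * x u\<bar> \<le> D" "\<bar>cos t * x v\<bar> \<le> D" "\<bar>sin t * x v\<bar> \<le> D"
    using assms by (auto intro!: m)
  then show ?thesis using assms(3)[OF assms(4)] D by (auto simp: rot_def)
qed

text \<open>A change of orthonormal coordinates in one plane preserves the Gaussian measure, so a
  splitting for \<open>b\<close> conjugates to a splitting for the conjugated field. The constants
  only change through the factor 2 of \<open>rot_bound\<close>.\<close>

lemma admissible_conj:
  assumes "admissible I b" and uv: "u \<in> I" "v \<in> I" "u \<noteq> v"
  shows "admissible I (\<lambda>z. rot u v (- t) (b (rot u v t z)))"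
proof -
  from assms obtain \<Phi> where lip: "loc_lipschitz I b" and \<Phi>: "gauss_splitting I b \<Phi>" by (auto simp: admissible_def)
  have "loc_lipschitz I (\<lambda>z. rot u v (- t) (b (rot u v t z)))"
    unfolding loc_lipschitz_def lip_bound_def
  proof
    fix K
    obtain L where L0: "lip_bound I b (2 * K) L" using lip unfolding loc_lipschitz_def by blast
    note L = lip_boundD[OF L0]
    show "\<exists>L. 0 \<le> L \<and> (\<forall>z z' \<delta>. (\<forall>j\<in>I. \<bar>z j\<bar> \<le> K \<and> \<bar>z' j\<bar> \<le> K \<and> \<bar>z j - z' j\<bar> \<le> \<delta>) \<longrightarrow>
       (\<forall>i\<in>I. \<bar>rot u v (- t) (b (rot u v t z)) i - rot u v (- t) (b (rot u v t z')) i\<bar> \<le> L * \<delta>))"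
    proof (intro exI[of _ "4 * L"] conjI allI impI ballI)
      fix z z' \<delta> i assume *: "\<forall>j\<in>I. \<bar>z j\<bar> \<le> K \<and> \<bar>z' j\<bar> \<le> K \<and> \<bar>z j - z' j\<bar> \<le> \<delta>" "i \<in> I"
      have d: "\<bar>rot u v t z j - rot u v t z' j\<bar> \<le> 2 * \<delta>" if "j \<in> I" for j
        using rot_bound[of u I v "\<lambda>j. z j - z' j" \<delta> j t] uv * that by (auto simp: rot_diff)
      have "\<bar>b (rot u v t z) j - b (rot u v t z') j\<bar> \<le> L * (2 * \<delta>)" if "j \<in> I" for j
        by (rule L) (use d * that uv in \<open>auto intro!: rot_bound\<close>)
      then have "\<bar>rot u v (- t) (\<lambda>j. b (rot u v t z) j - b (rot u v t z') j) i\<bar> \<le> 2 * (L * (2 * \<delta>))"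
        using uv * by (intro rot_bound[of u I v]) auto
      then show "\<bar>rot u v (- t) (b (rot u v t z)) i - rot u v (- t) (b (rot u v t z')) i\<bar> \<le> 4 * L * \<delta>"
        by (simp add: rot_diff)
    qed (use L(1) in auto)
  qed
  moreover have "gauss_splitting I (\<lambda>z. rot u v (- t) (b (rot u v t z))) (\<lambda>h z. rot u v (- t) (\<Phi> h (rot u v t z)))"
    unfolding gauss_splitting_def splitting_bound_def
  proof (intro conjI allI impI)
    fix h and J :: "'a set" assume J: "finite J" "I \<subseteq> J"
    have r: "gauss_preserving J (rot u v s)" for s
      by (rule gauss_preserving_rot) (use J uv in auto)
    show "gauss_preserving J (\<lambda>z. rot u v (- t) (\<Phi> h (rot u v t z)))"
      using \<Phi> J unfolding gauss_splitting_def by (intro gauss_preserving_comp[OF r gauss_preserving_comp[OF _ r]]) blast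
  next
    fix h z j assume "j \<notin> I"
    then have "\<Phi> h (rot u v t z) j = rot u v t z j"
      using \<Phi> unfolding gauss_splitting_def by blast
    moreover have "j \<noteq> u" "j \<noteq> v" using \<open>j \<notin> I\<close> uv by auto
    ultimately show "rot u v (- t) (\<Phi> h (rot u v t z)) j = z j" by (simp add: rot_def)
  next
    fix K
    obtain C where C0: "splitting_bound I b \<Phi> (2 * K) C" using \<Phi> unfolding gauss_splitting_def by blast
    note C = splitting_boundD[OF C0]
    show "\<exists>C. 0 \<le> C \<and> (\<forall>(h::real) z. 0 \<le> h \<longrightarrow> h \<le> 1 \<longrightarrow> (\<forall>j\<in>I. \<bar>z j\<bar> \<le> K) \<longrightarrow>
        (\<forall>i\<in>I. \<bar>rot u v (- t) (\<Phi> h (rot u v t z)) i - z i - h * rot u v (- t) (b (rot u v t z)) i\<bar> \<le> C * h\<^sup>2))"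
    proof (intro exI[of _ "2 * C"] conjI allI impI ballI)
      fix h :: real and z i assume h: "0 \<le> h" "h \<le> 1" and z: "\<forall>j\<in>I. \<bar>z j\<bar> \<le> K" and i: "i \<in> I"
      define z' where "z' = rot u v t z"
      have "\<bar>\<Phi> h z' j - z' j - h * b z' j\<bar> \<le> C * h\<^sup>2" if "j \<in> I" for j
        by (rule C) (use h z that uv in \<open>auto intro!: rot_bound simp: z'_def\<close>)
      then have "\<bar>rot u v (- t) (\<lambda>j. \<Phi> h z' j - z' j - h * b z' j) i\<bar> \<le> 2 * (C * h\<^sup>2)"
        using uv i by (intro rot_bound[of u I v]) auto
      then show "\<bar>rot u v (- t) (\<Phi> h (rot u v t z)) i - z i - h * rot u v (- t) (b (rot u v t z)) i\<bar> \<le> 2 * C * h\<^sup>2"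
        using rot_inverse[OF uv(3), of t z] by (simp add: rot_diff rot_scale z'_def)
    qed (use C(1) in auto)
  qed
  ultimately show ?thesis by (auto simp: admissible_def)
qed

text \<open>Infinitesimal rotation of the plane of the coordinates \<open>p\<close> and
  \<open>q\<close> with angular speed c times the coordinate \<open>r\<close>.\<close>

definition triad_field :: "'j \<Rightarrow> 'j \<Rightarrow> 'j \<Rightarrow> real \<Rightarrow> ('j \<Rightarrow> real) \<Rightarrow> 'j \<Rightarrow> real" where
  "triad_field p q r c z l = (if l = q then c * z r * z p else 0) - (if l = p then c * z r * z q else 0)"

lemma abs_mult_diff_le:
  fixes x y x' y' :: real
  assumes "\<bar>x\<bar> \<le> K" "\<bar>y'\<bar> \<le> K" "\<bar>x - x'\<bar> \<le> \<delta>" "\<bar>y - y'\<bar> \<le> \<delta>"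
  shows "\<bar>x * y - x' * y'\<bar> \<le> 2 * K * \<delta>"
proof -
  have "x * y - x' * y' = x * (y - y') + (x - x') * y'" by (simp add: algebra_simps)
  moreover have "\<bar>x * (y - y')\<bar> \<le> K * \<delta>" unfolding abs_mult by (rule mult_mono) (use assms in auto)
  moreover have "\<bar>(x - x') * y'\<bar> \<le> \<delta> * K" unfolding abs_mult by (rule mult_mono) (use assms in auto)
  ultimately show ?thesis by (simp add: algebra_simps)
qed

lemma abs_sin_minus_self_le: "\<bar>sin t - t\<bar> \<le> t\<^sup>2" and abs_cos_minus_one_le: "\<bar>cos t - 1\<bar> \<le> t\<^sup>2" for t :: real
proof -
  have c: "1 - cos t \<le> t\<^sup>2 / 2"
  proof -
    have "1 - cos t = 2 * (sin (t / 2))\<^sup>2" using cos_double_sin[of "t / 2"] by simp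
    also have "\<dots> \<le> 2 * (t / 2)\<^sup>2"
      using abs_sin_x_le_abs_x[of "t / 2"] by (simp add: abs_le_square_iff[symmetric])
    finally show ?thesis by (simp add: power2_eq_square)
  qed
  then show "\<bar>cos t - 1\<bar> \<le> t\<^sup>2" using cos_le_one[of t] zero_le_power2[of t] by linarith
  have "\<bar>sin t - t\<bar> \<le> inverse (fact 2) * \<bar>t\<bar> ^ 2"
    using Maclaurin_sin_bound[of t 2] by (simp add: sin_coeff_def lessThan_nat_numeral eval_nat_numeral)
  then have "2 * \<bar>sin t - t\<bar> \<le> t\<^sup>2" by (simp add: fact_numeral field_simps)
  then show "\<bar>sin t - t\<bar> \<le> t\<^sup>2" by (rule order_trans[rotated]) simp
qed

text \<open>When \<open>r\<close> differs from \<open>p\<close> and \<open>q\<close>, the angular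
  speed is constant along the flow and independent of the rotated plane. The exact flow is then the
  rotation by h c z(r), which \<open>gauss_preserving_rot\<close> accepts; the local error is the
  Taylor remainder of sine and cosine.\<close>

lemma admissible_triad:
  assumes fin: "finite I" and I: "p \<in> I" "q \<in> I" "r \<in> I" and d: "p \<noteq> q" "r \<noteq> p" "r \<noteq> q"
  shows "admissible I (triad_field p q r c)"
  unfolding admissible_def
proof
  show "loc_lipschitz I (triad_field p q r c)"
    unfolding loc_lipschitz_def lip_bound_def
  proof
    fix K
    show "\<exists>L. 0 \<le> L \<and> (\<forall>z z' \<delta>. (\<forall>j\<in>I. \<bar>z j\<bar> \<le> K \<and> \<bar>z' j\<bar> \<le> K \<and> \<bar>z j - z' j\<bar> \<le> \<delta>) \<longrightarrow>
       (\<forall>i\<in>I. \<bar>triad_field p q r c z i - triad_field p q r c z' i\<bar> \<le> L * \<delta>))"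
    proof (intro exI[of _ "\<bar>c\<bar> * (2 * \<bar>K\<bar>)"] conjI allI impI ballI)
      fix z z' \<delta> i assume *: "\<forall>j\<in>I. \<bar>z j\<bar> \<le> K \<and> \<bar>z' j\<bar> \<le> K \<and> \<bar>z j - z' j\<bar> \<le> \<delta>" "i \<in> I"
      have \<delta>: "0 \<le> \<delta>" using *(1) I(1) by fastforce
      have m: "\<bar>c * z r * z s - c * z' r * z' s\<bar> \<le> \<bar>c\<bar> * (2 * \<bar>K\<bar>) * \<delta>" if "s \<in> I" for s
      proof -
        have "\<bar>z r * z s - z' r * z' s\<bar> \<le> 2 * \<bar>K\<bar> * \<delta>"
          by (rule abs_mult_diff_le) (use * I that in \<open>auto intro: order_trans[OF _ abs_ge_self]\<close>)
        then have "\<bar>c\<bar> * \<bar>z r * z s - z' r * z' s\<bar> \<le> \<bar>c\<bar> * (2 * \<bar>K\<bar> * \<delta>)" by (rule mult_left_mono) simp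
        then show ?thesis by (simp add: abs_mult[symmetric] right_diff_distrib mult.assoc)
      qed
      show "\<bar>triad_field p q r c z i - triad_field p q r c z' i\<bar> \<le> \<bar>c\<bar> * (2 * \<bar>K\<bar>) * \<delta>"
        using m[of p] m[of q] I d \<delta> unfolding triad_field_def by (auto simp: abs_minus_commute)
    qed auto
  qed
  show "\<exists>\<Phi>. gauss_splitting I (triad_field p q r c) \<Phi>"
  proof
    show "gauss_splitting I (triad_field p q r c) (\<lambda>h z. rot p q (h * c * z r) z)"
      unfolding gauss_splitting_def splitting_bound_def
    proof (intro conjI allI impI)
      fix h and J :: "'a set" assume J: "finite J" "I \<subseteq> J"
      have [measurable]: "(\<lambda>z. z r) \<in> borel_measurable (PiM J (\<lambda>_. borel))" using J I by auto
      show "gauss_preserving J (\<lambda>z. rot p q (h * c * z r) z)"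
        by (rule gauss_preserving_rot) (use J I d in auto)
    next
      fix h z j assume "j \<notin> I"
      then show "rot p q (h * c * z r) z j = z j" using I by (auto simp: rot_def)
    next
      fix K
      show "\<exists>C. 0 \<le> C \<and> (\<forall>(h::real) z. 0 \<le> h \<longrightarrow> h \<le> 1 \<longrightarrow> (\<forall>j\<in>I. \<bar>z j\<bar> \<le> K) \<longrightarrow>
        (\<forall>i\<in>I. \<bar>rot p q (h * c * z r) z i - z i - h * triad_field p q r c z i\<bar> \<le> C * h\<^sup>2))"
      proof (intro exI[of _ "2 * (c * K)\<^sup>2 * \<bar>K\<bar>"] conjI allI impI ballI)
        fix h :: real and z i assume h: "0 \<le> h" "h \<le> 1" and z: "\<forall>j\<in>I. \<bar>z j\<bar> \<le> K" and i: "i \<in> I"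
        define t where "t = h * c * z r"
        have "(z r)\<^sup>2 \<le> K\<^sup>2" using z I by (auto simp: abs_le_square_iff[symmetric] intro: order_trans[OF _ abs_ge_self])
        then have t2: "t\<^sup>2 \<le> h\<^sup>2 * (c * K)\<^sup>2" unfolding t_def by (simp add: power_mult_distrib mult_left_mono mult.assoc)
        have b: "\<bar>(cos t - 1) * z s\<bar> \<le> h\<^sup>2 * (c * K)\<^sup>2 * \<bar>K\<bar>" "\<bar>(sin t - t) * z s\<bar> \<le> h\<^sup>2 * (c * K)\<^sup>2 * \<bar>K\<bar>" if "s \<in> I" for s
          unfolding abs_mult using that z t2 abs_cos_minus_one_le[of t] abs_sin_minus_self_le[of t]
          by (auto intro!: mult_mono intro: order_trans[OF _ abs_ge_self])
        have e: "rot p q t z i - z i - h * triad_field p q r c z i =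
          (if i = p then (cos t - 1) * z p - (sin t - t) * z q else if i = q then (sin t - t) * z p + (cos t - 1) * z q else 0)"
          using d by (auto simp: rot_def triad_field_def t_def algebra_simps)
        show "\<bar>rot p q (h * c * z r) z i - z i - h * triad_field p q r c z i\<bar> \<le> 2 * (c * K)\<^sup>2 * \<bar>K\<bar> * h\<^sup>2"
        proof -
          have gen: "\<bar>if P then x - y else if Q then x' + y' else 0\<bar> \<le> 2 * D"
            if "\<bar>x\<bar> \<le> D" "\<bar>y\<bar> \<le> D" "\<bar>x'\<bar> \<le> D" "\<bar>y'\<bar> \<le> D" for P Q and x y x' y' D :: real
            using that by auto
          have "2 * (c * K)\<^sup>2 * \<bar>K\<bar> * h\<^sup>2 = 2 * (h\<^sup>2 * (c * K)\<^sup>2 * \<bar>K\<bar>)" by simp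
          then show ?thesis unfolding t_def[symmetric] e
            using gen[OF b(1)[OF I(1)] b(2)[OF I(2)] b(2)[OF I(1)] b(1)[OF I(2)]] by presburger
        qed
      qed auto
    qed
  qed
qed

text \<open>The divergences of the \<open>u\<close> and \<open>v\<close> components are d z(w) and
  -d z(w) and cancel; the \<open>w\<close> component restores tangency to spheres. Neither half of
  the pair would be divergence free alone.\<close>

definition pair_field :: "'j \<Rightarrow> 'j \<Rightarrow> 'j \<Rightarrow> real \<Rightarrow> ('j \<Rightarrow> real) \<Rightarrow> 'j \<Rightarrow> real" where
  "pair_field u v w d z l = (if l = u then d * z u * z w else 0) - (if l = v then d * z v * z w else 0)
     + (if l = w then d * ((z v)\<^sup>2 - (z u)\<^sup>2) else 0)"

text \<open>In the coordinates rotated by \<open>\<pi>/4\<close>, \<open>v\<^sup>2 - u\<^sup>2\<close> becomes a product of the two new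
  coordinates, which are distinct.\<close>

lemma admissible_pair:
  assumes fin: "finite I" and I: "u \<in> I" "v \<in> I" "w \<in> I" and d: "u \<noteq> v" "w \<noteq> u" "w \<noteq> v"
  shows "admissible I (pair_field u v w d)"
proof -
  let ?b = "\<lambda>z i. triad_field u w v d z i + triad_field v w u d z i"
  have "admissible I ?b" by (intro admissible_add admissible_triad) (use assms in auto)
  then have "admissible I (\<lambda>z. rot u v (- (- (pi/4))) (?b (rot u v (- (pi/4)) z)))"
    by (rule admissible_conj) (use assms in auto)
  also have "(\<lambda>z. rot u v (- (- (pi/4))) (?b (rot u v (- (pi/4)) z))) = pair_field u v w d"
  proof (intro ext)
    fix z l
    define s where "s = sqrt 2 / (2::real)"
    have ss: "s * s = 1/2" unfolding s_def by simp
    have s2: "s * (s * x) = x / 2" for x using ss by (metis mult.assoc times_divide_eq_left mult_1)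
    show "rot u v (- (- (pi/4))) (?b (rot u v (- (pi/4)) z)) l = pair_field u v w d z l"
      using d unfolding rot_def triad_field_def pair_field_def cos_minus sin_minus cos_45 sin_45 s_def[symmetric]
      by (auto simp: algebra_simps power2_eq_square s2)
  qed
  finally show ?thesis .
qed

text \<open>The pair fields absorb the terms with a repeated index; \<open>\<sigma>\<close> pairs them so that the
  divergence cancels.\<close>

lemma admissible_quadratic:
  fixes \<beta> :: "'j \<Rightarrow> 'j \<Rightarrow> 'j \<Rightarrow> real"
  assumes fin: "finite I"
    and sym: "\<And>i j k. i \<in> I \<Longrightarrow> j \<in> I \<Longrightarrow> k \<in> I \<Longrightarrow> \<beta> i j k = \<beta> i k j"
    and cyc: "\<And>i j k. i \<in> I \<Longrightarrow> j \<in> I \<Longrightarrow> k \<in> I \<Longrightarrow> \<beta> i j k + \<beta> j k i + \<beta> k i j = 0"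
    and \<sigma>: "\<And>i. i \<in> I \<Longrightarrow> \<sigma> i \<in> I" "\<And>i. i \<in> I \<Longrightarrow> \<sigma> (\<sigma> i) = i"
    and pair: "\<And>i j. i \<in> I \<Longrightarrow> j \<in> I \<Longrightarrow> \<beta> (\<sigma> i) (\<sigma> i) j = - \<beta> i i j"
    and dist: "\<And>i j. i \<in> I \<Longrightarrow> j \<in> I \<Longrightarrow> \<beta> i i j \<noteq> 0 \<Longrightarrow> i \<noteq> \<sigma> i \<and> j \<noteq> i \<and> j \<noteq> \<sigma> i"
  shows "admissible I (\<lambda>z i. \<Sum>j\<in>I. \<Sum>k\<in>I. \<beta> i j k * z j * z k)"
proof -
  \<comment> \<open>Each ordered triple of distinct indices contributes a rotation in the plane of
    its first two members. The resulting field is S - S', and the cyclic identity gives S' = -S/2,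
    so the sum is 3/2 times S; the factor 2/3 undoes this.\<close>
  define g where "g i j k = (if i \<noteq> j \<and> j \<noteq> k \<and> i \<noteq> k then 2/3 * \<beta> i j k else 0)" for i j k
  define b1 where "b1 z l = (\<Sum>i\<in>I. \<Sum>j\<in>I. \<Sum>k\<in>I. triad_field j i k (g i j k) z l)" for z l
  define b2 where "b2 z l = (\<Sum>i\<in>I. \<Sum>j\<in>I. pair_field i (\<sigma> i) j (\<beta> i i j) z l)" for z l
  have z1: "triad_field p q r 0 = (\<lambda>_ _. 0)" for p q r :: 'j by (auto simp: triad_field_def fun_eq_iff)
  have z2: "pair_field p q r 0 = (\<lambda>_ _. 0)" for p q r :: 'j by (auto simp: pair_field_def fun_eq_iff)
  have t: "admissible I (triad_field j i k (g i j k))" if "i \<in> I" "j \<in> I" "k \<in> I" for i j k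
    using that by (cases "i \<noteq> j \<and> j \<noteq> k \<and> i \<noteq> k") (auto simp: g_def z1 admissible_zero intro!: admissible_triad fin)
  have p: "admissible I (pair_field i (\<sigma> i) j (\<beta> i i j))" if "i \<in> I" "j \<in> I" for i j
    using that dist[OF that] by (cases "\<beta> i i j = 0") (auto simp: z2 admissible_zero intro!: admissible_pair fin \<sigma>)
  have "admissible I b1" unfolding b1_def[abs_def] by (intro admissible_sum fin t)
  moreover have "admissible I b2" unfolding b2_def[abs_def] by (intro admissible_sum fin p)
  ultimately have "admissible I (\<lambda>z i. b1 z i + b2 z i)" by (rule admissible_add[OF fin])
  moreover have "b1 z l + b2 z l = (\<Sum>j\<in>I. \<Sum>k\<in>I. \<beta> l j k * z j * z k)" if l: "l \<in> I" for z l
  proof -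
    define S where "S = (\<Sum>j\<in>I. \<Sum>k\<in>I. g l j k * z j * z k)"
    define S' where "S' = (\<Sum>j\<in>I. \<Sum>k\<in>I. g j l k * z j * z k)"
    have "b1 z l = (\<Sum>i\<in>I. \<Sum>j\<in>I. \<Sum>k\<in>I. if l = i then g i j k * z k * z j else 0)
       - (\<Sum>i\<in>I. \<Sum>j\<in>I. \<Sum>k\<in>I. if l = j then g i j k * z k * z i else 0)"
      unfolding b1_def triad_field_def by (simp add: sum_subtractf)
    also have "(\<Sum>i\<in>I. \<Sum>j\<in>I. \<Sum>k\<in>I. if l = i then g i j k * z k * z j else 0) = (\<Sum>i\<in>I. if l = i then (\<Sum>j\<in>I. \<Sum>k\<in>I. g i j k * z k * z j) else 0)"
      by (intro sum.cong refl) auto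
    also have "\<dots> = S" using fin l by (simp add: S_def mult_ac)
    also have "(\<Sum>i\<in>I. \<Sum>j\<in>I. \<Sum>k\<in>I. if l = j then g i j k * z k * z i else 0) = (\<Sum>i\<in>I. \<Sum>j\<in>I. if l = j then (\<Sum>k\<in>I. g i j k * z k * z i) else 0)"
      by (intro sum.cong refl) auto
    also have "\<dots> = S'" using fin l by (simp add: S'_def mult_ac)
    finally have b1: "b1 z l = S - S'" .
    have "S' + S' = (\<Sum>j\<in>I. \<Sum>k\<in>I. g j l k * z j * z k) + (\<Sum>j\<in>I. \<Sum>k\<in>I. g k l j * z j * z k)"
      unfolding S'_def by (subst (3) sum.swap) (simp add: mult_ac)
    also have "\<dots> = (\<Sum>j\<in>I. \<Sum>k\<in>I. (g j l k + g k l j) * z j * z k)"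
      by (simp add: sum.distrib distrib_right)
    also have "\<dots> = (\<Sum>j\<in>I. \<Sum>k\<in>I. - (g l j k * z j * z k))"
    proof (intro sum.cong refl)
      fix j k assume jk: "j \<in> I" "k \<in> I"
      have "\<beta> j l k + \<beta> k l j = - \<beta> l j k" using cyc[of l j k] sym[of j k l] l jk by simp
      then have "g j l k + g k l j = - g l j k" unfolding g_def by auto
      then show "(g j l k + g k l j) * z j * z k = - (g l j k * z j * z k)" by simp
    qed
    also have "\<dots> = - S" by (simp add: S_def sum_negf)
    finally have "b1 z l = 3/2 * S" using b1 by simp
    also have "\<dots> = (\<Sum>j\<in>I. \<Sum>k\<in>I. (if l \<noteq> j \<and> j \<noteq> k \<and> l \<noteq> k then \<beta> l j k * z j * z k else 0))"
      unfolding S_def sum_distrib_left by (intro sum.cong refl) (auto simp: g_def)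
    finally have B1: "b1 z l = (\<Sum>j\<in>I. \<Sum>k\<in>I. (if l \<noteq> j \<and> j \<noteq> k \<and> l \<noteq> k then \<beta> l j k * z j * z k else 0))" .
    have \<sigma>l: "l = \<sigma> i \<longleftrightarrow> i = \<sigma> l" if "i \<in> I" for i using \<sigma> l that by metis
    have "b2 z l = (\<Sum>i\<in>I. \<Sum>j\<in>I. if l = i then \<beta> i i j * z i * z j else 0)
       - (\<Sum>i\<in>I. \<Sum>j\<in>I. if l = \<sigma> i then \<beta> i i j * z (\<sigma> i) * z j else 0)
       + (\<Sum>i\<in>I. \<Sum>j\<in>I. if l = j then \<beta> i i j * ((z (\<sigma> i))\<^sup>2 - (z i)\<^sup>2) else 0)"
      unfolding b2_def pair_field_def by (simp add: sum_subtractf sum.distrib)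
    also have "(\<Sum>i\<in>I. \<Sum>j\<in>I. if l = i then \<beta> i i j * z i * z j else 0) = (\<Sum>i\<in>I. if l = i then (\<Sum>j\<in>I. \<beta> i i j * z i * z j) else 0)"
      by (intro sum.cong refl) auto
    also have "\<dots> = (\<Sum>j\<in>I. \<beta> l l j * z l * z j)" using fin l by simp
    also have "(\<Sum>i\<in>I. \<Sum>j\<in>I. if l = \<sigma> i then \<beta> i i j * z (\<sigma> i) * z j else 0) = (\<Sum>i\<in>I. if i = \<sigma> l then (\<Sum>j\<in>I. \<beta> i i j * z (\<sigma> i) * z j) else 0)"
      using \<sigma>l by (intro sum.cong refl) auto
    also have "\<dots> = - (\<Sum>j\<in>I. \<beta> l l j * z l * z j)"
      using fin l \<sigma> by (simp add: pair sum_negf)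
    also have "(\<Sum>i\<in>I. \<Sum>j\<in>I. if l = j then \<beta> i i j * ((z (\<sigma> i))\<^sup>2 - (z i)\<^sup>2) else 0) = (\<Sum>i\<in>I. \<beta> i i l * (z (\<sigma> i))\<^sup>2) - (\<Sum>i\<in>I. \<beta> i i l * (z i)\<^sup>2)"
      using fin l by (simp add: sum_subtractf right_diff_distrib)
    also have "(\<Sum>i\<in>I. \<beta> i i l * (z (\<sigma> i))\<^sup>2) = (\<Sum>i\<in>I. \<beta> (\<sigma> i) (\<sigma> i) l * (z i)\<^sup>2)"
      by (rule sum.reindex_bij_witness[of _ \<sigma> \<sigma>]) (auto simp: \<sigma>)
    also have "\<dots> = - (\<Sum>i\<in>I. \<beta> i i l * (z i)\<^sup>2)"
      unfolding sum_negf[symmetric] by (intro sum.cong refl) (simp add: pair l)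
    finally have B2: "b2 z l = 2 * (\<Sum>j\<in>I. \<beta> l l j * z l * z j) - 2 * (\<Sum>i\<in>I. \<beta> i i l * (z i)\<^sup>2)" by simp
    have lll: "\<beta> l l l = 0" using cyc[of l l l] l by simp
    \<comment> \<open>Apart from distinct indices there are three ways to repeat one. They overlap
      only when l = j = k, where the coefficient vanishes by cyclicity, so nothing is counted
      twice.\<close>
    have "(\<Sum>j\<in>I. \<Sum>k\<in>I. \<beta> l j k * z j * z k) = (\<Sum>j\<in>I. \<Sum>k\<in>I. (if l \<noteq> j \<and> j \<noteq> k \<and> l \<noteq> k then \<beta> l j k * z j * z k else 0)
        + ((if j = k then \<beta> l j j * z j * z j else 0) + (if l = j then \<beta> l l k * z l * z k else 0) + (if l = k then \<beta> l j l * z j * z l else 0)))"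
      by (intro sum.cong refl) (auto simp: lll)
    also have "\<dots> = b1 z l + (\<Sum>j\<in>I. \<beta> l j j * z j * z j) + (\<Sum>j\<in>I. \<Sum>k\<in>I. if l = j then \<beta> l l k * z l * z k else 0) + (\<Sum>j\<in>I. \<beta> l j l * z j * z l)"
      unfolding B1 using fin l by (simp add: sum.distrib)
    also have "(\<Sum>j\<in>I. \<Sum>k\<in>I. if l = j then \<beta> l l k * z l * z k else 0) = (\<Sum>j\<in>I. if l = j then (\<Sum>k\<in>I. \<beta> l l k * z l * z k) else 0)"
      by (intro sum.cong refl) auto
    also have "\<dots> = (\<Sum>k\<in>I. \<beta> l l k * z l * z k)" using fin l by simp
    also have "(\<Sum>j\<in>I. \<beta> l j l * z j * z l) = (\<Sum>k\<in>I. \<beta> l l k * z l * z k)"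
      by (intro sum.cong refl) (use sym l in \<open>auto simp: mult_ac\<close>)
    also have "(\<Sum>j\<in>I. \<beta> l j j * z j * z j) = (\<Sum>i\<in>I. - 2 * (\<beta> i i l * (z i)\<^sup>2))"
    proof (intro sum.cong refl)
      fix j assume j: "j \<in> I"
      \<comment> \<open>Symmetry in the last two indices and the cyclic identity express the
        coefficient of a square in component \<open>l\<close> through the mixed coefficient in
        component \<open>j\<close>; this matches the third component of
        \<open>pair_field\<close>.\<close>
      have "\<beta> l j j = - 2 * \<beta> j j l" using cyc[of l j j] sym[of j l j] l j by simp
      then show "\<beta> l j j * z j * z j = - 2 * (\<beta> j j l * (z j)\<^sup>2)" by (simp add: power2_eq_square)
    qed
    also have "\<dots> = - 2 * (\<Sum>i\<in>I. \<beta> i i l * (z i)\<^sup>2)" by (simp only: sum_distrib_left)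
    finally show ?thesis using B2 by simp
  qed
  ultimately show ?thesis by (rule admissible_cong[rotated])
qed

section \<open>Convergence of the splitting scheme\<close>

lemma sqrt_one_minus_bound:
  assumes "0 \<le> x" "x \<le> (1::real)"
  shows "\<bar>sqrt (1 - x) - 1\<bar> \<le> x"
proof -
  have "1 - x \<le> sqrt (1 - x)"
    using assms by (intro real_le_rsqrt) (simp add: power2_eq_square mult_left_le)
  moreover have "sqrt (1 - x) \<le> 1" using assms by simp
  ultimately show ?thesis by linarith
qed

text \<open>The damping factor 1 - a h reproduces the linear drift, the splitting step reproduces
  \<open>b\<close>, and \<open>W\<close> is the noise increment recovered from the path itself.
  Every discrepancy is at most a constant times h \<eta>, where \<open>\<eta>\<close> bounds both
  the step size and the oscillation of the path over one step.\<close>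

lemma one_step_error:
  fixes T :: real and X :: "real \<Rightarrow> 'j \<Rightarrow> real"
  assumes i: "i \<in> I" and h: "0 < h" "h \<le> 1" "A * h \<le> 1" "h \<le> \<eta>"
    and a: "0 \<le> a i" "a i \<le> A"
    and st: "0 \<le> s" "t = s + h"
    and cont: "continuous_on {s..t} (\<lambda>r. - a i * X r i + b (X r) i)"
    and XK: "\<And>r j. s \<le> r \<Longrightarrow> r \<le> t \<Longrightarrow> j \<in> I \<Longrightarrow> \<bar>X r j\<bar> \<le> K"
    and mod: "\<And>r j. s \<le> r \<Longrightarrow> r \<le> t \<Longrightarrow> j \<in> I \<Longrightarrow> \<bar>X r j - X s j\<bar> \<le> \<eta>"
    and zK: "\<And>j. j \<in> I \<Longrightarrow> \<bar>z j\<bar> \<le> K"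
    and lip: "lip_bound I b K L" and B: "0 \<le> B" "\<forall>z. (\<forall>j\<in>I. \<bar>z j\<bar> \<le> K) \<longrightarrow> (\<forall>i\<in>I. \<bar>b z i\<bar> \<le> B)"
    and spl: "splitting_bound I b \<Phi> K C"
    and W: "W = X t i - X s i - integral {s..t} (\<lambda>r. - a i * X r i + b (X r) i)"
    and z': "z' = (1 - a i * h) * \<Phi> h z i + sqrt (1 - a i * h / 2) * W"
    and e: "\<And>j. j \<in> I \<Longrightarrow> \<bar>z j - X s j\<bar> \<le> e"
  shows "\<bar>z' - X t i\<bar> \<le> (1 + h * (A + L)) * e + h * (\<eta> * ((A + L) + C + A * B + A * (1 + A * K + B)))"
proof -
  define F where "F x = - a i * x i + b x i" for x
  have L: "0 \<le> L" using lip_boundD(1)[OF lip] .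
  have C: "0 \<le> C" using splitting_boundD(1)[OF spl] .
  have K: "0 \<le> K" using zK[OF i] by linarith
  have A: "0 \<le> A" using a by linarith
  have \<eta>: "0 < \<eta>" using h by linarith
  have Flip: "\<bar>F x - F y\<bar> \<le> (A + L) * d" if "\<And>j. j \<in> I \<Longrightarrow> \<bar>x j\<bar> \<le> K" "\<And>j. j \<in> I \<Longrightarrow> \<bar>y j\<bar> \<le> K" "\<And>j. j \<in> I \<Longrightarrow> \<bar>x j - y j\<bar> \<le> d" for x y d
  proof -
    have "\<bar>b x i - b y i\<bar> \<le> L * d" by (rule lip_boundD(2)[OF lip]) (use that i in auto)
    moreover have "\<bar>a i * (x i - y i)\<bar> \<le> A * d" unfolding abs_mult by (rule mult_mono) (use that i a in auto)
    moreover have "F x - F y = - (a i * (x i - y i)) + (b x i - b y i)" by (simp add: F_def algebra_simps)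
    ultimately show ?thesis by (simp add: distrib_right)
  qed
  have FB: "\<bar>F x\<bar> \<le> A * K + B" if "\<And>j. j \<in> I \<Longrightarrow> \<bar>x j\<bar> \<le> K" for x
  proof -
    have "\<bar>b x i\<bar> \<le> B" using B that i by blast
    moreover have "\<bar>a i * x i\<bar> \<le> A * K" unfolding abs_mult by (rule mult_mono) (use that i a in auto)
    ultimately show ?thesis unfolding F_def by (simp add: abs_le_iff)
  qed
  have sst: "s \<le> t" "t - s = h" using st h by auto
  have int: "(\<lambda>r. F (X r)) integrable_on {s..t}"
    unfolding F_def by (rule integrable_continuous_interval[OF cont])
  define Q where "Q = integral {s..t} (\<lambda>r. F (X r))"
  have Q1: "\<bar>Q\<bar> \<le> (A * K + B) * h"
    unfolding Q_def using integral_bound[of s t "\<lambda>r. F (X r)" "A * K + B"] cont sst FB XK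
    by (auto simp: F_def)
  have Q2: "\<bar>Q - h * F (X s)\<bar> \<le> (A + L) * \<eta> * h"
  proof -
    have "Q - h * F (X s) = integral {s..t} (\<lambda>r. F (X r) - F (X s))"
      unfolding Q_def using int sst by (subst Henstock_Kurzweil_Integration.integral_diff) auto
    also have "\<bar>\<dots>\<bar> \<le> (A + L) * \<eta> * (t - s)"
    proof -
      have "norm (integral {s..t} (\<lambda>r. F (X r) - F (X s))) \<le> (A + L) * \<eta> * (t - s)"
      proof (rule integral_bound)
        show "continuous_on {s..t} (\<lambda>r. F (X r) - F (X s))"
          unfolding F_def by (intro continuous_on_diff cont continuous_on_const)
        show "\<And>r. r \<in> {s..t} \<Longrightarrow> norm (F (X r) - F (X s)) \<le> (A + L) * \<eta>"
          using XK mod sst by (auto intro!: Flip)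
      qed (use sst in auto)
      then show ?thesis by simp
    qed
    finally show ?thesis using sst by simp
  qed
  have W': "W = X t i - X s i - Q" unfolding W Q_def F_def ..
  have Wb: "\<bar>W\<bar> \<le> \<eta> + (A * K + B) * h" using mod[of t i] Q1 sst i W' by auto
  \<comment> \<open>The noise increment has no smoothness in time. It is small because the path
    oscillates by at most \<open>\<eta>\<close> and the drift integral is of order h \<le> \<eta>;
    multiplied by the defect of the square root, of order \<open>h\<close>, it becomes an error of
    order h \<eta>.\<close>
  have Wb2: "\<bar>W\<bar> \<le> \<eta> * (1 + A * K + B)"
  proof -
    have "(A * K + B) * h \<le> (A * K + B) * \<eta>" using h A K B by (intro mult_left_mono) auto
    then show ?thesis using Wb by (simp add: algebra_simps)
  qed
  have ah: "0 \<le> a i * h" "a i * h \<le> A * h" "a i * h \<le> 1"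
    using a h by (auto intro: mult_right_mono order_trans[OF mult_right_mono[of "a i" A h]])
  have sq: "\<bar>sqrt (1 - a i * h / 2) - 1\<bar> \<le> A * h"
    using sqrt_one_minus_bound[of "a i * h / 2"] ah by auto
  have t1: "\<bar>(sqrt (1 - a i * h / 2) - 1) * W\<bar> \<le> A * h * (\<eta> * (1 + A * K + B))"
    unfolding abs_mult by (rule mult_mono[OF sq Wb2]) (use A h in auto)
  have hh: "h\<^sup>2 \<le> h * \<eta>" using h by (simp add: power2_eq_square)
  have t2: "\<bar>(1 - a i * h) * (\<Phi> h z i - z i - h * b z i)\<bar> \<le> C * (h * \<eta>)"
  proof -
    have "\<bar>\<Phi> h z i - z i - h * b z i\<bar> \<le> C * h\<^sup>2"
      by (rule splitting_boundD(2)[OF spl]) (use h zK i in auto)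
    also have "\<dots> \<le> C * (h * \<eta>)" using hh C by (rule mult_left_mono)
    finally have 1: "\<bar>\<Phi> h z i - z i - h * b z i\<bar> \<le> C * (h * \<eta>)" .
    have "\<bar>(1 - a i * h) * (\<Phi> h z i - z i - h * b z i)\<bar> \<le> 1 * (C * (h * \<eta>))"
      unfolding abs_mult by (rule mult_mono[OF _ 1]) (use ah in auto)
    then show ?thesis by simp
  qed
  have t3: "\<bar>a i * h\<^sup>2 * b z i\<bar> \<le> A * B * (h * \<eta>)"
  proof -
    have "\<bar>b z i\<bar> \<le> B" using B zK i by blast
    then have "\<bar>a i * h\<^sup>2 * b z i\<bar> \<le> A * (h * \<eta>) * B"
      unfolding abs_mult using hh a h \<eta> by (intro mult_mono) auto
    then show ?thesis by (simp add: mult_ac)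
  qed
  have t4: "\<bar>h * (F z - F (X s))\<bar> \<le> h * ((A + L) * e)"
    unfolding abs_mult using h sst by (intro mult_mono Flip) (use zK XK[of s] e in auto)
  \<comment> \<open>An exact identity. The first two terms propagate the old error through the
    Lipschitz drift; the other four are of order h \<eta>.\<close>
  have "z' - X t i = (z i - X s i) + h * (F z - F (X s)) - (Q - h * F (X s))
     + (1 - a i * h) * (\<Phi> h z i - z i - h * b z i) - a i * h\<^sup>2 * b z i + (sqrt (1 - a i * h / 2) - 1) * W"
    unfolding z' F_def by (simp add: W' algebra_simps power2_eq_square)
  then have "\<bar>z' - X t i\<bar> \<le> \<bar>z i - X s i\<bar> + \<bar>h * (F z - F (X s))\<bar> + \<bar>Q - h * F (X s)\<bar>
     + \<bar>(1 - a i * h) * (\<Phi> h z i - z i - h * b z i)\<bar> + \<bar>a i * h\<^sup>2 * b z i\<bar> + \<bar>(sqrt (1 - a i * h / 2) - 1) * W\<bar>"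
    by linarith
  also have "\<dots> \<le> e + h * ((A + L) * e) + (A + L) * \<eta> * h + C * (h * \<eta>) + A * B * (h * \<eta>) + A * h * (\<eta> * (1 + A * K + B))"
    by (intro add_mono e[OF i] t4 Q2 t2 t3 t1)
  also have "\<dots> = (1 + h * (A + L)) * e + h * (\<eta> * ((A + L) + C + A * B + A * (1 + A * K + B)))"
    by (simp add: algebra_simps)
  finally show ?thesis .
qed

text \<open>The step hypothesis may assume the bound already reached at time \<open>m\<close>. This
  form is dictated by local Lipschitz constants: they hold only while the scheme stays in a cube,
  and the bound at time \<open>m\<close> is what places it there.\<close>

lemma discrete_gronwall:
  fixes h L \<rho> :: real
  assumes "0 \<le> h" "0 \<le> L" "0 \<le> \<rho>" and e0: "e 0 \<le> 0"
    and step: "\<And>m. m < n \<Longrightarrow> e m \<le> real m * h * \<rho> * exp (L * (real m * h)) \<Longrightarrow> e (Suc m) \<le> (1 + h * L) * max 0 (real m * h * \<rho> * exp (L * (real m * h))) + h * \<rho>"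
  shows "m \<le> n \<Longrightarrow> e m \<le> real m * h * \<rho> * exp (L * (real m * h))"
proof (induction m)
  case (Suc m)
  let ?E = "exp (L * (real m * h))"
  have p: "0 \<le> real m * h * \<rho> * ?E" using assms by simp
  have "e (Suc m) \<le> (1 + h * L) * (real m * h * \<rho> * ?E) + h * \<rho>"
    using step[of m] Suc p by (simp add: max_def split: if_splits)
  also have "\<dots> \<le> exp (L * h) * (real m * h * \<rho> * ?E) + h * \<rho> * (exp (L * h) * ?E)"
  proof (rule add_mono)
    show "(1 + h * L) * (real m * h * \<rho> * ?E) \<le> exp (L * h) * (real m * h * \<rho> * ?E)"
      using exp_ge_add_one_self[of "L * h"] p by (intro mult_right_mono) (auto simp: mult.commute)
    have "1 \<le> exp (L * h + L * (real m * h))" using assms by simp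
    then show "h * \<rho> \<le> h * \<rho> * (exp (L * h) * ?E)"
      using assms by (simp add: exp_add mult_left_mono[of 1 _ "h * \<rho>", simplified])
  qed
  also have "\<dots> = real (Suc m) * h * \<rho> * exp (L * (real (Suc m) * h))"
    by (simp add: exp_add[symmetric] algebra_simps)
  finally show ?case .
qed (use e0 in simp)

text \<open>A deterministic statement about one continuous path. The path lies in the cube of
  half-side K - 1; as long as the error is at most 1 the scheme lies in the cube of half-side K,
  where all constants apply, and for small steps the discrete Gronwall bound keeps the error below 1
  until time \<open>T\<close>.\<close>

lemma scheme_converges:
  fixes X :: "real \<Rightarrow> 'j \<Rightarrow> real" and Z :: "nat \<Rightarrow> nat \<Rightarrow> 'j \<Rightarrow> real"
  assumes fin: "finite I" and T: "0 < T"
    and cont: "\<And>i. i \<in> I \<Longrightarrow> continuous_on {0..T} (\<lambda>s. X s i)"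
    and contF: "\<And>i. i \<in> I \<Longrightarrow> continuous_on {0..T} (\<lambda>r. - a i * X r i + b (X r) i)"
    and a: "\<And>i. i \<in> I \<Longrightarrow> 0 \<le> a i"
    and lip: "loc_lipschitz I b" and spl: "gauss_splitting I b \<Phi>"
    and Z0: "\<And>n i. i \<in> I \<Longrightarrow> Z n 0 i = X 0 i"
    and Z: "\<And>n m i. n \<ge> n0 \<Longrightarrow> m < n \<Longrightarrow> i \<in> I \<Longrightarrow> Z n (Suc m) i = (1 - a i * (T / n)) * \<Phi> (T / n) (Z n m) i
       + sqrt (1 - a i * (T / n) / 2) * (X (Suc m * (T / n)) i - X (m * (T / n)) i
           - integral {m * (T / n)..Suc m * (T / n)} (\<lambda>r. - a i * X r i + b (X r) i))"
    and i: "i \<in> I"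
  shows "(\<lambda>n. Z n n i) \<longlonglongrightarrow> X T i"
proof -
  have "\<exists>K. \<forall>r\<in>{0..T}. \<bar>X r j\<bar> \<le> K" if "j \<in> I" for j
    using compact_imp_bounded[OF compact_continuous_image[OF cont[OF that]]]
    by (auto simp: bounded_iff)
  then obtain Kf where Kf: "\<And>j r. j \<in> I \<Longrightarrow> r \<in> {0..T} \<Longrightarrow> \<bar>X r j\<bar> \<le> Kf j" by metis
  define K where "K = (\<Sum>j\<in>I. \<bar>Kf j\<bar>) + 1"
  have XK: "\<bar>X r j\<bar> \<le> K - 1" if "j \<in> I" "r \<in> {0..T}" for r j
    using Kf[OF that] member_le_sum[of j I "\<lambda>j. \<bar>Kf j\<bar>"] that fin unfolding K_def by auto
  have K: "1 \<le> K" unfolding K_def by (simp add: sum_nonneg)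
  define A where "A = (\<Sum>j\<in>I. a j)"
  have aA: "a j \<le> A" if "j \<in> I" for j unfolding A_def by (rule member_le_sum) (use that fin a in auto)
  have A: "0 \<le> A" unfolding A_def by (intro sum_nonneg a)
  obtain L where L: "lip_bound I b K L" using lip unfolding loc_lipschitz_def by blast
  obtain C where C: "splitting_bound I b \<Phi> K C" using spl unfolding gauss_splitting_def by blast
  obtain B where B: "0 \<le> B" "\<forall>z. (\<forall>j\<in>I. \<bar>z j\<bar> \<le> K) \<longrightarrow> (\<forall>i\<in>I. \<bar>b z i\<bar> \<le> B)"
    using loc_lipschitz_bounded[OF fin lip] by blast
  note L0 = lip_boundD(1)[OF L] and C0 = splitting_boundD(1)[OF C]
  define G where "G = (A + L) + C + A * B + A * (1 + A * K + B)"
  have G: "0 \<le> G" unfolding G_def using L0 C0 A B K by simp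
  \<comment> \<open>Amplification of the consistency error \<open>\<eta>\<close> over the whole
    interval: the final error is at most \<eta> D, which is why \<open>\<eta>\<close> is taken as
    \<epsilon> / (D + 1) below.\<close>
  define D where "D = T * exp ((A + L) * T) * G"
  have D: "0 \<le> D" unfolding D_def using T G by simp
  show ?thesis
  proof (rule LIMSEQ_I)
    fix r :: real assume r: "0 < r"
    define \<epsilon> where "\<epsilon> = min r 1 / 2"
    have \<epsilon>: "0 < \<epsilon>" "\<epsilon> < r" "\<epsilon> \<le> 1" unfolding \<epsilon>_def using r by auto
    define \<eta> where "\<eta> = \<epsilon> / (D + 1)"
    have \<eta>: "0 < \<eta>" unfolding \<eta>_def using \<epsilon> D by simp
    have \<eta>D: "\<eta> * D \<le> \<epsilon>" unfolding \<eta>_def using \<epsilon> D by (simp add: field_simps)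
    have "\<exists>d>0. \<forall>s\<in>{0..T}. \<forall>t\<in>{0..T}. \<bar>t - s\<bar> < d \<longrightarrow> \<bar>X t j - X s j\<bar> < \<eta>" if "j \<in> I" for j
      using compact_uniformly_continuous[OF cont[OF that]] \<eta> unfolding uniformly_continuous_on_def
      by (simp add: dist_real_def)
    then obtain d where d: "\<And>j. j \<in> I \<Longrightarrow> 0 < d j" "\<And>j s t. j \<in> I \<Longrightarrow> s \<in> {0..T} \<Longrightarrow> t \<in> {0..T} \<Longrightarrow> \<bar>t - s\<bar> < d j \<Longrightarrow> \<bar>X t j - X s j\<bar> < \<eta>"
      by metis
    define d0 where "d0 = Min (d ` I)"
    have d0: "0 < d0" "\<And>j. j \<in> I \<Longrightarrow> d0 \<le> d j"
    proof -
      have "I \<noteq> {}" using i by auto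
      then show "0 < d0" unfolding d0_def using fin d(1) by (simp add: Min_gr_iff)
    qed (use fin in \<open>auto simp: d0_def\<close>)
    have "(\<lambda>n. T / real n) \<longlonglongrightarrow> 0" by (rule lim_const_over_n)
    \<comment> \<open>The four thresholds make the splitting bounds available, keep A h \<le> 1,
      allow \<open>\<eta>\<close> to dominate the step, and bring one step within the radius of
      uniform continuity.\<close>
    then have "eventually (\<lambda>n. T / real n < Min {1, 1 / (A + 1), \<eta>, d0}) sequentially"
      using A \<eta> d0 by (intro order_tendstoD) auto
    then obtain n1 where n1: "\<And>n. n \<ge> n1 \<Longrightarrow> T / real n < Min {1, 1 / (A + 1), \<eta>, d0}"
      unfolding eventually_sequentially by blast
    show "\<exists>no. \<forall>n\<ge>no. norm (Z n n i - X T i) < r"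
    proof (intro exI[of _ "max (max n0 n1) 1"] allI impI)
      fix n assume n: "max (max n0 n1) 1 \<le> n"
      define h where "h = T / real n"
      have hm: "h < 1" "h < 1 / (A + 1)" "h < \<eta>" "h < d0" using n1[of n] n unfolding h_def by auto
      have h0: "0 < h" unfolding h_def using T n by auto
      have hA: "A * h \<le> 1"
      proof -
        have "(A + 1) * h < 1" using hm(2) A by (simp add: field_simps)
        then show ?thesis using h0 by (simp add: algebra_simps)
      qed
      have nh: "real n * h = T" unfolding h_def using n by simp
      define e where "e m = (if I = {} then 0 else Max ((\<lambda>j. \<bar>Z n m j - X (m * h) j\<bar>) ` I))" for m
      have eI: "\<bar>Z n m j - X (m * h) j\<bar> \<le> e m" if "j \<in> I" for m j
        unfolding e_def using that fin by auto
      have eD: "e m \<le> c" if "\<And>j. j \<in> I \<Longrightarrow> \<bar>Z n m j - X (m * h) j\<bar> \<le> c" for m c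
        unfolding e_def using that fin i by auto
      have gr: "e m \<le> real m * h * (\<eta> * G) * exp ((A + L) * (real m * h))" if "m \<le> n" for m
      proof (rule discrete_gronwall[OF _ _ _ _ _ that])
        show "0 \<le> h" "0 \<le> A + L" "0 \<le> \<eta> * G" using h0 A L0 \<eta> G by auto
        show "e 0 \<le> 0" by (rule eD) (simp add: Z0)
        fix m assume m: "m < n" and em: "e m \<le> real m * h * (\<eta> * G) * exp ((A + L) * (real m * h))"
        let ?e = "real m * h * (\<eta> * G) * exp ((A + L) * (real m * h))"
        have mh: "real m * h \<le> T" "real (Suc m) * h \<le> T"
          using m h0 nh mult_right_mono[of "real m" "real n" h] mult_right_mono[of "real (Suc m)" "real n" h] by auto
        have e0: "0 \<le> ?e" using h0 \<eta> G by simp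
        have "?e \<le> T * (\<eta> * G) * exp ((A + L) * T)"
          using mh h0 \<eta> G A L0 T by (intro mult_mono) (auto intro!: mult_left_mono)
        also have "\<dots> = \<eta> * D" unfolding D_def by simp
        finally have e1: "?e \<le> 1" using \<eta>D \<epsilon> by linarith
        \<comment> \<open>Bootstrap: the path leaves a margin of 1 inside the cube, and the error is
          at most \<epsilon> \<le> 1.\<close>
        have zK: "\<bar>Z n m j\<bar> \<le> K" if "j \<in> I" for j
          using eI[OF that, of m] em e1 XK[OF that, of "m * h"] mh h0 by auto
        show "e (Suc m) \<le> (1 + h * (A + L)) * max 0 ?e + h * (\<eta> * G)"
          unfolding max_absorb2[OF e0]
        proof (rule eD)
          fix j assume j: "j \<in> I"
          have sub: "{m * h..Suc m * h} \<subseteq> {0..T}" using mh h0 by auto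
          show "\<bar>Z n (Suc m) j - X (Suc m * h) j\<bar> \<le> (1 + h * (A + L)) * ?e + h * (\<eta> * G)"
          proof (rule one_step_error[where s="real m * h" and t="real (Suc m) * h" and X=X and i=j and I=I and K=K and W="X (real (Suc m) * h) j - X (real m * h) j - integral {real m * h..real (Suc m) * h} (\<lambda>r. - a j * X r j + b (X r) j)" and z="Z n m" and \<Phi>=\<Phi> and b=b and a=a and B=B and A=A and L=L and C=C, folded G_def])
            show "Suc m * h = m * h + h" by (simp add: algebra_simps)
            show "continuous_on {m * h..Suc m * h} (\<lambda>r. - a j * X r j + b (X r) j)"
              by (rule continuous_on_subset[OF contF[OF j] sub])
            show "\<bar>X r k\<bar> \<le> K" if "m * h \<le> r" "r \<le> Suc m * h" "k \<in> I" for r k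
              using XK[of k r] that sub by auto
            show "\<bar>X r k - X (m * h) k\<bar> \<le> \<eta>" if "m * h \<le> r" "r \<le> Suc m * h" "k \<in> I" for r k
            proof -
              have "real (Suc m) * h = real m * h + h" by (simp add: algebra_simps)
              then have "\<bar>r - real m * h\<bar> < d k" using that d0(2)[OF that(3)] hm by linarith
              moreover have "0 \<le> real m * h" using h0 by simp
              then have "real m * h \<in> {0..T}" "r \<in> {0..T}"
                using mh that unfolding atLeastAtMost_iff by linarith+
              ultimately show ?thesis using d(2)[OF that(3), of "real m * h" r] by linarith
            qed
            show "Z n (Suc m) j = (1 - a j * h) * \<Phi> h (Z n m) j + sqrt (1 - a j * h / 2) * (X (Suc m * h) j - X (m * h) j - integral {m * h..Suc m * h} (\<lambda>r. - a j * X r j + b (X r) j))"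
              unfolding h_def by (rule Z) (use n m j in auto)
            show "\<bar>Z n m k - X (m * h) k\<bar> \<le> ?e" if "k \<in> I" for k
              using eI[OF that, of m] em by linarith
          qed (use j h0 hm hA a aA zK L B C in auto)
        qed
      qed
      have "\<bar>Z n n i - X T i\<bar> \<le> e n" using eI[OF i, of n] nh by simp
      also have "\<dots> \<le> \<eta> * D" using gr[of n] unfolding nh D_def by (simp add: mult_ac)
      also have "\<dots> < r" using \<eta>D \<epsilon> by linarith
      finally show "norm (Z n n i - X T i) < r" by simp
    qed
  qed
qed

section \<open>From the splitting scheme to the law of the solution\<close>

lemma gauss_preserving_foldr:
  assumes "\<And>i. i \<in> set xs \<Longrightarrow> gauss_preserving J (F i)"
  shows "gauss_preserving J (foldr F xs)"
  using assms
proof (induction xs)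
  case Nil
  then show ?case using gauss_preserving_id by (simp add: id_def)
next
  case (Cons i xs)
  then show ?case using gauss_preserving_comp[of J "F i" "foldr F xs"] by (simp add: comp_def)
qed

text \<open>The rotations act in pairwise disjoint planes, one for each \<open>i\<close>, so their
  composition can be read off coordinate by coordinate.\<close>

lemma foldr_rot_apply:
  assumes "distinct xs" "k0 \<noteq> k1"
  shows "foldr (\<lambda>i. rot (k0, i) (k1, i) (t i)) xs z (k, i) =
    (if i \<in> set xs then rot (k0, i) (k1, i) (t i) z (k, i) else z (k, i))"
  using assms by (induction xs arbitrary: k i) (auto simp: rot_def)

lemma nn_integral_std_gauss_reindex:
  assumes "finite J" "inj_on \<iota> I" "\<iota> ` I \<subseteq> J" and q: "q \<in> borel_measurable (PiM I (\<lambda>_. borel))"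
  shows "(\<integral>\<^sup>+z. q (\<lambda>i\<in>I. z (\<iota> i)) \<partial>std_gauss J) = (\<integral>\<^sup>+z. q z \<partial>std_gauss I)"
proof -
  have [measurable]: "(\<lambda>z. \<lambda>i\<in>I. z (\<iota> i)) \<in> measurable (std_gauss J) (PiM I (\<lambda>_. borel))"
  proof (rule measurable_restrict)
    fix i assume "i \<in> I"
    then show "(\<lambda>z. z (\<iota> i)) \<in> borel_measurable (std_gauss J)"
      using assms(3) measurable_component_singleton[of "\<iota> i" J "\<lambda>_. std_normal_distribution"] by auto
  qed
  have "(\<integral>\<^sup>+z. q z \<partial>std_gauss I) = (\<integral>\<^sup>+z. q z \<partial>distr (std_gauss J) (PiM I (\<lambda>_. borel)) (\<lambda>z. \<lambda>i\<in>I. z (\<iota> i)))"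
    by (simp add: distr_std_gauss_reindex[OF assms(1-3)])
  also have "\<dots> = (\<integral>\<^sup>+z. q (\<lambda>i\<in>I. z (\<iota> i)) \<partial>std_gauss J)"
    by (rule nn_integral_distr) (use q in auto)
  finally show ?thesis by simp
qed

lemma nn_integral_gauss_law:
  assumes "finite J" "prob_space M" "\<And>j. j \<in> J \<Longrightarrow> X j \<in> borel_measurable M" "std_gauss_char M J X"
    and q: "q \<in> borel_measurable (PiM J (\<lambda>_. borel))"
  shows "(\<integral>\<^sup>+\<omega>. q (\<lambda>j\<in>J. X j \<omega>) \<partial>M) = (\<integral>\<^sup>+z. q z \<partial>std_gauss J)"
proof -
  have [measurable]: "(\<lambda>\<omega>. \<lambda>j\<in>J. X j \<omega>) \<in> measurable M (PiM J (\<lambda>_. borel))"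
    using assms(3) by (intro measurable_restrict) auto
  have "(\<integral>\<^sup>+z. q z \<partial>std_gauss J) = (\<integral>\<^sup>+z. q z \<partial>distr M (PiM J (\<lambda>_. borel)) (\<lambda>\<omega>. \<lambda>j\<in>J. X j \<omega>))"
    by (simp only: distr_eq_std_gauss[OF assms(1-4)])
  also have "\<dots> = (\<integral>\<^sup>+\<omega>. q (\<lambda>j\<in>J. X j \<omega>) \<partial>M)"
    by (rule nn_integral_distr) (use q in auto)
  finally show ?thesis by simp
qed

text \<open>Time index 0 holds the initial datum and index Suc k the noise of step k. The variance 2
  a h of an increment expresses the fluctuation-dissipation balance between damping \<open>a\<close>
  and unit stationary variance, so under that balance every entry has variance 1.\<close>

definition normalised_noise ::
  "('i \<Rightarrow> real) \<Rightarrow> real \<Rightarrow> ('i \<Rightarrow> 'a \<Rightarrow> real) \<Rightarrow> (real \<Rightarrow> 'i \<Rightarrow> 'a \<Rightarrow> real) \<Rightarrow> nat \<times> 'i \<Rightarrow> 'a \<Rightarrow> real" where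
  "normalised_noise a h X0 W = (\<lambda>(m, i) \<omega>. case m of 0 \<Rightarrow> X0 i \<omega>
     | Suc k \<Rightarrow> (W (real (Suc k) * h) i \<omega> - W (real k * h) i \<omega>) / sqrt (2 * a i * h))"

text \<open>The law of the solution at time \<open>T\<close> is the limit of the laws of a splitting scheme that
  preserves the Gaussian measure exactly: the Ornstein-Uhlenbeck step is a rotation in the plane of a
  coordinate and the corresponding normalised noise increment.\<close>

lemma sde_gaussian_bound:
  fixes X :: "real \<Rightarrow> 'i \<Rightarrow> 'a \<Rightarrow> real"
  assumes "prob_space M" and fin: "finite I" and T: "0 < T"
    and X[measurable]: "\<And>s i. 0 \<le> s \<Longrightarrow> i \<in> I \<Longrightarrow> X s i \<in> borel_measurable M"
    and W[measurable]: "\<And>s i. 0 \<le> s \<Longrightarrow> i \<in> I \<Longrightarrow> W s i \<in> borel_measurable M"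
    and cont: "AE \<omega> in M. \<forall>i\<in>I. continuous_on {0..T} (\<lambda>s. X s i \<omega>)"
    and bcont: "\<And>x i. (\<And>j. j \<in> I \<Longrightarrow> continuous_on {0..T} (\<lambda>s. x s j)) \<Longrightarrow> i \<in> I \<Longrightarrow> continuous_on {0..T} (\<lambda>s. b (x s) i)"
    and a: "\<And>i. i \<in> I \<Longrightarrow> 0 < a i"
    and adm: "admissible (Pair (0::nat) ` I) (\<lambda>z p. b (\<lambda>i. z (0, i)) (snd p))"
    and eq: "\<And>t i. 0 \<le> t \<Longrightarrow> i \<in> I \<Longrightarrow> AE \<omega> in M. X t i \<omega> = X 0 i \<omega>
        + integral {0..t} (\<lambda>s. - a i * X s i \<omega> + b (\<lambda>j. X s j \<omega>) i) + W t i \<omega>"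
    and gauss: "\<And>n. 1 \<le> n \<Longrightarrow> std_gauss_char M ({0..n} \<times> I) (normalised_noise a (T / real n) (X 0) W)"
    and q[measurable]: "q \<in> borel_measurable (PiM I (\<lambda>_. borel))"
    and qcont: "\<And>x y. (\<And>i. i \<in> I \<Longrightarrow> (\<lambda>n. x n i) \<longlonglongrightarrow> y i) \<Longrightarrow> (\<lambda>n. q (x n)) \<longlonglongrightarrow> (q y :: real)"
  shows "(\<integral>\<^sup>+\<omega>. ennreal (q (\<lambda>i\<in>I. X T i \<omega>)) \<partial>M) \<le> (\<integral>\<^sup>+z. ennreal (q z) \<partial>std_gauss I)"
proof -
  \<comment> \<open>First component 0 marks the coordinates of the solution; (Suc m, i) is the noise
    coordinate consumed in step m.\<close>
  define I' where "I' = Pair (0::nat) ` I"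
  define b' where "b' z p = b (\<lambda>i. z (0, i)) (snd p)" for z :: "nat \<times> 'i \<Rightarrow> real" and p :: "nat \<times> 'i"
  from adm obtain \<Phi> where lip: "loc_lipschitz I' b'" and \<Phi>: "gauss_splitting I' b' \<Phi>"
    unfolding admissible_def I'_def b'_def[abs_def] by blast
  obtain xs where xs: "set xs = I" "distinct xs" using finite_distinct_list[OF fin] by blast
  define h where "h n = T / real n" for n :: nat
  \<comment> \<open>The angle is chosen so that its cosine is the Euler damping factor 1 - a
    h.\<close>
  define \<alpha> where "\<alpha> n i = arccos (1 - a i * h n)" for n i
  \<comment> \<open>Mixing a coordinate with a fresh independent one of the same variance is an
    Ornstein-Uhlenbeck transition; the minus sign makes the noise enter with coefficient +
    sin.\<close>
  define ou where "ou n m = foldr (\<lambda>i. rot (0, i) (Suc m, i) (- \<alpha> n i)) xs" for n m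
  define Y where "Y n m = rec_nat (\<lambda>z. z) (\<lambda>m y z. ou n m (\<Phi> (h n) (y z))) m" for n m
  have Y0: "Y n 0 z = z" and YS: "Y n (Suc m) z = ou n m (\<Phi> (h n) (Y n m z))" for n m z
    by (simp_all add: Y_def)
  define J where "J n = {0..n} \<times> I" for n :: nat
  have finJ: "finite (J n)" and subJ: "I' \<subseteq> J n" for n using fin by (auto simp: J_def I'_def)
  have Ygp: "gauss_preserving (J n) (Y n m)" if "m \<le> n" for n m
    using that
  proof (induction m)
    case 0
    then show ?case using gauss_preserving_id by (simp add: Y0[abs_def])
  next
    case (Suc m)
    have "gauss_preserving (J n) (ou n m)"
      unfolding ou_def
      by (rule gauss_preserving_foldr, rule gauss_preserving_rot) (use Suc.prems xs finJ in \<open>auto simp: J_def\<close>)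
    moreover have "gauss_preserving (J n) (\<lambda>z. \<Phi> (h n) (Y n m z))"
    proof (rule gauss_preserving_comp[where F="\<Phi> (h n)" and G="Y n m"])
      show "gauss_preserving (J n) (\<Phi> (h n))" using \<Phi> finJ subJ unfolding gauss_splitting_def by blast
    qed (use Suc in simp)
    ultimately show ?case unfolding YS[abs_def] by (rule gauss_preserving_comp)
  qed
  have ou_apply: "ou n m z (k, i) = (if i \<in> I then rot (0, i) (Suc m, i) (- \<alpha> n i) z (k, i) else z (k, i))" for n m z k i
    unfolding ou_def by (subst foldr_rot_apply) (use xs in auto)
  have \<Phi>I: "\<Phi> t z p = z p" if "p \<notin> I'" for t z p using \<Phi> that unfolding gauss_splitting_def by blast
  \<comment> \<open>Noise coordinates of later steps are untouched, so each step meets its own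
    increment in original form.\<close>
  have Yun: "Y n m z (k, i) = z (k, i)" if "m < k" for n m z k i
    using that
  proof (induction m)
    case (Suc m)
    have "(k, i) \<notin> I'" using Suc by (auto simp: I'_def)
    then show ?case using Suc by (simp add: YS ou_apply rot_def \<Phi>I)
  qed (simp add: Y0)
  have YS0: "Y n (Suc m) z (0, i) = cos (\<alpha> n i) * \<Phi> (h n) (Y n m z) (0, i) + sin (\<alpha> n i) * z (Suc m, i)" if "i \<in> I" for n m z i
  proof -
    have "(Suc m, i) \<notin> I'" by (auto simp: I'_def)
    then show ?thesis using that by (simp add: YS ou_apply rot_def \<Phi>I Yun)
  qed
  define G where "G n = normalised_noise a (h n) (X 0) W" for n
  have G[measurable]: "G n p \<in> borel_measurable M" if "p \<in> J n" for n p
    using that T unfolding G_def normalised_noise_def J_def h_def by (cases p; cases "fst p") auto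
  define Z where "Z n m \<omega> = Y n m (\<lambda>p\<in>J n. G n p \<omega>)" for n m \<omega>
  have [measurable]: "(\<lambda>\<omega>. \<lambda>p\<in>J n. G n p \<omega>) \<in> measurable M (PiM (J n) (\<lambda>_. borel))" for n
    by (intro measurable_restrict) auto
  have [measurable]: "Y n n \<in> measurable (PiM (J n) (\<lambda>_. borel)) (PiM (J n) (\<lambda>_. borel))" for n
    using Ygp[of n n] by (simp add: gauss_preserving_def)
  have [measurable]: "(\<lambda>z. \<lambda>i\<in>I. z (0, i)) \<in> measurable (PiM (J n) (\<lambda>_. borel)) (PiM I (\<lambda>_. borel :: real measure))" for n
  proof (rule measurable_restrict)
    fix i assume "i \<in> I"
    then show "(\<lambda>z. z (0, i)) \<in> borel_measurable (PiM (J n) (\<lambda>_. borel))"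
      by (intro measurable_component_singleton) (auto simp: J_def)
  qed
  have law: "(\<integral>\<^sup>+\<omega>. ennreal (q (\<lambda>i\<in>I. Z n n \<omega> (0, i))) \<partial>M) = (\<integral>\<^sup>+z. ennreal (q z) \<partial>std_gauss I)" if "1 \<le> n" for n
  proof -
    have "(\<integral>\<^sup>+\<omega>. ennreal (q (\<lambda>i\<in>I. Z n n \<omega> (0, i))) \<partial>M)
      = (\<integral>\<^sup>+\<omega>. (\<lambda>z. ennreal (q (\<lambda>i\<in>I. Y n n z (0, i)))) (\<lambda>p\<in>J n. G n p \<omega>) \<partial>M)"
      unfolding Z_def ..
    also have "\<dots> = (\<integral>\<^sup>+z. ennreal (q (\<lambda>i\<in>I. Y n n z (0, i))) \<partial>std_gauss (J n))"
    proof (rule nn_integral_gauss_law[OF finJ \<open>prob_space M\<close>])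
      show "std_gauss_char M (J n) (G n)" using gauss[OF that] by (simp add: G_def J_def h_def)
    qed measurable
    also have "\<dots> = (\<integral>\<^sup>+z. ennreal (q (\<lambda>i\<in>I. z (0, i))) \<partial>distr (std_gauss (J n)) (PiM (J n) (\<lambda>_. borel)) (Y n n))"
      by (subst nn_integral_distr) (auto cong: measurable_cong_sets simp: sets_std_gauss)
    also have "\<dots> = (\<integral>\<^sup>+z. ennreal (q (\<lambda>i\<in>I. z (0, i))) \<partial>std_gauss (J n))"
      using Ygp[of n n] by (simp add: gauss_preserving_def)
    also have "\<dots> = (\<integral>\<^sup>+z. ennreal (q z) \<partial>std_gauss I)"
      by (rule nn_integral_std_gauss_reindex[OF finJ]) (auto simp: J_def inj_on_def)
    finally show ?thesis .
  qed
  have "AE \<omega> in M. \<forall>n m. \<forall>i\<in>I. X (real m * h n) i \<omega> = X 0 i \<omega>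
        + integral {0..real m * h n} (\<lambda>s. - a i * X s i \<omega> + b (\<lambda>j. X s j \<omega>) i) + W (real m * h n) i \<omega>"
    unfolding AE_all_countable
    by (intro allI AE_finite_allI fin eq) (use T in \<open>auto simp: h_def\<close>)
  then have conv: "AE \<omega> in M. (\<lambda>n. q (\<lambda>i\<in>I. Z n n \<omega> (0, i))) \<longlonglongrightarrow> q (\<lambda>i\<in>I. X T i \<omega>)"
    using cont
  proof eventually_elim
    fix \<omega> assume E: "\<forall>n m. \<forall>i\<in>I. X (real m * h n) i \<omega> = X 0 i \<omega>
        + integral {0..real m * h n} (\<lambda>s. - a i * X s i \<omega> + b (\<lambda>j. X s j \<omega>) i) + W (real m * h n) i \<omega>"
      and C: "\<forall>i\<in>I. continuous_on {0..T} (\<lambda>s. X s i \<omega>)"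
    define A where "A = (\<Sum>i\<in>I. a i)"
    have aA: "a i \<le> A" "0 < a i" if "i \<in> I" for i
    proof -
      show "a i \<le> A" unfolding A_def by (rule member_le_sum) (use that fin a in \<open>auto intro: less_imp_le\<close>)
    qed (use that a in auto)
    have contF: "continuous_on {0..T} (\<lambda>s. - a i * X s i \<omega> + b (\<lambda>j. X s j \<omega>) i)" if "i \<in> I" for i
      using that C by (intro continuous_intros bcont) auto
    \<comment> \<open>From here on a h \<le> 1 for all modes, which makes both the arccosine and the
      square root meaningful.\<close>
    obtain n0 :: nat where n0: "A * T \<le> real n0" using real_arch_simple by blast
    have "(\<lambda>n. Z n n \<omega> (0, i)) \<longlonglongrightarrow> X T i \<omega>" if i: "i \<in> I" for i
    proof -
      define Xp where "Xp = (\<lambda>s p. X s (snd (p :: nat \<times> 'i)) \<omega>)"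
      define Zp where "Zp = (\<lambda>n m. Z n m \<omega>)"
      define ap where "ap = (\<lambda>p. a (snd (p :: nat \<times> 'i)))"
      have "(\<lambda>n. Zp n n (0, i)) \<longlonglongrightarrow> Xp T (0, i)"
      proof (rule scheme_converges[of I' T Xp ap b' \<Phi> Zp "max n0 1"], unfold Xp_def Zp_def ap_def)
        show "finite I'" using fin by (simp add: I'_def)
        show "continuous_on {0..T} (\<lambda>s. X s (snd p) \<omega>)" if "p \<in> I'" for p using that C by (auto simp: I'_def)
        show "continuous_on {0..T} (\<lambda>r. - a (snd p) * X r (snd p) \<omega> + b' (\<lambda>p. X r (snd p) \<omega>) p)" if "p \<in> I'" for p
          using that contF by (auto simp: I'_def b'_def)
        show "0 \<le> a (snd p)" if "p \<in> I'" for p using that a by (auto simp: I'_def less_imp_le)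
        show "Z n 0 \<omega> p = X 0 (snd p) \<omega>" if "p \<in> I'" for n p
          using that by (auto simp: Z_def Y0 I'_def J_def G_def normalised_noise_def)
        fix n m p assume n: "max n0 1 \<le> n" "m < n" and p: "p \<in> I'"
        then obtain i where i: "p = (0, i)" "i \<in> I" by (auto simp: I'_def)
        have hn: "0 < h n" "T / real n = h n" using T n by (auto simp: h_def)
        have nT: "real n * h n = T" using n by (simp add: h_def)
        have ah: "0 < a i * h n" "a i * h n \<le> 1"
        proof -
          have "a i * T \<le> A * T" using aA[OF i(2)] T by simp
          also have "\<dots> \<le> real n" using n0 n by linarith
          finally show "a i * h n \<le> 1" using n by (simp add: h_def field_simps)
        qed (use aA[OF i(2)] hn in simp)
        have c: "cos (\<alpha> n i) = 1 - a i * h n" unfolding \<alpha>_def using ah by (intro cos_arccos) auto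
        \<comment> \<open>The first factor cancels the normalisation of the noise increment; the
          second, tending to 1, is the square root that appears in
          \<open>scheme_converges\<close>.\<close>
        have s: "sin (\<alpha> n i) = sqrt (2 * a i * h n) * sqrt (1 - a i * h n / 2)"
        proof -
          have "sin (\<alpha> n i) = sqrt (1 - (1 - a i * h n)\<^sup>2)"
            unfolding \<alpha>_def using ah by (intro sin_arccos) auto
          also have "1 - (1 - a i * h n)\<^sup>2 = (2 * a i * h n) * (1 - a i * h n / 2)"
            by (simp add: power2_eq_square algebra_simps)
          finally show ?thesis by (simp add: real_sqrt_mult)
        qed
        let ?F = "\<lambda>s. - a i * X s i \<omega> + b (\<lambda>j. X s j \<omega>) i"
        have mt: "0 \<le> real m * h n" "real m * h n \<le> real (Suc m) * h n" "real (Suc m) * h n \<le> T"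
          using hn n nT mult_right_mono[of "real (Suc m)" "real n" "h n"] by (auto simp: mult_right_mono)
        have int: "?F integrable_on {0..real (Suc m) * h n}"
          by (rule integrable_continuous_interval[OF continuous_on_subset[OF contF[OF i(2)]]]) (use mt in auto)
        have "integral {0..real m * h n} ?F + integral {real m * h n..real (Suc m) * h n} ?F = integral {0..real (Suc m) * h n} ?F"
          using mt int by (intro Henstock_Kurzweil_Integration.integral_combine) auto
        then have Wd: "W (real (Suc m) * h n) i \<omega> - W (real m * h n) i \<omega>
          = X (real (Suc m) * h n) i \<omega> - X (real m * h n) i \<omega> - integral {real m * h n..real (Suc m) * h n} ?F"
          using E[rule_format, OF i(2), of m n] E[rule_format, OF i(2), of "Suc m" n] by linarith
        have "(Suc m, i) \<in> J n" using n i by (simp add: J_def)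
        then have "sin (\<alpha> n i) * (\<lambda>p\<in>J n. G n p \<omega>) (Suc m, i) = sqrt (1 - a i * h n / 2) * (W (real (Suc m) * h n) i \<omega> - W (real m * h n) i \<omega>)"
          using ah a[OF i(2)] unfolding s by (simp add: G_def normalised_noise_def)
        then show "Z n (Suc m) \<omega> p = (1 - a (snd p) * (T / real n)) * \<Phi> (T / real n) (Z n m \<omega>) p
            + sqrt (1 - a (snd p) * (T / real n) / 2) * (X (real (Suc m) * (T / real n)) (snd p) \<omega> - X (real m * (T / real n)) (snd p) \<omega>
            - integral {real m * (T / real n)..real (Suc m) * (T / real n)} (\<lambda>r. - a (snd p) * X r (snd p) \<omega> + b' (\<lambda>p. X r (snd p) \<omega>) p))"
          unfolding hn(2) i(1) Z_def YS0[OF i(2)] c Wd by (simp add: b'_def Wd)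
      qed (use T lip \<Phi> i in \<open>auto simp: I'_def\<close>)
      then show ?thesis by (simp add: Zp_def Xp_def)
    qed
    then show "(\<lambda>n. q (\<lambda>i\<in>I. Z n n \<omega> (0, i))) \<longlonglongrightarrow> q (\<lambda>i\<in>I. X T i \<omega>)"
      by (intro qcont) auto
  qed
  have "(\<integral>\<^sup>+\<omega>. ennreal (q (\<lambda>i\<in>I. X T i \<omega>)) \<partial>M) = (\<integral>\<^sup>+\<omega>. liminf (\<lambda>n. ennreal (q (\<lambda>i\<in>I. Z n n \<omega> (0, i)))) \<partial>M)"
  proof (rule nn_integral_cong_AE)
    show "AE \<omega> in M. ennreal (q (\<lambda>i\<in>I. X T i \<omega>)) = liminf (\<lambda>n. ennreal (q (\<lambda>i\<in>I. Z n n \<omega> (0, i))))"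
      using conv
    proof eventually_elim
      case (elim \<omega>)
      have "(\<lambda>n. ennreal (q (\<lambda>i\<in>I. Z n n \<omega> (0, i)))) \<longlonglongrightarrow> ennreal (q (\<lambda>i\<in>I. X T i \<omega>))"
        using elim by (rule tendsto_ennrealI)
      then show ?case by (rule lim_imp_Liminf[OF sequentially_bot, symmetric])
    qed
  qed
  also have "\<dots> \<le> liminf (\<lambda>n. \<integral>\<^sup>+\<omega>. ennreal (q (\<lambda>i\<in>I. Z n n \<omega> (0, i))) \<partial>M)"
    unfolding Z_def by (rule nn_integral_liminf) measurable
  also have "\<dots> \<le> (\<integral>\<^sup>+z. ennreal (q z) \<partial>std_gauss I)"
  proof (rule Liminf_le)
    show "\<forall>\<^sub>F n in sequentially. (\<integral>\<^sup>+\<omega>. ennreal (q (\<lambda>i\<in>I. Z n n \<omega> (0, i))) \<partial>M) \<le> (\<integral>\<^sup>+z. ennreal (q z) \<partial>std_gauss I)"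
      using eventually_ge_at_top[of 1] by eventually_elim (simp add: law)
  qed simp
  finally show ?thesis .
qed

section \<open>Partial derivatives and the classes of differentiable functions\<close>

lemma partial_eqI:
  assumes "(f has_derivative D) (at x)"
  shows "partial i f x = D (axis i 1)"
  unfolding partial_def using frechet_derivative_at[OF assms] by simp

lemma differentiable_partial:
  assumes "f differentiable (at x)"
  shows "((\<lambda>s. f (x + s *\<^sub>R axis i 1)) has_real_derivative partial i f x) (at 0)"
proof -
  have "(f has_derivative frechet_derivative f (at x)) (at x)"
    using assms by (simp add: frechet_derivative_works)
  then have D: "(f has_derivative frechet_derivative f (at x)) (at (x + 0 *\<^sub>R axis i 1))" by simp
  have "((\<lambda>s. x + s *\<^sub>R axis i 1) has_derivative (\<lambda>s. s *\<^sub>R axis i 1)) (at 0)"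
    by (auto intro!: derivative_eq_intros)
  from diff_chain_at[OF this D]
  have "((\<lambda>s. f (x + s *\<^sub>R axis i 1)) has_derivative (\<lambda>s. frechet_derivative f (at x) (s *\<^sub>R axis i 1))) (at 0)"
    by (simp add: comp_def)
  moreover have "frechet_derivative f (at x) (s *\<^sub>R axis i 1) = s * partial i f x" for s
    using linear_scale[OF linear_frechet_derivative[OF assms]] by (simp add: partial_def)
  ultimately show ?thesis by (simp add: has_field_derivative_def mult_commute_abs)
qed

lemma partial_line:
  assumes "f differentiable_on UNIV"
  shows "((\<lambda>s. f (c + s *\<^sub>R axis i 1)) has_real_derivative partial i f (c + s *\<^sub>R axis i 1)) (at s)"
proof -
  have "f differentiable (at (c + s *\<^sub>R axis i 1))"
    using assms by (auto simp: differentiable_on_def)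
  from differentiable_partial[OF this, of i]
  have "((\<lambda>t. f (c + (s + t) *\<^sub>R axis i 1)) has_real_derivative partial i f (c + s *\<^sub>R axis i 1)) (at 0)"
    by (simp add: scaleR_add_left add.assoc)
  then show ?thesis
    using DERIV_shift[of "\<lambda>t. f (c + t *\<^sub>R axis i 1)" "partial i f (c + s *\<^sub>R axis i 1)" 0 s] by (simp add: add.commute)
qed

lemma Ck_Suc_continuous: "Ck n f \<Longrightarrow> continuous_on UNIV f"
  by (cases n) (auto simp: differentiable_imp_continuous_on)

lemma partial_linear:
  assumes "f differentiable (at x)" "g differentiable (at x)"
  shows "partial i (\<lambda>x. a * f x + b * g x) x = a * partial i f x + b * partial i g x"
proof -
  have "(f has_derivative frechet_derivative f (at x)) (at x)" "(g has_derivative frechet_derivative g (at x)) (at x)"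
    using assms by (auto simp: frechet_derivative_works)
  then have "((\<lambda>x. a * f x + b * g x) has_derivative (\<lambda>h. a * frechet_derivative f (at x) h + b * frechet_derivative g (at x) h)) (at x)"
    by (auto intro!: derivative_eq_intros)
  from partial_eqI[OF this] show ?thesis by (simp add: partial_def)
qed

lemma Ck_linear: "Ck n f \<Longrightarrow> Ck n g \<Longrightarrow> Ck n (\<lambda>x. a * f x + b * g x)"
proof (induction n arbitrary: f g)
  case 0
  then show ?case by (auto intro!: continuous_intros)
next
  case (Suc n)
  then have d: "f differentiable (at x)" "g differentiable (at x)" for x by (auto simp: differentiable_on_def)
  have "partial i (\<lambda>x. a * f x + b * g x) = (\<lambda>x. a * partial i f x + b * partial i g x)" for i
    by (rule ext) (rule partial_linear[OF d])
  moreover have "(\<lambda>x. a * f x + b * g x) differentiable_on UNIV"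
    using Suc by (auto intro!: derivative_intros)
  ultimately show ?case using Suc by auto
qed

lemma torus_Ck_linear: "f \<in> torus_Ck N n \<Longrightarrow> g \<in> torus_Ck N n \<Longrightarrow> (\<lambda>x. a * f x + b * g x) \<in> torus_Ck N n"
  unfolding torus_Ck_def using Ck_linear by auto

lemma partial_mult:
  assumes "f differentiable (at x)" "g differentiable (at x)"
  shows "partial i (\<lambda>x. f x * g x) x = f x * partial i g x + partial i f x * g x"
proof -
  have "(f has_derivative frechet_derivative f (at x)) (at x)" "(g has_derivative frechet_derivative g (at x)) (at x)"
    using assms by (auto simp: frechet_derivative_works)
  from has_derivative_mult[OF this]
  show ?thesis by (subst partial_eqI) (auto simp: partial_def)
qed

section \<open>Integration on the torus\<close>

definition vec2 :: "real \<Rightarrow> real \<Rightarrow> plane" where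
  "vec2 a b = (\<chi> i. if i = 1 then a else b)"

lemma vec2_nth [simp]: "vec2 a b $ 1 = a" "vec2 a b $ 2 = b"
  by (simp_all add: vec2_def)

lemma vec2_line: "vec2 a b = vec2 0 b + a *\<^sub>R axis 1 1" "vec2 a b = vec2 a 0 + b *\<^sub>R axis 2 1"
  by (auto simp: vec_eq_iff vec2_def axis_def forall_2)

lemma continuous_on_vec2 [continuous_intros]:
  "continuous_on S f \<Longrightarrow> continuous_on S g \<Longrightarrow> continuous_on S (\<lambda>x. vec2 (f x) (g x))"
  unfolding vec2_def
proof (rule continuous_on_vec_lambda)
  fix i :: 2 assume "continuous_on S f" "continuous_on S g"
  then show "continuous_on S (\<lambda>x. if i = 1 then f x else g x)" by (cases "i = 1") auto
qed

lemma measurable_vec2 [measurable]: "(\<lambda>(a, b). vec2 a b) \<in> borel_measurable (lborel \<Otimes>\<^sub>M lborel)"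
proof -
  have "continuous_on UNIV (\<lambda>p. vec2 (fst p) (snd p))" by (intro continuous_intros)
  then have "(\<lambda>p. vec2 (fst p) (snd p)) \<in> borel_measurable borel" by (rule borel_measurable_continuous_onI)
  then show ?thesis by (simp add: split_beta' borel_prod[symmetric] cong: measurable_cong_sets)
qed

lemma prod_Basis_plane: "(\<Prod>b\<in>Basis. (x::plane) \<bullet> b) = x $ 1 * x $ 2"
proof -
  have B: "(Basis :: plane set) = {axis 1 1, axis 2 1}"
    by (auto simp: Basis_vec_def UNIV_2)
  have "axis 1 1 \<noteq> (axis 2 1 :: plane)" by (auto simp: axis_eq_axis)
  then show ?thesis unfolding B by (simp add: inner_axis)
qed

lemma lborel_plane: "lborel = distr (lborel \<Otimes>\<^sub>M lborel) borel (\<lambda>(a, b). vec2 a b)"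
proof (rule lborel_eqI)
  fix l u :: plane assume lu: "\<And>b. b \<in> Basis \<Longrightarrow> l \<bullet> b \<le> u \<bullet> b"
  have ax: "axis i 1 \<in> (Basis :: plane set)" for i by (auto simp: Basis_vec_def)
  have lu': "l $ i \<le> u $ i" for i using lu[OF ax[of i]] by (simp add: inner_axis)
  have "(\<lambda>(a, b). vec2 a b) -` box l u \<inter> space (lborel \<Otimes>\<^sub>M lborel) = {l $ 1<..<u $ 1} \<times> {l $ 2<..<u $ 2}"
    by (auto simp: mem_box_cart forall_2 space_pair_measure)
  then have "emeasure (distr (lborel \<Otimes>\<^sub>M lborel) borel (\<lambda>(a, b). vec2 a b)) (box l u) = emeasure (lborel \<Otimes>\<^sub>M lborel) ({l $ 1<..<u $ 1} \<times> {l $ 2<..<u $ 2})"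
    by (subst emeasure_distr) auto
  also have "\<dots> = ennreal (u $ 1 - l $ 1) * ennreal (u $ 2 - l $ 2)"
    using lu' by (subst lborel.emeasure_pair_measure_Times) auto
  also have "\<dots> = ennreal (\<Prod>b\<in>Basis. (u - l) \<bullet> b)"
    using lu' by (simp add: prod_Basis_plane ennreal_mult)
  finally show "emeasure (distr (lborel \<Otimes>\<^sub>M lborel) borel (\<lambda>(a, b). vec2 a b)) (box l u) = ennreal (\<Prod>b\<in>Basis. (u - l) \<bullet> b)" .
qed simp

abbreviation half_side :: "nat \<Rightarrow> real" where "half_side N \<equiv> pi * real N"

lemma torus_box_sets [measurable]: "torus_box N \<in> sets borel"
proof -
  have "torus_box N = {x. - (pi * real N) \<le> x $ 1 \<and> x $ 1 < pi * real N} \<inter> {x. - (pi * real N) \<le> x $ 2 \<and> x $ 2 < pi * real N}"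
    by (auto simp: torus_box_def forall_2)
  also have "\<dots> \<in> sets borel"
  proof -
    have [measurable]: "(\<lambda>x::plane. x $ i) \<in> borel_measurable borel" for i
      by (intro borel_measurable_continuous_onI continuous_intros)
    show ?thesis by measurable
  qed
  finally show ?thesis .
qed

lemma torus_set_integrable:
  assumes "continuous_on UNIV f"
  shows "set_integrable lborel (torus_box N) (f :: plane \<Rightarrow> real)"
proof -
  let ?c = "cbox (\<chi> i. - half_side N) (\<chi> i. half_side N) :: plane set"
  have "set_integrable lborel ?c f"
    unfolding set_integrable_def by (rule borel_integrable_compact) (auto intro: continuous_on_subset[OF assms])
  then show ?thesis
    by (rule set_integrable_subset) (auto simp: torus_box_def mem_box_cart less_imp_le)
qed

lemma torus_integral_linear:
  assumes "continuous_on UNIV f" "continuous_on UNIV g"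
  shows "torus_integral N (\<lambda>x. a * f x + b * g x) = a * torus_integral N f + b * torus_integral N g"
proof -
  have "set_integrable lborel (torus_box N) (\<lambda>x. a * f x)" "set_integrable lborel (torus_box N) (\<lambda>x. b * g x)"
    using assms by (auto intro!: torus_set_integrable continuous_intros)
  then show ?thesis unfolding torus_integral_def by (simp add: set_integral_add)
qed

lemma torus_integral_cmult: "torus_integral N (\<lambda>x. a * f x) = a * torus_integral N f"
  unfolding torus_integral_def by simp

lemma torus_integral_sum:
  assumes "\<And>s. s \<in> S \<Longrightarrow> continuous_on UNIV (f s)"
  shows "torus_integral N (\<lambda>x. \<Sum>s\<in>S. f s x) = (\<Sum>s\<in>S. torus_integral N (f s))"
  using assms
proof (induction S rule: infinite_finite_induct)
  case (insert s S)
  have "continuous_on UNIV (\<lambda>x. \<Sum>s\<in>S. f s x)" using insert.prems by (intro continuous_on_sum) auto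
  then show ?case using insert torus_integral_linear[of "f s" "\<lambda>x. \<Sum>s\<in>S. f s x" N 1 1] by simp
qed (simp_all add: torus_integral_def)

lemma torus_integral_mono:
  assumes "continuous_on UNIV f" "continuous_on UNIV g" "\<And>x. f x \<le> g x"
  shows "torus_integral N f \<le> torus_integral N g"
  unfolding torus_integral_def set_lebesgue_integral_def
  using torus_set_integrable[OF assms(1)] torus_set_integrable[OF assms(2)] assms(3)
  by (intro integral_mono) (auto simp: set_integrable_def indicator_def)

lemma torus_integral_abs_le:
  assumes "continuous_on UNIV f"
  shows "\<bar>torus_integral N f\<bar> \<le> torus_integral N (\<lambda>x. \<bar>f x\<bar>)"
proof -
  have 1: "torus_integral N f \<le> torus_integral N (\<lambda>x. \<bar>f x\<bar>)"
    by (rule torus_integral_mono) (auto intro!: continuous_intros assms)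
  have 2: "torus_integral N (\<lambda>x. - 1 * f x) \<le> torus_integral N (\<lambda>x. \<bar>f x\<bar>)"
    by (rule torus_integral_mono) (auto intro!: continuous_intros assms)
  show ?thesis using 1 2 torus_integral_cmult[of N "-1" f] by linarith
qed

lemma torus_integral_Fubini:
  fixes f :: "plane \<Rightarrow> real" and N :: nat
  assumes f: "continuous_on UNIV f"
  defines "I \<equiv> {- half_side N..<half_side N}"
  shows "torus_integral N f = (LBINT a:I. (LBINT b:I. f (vec2 a b)))"
    and "torus_integral N f = (LBINT b:I. (LBINT a:I. f (vec2 a b)))"
proof -
  let ?g = "\<lambda>x. indicator (torus_box N) x *\<^sub>R f x"
  have [measurable]: "f \<in> borel_measurable borel" by (rule borel_measurable_continuous_onI[OF f])
  have g: "integrable lborel ?g" using torus_set_integrable[OF f] by (simp add: set_integrable_def)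
  have gm[measurable]: "?g \<in> borel_measurable borel" by measurable
  have ge: "?g (vec2 a b) = indicator I a * (indicator I b * f (vec2 a b))" for a b
    by (auto simp: torus_box_def indicator_def I_def forall_2)
  have int: "integrable (lborel \<Otimes>\<^sub>M lborel) (\<lambda>(a, b). ?g (vec2 a b))"
  proof -
    have "integrable (distr (lborel \<Otimes>\<^sub>M lborel) borel (\<lambda>(a, b). vec2 a b)) ?g"
      using g unfolding lborel_plane[symmetric] .
    then have "integrable (lborel \<Otimes>\<^sub>M lborel) (\<lambda>p. ?g ((\<lambda>(a, b). vec2 a b) p))"
      by (rule integrable_distr[rotated]) measurable
    then show ?thesis by (simp add: split_beta')
  qed
  have e: "torus_integral N f = integral\<^sup>L (lborel \<Otimes>\<^sub>M lborel) (\<lambda>(a, b). ?g (vec2 a b))"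
  proof -
    have "torus_integral N f = integral\<^sup>L (distr (lborel \<Otimes>\<^sub>M lborel) borel (\<lambda>(a, b). vec2 a b)) ?g"
      unfolding lborel_plane[symmetric] torus_integral_def set_lebesgue_integral_def ..
    also have "\<dots> = integral\<^sup>L (lborel \<Otimes>\<^sub>M lborel) (\<lambda>p. ?g ((\<lambda>(a, b). vec2 a b) p))"
      by (rule integral_distr) measurable
    finally show ?thesis by (simp add: split_beta')
  qed
  have g1: "(\<integral>b. ?g (vec2 a b) \<partial>lborel) = indicator I a * (\<integral>b. indicator I b * f (vec2 a b) \<partial>lborel)" for a
    unfolding ge by simp
  have g2: "(\<integral>a. ?g (vec2 a b) \<partial>lborel) = indicator I b * (\<integral>a. indicator I a * f (vec2 a b) \<partial>lborel)" for b
    unfolding ge by (subst integral_mult_right_zero[symmetric]) (simp add: mult_ac)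
  have "torus_integral N f = (\<integral>a. (\<integral>b. ?g (vec2 a b) \<partial>lborel) \<partial>lborel)"
    unfolding e using lborel_pair.integral_fst'[OF int] by (simp only: split_conv)
  then show "torus_integral N f = (LBINT a:I. (LBINT b:I. f (vec2 a b)))"
    unfolding g1 by (simp add: set_lebesgue_integral_def)
  have "torus_integral N f = (\<integral>b. (\<integral>a. ?g (vec2 a b) \<partial>lborel) \<partial>lborel)"
    unfolding e using lborel_pair.integral_snd[OF int] by (simp only: split_conv)
  then show "torus_integral N f = (LBINT b:I. (LBINT a:I. f (vec2 a b)))"
    unfolding g2 by (simp add: set_lebesgue_integral_def)
qed

lemma periodic_derivative_integral:
  fixes F F' :: "real \<Rightarrow> real"
  assumes "\<And>s. (F has_real_derivative F' s) (at s)" "continuous_on UNIV F'" "l \<le> u" "F l = F u"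
  shows "(LBINT s:{l..<u}. F' s) = 0"
proof -
  have "(LBINT s:{l..<u}. F' s) = (\<integral>s. F' s * indicator {l..u} s \<partial>lborel)"
    unfolding set_lebesgue_integral_def
  proof (rule integral_cong_AE)
    have [measurable]: "F' \<in> borel_measurable borel" by (rule borel_measurable_continuous_onI[OF assms(2)])
    show "(\<lambda>x. indicat_real {l..<u} x *\<^sub>R F' x) \<in> borel_measurable lborel" "(\<lambda>s. F' s * indicat_real {l..u} s) \<in> borel_measurable lborel"
      by measurable
    show "AE x in lborel. indicat_real {l..<u} x *\<^sub>R F' x = F' x * indicat_real {l..u} x"
      using AE_lborel_singleton[of u] by eventually_elim (auto simp: indicator_def)
  qed
  also have "\<dots> = F u - F l"
    using assms by (intro integral_FTC_Icc_real) (auto simp: continuous_on_eq_continuous_at)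
  finally show ?thesis using assms by simp
qed

lemma torus_integral_partial:
  assumes "f \<in> torus_Ck N 1"
  shows "torus_integral N (partial i f) = 0"
proof -
  let ?L = "half_side N"
  have d: "f differentiable_on UNIV" and c: "continuous_on UNIV (partial i f)"
    and per: "f (x + axis i (2 * pi * real N)) = f x" for x i
    using assms by (auto simp: torus_Ck_def)
  have c2: "continuous_on UNIV (\<lambda>a. partial i f (vec2 a b))" "continuous_on UNIV (\<lambda>a. partial i f (vec2 b a))" for b
    by (auto intro!: continuous_intros continuous_on_compose2[OF c])
  have 1: "(LBINT a:{-?L..<?L}. partial 1 f (vec2 a b)) = 0" if "i = 1" for b
  proof (rule periodic_derivative_integral)
    show "((\<lambda>s. f (vec2 s b)) has_real_derivative partial 1 f (vec2 s b)) (at s)" for s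
      using partial_line[OF d, of "vec2 0 b" 1 s] by (simp add: vec2_line(1)[symmetric])
    have "vec2 ?L b = vec2 (- ?L) b + axis 1 (2 * pi * real N)"
      by (auto simp: vec_eq_iff forall_2 axis_def)
    then show "f (vec2 (- ?L) b) = f (vec2 ?L b)" by (simp add: per)
  qed (use c2 that in auto)
  have 2: "(LBINT a:{-?L..<?L}. partial 2 f (vec2 b a)) = 0" if "i = 2" for b
  proof (rule periodic_derivative_integral)
    show "((\<lambda>s. f (vec2 b s)) has_real_derivative partial 2 f (vec2 b s)) (at s)" for s
      using partial_line[OF d, of "vec2 b 0" 2 s] by (simp add: vec2_line(2)[symmetric])
    have "vec2 b ?L = vec2 b (- ?L) + axis 2 (2 * pi * real N)"
      by (auto simp: vec_eq_iff forall_2 axis_def)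
    then show "f (vec2 b (- ?L)) = f (vec2 b ?L)" by (simp add: per)
  qed (use c2 that in auto)
  show ?thesis
  proof (cases "i = 1")
    case True
    show ?thesis unfolding torus_integral_Fubini(2)[OF c] using 1[OF True] True by (simp add: set_lebesgue_integral_def)
  next
    case False
    then have "i = 2" using exhaust_2 by blast
    show ?thesis unfolding torus_integral_Fubini(1)[OF c] using 2[OF \<open>i = 2\<close>] \<open>i = 2\<close> by (simp add: set_lebesgue_integral_def)
  qed
qed

definition torus_area :: "nat \<Rightarrow> real" where "torus_area N = (2 * pi * real N)\<^sup>2"

lemma torus_area_pos: "1 \<le> N \<Longrightarrow> 0 < torus_area N" by (simp add: torus_area_def)

lemma torus_integral_const: "torus_integral N (\<lambda>_. c) = c * torus_area N"
proof -
  have "(LBINT a:{- half_side N..<half_side N}. c) = c * (2 * half_side N)" for c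
    by (simp add: set_lebesgue_integral_def)
  then show ?thesis
    using torus_integral_Fubini(1)[of "\<lambda>_. c" N] by (simp add: torus_area_def power2_eq_square)
qed

section \<open>Trigonometric polynomials\<close>

definition freq :: "nat \<Rightarrow> int \<times> int \<Rightarrow> plane" where
  "freq N m = (\<chi> i. of_int (if i = 1 then fst m else snd m) / real N)"

text \<open>Carrying both coefficients makes the family closed under differentiation and
  translation, and under products up to sums of two waves.\<close>

definition wave :: "plane \<Rightarrow> real \<Rightarrow> real \<Rightarrow> plane \<Rightarrow> real" where
  "wave k \<alpha> \<beta> x = \<alpha> * cos (k \<bullet> x) + \<beta> * sin (k \<bullet> x)"

text \<open>The Hartley functions \<open>cos + sin\<close> form a real orthogonal basis indexed by all of \<open>\<int>\<^sup>2\<close>.\<close>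

abbreviation cas :: "nat \<Rightarrow> int \<times> int \<Rightarrow> plane \<Rightarrow> real" where
  "cas N m \<equiv> wave (freq N m) 1 1"

lemma freq_simps [simp]: "freq N (m + n) = freq N m + freq N n" "freq N (- m) = - freq N m"
  "freq N (m - n) = freq N m - freq N n" "freq N 0 = 0"
  by (auto simp: freq_def vec_eq_iff add_divide_distrib diff_divide_distrib forall_2)

lemma freq_nth [simp]: "freq N m $ 1 = of_int (fst m) / real N" "freq N m $ 2 = of_int (snd m) / real N"
  by (auto simp: freq_def)

lemma freq_eq_0_iff: "1 \<le> N \<Longrightarrow> freq N m = 0 \<longleftrightarrow> m = 0"
  by (auto simp: vec_eq_iff forall_2 prod_eq_iff)

lemma inj_freq: "1 \<le> N \<Longrightarrow> inj (freq N)"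
  by (auto simp: inj_on_def vec_eq_iff forall_2 prod_eq_iff)

lemma wave_has_derivative:
  "(wave k \<alpha> \<beta> has_derivative (\<lambda>h. (\<beta> * cos (k \<bullet> x) - \<alpha> * sin (k \<bullet> x)) * (k \<bullet> h))) (at x)"
  unfolding wave_def[abs_def] by (auto intro!: derivative_eq_intros simp: algebra_simps)

lemma partial_wave: "partial i (wave k \<alpha> \<beta>) = wave k (k $ i * \<beta>) (- (k $ i * \<alpha>))"
proof
  fix x
  show "partial i (wave k \<alpha> \<beta>) x = wave k (k $ i * \<beta>) (- (k $ i * \<alpha>)) x"
    using partial_eqI[OF wave_has_derivative, of i k \<alpha> \<beta> x] by (simp add: wave_def inner_axis algebra_simps)
qed

lemma Ck_wave: "Ck n (wave k \<alpha> \<beta>)"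
proof (induction n arbitrary: \<alpha> \<beta>)
  case 0
  then show ?case by (auto simp: wave_def[abs_def] intro!: continuous_intros)
next
  case (Suc n)
  have "wave k \<alpha> \<beta> differentiable_on UNIV"
    using differentiableI[OF wave_has_derivative] by (simp add: differentiable_on_def)
  then show ?case using Suc by (simp add: partial_wave)
qed

lemma continuous_wave: "continuous_on S (wave k \<alpha> \<beta>)"
  using Ck_wave[of 0 k \<alpha> \<beta>] by (auto intro: continuous_on_subset)

lemma cos_sin_shift_int: "cos (x + 2 * pi * of_int m) = cos x" "sin (x + 2 * pi * of_int m) = sin x"
  by (simp_all only: cos_add sin_add cos_int_2pin sin_int_2pin mult_1_right mult_zero_right diff_0_right add_0_right)

lemma wave_torus:
  assumes "1 \<le> N"
  shows "wave (freq N m) \<alpha> \<beta> \<in> torus_Ck N n"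
proof -
  have "wave (freq N m) \<alpha> \<beta> (x + axis i (2 * pi * real N)) = wave (freq N m) \<alpha> \<beta> x" for x i
  proof -
    have "freq N m \<bullet> (x + axis i (2 * pi * real N)) = freq N m \<bullet> x + 2 * pi * of_int (if i = 1 then fst m else snd m)"
      using assms by (simp add: inner_add_right inner_axis freq_def)
    then show ?thesis by (simp add: wave_def cos_sin_shift_int)
  qed
  then show ?thesis using Ck_wave by (simp add: torus_Ck_def)
qed

text \<open>A wave of non-zero frequency is a partial derivative of another wave, in a direction
  where the frequency does not vanish, and derivatives of periodic functions integrate to
  zero.\<close>

lemma torus_integral_wave:
  assumes N: "1 \<le> N"
  shows "torus_integral N (wave (freq N m) \<alpha> \<beta>) = (if m = 0 then \<alpha> * torus_area N else 0)"
proof (cases "m = 0")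
  case True
  have "wave 0 \<alpha> \<beta> = (\<lambda>_. \<alpha>)" by (simp add: wave_def fun_eq_iff)
  then show ?thesis using True by (simp add: torus_integral_const)
next
  case False
  then have "freq N m \<noteq> 0" using freq_eq_0_iff[OF N] by simp
  then obtain i where i: "freq N m $ i \<noteq> 0" by (auto simp: vec_eq_iff)
  have "wave (freq N m) \<alpha> \<beta> = partial i (wave (freq N m) (- \<beta> / freq N m $ i) (\<alpha> / freq N m $ i))"
    using i by (simp add: partial_wave)
  then show ?thesis using False torus_integral_partial[OF wave_torus[OF N]] by simp
qed

lemma wave_mult:
  "wave k \<alpha> \<beta> x * wave l \<gamma> \<delta> x = 1/2 * wave (k - l) (\<alpha> * \<gamma> + \<beta> * \<delta>) (\<beta> * \<gamma> - \<alpha> * \<delta>) x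
     + 1/2 * wave (k + l) (\<alpha> * \<gamma> - \<beta> * \<delta>) (\<beta> * \<gamma> + \<alpha> * \<delta>) x"
  by (simp add: wave_def inner_add_left inner_diff_left cos_add sin_add cos_diff sin_diff field_simps)

lemma torus_integral_wave2:
  assumes N: "1 \<le> N"
  shows "torus_integral N (\<lambda>x. wave (freq N m) \<alpha> \<beta> x * wave (freq N n) \<gamma> \<delta> x) = torus_area N / 2 *
    ((if m = n then \<alpha> * \<gamma> + \<beta> * \<delta> else 0) + (if m + n = 0 then \<alpha> * \<gamma> - \<beta> * \<delta> else 0))"
  unfolding wave_mult freq_simps[symmetric]
  by (subst torus_integral_linear[OF continuous_wave continuous_wave])
    (auto simp del: freq_simps simp: torus_integral_wave[OF N] field_simps)

lemma cas_orthogonal: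
  assumes N: "1 \<le> N"
  shows "torus_integral N (\<lambda>x. cas N m x * cas N n x) = (if m = n then torus_area N else 0)"
  unfolding torus_integral_wave2[OF N] by auto

text \<open>The integral of a product of three Hartley functions divided by the area. Unlike for
  complex exponentials, all four sign relations between the frequencies contribute, one of them with
  a minus sign.\<close>

definition triple :: "int \<times> int \<Rightarrow> int \<times> int \<Rightarrow> int \<times> int \<Rightarrow> real" where
  "triple a b c = (of_bool (a = b + c) + of_bool (b = a + c) + of_bool (c = a + b) - of_bool (a + b + c = 0)) / 2"

lemma torus_integral_cas3:
  assumes N: "1 \<le> N"
  shows "torus_integral N (\<lambda>x. cas N a x * cas N b x * cas N c x) = torus_area N * triple a b c"
proof -
  \<comment> \<open>The product of two Hartley functions is the cosine of the difference frequency
    plus the sine of the sum frequency.\<close>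
  have "cas N a x * cas N b x * cas N c x = 1 * (wave (freq N (a - b)) 1 0 x * cas N c x) + 1 * (wave (freq N (a + b)) 0 1 x * cas N c x)" for x
    unfolding wave_mult[of _ 1 1 x _ 1 1] by (simp add: wave_def algebra_simps)
  then have "torus_integral N (\<lambda>x. cas N a x * cas N b x * cas N c x) =
     1 * torus_integral N (\<lambda>x. wave (freq N (a - b)) 1 0 x * cas N c x) + 1 * torus_integral N (\<lambda>x. wave (freq N (a + b)) 0 1 x * cas N c x)"
    by (simp only:) (rule torus_integral_linear; intro continuous_on_mult continuous_wave)
  also have "\<dots> = torus_area N * triple a b c"
    unfolding torus_integral_wave2[OF N] triple_def
    by (auto simp: algebra_simps)
  finally show ?thesis .
qed

text \<open>Linearity between the cosine and the sine of one frequency is what the Fourier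
  coefficients of a functional see. The property passes from \<open>w\<close> to its derivatives and
  holds for every continuous density, so the cut-off formulas can be iterated.\<close>

definition trig_linear :: "nat \<Rightarrow> distribution \<Rightarrow> bool" where
  "trig_linear N w \<longleftrightarrow> (\<forall>m \<alpha> \<beta>. w (wave (freq N m) \<alpha> \<beta>)
     = \<alpha> * w (wave (freq N m) 1 0) + \<beta> * w (wave (freq N m) 0 1))"

lemma trig_linearD: "trig_linear N w \<Longrightarrow> w (wave (freq N m) \<alpha> \<beta>)
     = \<alpha> * w (wave (freq N m) 1 0) + \<beta> * w (wave (freq N m) 0 1)"
  unfolding trig_linear_def by blast

lemma wave_decomp: "wave k \<alpha> \<beta> = (\<lambda>x. \<alpha> * wave k 1 0 x + \<beta> * wave k 0 1 x)"
  by (simp add: wave_def fun_eq_iff)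

lemma wave_uminus: "wave (- k) \<alpha> \<beta> = wave k \<alpha> (- \<beta>)"
  by (simp add: wave_def fun_eq_iff)

lemma is_distribution_linear:
  assumes "is_distribution N w" "f \<in> torus_Ck N 1" "g \<in> torus_Ck N 1"
  shows "w (\<lambda>x. a * f x + b * g x) = a * w f + b * w g"
  using assms by (auto simp: is_distribution_def)

lemma is_distribution_trig_linear:
  assumes "1 \<le> N" "is_distribution N w"
  shows "trig_linear N w"
  unfolding trig_linear_def
proof (intro allI)
  fix m \<alpha> \<beta>
  show "w (wave (freq N m) \<alpha> \<beta>) = \<alpha> * w (wave (freq N m) 1 0) + \<beta> * w (wave (freq N m) 0 1)"
    by (subst wave_decomp) (rule is_distribution_linear[OF assms(2) wave_torus[OF assms(1)] wave_torus[OF assms(1)]])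
qed

lemma trig_linear_partial: "trig_linear N w \<Longrightarrow> trig_linear N (dist_partial i w)"
  unfolding trig_linear_def dist_partial_def partial_wave
proof (intro allI)
  fix m \<alpha> \<beta>
  let ?k = "freq N m"
  assume *: "\<forall>m \<alpha> \<beta>. w (wave (freq N m) \<alpha> \<beta>) = \<alpha> * w (wave (freq N m) 1 0) + \<beta> * w (wave (freq N m) 0 1)"
  note w = *[rule_format, of m]
  show "- w (wave ?k (?k $ i * \<beta>) (- (?k $ i * \<alpha>))) = \<alpha> * - w (wave ?k (?k $ i * 0) (- (?k $ i * 1))) + \<beta> * - w (wave ?k (?k $ i * 1) (- (?k $ i * 0)))"
    unfolding w[of "?k $ i * \<beta>"] w[of "?k $ i * 0"] w[of "?k $ i * 1"] by (simp add: algebra_simps)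
qed

lemma trig_linear_distribution_of:
  assumes "continuous_on UNIV g"
  shows "trig_linear N (distribution_of N g)"
  unfolding trig_linear_def
proof (intro allI)
  fix m \<alpha> \<beta>
  have "distribution_of N g (wave (freq N m) \<alpha> \<beta>) = torus_integral N (\<lambda>x. \<alpha> * (g x * wave (freq N m) 1 0 x) + \<beta> * (g x * wave (freq N m) 0 1 x))"
    unfolding distribution_of_def wave_decomp[of _ \<alpha> \<beta>] by (simp add: algebra_simps)
  also have "\<dots> = \<alpha> * distribution_of N g (wave (freq N m) 1 0) + \<beta> * distribution_of N g (wave (freq N m) 0 1)"
    unfolding distribution_of_def
    by (rule torus_integral_linear) (intro continuous_on_mult assms continuous_wave)+
  finally show "distribution_of N g (wave (freq N m) \<alpha> \<beta>) = \<alpha> * distribution_of N g (wave (freq N m) 1 0) + \<beta> * distribution_of N g (wave (freq N m) 0 1)" .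
qed

section \<open>The Fourier cut-off and the nonlinearity in Hartley modes\<close>

definition low_modes :: "nat \<Rightarrow> real \<Rightarrow> (int \<times> int) set" where
  "low_modes N M = {m. norm (freq N m) \<le> M}"

definition box_modes :: "int \<Rightarrow> (int \<times> int) set" where
  "box_modes K = {- K..K} \<times> {- K..K}"

lemma finite_box_modes [simp]: "finite (box_modes K)" by (simp add: box_modes_def)

lemma norm_freq_sq: "(norm (freq N m))\<^sup>2 = ((of_int (fst m))\<^sup>2 + (of_int (snd m))\<^sup>2) / (real N)\<^sup>2"
proof -
  have "(norm (freq N m))\<^sup>2 = freq N m \<bullet> freq N m" by (simp add: power2_norm_eq_inner)
  also have "\<dots> = freq N m $ 1 * freq N m $ 1 + freq N m $ 2 * freq N m $ 2"
    unfolding inner_vec_def sum_2 by simp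
  finally show ?thesis by (simp add: power2_eq_square add_divide_distrib)
qed

lemma norm_freq_ge: "\<bar>of_int (fst m)\<bar> / real N \<le> norm (freq N m)" "\<bar>of_int (snd m)\<bar> / real N \<le> norm (freq N m)"
  using component_le_norm_cart[of "freq N m" 1] component_le_norm_cart[of "freq N m" 2] by auto

lemma low_modes_subset_box:
  assumes "1 \<le> N"
  shows "low_modes N 1 \<subseteq> box_modes (int N)"
proof
  fix m assume "m \<in> low_modes N 1"
  then have "\<bar>of_int (fst m)\<bar> / real N \<le> 1" "\<bar>of_int (snd m)\<bar> / real N \<le> 1"
    using norm_freq_ge[of m N] by (auto simp: low_modes_def)
  then have "\<bar>of_int (fst m) :: real\<bar> \<le> of_int (int N)" "\<bar>of_int (snd m) :: real\<bar> \<le> of_int (int N)"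
    using assms by (auto simp: field_simps)
  then have "\<bar>fst m\<bar> \<le> int N" "\<bar>snd m\<bar> \<le> int N"
    by (simp_all only: of_int_abs[symmetric] of_int_le_iff)
  then show "m \<in> box_modes (int N)" by (cases m) (auto simp: box_modes_def)
qed

lemma finite_low_modes: "1 \<le> N \<Longrightarrow> finite (low_modes N 1)"
  by (rule finite_subset[OF low_modes_subset_box finite_box_modes])

lemma low_modes_uminus: "- m \<in> low_modes N M \<longleftrightarrow> m \<in> low_modes N M"
  by (simp add: low_modes_def)

lemma ZN2_eq:
  assumes "1 \<le> N"
  shows "{k \<in> ZN2 N. norm k \<le> M} = freq N ` low_modes N M"
proof
  show "{k \<in> ZN2 N. norm k \<le> M} \<subseteq> freq N ` low_modes N M"
  proof
    fix k assume k: "k \<in> {k \<in> ZN2 N. norm k \<le> M}"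
    then obtain a b :: int where ab: "k $ 1 = of_int a / real N" "k $ 2 = of_int b / real N"
      unfolding ZN2_def by blast
    have "k = freq N (a, b)" using ab by (simp add: vec_eq_iff forall_2)
    then show "k \<in> freq N ` low_modes N M" using k by (auto simp: low_modes_def)
  qed
  show "freq N ` low_modes N M \<subseteq> {k \<in> ZN2 N. norm k \<le> M}"
    by (auto simp: low_modes_def ZN2_def freq_def)
qed

lemma Re_fourier_fmode:
  assumes w: "trig_linear N w"
  shows "Re (fourier w (freq N m) * fmode (freq N m) x)
    = 1 / (4 * pi\<^sup>2) * (w (wave (freq N m) 1 0) * wave (freq N m) 1 0 x + w (wave (freq N m) 0 1) * wave (freq N m) 0 1 x)"
proof -
  let ?k = "freq N m"
  have re: "(\<lambda>x. Re (fmode (- ?k) x)) = wave ?k (1 / (2 * pi)) 0"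
    by (simp add: fmode_def wave_def fun_eq_iff Re_exp)
  have im: "(\<lambda>x. Im (fmode (- ?k) x)) = wave ?k 0 (- 1 / (2 * pi))"
    by (simp add: fmode_def wave_def fun_eq_iff Im_exp)
  have "fourier w ?k = Complex (w (wave ?k 1 0) / (2 * pi)) (- w (wave ?k 0 1) / (2 * pi))"
    unfolding fourier_def re im trig_linearD[OF w, of m "1 / (2 * pi)" 0] trig_linearD[OF w, of m 0 "- 1 / (2 * pi)"]
    by (simp add: complex_eq_iff)
  moreover have "fmode ?k x = Complex (wave ?k 1 0 x / (2 * pi)) (wave ?k 0 1 x / (2 * pi))"
    by (simp add: fmode_def wave_def complex_eq_iff Re_exp Im_exp)
  ultimately show ?thesis by (simp add: power2_eq_square field_simps)
qed

lemma sum_antisym_eq_0: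
  fixes f :: "'i \<Rightarrow> real"
  assumes "\<And>m. m \<in> S \<Longrightarrow> \<sigma> m \<in> S" "\<And>m. m \<in> S \<Longrightarrow> \<sigma> (\<sigma> m) = m" "\<And>m. m \<in> S \<Longrightarrow> f (\<sigma> m) = - f m"
  shows "sum f S = 0"
proof -
  have "sum f S = (\<Sum>m\<in>S. f (\<sigma> m))"
    by (rule sum.reindex_bij_witness[of _ \<sigma> \<sigma>]) (auto simp: assms)
  also have "\<dots> = - sum f S" using assms(3) by (simp add: sum_negf)
  finally show ?thesis by simp
qed

text \<open>Passing from cosine and sine pairs to Hartley functions adds mixed cosine-sine terms;
  these are odd under m -> -m and cancel because the cut-off set is symmetric. The factor 1/(4
  \<pi>^2) of the two normalised exponentials times 1/N^2 is one over the area.\<close>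

lemma fourier_cutoff_eq:
  assumes N: "1 \<le> N" and w: "trig_linear N w"
  shows "fourier_cutoff N M w x = (\<Sum>m\<in>low_modes N M. w (cas N m) * cas N m x) / torus_area N"
proof -
  have inj: "inj_on (freq N) (low_modes N M)" using inj_freq[OF N] by (rule inj_on_subset) simp
  have cas: "w (cas N m) = w (wave (freq N m) 1 0) + w (wave (freq N m) 0 1)" for m
    using trig_linearD[OF w, of m 1 1] by simp
  have casx: "cas N m x = wave (freq N m) 1 0 x + wave (freq N m) 0 1 x" for m
    by (simp add: wave_def)
  have "(\<Sum>m\<in>low_modes N M. w (wave (freq N m) 1 0) * wave (freq N m) 0 1 x + w (wave (freq N m) 0 1) * wave (freq N m) 1 0 x) = 0"
  proof (rule sum_antisym_eq_0[where \<sigma> = uminus])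
    fix m
    have "w (wave (freq N m) 0 (- 1)) = - w (wave (freq N m) 0 1)"
      using trig_linearD[OF w, of m 0 "- 1"] by simp
    then show "w (wave (freq N (- m)) 1 0) * wave (freq N (- m)) 0 1 x + w (wave (freq N (- m)) 0 1) * wave (freq N (- m)) 1 0 x
      = - (w (wave (freq N m) 1 0) * wave (freq N m) 0 1 x + w (wave (freq N m) 0 1) * wave (freq N m) 1 0 x)"
      by (simp add: wave_uminus) (simp add: wave_def)
  qed (simp_all add: low_modes_uminus)
  then have odd: "(\<Sum>m\<in>low_modes N M. w (cas N m) * cas N m x) = (\<Sum>m\<in>low_modes N M. w (wave (freq N m) 1 0) * wave (freq N m) 1 0 x + w (wave (freq N m) 0 1) * wave (freq N m) 0 1 x)"
    unfolding cas casx by (simp add: algebra_simps sum.distrib)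
  have "fourier_cutoff N M w x = (\<Sum>m\<in>low_modes N M. Re (fourier w (freq N m) * fmode (freq N m) x)) / (real N)\<^sup>2"
    unfolding fourier_cutoff_def ZN2_eq[OF N] sum.reindex[OF inj] by simp
  also have "\<dots> = (1 / (4 * pi\<^sup>2)) * (\<Sum>m\<in>low_modes N M. w (cas N m) * cas N m x) / (real N)\<^sup>2"
    unfolding Re_fourier_fmode[OF w] odd by (simp add: sum_distrib_left)
  also have "\<dots> = (\<Sum>m\<in>low_modes N M. w (cas N m) * cas N m x) / torus_area N"
    by (simp add: torus_area_def power_mult_distrib)
  finally show ?thesis .
qed

text \<open>The polarised symbol of the quadratic form in the gradient; with frequencies read as
  complex numbers it is the real part of the product k l.\<close>

definition hyp :: "plane \<Rightarrow> plane \<Rightarrow> real" where "hyp k l = k $ 1 * l $ 1 - k $ 2 * l $ 2"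

text \<open>A partial derivative of the Hartley function of frequency k is the component of k times
  the Hartley function of frequency -k, whence \<open>cas N (- m)\<close>.\<close>

definition gradient_mode :: "nat \<Rightarrow> distribution \<Rightarrow> 2 \<Rightarrow> plane \<Rightarrow> real" where
  "gradient_mode N w i x = (\<Sum>m\<in>low_modes N 1. freq N m $ i * w (cas N m) * cas N (- m) x) / torus_area N"

lemma fourier_cutoff_partial:
  assumes N: "1 \<le> N" and w: "trig_linear N w"
  shows "fourier_cutoff N 1 (dist_partial i w) = gradient_mode N w i"
proof
  fix x
  have p: "dist_partial i w (cas N m) = - (freq N m $ i * w (cas N (- m)))" for m
    unfolding dist_partial_def partial_wave freq_simps wave_uminus
    unfolding trig_linearD[OF w, of m "freq N m $ i * 1"] trig_linearD[OF w, of m 1 "- 1"]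
    by (simp add: algebra_simps)
  have "(\<Sum>m\<in>low_modes N 1. dist_partial i w (cas N m) * cas N m x) = (\<Sum>m\<in>low_modes N 1. freq N m $ i * w (cas N m) * cas N (- m) x)"
    unfolding p by (rule sum.reindex_bij_witness[of _ uminus uminus]) (auto simp: low_modes_uminus)
  then show "fourier_cutoff N 1 (dist_partial i w) x = gradient_mode N w i x"
    unfolding fourier_cutoff_eq[OF N trig_linear_partial[OF w]] gradient_mode_def by simp
qed

text \<open>The pairing of the nonlinearity with the Hartley function of index \<open>c\<close>, as
  a quadratic form in the unnormalised modes \<open>h\<close>. The minus signs in
  \<open>triple\<close> come from the derivatives.\<close>

definition nonlin_mode :: "nat \<Rightarrow> (int \<times> int \<Rightarrow> real) \<Rightarrow> int \<times> int \<Rightarrow> real" where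
  "nonlin_mode N h c = (\<Sum>a\<in>low_modes N 1. \<Sum>b\<in>low_modes N 1.
     hyp (freq N a) (freq N b) * triple (- a) (- b) c * h a * h b) / torus_area N"

lemma continuous_gradient_mode: "continuous_on UNIV (gradient_mode N w i)"
  unfolding gradient_mode_def[abs_def] divide_inverse
  by (intro continuous_intros continuous_wave)

lemma akpz_nonlinearity_eq:
  assumes N: "1 \<le> N" and w: "trig_linear N w"
  shows "akpz_nonlinearity N w x = (\<Sum>c\<in>low_modes N 1. nonlin_mode N (\<lambda>m. w (cas N m)) c * cas N c x) / torus_area N"
proof -
  let ?A = "torus_area N" and ?D = "low_modes N 1"
  let ?u = "gradient_mode N w"
  let ?F = "\<lambda>x. (?u 1 x)\<^sup>2 - (?u 2 x)\<^sup>2"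
  have A: "0 < ?A" by (rule torus_area_pos[OF N])
  have cF: "continuous_on UNIV ?F" by (intro continuous_intros continuous_gradient_mode)
  have Fx: "?F x * cas N c x = (1 / ?A\<^sup>2) * (\<Sum>a\<in>?D. \<Sum>b\<in>?D. hyp (freq N a) (freq N b) * w (cas N a) * w (cas N b) * (cas N (- a) x * cas N (- b) x * cas N c x))" for c x
  proof -
    have sq: "(?u i x)\<^sup>2 = (1 / ?A\<^sup>2) * (\<Sum>a\<in>?D. \<Sum>b\<in>?D. (freq N a $ i * freq N b $ i) * w (cas N a) * w (cas N b) * (cas N (- a) x * cas N (- b) x))" for i
      unfolding gradient_mode_def power2_eq_square by (simp add: sum_product mult_ac)
    show ?thesis unfolding sq hyp_def
      by (simp add: left_diff_distrib sum_subtractf right_diff_distrib sum_distrib_left sum_distrib_right diff_divide_distrib mult_ac del: freq_nth)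
  qed
  have F: "distribution_of N ?F (cas N c) = nonlin_mode N (\<lambda>m. w (cas N m)) c" for c
  proof -
    have "distribution_of N ?F (cas N c) = (1 / ?A\<^sup>2) * torus_integral N (\<lambda>x. \<Sum>a\<in>?D. \<Sum>b\<in>?D. hyp (freq N a) (freq N b) * w (cas N a) * w (cas N b) * (cas N (- a) x * cas N (- b) x * cas N c x))"
      unfolding distribution_of_def Fx by (rule torus_integral_cmult)
    also have "torus_integral N (\<lambda>x. \<Sum>a\<in>?D. \<Sum>b\<in>?D. hyp (freq N a) (freq N b) * w (cas N a) * w (cas N b) * (cas N (- a) x * cas N (- b) x * cas N c x))
      = (\<Sum>a\<in>?D. \<Sum>b\<in>?D. torus_integral N (\<lambda>x. hyp (freq N a) (freq N b) * w (cas N a) * w (cas N b) * (cas N (- a) x * cas N (- b) x * cas N c x)))"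
      by (subst torus_integral_sum; (intro continuous_intros continuous_wave)?)
        (intro sum.cong refl torus_integral_sum continuous_intros continuous_wave)
    also have "\<dots> = (\<Sum>a\<in>?D. \<Sum>b\<in>?D. hyp (freq N a) (freq N b) * w (cas N a) * w (cas N b) * (?A * triple (- a) (- b) c))"
      unfolding torus_integral_cmult torus_integral_cas3[OF N] ..
    also have "(1 / ?A\<^sup>2) * \<dots> = nonlin_mode N (\<lambda>m. w (cas N m)) c"
      unfolding nonlin_mode_def using A
      by (simp add: sum_distrib_left sum_divide_distrib power2_eq_square mult_ac)
    finally show ?thesis .
  qed
  have "akpz_nonlinearity N w x = fourier_cutoff N 1 (distribution_of N ?F) x"
    unfolding akpz_nonlinearity_def fourier_cutoff_partial[OF N w] ..
  also have "\<dots> = (\<Sum>c\<in>?D. nonlin_mode N (\<lambda>m. w (cas N m)) c * cas N c x) / ?A"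
    unfolding fourier_cutoff_eq[OF N trig_linear_distribution_of[OF cF]] F ..
  finally show ?thesis .
qed

lemma akpz_nonlinearity_pairing:
  assumes N: "1 \<le> N" and w: "trig_linear N w" and S: "finite S"
  shows "distribution_of N (akpz_nonlinearity N w) (\<lambda>x. \<Sum>e\<in>S. p e * cas N e x)
    = (\<Sum>e\<in>S. if e \<in> low_modes N 1 then p e * nonlin_mode N (\<lambda>m. w (cas N m)) e else 0)"
proof -
  let ?A = "torus_area N" and ?D = "low_modes N 1" and ?n = "nonlin_mode N (\<lambda>m. w (cas N m))"
  have A: "0 < ?A" by (rule torus_area_pos[OF N])
  note fD = finite_low_modes[OF N]
  have "distribution_of N (akpz_nonlinearity N w) (\<lambda>x. \<Sum>e\<in>S. p e * cas N e x)
     = (1 / ?A) * torus_integral N (\<lambda>x. \<Sum>e\<in>S. \<Sum>c\<in>?D. ?n c * p e * (cas N c x * cas N e x))"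
    unfolding distribution_of_def akpz_nonlinearity_eq[OF N w]
    by (subst torus_integral_cmult[symmetric]) (simp add: sum_product sum.swap[of _ ?D S] mult_ac)
  also have "torus_integral N (\<lambda>x. \<Sum>e\<in>S. \<Sum>c\<in>?D. ?n c * p e * (cas N c x * cas N e x))
     = (\<Sum>e\<in>S. \<Sum>c\<in>?D. torus_integral N (\<lambda>x. ?n c * p e * (cas N c x * cas N e x)))"
    by (subst torus_integral_sum; (intro continuous_intros continuous_wave)?)
        (intro sum.cong refl torus_integral_sum continuous_intros continuous_wave)
  also have "\<dots> = (\<Sum>e\<in>S. \<Sum>c\<in>?D. if c = e then ?n c * p e * ?A else 0)"
    unfolding torus_integral_cmult cas_orthogonal[OF N] by (intro sum.cong refl) auto
  also have "\<dots> = (\<Sum>e\<in>S. if e \<in> ?D then ?n e * p e * ?A else 0)"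
    using fD by (intro sum.cong refl) (simp add: sum.delta)
  also have "(1 / ?A) * \<dots> = (\<Sum>e\<in>S. if e \<in> ?D then p e * ?n e else 0)"
    unfolding sum_distrib_left using A by (intro sum.cong refl) auto
  finally show ?thesis .
qed

section \<open>Periodic functions and the fundamental domain\<close>

abbreviation period :: "nat \<Rightarrow> real" where "period N \<equiv> 2 * pi * real N"

definition periodic :: "nat \<Rightarrow> (plane \<Rightarrow> real) \<Rightarrow> bool" where
  "periodic N f \<longleftrightarrow> (\<forall>x i. f (x + axis i (period N)) = f x)"

lemma torus_Ck_periodic: "f \<in> torus_Ck N n \<Longrightarrow> periodic N f"
  by (auto simp: torus_Ck_def periodic_def)

lemma periodic_int_axis:
  assumes "periodic N f"
  shows "f (x + axis i (period N * of_int z)) = f x"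
proof -
  have nat: "f (x + axis i (period N * of_nat n)) = f x" for n x
  proof (induction n)
    case 0
    have "x + axis i (period N * of_nat 0) = x" by (simp add: axis_def vec_eq_iff)
    then show ?case by (simp only:)
  next
    case (Suc n)
    have e: "x + axis i (period N * of_nat (Suc n)) = (x + axis i (period N * of_nat n)) + axis i (period N)"
      by (simp add: axis_def vec_eq_iff algebra_simps)
    show ?case unfolding e using assms Suc unfolding periodic_def by (simp only:)
  qed
  show ?thesis
  proof (cases "0 \<le> z")
    case True
    then show ?thesis using nat[of x "nat z"] by simp
  next
    case False
    have e: "(x + axis i (period N * of_int z)) + axis i (period N * of_nat (nat (- z))) = x"
      using False by (simp add: axis_def vec_eq_iff)
    show ?thesis using nat[of "x + axis i (period N * of_int z)" "nat (- z)"] unfolding e by (rule sym)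
  qed
qed

lemma periodic_lattice:
  assumes "periodic N f"
  shows "f (x + (\<chi> i. period N * of_int (z i))) = f x"
proof -
  have e: "x + (\<chi> i. period N * of_int (z i)) = (x + axis 1 (period N * of_int (z 1))) + axis 2 (period N * of_int (z 2))"
    by (simp add: vec_eq_iff forall_2 axis_def)
  show ?thesis unfolding e periodic_int_axis[OF assms] ..
qed

lemma torus_Ck_continuous: "f \<in> torus_Ck N n \<Longrightarrow> continuous_on UNIV f"
  using Ck_Suc_continuous by (auto simp: torus_Ck_def simp del: Ck.simps)

lemma torus_Ck1_partial_continuous: "f \<in> torus_Ck N 1 \<Longrightarrow> continuous_on UNIV (partial i f)"
  by (auto simp: torus_Ck_def)

definition cell :: "nat \<Rightarrow> plane \<Rightarrow> 2 \<Rightarrow> int" where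
  "cell N x i = \<lfloor>(x $ i + half_side N) / period N\<rfloor>"

definition wrap :: "nat \<Rightarrow> plane \<Rightarrow> plane" where
  "wrap N x = (\<chi> i. x $ i - period N * of_int (cell N x i))"

lemma to_torus_wrap: "to_torus N f x = f (wrap N x)"
  by (simp add: to_torus_def wrap_def cell_def)

lemma wrap_bounds:
  assumes "1 \<le> N"
  shows "- half_side N \<le> wrap N x $ i" "wrap N x $ i < half_side N"
proof -
  let ?f = "(x $ i + half_side N) / period N"
  have P: "0 < period N" using assms by simp
  have "of_int \<lfloor>?f\<rfloor> \<le> ?f" "?f < of_int \<lfloor>?f\<rfloor> + 1" by linarith+
  then have "of_int \<lfloor>?f\<rfloor> * period N \<le> x $ i + half_side N" "x $ i + half_side N < (of_int \<lfloor>?f\<rfloor> + 1) * period N"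
    by (simp_all only: pos_le_divide_eq[OF P] pos_divide_less_eq[OF P])
  then show "- half_side N \<le> wrap N x $ i" "wrap N x $ i < half_side N"
    by (simp_all add: wrap_def cell_def algebra_simps)
qed

lemma wrap_id:
  assumes "1 \<le> N" "x \<in> torus_box N"
  shows "wrap N x = x"
proof -
  have "cell N x i = 0" for i
  proof -
    have "0 \<le> (x $ i + half_side N) / period N" "(x $ i + half_side N) / period N < 1"
    proof -
      have x: "- half_side N \<le> x $ i" "x $ i < half_side N" and P: "0 < period N"
        using assms by (auto simp: torus_box_def)
      show "0 \<le> (x $ i + half_side N) / period N" using x(1) P by (intro divide_nonneg_pos) auto
      show "(x $ i + half_side N) / period N < 1" unfolding pos_divide_less_eq[OF P] using x(2) by simp
    qed
    then show ?thesis unfolding cell_def by linarith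
  qed
  then show ?thesis by (simp add: wrap_def vec_eq_iff)
qed

text \<open>Wrapping changes x - u by a lattice vector only. Both points may thus be assumed to lie
  in one compact box, where continuity is uniform.\<close>

lemma periodic_wrap_diff:
  assumes "periodic N f"
  shows "f (wrap N x - wrap N u) = f (x - u)"
proof -
  have "x - u = (wrap N x - wrap N u) + (\<chi> i. period N * of_int (cell N x i - cell N u i))"
    by (simp add: wrap_def vec_eq_iff algebra_simps)
  then show ?thesis using periodic_lattice[OF assms] by metis
qed

lemma periodic_wrap:
  assumes "periodic N f"
  shows "f (wrap N x) = f x"
proof -
  have "x = wrap N x + (\<chi> i. period N * of_int (cell N x i))"
    by (simp add: wrap_def vec_eq_iff)
  then show ?thesis using periodic_lattice[OF assms] by metis
qed

lemma periodic_bounded: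
  assumes N: "1 \<le> N" and g: "continuous_on UNIV g" "periodic N g"
  obtains B where "0 < B" "\<And>x. \<bar>g x\<bar> \<le> B"
proof -
  let ?C = "cbox (\<chi> i. - half_side N) (\<chi> i. half_side N) :: plane set"
  have "bounded (g ` ?C)"
    by (intro compact_imp_bounded compact_continuous_image continuous_on_subset[OF g(1)]) auto
  then obtain B where B: "0 < B" "\<And>x. x \<in> ?C \<Longrightarrow> \<bar>g x\<bar> \<le> B"
    unfolding bounded_pos by auto
  show thesis
  proof (rule that[OF B(1)])
    fix x
    have "wrap N x \<in> ?C" using wrap_bounds[OF N, of x] by (auto simp: mem_box_cart less_imp_le)
    then show "\<bar>g x\<bar> \<le> B" using B(2)[of "wrap N x"] by (simp add: periodic_wrap[OF g(2)])
  qed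
qed

section \<open>Trigonometric polynomials and a kernel that concentrates at the origin\<close>

definition kern :: "nat \<Rightarrow> plane \<Rightarrow> real" where
  "kern N u = (1/2 + 1/2 * cos (u $ 1 / real N)) * (1/2 + 1/2 * cos (u $ 2 / real N))"

lemma kern_bounds: "0 \<le> kern N u" "kern N u \<le> 1" "kern N u \<le> 1/2 + 1/2 * cos (u $ i / real N)"
proof -
  have c: "0 \<le> 1/2 + 1/2 * cos t" "1/2 + 1/2 * cos t \<le> 1" for t :: real
    using cos_ge_minus_one[of t] cos_le_one[of t] by linarith+
  show 0: "0 \<le> kern N u" unfolding kern_def using c by simp
  have 1: "kern N u \<le> 1/2 + 1/2 * cos (u $ 1 / real N)" unfolding kern_def by (rule mult_left_le) (use c in auto)
  have 2: "kern N u \<le> 1/2 + 1/2 * cos (u $ 2 / real N)" unfolding kern_def by (rule mult_left_le_one_le) (use c in auto)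
  show "kern N u \<le> 1" using 1 c(2)[of "u $ 1 / real N"] by linarith
  show "kern N u \<le> 1/2 + 1/2 * cos (u $ i / real N)"
    using 1 2 exhaust_2[of i] by auto
qed

text \<open>The kernel equals 1 exactly at lattice points. A value close to 1 forces both wrapped
  coordinates of \<open>u\<close> to be small, and a periodic continuous function is insensitive to
  such a shift, uniformly in \<open>x\<close>.\<close>

lemma kern_concentrates:
  assumes N: "1 \<le> N" and g: "continuous_on UNIV g" "periodic N g" and \<epsilon>: "0 < \<epsilon>"
  obtains \<delta> where "0 < \<delta>" "\<delta> \<le> 1" "\<And>x u. 1 - \<delta> < kern N u \<Longrightarrow> \<bar>g (x - u) - g x\<bar> < \<epsilon>"
proof -
  let ?C = "cbox (\<chi> i. - period N) (\<chi> i. period N) :: plane set"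
  have "uniformly_continuous_on ?C g"
    by (intro compact_uniformly_continuous continuous_on_subset[OF g(1)]) auto
  then obtain d where d: "0 < d" "\<And>x y. x \<in> ?C \<Longrightarrow> y \<in> ?C \<Longrightarrow> dist y x < d \<Longrightarrow> dist (g y) (g x) < \<epsilon>"
    unfolding uniformly_continuous_on_def using \<epsilon> by meson
  define r where "r = min (d / 2) (half_side N)"
  have r: "0 < r" "r \<le> d / 2" "r \<le> half_side N" using d(1) N by (auto simp: r_def)
  have rN: "0 < r / real N" "r / real N \<le> pi" using r N by (auto simp: field_simps)
  \<comment> \<open>One cosine factor of the kernel equals 1 - \<delta> at distance
    \<open>r\<close>. Capping \<open>r\<close> at half a period keeps the argument in [0, \<pi>],
    where the cosine decreases.\<close>
  define \<delta> where "\<delta> = (1 - cos (r / real N)) / 2"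
  have "cos (r / real N) < 1" using cos_monotone_0_pi[of 0 "r / real N"] rN by simp
  then have \<delta>: "0 < \<delta>" "\<delta> \<le> 1" unfolding \<delta>_def using cos_ge_minus_one[of "r / real N"] by auto
  show thesis
  proof (rule that[OF \<delta>])
    fix x u assume u: "1 - \<delta> < kern N u"
    have small: "\<bar>wrap N u $ i\<bar> < r" for i
    proof (rule ccontr)
      assume "\<not> \<bar>wrap N u $ i\<bar> < r"
      then have 1: "r / real N \<le> \<bar>wrap N u $ i\<bar> / real N" using N by (simp add: divide_right_mono)
      have "\<bar>wrap N u $ i\<bar> \<le> half_side N" using wrap_bounds[OF N, of u i] by linarith
      then have 2: "\<bar>wrap N u $ i\<bar> / real N \<le> pi" using N by (simp add: field_simps)
      have "wrap N u $ i / real N = u $ i / real N + 2 * pi * of_int (- cell N u i)"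
        using N by (simp add: wrap_def field_simps)
      then have "cos (wrap N u $ i / real N) = cos (u $ i / real N)" using cos_sin_shift_int(1) by metis
      then have "cos (u $ i / real N) = cos (\<bar>wrap N u $ i\<bar> / real N)"
        by (cases "0 \<le> wrap N u $ i") (auto simp: abs_if)
      also have "\<dots> \<le> cos (r / real N)"
        using cos_monotone_0_pi_le[of "r / real N" "\<bar>wrap N u $ i\<bar> / real N"] rN 1 2 by simp
      finally have "kern N u \<le> 1 - \<delta>" using kern_bounds(3)[of N u i] by (simp add: \<delta>_def field_simps)
      then show False using u by simp
    qed
    have "norm (wrap N u) \<le> (\<Sum>i\<in>UNIV. \<bar>wrap N u $ i\<bar>)" by (rule norm_le_l1_cart)
    also have "\<dots> < r + r" unfolding sum_2 using small[of 1] small[of 2] by linarith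
    finally have nu: "norm (wrap N u) < d" using r by linarith
    have xC: "wrap N x \<in> ?C" unfolding mem_box_cart
    proof
      fix i show "(\<chi> i. - period N) $ i \<le> wrap N x $ i \<and> wrap N x $ i \<le> (\<chi> i. period N) $ i"
        using wrap_bounds[OF N, of x i] N pi_gt_zero by auto
    qed
    have xuC: "wrap N x - wrap N u \<in> ?C" unfolding mem_box_cart
    proof
      fix i show "(\<chi> i. - period N) $ i \<le> (wrap N x - wrap N u) $ i \<and> (wrap N x - wrap N u) $ i \<le> (\<chi> i. period N) $ i"
        using wrap_bounds[OF N, of x i] wrap_bounds[OF N, of u i] by auto
    qed
    have "dist (g (wrap N x - wrap N u)) (g (wrap N x)) < \<epsilon>"
      by (rule d(2)[OF xC xuC]) (use nu in \<open>simp add: dist_norm\<close>)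
    then show "\<bar>g (x - u) - g x\<bar> < \<epsilon>"
      by (simp add: dist_real_def periodic_wrap[OF g(2)] periodic_wrap_diff[OF g(2)])
  qed
qed

inductive trig_poly :: "nat \<Rightarrow> (plane \<Rightarrow> real) \<Rightarrow> bool" for N where
  wave: "trig_poly N (wave (freq N m) \<alpha> \<beta>)"
| add: "trig_poly N f \<Longrightarrow> trig_poly N g \<Longrightarrow> trig_poly N (\<lambda>x. f x + g x)"

lemma trig_poly_scale: "trig_poly N f \<Longrightarrow> trig_poly N (\<lambda>x. c * f x)"
proof (induction rule: trig_poly.induct)
  case (wave m \<alpha> \<beta>)
  have "(\<lambda>x. c * wave (freq N m) \<alpha> \<beta> x) = wave (freq N m) (c * \<alpha>) (c * \<beta>)"
    by (simp add: wave_def fun_eq_iff algebra_simps)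
  then show ?case by (simp add: trig_poly.wave)
next
  case (add f g)
  then show ?case by (simp add: distrib_left trig_poly.add)
qed

lemma trig_poly_const: "trig_poly N (\<lambda>_. c)"
proof -
  have "(\<lambda>_. c) = wave (freq N 0) c 0" by (simp add: wave_def fun_eq_iff)
  then show ?thesis using trig_poly.wave[of N 0 c 0] by simp
qed

lemma trig_poly_mult: "trig_poly N f \<Longrightarrow> trig_poly N g \<Longrightarrow> trig_poly N (\<lambda>x. f x * g x)"
proof (induction rule: trig_poly.induct)
  case (wave m \<alpha> \<beta>)
  from wave show ?case
  proof (induction rule: trig_poly.induct)
    case (wave n \<gamma> \<delta>)
    show ?case unfolding wave_mult freq_simps[symmetric]
      by (intro trig_poly.add trig_poly_scale trig_poly.wave)
  next
    case (add f g)
    then show ?case by (simp add: distrib_left trig_poly.add)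
  qed
next
  case (add f1 f2)
  then show ?case by (simp add: distrib_right trig_poly.add)
qed

lemma trig_poly_power: "trig_poly N f \<Longrightarrow> trig_poly N (\<lambda>x. f x ^ n)"
  by (induction n) (auto intro: trig_poly_const trig_poly_mult)

lemma trig_poly_kern: "trig_poly N (kern N)"
proof -
  have k: "cos (u $ 1 / real N) = wave (freq N (1, 0)) 1 0 u" "cos (u $ 2 / real N) = wave (freq N (0, 1)) 1 0 u" for u
    by (simp_all add: wave_def inner_vec_def sum_2)
  have "kern N = (\<lambda>u. (1/2 + 1/2 * wave (freq N (1, 0)) 1 0 u) * (1/2 + 1/2 * wave (freq N (0, 1)) 1 0 u))"
    by (simp add: kern_def k fun_eq_iff)
  then show ?thesis
    by (simp only:) (intro trig_poly_mult trig_poly.add trig_poly_const trig_poly_scale trig_poly.wave)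
qed

lemma trig_poly_continuous: "trig_poly N f \<Longrightarrow> continuous_on S f"
  by (induction rule: trig_poly.induct) (auto intro: continuous_wave continuous_intros)

lemma trig_poly_torus:
  assumes "1 \<le> N" "trig_poly N f"
  shows "f \<in> torus_Ck N n"
  using assms(2)
proof (induction rule: trig_poly.induct)
  case (add f g)
  then show ?case using torus_Ck_linear[of f N n g 1 1] by simp
qed (rule wave_torus[OF assms(1)])

lemma trig_poly_cas_sum:
  assumes "trig_poly N f"
  shows "\<exists>K c. f = (\<lambda>x. \<Sum>m\<in>box_modes K. c m * cas N m x)"
  using assms
proof (induction rule: trig_poly.induct)
  case (wave m \<alpha> \<beta>)
  define K where "K = \<bar>fst m\<bar> + \<bar>snd m\<bar>"
  have K: "m \<in> box_modes K" "- m \<in> box_modes K" by (cases m; auto simp: K_def box_modes_def)+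
  \<comment> \<open>A cosine is the half sum and a sine the half difference of the Hartley functions
    at m and -m. For m = 0 the two contributions fall on the same index and add up to \<alpha>, as
    they should.\<close>
  define c where "c n = (if n = m then (\<alpha> + \<beta>) / 2 else 0) + (if n = - m then (\<alpha> - \<beta>) / 2 else 0)" for n
  have "wave (freq N m) \<alpha> \<beta> x = (\<Sum>n\<in>box_modes K. c n * cas N n x)" for x
  proof -
    have "(\<Sum>n\<in>box_modes K. c n * cas N n x) = (\<Sum>n\<in>box_modes K. (if n = m then (\<alpha> + \<beta>) / 2 * cas N n x else 0) + (if n = - m then (\<alpha> - \<beta>) / 2 * cas N n x else 0))"
      by (intro sum.cong refl) (simp add: c_def distrib_right mult_delta_left)
    also have "\<dots> = (\<alpha> + \<beta>) / 2 * cas N m x + (\<alpha> - \<beta>) / 2 * cas N (- m) x"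
      using K by (simp add: sum.distrib)
    also have "\<dots> = wave (freq N m) \<alpha> \<beta> x" by (simp add: wave_def field_simps)
    finally show ?thesis by simp
  qed
  then show ?case by blast
next
  case (add f g)
  then obtain K1 c1 K2 c2 where fg: "f = (\<lambda>x. \<Sum>m\<in>box_modes K1. c1 m * cas N m x)" "g = (\<lambda>x. \<Sum>m\<in>box_modes K2. c2 m * cas N m x)"
    by blast
  define K where "K = max K1 K2"
  define c where "c m = (if m \<in> box_modes K1 then c1 m else 0) + (if m \<in> box_modes K2 then c2 m else 0)" for m
  have ext: "(\<Sum>m\<in>box_modes K'. d m * cas N m x) = (\<Sum>m\<in>box_modes K. (if m \<in> box_modes K' then d m * cas N m x else 0))"
    if "K' \<le> K" for K' d x
  proof -
    have "box_modes K \<inter> box_modes K' = box_modes K'" using that by (auto simp: box_modes_def)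
    then show ?thesis by (simp add: sum.inter_restrict[symmetric])
  qed
  have "f x + g x = (\<Sum>m\<in>box_modes K. c m * cas N m x)" for x
    unfolding fg ext[of K1, OF max.cobounded1[of K1 K2, folded K_def]] ext[of K2, OF max.cobounded2[of K2 K1, folded K_def]] sum.distrib[symmetric]
    by (intro sum.cong refl) (auto simp: c_def distrib_right)
  then show ?case by blast
qed

section \<open>Convolution with trigonometric kernels and approximation together with first
  derivatives\<close>

definition conv :: "nat \<Rightarrow> (plane \<Rightarrow> real) \<Rightarrow> (plane \<Rightarrow> real) \<Rightarrow> plane \<Rightarrow> real" where
  "conv N f K x = torus_integral N (\<lambda>y. f y * K (x - y))"

lemma conv_wave:
  fixes N :: nat and f :: "plane \<Rightarrow> real"
  assumes f: "continuous_on UNIV f"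
  defines "C k \<equiv> torus_integral N (\<lambda>y. f y * wave k 1 0 y)" and "S k \<equiv> torus_integral N (\<lambda>y. f y * wave k 0 1 y)"
  shows "conv N f (wave k \<alpha> \<beta>) = wave k (\<alpha> * C k - \<beta> * S k) (\<alpha> * S k + \<beta> * C k)"
proof
  fix x
  let ?c = "\<alpha> * cos (k \<bullet> x) + \<beta> * sin (k \<bullet> x)" and ?s = "\<alpha> * sin (k \<bullet> x) - \<beta> * cos (k \<bullet> x)"
  have "conv N f (wave k \<alpha> \<beta>) x = torus_integral N (\<lambda>y. ?c * (f y * wave k 1 0 y) + ?s * (f y * wave k 0 1 y))"
    unfolding conv_def by (rule arg_cong[of _ _ "torus_integral N"])
      (simp add: fun_eq_iff wave_def inner_diff_right cos_diff sin_diff algebra_simps)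
  also have "\<dots> = ?c * C k + ?s * S k"
    unfolding C_def S_def by (rule torus_integral_linear) (intro continuous_on_mult f continuous_wave)+
  finally show "conv N f (wave k \<alpha> \<beta>) x = wave k (\<alpha> * C k - \<beta> * S k) (\<alpha> * S k + \<beta> * C k) x"
    by (simp add: wave_def algebra_simps)
qed

lemma conv_add:
  assumes f: "continuous_on UNIV f" and "trig_poly N K" "trig_poly N L"
  shows "conv N f (\<lambda>x. K x + L x) = (\<lambda>x. conv N f K x + conv N f L x)"
proof
  fix x
  have c: "continuous_on UNIV (\<lambda>y. f y * K (x - y))" if "trig_poly N K" for K
    by (intro continuous_on_mult f continuous_on_compose2[OF trig_poly_continuous[OF that, of UNIV]] continuous_intros) auto
  have "conv N f (\<lambda>x. K x + L x) x = torus_integral N (\<lambda>y. 1 * (f y * K (x - y)) + 1 * (f y * L (x - y)))"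
    by (simp add: conv_def distrib_left)
  also have "\<dots> = conv N f K x + conv N f L x"
    unfolding conv_def by (subst torus_integral_linear) (use c assms in auto)
  finally show "conv N f (\<lambda>x. K x + L x) x = conv N f K x + conv N f L x" .
qed

lemma trig_poly_conv:
  assumes f: "continuous_on UNIV f" and K: "trig_poly N K"
  shows "trig_poly N (conv N f K)"
  using K
proof (induction rule: trig_poly.induct)
  case (wave m \<alpha> \<beta>)
  then show ?case unfolding conv_wave[OF f] by (rule trig_poly.wave)
next
  case (add K L)
  then show ?case unfolding conv_add[OF f add(1,2)] by (intro trig_poly.add)
qed

lemma torus_Ck1_mult:
  assumes "f \<in> torus_Ck N 1" "g \<in> torus_Ck N 1"
  shows "(\<lambda>x. f x * g x) \<in> torus_Ck N 1"
proof -
  have d: "f differentiable (at x)" "g differentiable (at x)" for x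
    using assms by (auto simp: torus_Ck_def differentiable_on_def)
  have "partial i (\<lambda>x. f x * g x) = (\<lambda>x. f x * partial i g x + partial i f x * g x)" for i
    by (rule ext) (rule partial_mult[OF d])
  moreover have "continuous_on UNIV f" "continuous_on UNIV g" using assms torus_Ck_continuous by auto
  ultimately show ?thesis using assms
    by (auto simp: torus_Ck_def intro!: continuous_intros derivative_intros)
qed

lemma torus_integral_by_parts:
  assumes N: "1 \<le> N" and f: "f \<in> torus_Ck N 1"
  shows "torus_integral N (\<lambda>x. partial i f x * wave (freq N m) \<alpha> \<beta> x) = - torus_integral N (\<lambda>x. f x * partial i (wave (freq N m) \<alpha> \<beta>) x)"
proof -
  let ?g = "wave (freq N m) \<alpha> \<beta>"
  have g: "?g \<in> torus_Ck N 1" by (rule wave_torus[OF N])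
  have d: "f differentiable (at x)" "?g differentiable (at x)" for x
    using f g by (auto simp: torus_Ck_def differentiable_on_def)
  have c: "continuous_on UNIV f" "continuous_on UNIV (partial i f)" using torus_Ck_continuous[OF f] torus_Ck1_partial_continuous[OF f] by auto
  have "0 = torus_integral N (partial i (\<lambda>x. f x * ?g x))"
    using torus_integral_partial[OF torus_Ck1_mult[OF f g]] by simp
  also have "partial i (\<lambda>x. f x * ?g x) = (\<lambda>x. 1 * (f x * partial i ?g x) + 1 * (partial i f x * ?g x))"
    using partial_mult[OF d] by auto
  also have "torus_integral N \<dots> = 1 * torus_integral N (\<lambda>x. f x * partial i ?g x) + 1 * torus_integral N (\<lambda>x. partial i f x * ?g x)"
    unfolding partial_wave by (rule torus_integral_linear) (intro continuous_on_mult c continuous_wave)+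
  finally show ?thesis by simp
qed

text \<open>Convolution with a wave multiplies it by Fourier coefficients of \<open>f\<close>;
  integration by parts exchanges the coefficients of a derivative for the frequency factor produced
  by differentiating the wave. Linearity extends this to all trigonometric kernels.\<close>

lemma partial_conv:
  assumes N: "1 \<le> N" and f: "f \<in> torus_Ck N 1" and K: "trig_poly N K"
  shows "partial i (conv N f K) = conv N (partial i f) K"
proof -
  have c: "continuous_on UNIV f" "continuous_on UNIV (partial i f)" using torus_Ck_continuous[OF f] torus_Ck1_partial_continuous[OF f] by auto
  show ?thesis
    using K
  proof (induction rule: trig_poly.induct)
    case (wave m \<alpha> \<beta>)
    let ?k = "freq N m"
    let ?C = "torus_integral N (\<lambda>y. f y * wave ?k 1 0 y)" and ?S = "torus_integral N (\<lambda>y. f y * wave ?k 0 1 y)"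
    have sc: "wave ?k (c * a) (c * b) = (\<lambda>x. c * wave ?k a b x)" for a b c by (simp add: wave_def fun_eq_iff algebra_simps)
    have C: "torus_integral N (\<lambda>y. partial i f y * wave ?k 1 0 y) = ?k $ i * ?S"
    proof -
      have "(\<lambda>x. f x * partial i (wave ?k 1 0) x) = (\<lambda>x. (- (?k $ i)) * (f x * wave ?k 0 1 x))"
        by (simp add: partial_wave wave_def fun_eq_iff)
      then show ?thesis unfolding torus_integral_by_parts[OF N f] by (simp only: torus_integral_cmult)
    qed
    have S: "torus_integral N (\<lambda>y. partial i f y * wave ?k 0 1 y) = - (?k $ i * ?C)"
    proof -
      have "(\<lambda>x. f x * partial i (wave ?k 0 1) x) = (\<lambda>x. ?k $ i * (f x * wave ?k 1 0 x))"
        by (simp add: partial_wave wave_def fun_eq_iff)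
      then show ?thesis unfolding torus_integral_by_parts[OF N f] by (simp only: torus_integral_cmult)
    qed
    have e: "?k $ i * (\<alpha> * ?S + \<beta> * ?C) = \<alpha> * (?k $ i * ?S) - \<beta> * - (?k $ i * ?C)"
      "- (?k $ i * (\<alpha> * ?C - \<beta> * ?S)) = \<alpha> * - (?k $ i * ?C) + \<beta> * (?k $ i * ?S)"
      by (simp_all add: algebra_simps del: freq_nth)
    show ?case unfolding conv_wave[OF c(1)] conv_wave[OF c(2)] partial_wave C S e ..
  next
    case (add K L)
    have d: "conv N f K differentiable (at x)" if "trig_poly N K" for x K
      using trig_poly_torus[OF N trig_poly_conv[OF c(1) that], of 1] by (auto simp: torus_Ck_def differentiable_on_def)
    show ?case unfolding conv_add[OF c(1) add(1,2)] conv_add[OF c(2) add(1,2)]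
    proof
      fix x
      show "partial i (\<lambda>x. conv N f K x + conv N f L x) x = conv N (partial i f) K x + conv N (partial i f) L x"
        using partial_linear[OF d[OF add(1)] d[OF add(2)], of i 1 1] add by simp
    qed
  qed
qed

text \<open>Translation invariance is read off the modes: convolving the constant 1 with a wave of
  non-zero frequency gives zero, and the zero mode is constant.\<close>

lemma torus_integral_shift:
  assumes N: "1 \<le> N" and K: "trig_poly N K"
  shows "torus_integral N (\<lambda>y. K (x - y)) = torus_integral N (\<lambda>y. K (- y))"
proof -
  have "conv N (\<lambda>_. 1) K x = conv N (\<lambda>_. 1) K 0"
    using K
  proof (induction rule: trig_poly.induct)
    case (wave m \<alpha> \<beta>)
    show ?case
    proof (cases "m = 0")
      case True
      then show ?thesis unfolding conv_wave[OF continuous_on_const] by (simp add: wave_def)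
    next
      case False
      then have "torus_integral N (\<lambda>y. 1 * wave (freq N m) 1 0 y) = 0" "torus_integral N (\<lambda>y. 1 * wave (freq N m) 0 1 y) = 0"
        by (simp_all add: torus_integral_wave[OF N])
      then show ?thesis by (simp only: conv_wave[OF continuous_on_const]) (simp add: wave_def)
    qed
  next
    case (add K L)
    then show ?case unfolding conv_add[OF continuous_on_const add(1,2)] by simp
  qed
  then show ?thesis by (simp add: conv_def)
qed

definition kern_mass :: "nat \<Rightarrow> nat \<Rightarrow> real" where
  "kern_mass N n = torus_integral N (\<lambda>y. kern N (- y) ^ n)"

text \<open>By continuity the kernel exceeds \<open>q\<close> on a small box around the origin, of
  volume \<open>v\<close>. The normalising mass therefore decays no faster than q^n, for any q below
  1.\<close>

lemma kern_mass_lower: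
  assumes N: "1 \<le> N" and q: "0 \<le> q" "q < 1"
  obtains v where "0 < v" "\<And>n. v * q ^ n \<le> kern_mass N n"
proof -
  have cont: "continuous_on UNIV (kern N)" by (rule trig_poly_continuous[OF trig_poly_kern])
  have k0: "kern N 0 = 1" by (simp add: kern_def)
  have "isCont (kern N) 0" using cont by (simp add: continuous_on_eq_continuous_at)
  then obtain d where d: "0 < d" "\<And>y. dist y 0 < d \<Longrightarrow> dist (kern N y) 1 < 1 - q"
    unfolding continuous_at_eps_delta using q k0 by (metis diff_gt_0_iff_gt)
  define r where "r = min (d / 2) (half_side N) / 2"
  have r: "0 < r" "2 * r \<le> d / 2" "r < half_side N" using d(1) N by (auto simp: r_def min_def)
  define S :: "plane set" where "S = box (\<chi> i. - r) (\<chi> i. r)"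
  have Sbox: "S \<subseteq> torus_box N" using r by (auto simp: S_def mem_box_cart torus_box_def intro: less_imp_le order_trans) (smt (verit))+
  have Sk: "q \<le> kern N (- y)" if "y \<in> S" for y
  proof -
    have y: "\<bar>y $ i\<bar> < r" for i
    proof -
      have "- r < y $ i" "y $ i < r" using that by (auto simp: S_def mem_box_cart)
      then show ?thesis by linarith
    qed
    have "norm y \<le> (\<Sum>i\<in>UNIV. \<bar>y $ i\<bar>)" by (rule norm_le_l1_cart)
    also have "\<dots> < 2 * r" unfolding sum_2 using y[of 1] y[of 2] by linarith
    finally have "dist (- y) 0 < d" using r d(1) by simp
    then show ?thesis using d(2)[of "- y"] by (simp add: dist_real_def abs_if split: if_splits)
  qed
  define v where "v = measure lborel S"
  have mS: "measure lborel S = (2 * r) * (2 * r)"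
  proof -
    have "measure lborel S = (\<Prod>b\<in>Basis. ((\<chi> i. r) - (\<chi> i. - r) :: plane) \<bullet> b)"
    proof -
      have "\<forall>b\<in>Basis. ((\<chi> i. - r) :: plane) \<bullet> b \<le> (\<chi> i. r) \<bullet> b"
        using r by (auto simp: Basis_vec_def inner_axis)
      then show ?thesis unfolding S_def measure_lborel_box_eq by simp
    qed
    then show ?thesis by (simp add: prod_Basis_plane)
  qed
  have v: "0 < v" unfolding v_def mS using r by simp
  show thesis
  proof (rule that[OF v])
    fix n
    have c: "continuous_on UNIV (\<lambda>y. kern N (- y) ^ n)"
      by (intro continuous_on_power continuous_on_compose2[OF cont] continuous_intros) auto
    have "v * q ^ n = (\<integral>y. indicator S y * q ^ n \<partial>lborel)" unfolding v_def by (simp add: S_def)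
    also have "\<dots> \<le> (\<integral>y. indicator (torus_box N) y *\<^sub>R (kern N (- y) ^ n) \<partial>lborel)"
    proof (rule integral_mono)
      have "integrable lborel (indicat_real S)"
        unfolding S_def by (rule integrable_real_indicator) (auto simp: emeasure_lborel_box_finite[simplified])
      then show "integrable lborel (\<lambda>y. indicator S y * q ^ n)" by simp
      show "integrable lborel (\<lambda>y. indicator (torus_box N) y *\<^sub>R (kern N (- y) ^ n))"
        using torus_set_integrable[OF c] by (simp add: set_integrable_def)
      show "indicator S y * q ^ n \<le> indicator (torus_box N) y *\<^sub>R (kern N (- y) ^ n)" for y
        using Sk[of y] Sbox q kern_bounds(1)[of N "- y"] by (auto simp: indicator_def intro!: power_mono)
    qed
    finally show "v * q ^ n \<le> kern_mass N n" by (simp add: kern_mass_def torus_integral_def set_lebesgue_integral_def)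
  qed
qed

text \<open>Where the kernel exceeds 1 - \<delta> the values of \<open>g\<close> are within
  \<epsilon>/2; elsewhere the n-th power is at most (1 - \<delta>)^n, which is negligible against
  the normalising mass.\<close>

lemma conv_kern_converges:
  assumes N: "1 \<le> N" and g: "continuous_on UNIV g" "periodic N g" and \<epsilon>: "0 < \<epsilon>"
  shows "\<forall>\<^sub>F n in sequentially. 0 < kern_mass N n \<and> (\<forall>x. \<bar>conv N g (\<lambda>u. kern N u ^ n) x / kern_mass N n - g x\<bar> \<le> \<epsilon>)"
proof -
  obtain B where B: "0 < B" "\<And>x. \<bar>g x\<bar> \<le> B" using periodic_bounded[OF N g] by blast
  obtain \<delta> where \<delta>: "0 < \<delta>" "\<delta> \<le> 1" "\<And>x u. 1 - \<delta> < kern N u \<Longrightarrow> \<bar>g (x - u) - g x\<bar> < \<epsilon> / 2"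
    using kern_concentrates[OF N g, of "\<epsilon> / 2"] \<epsilon> by auto
  \<comment> \<open>Any value strictly between 1 - \<delta> and 1 would do: the tail divided by the
    mass is then geometric with ratio \<open>\<rho>\<close> below 1.\<close>
  define q where "q = 1 - \<delta> / 2"
  have q: "0 < q" "q < 1" "1 - \<delta> < q" unfolding q_def using \<delta> by auto
  obtain v where v: "0 < v" "\<And>n. v * q ^ n \<le> kern_mass N n" using kern_mass_lower[OF N, of q] q by auto
  have Z: "0 < kern_mass N n" for n using v q by (meson less_le_trans mult_pos_pos zero_less_power)
  let ?A = "torus_area N"
  have A: "0 < ?A" by (rule torus_area_pos[OF N])
  define \<rho> where "\<rho> = (1 - \<delta>) / q"
  have \<rho>: "0 \<le> \<rho>" "\<rho> < 1" unfolding \<rho>_def using q \<delta> by auto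
  have "(\<lambda>n. (2 * B * ?A / v) * \<rho> ^ n) \<longlonglongrightarrow> (2 * B * ?A / v) * 0"
    by (intro tendsto_mult tendsto_const LIMSEQ_realpow_zero \<rho>)
  then have "\<forall>\<^sub>F n in sequentially. (2 * B * ?A / v) * \<rho> ^ n < \<epsilon> / 2"
    using \<epsilon> by (intro order_tendstoD(2)) auto
  then show ?thesis
  proof eventually_elim
    case (elim n)
    let ?K = "\<lambda>u. kern N u ^ n"
    have tK: "trig_poly N ?K" by (intro trig_poly_power trig_poly_kern)
    have small: "2 * B * ?A * (1 - \<delta>) ^ n \<le> \<epsilon> / 2 * kern_mass N n"
    proof -
      have "2 * B * ?A * (1 - \<delta>) ^ n = ((2 * B * ?A / v) * \<rho> ^ n) * (v * q ^ n)"
        using v q by (simp add: \<rho>_def power_divide)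
      also have "\<dots> \<le> \<epsilon> / 2 * (v * q ^ n)" using elim v q by (intro mult_right_mono) auto
      also have "\<dots> \<le> \<epsilon> / 2 * kern_mass N n" using v(2)[of n] \<epsilon> by (intro mult_left_mono) auto
      finally show ?thesis .
    qed
    have "\<bar>conv N g ?K x / kern_mass N n - g x\<bar> \<le> \<epsilon>" for x
    proof -
      have cK: "continuous_on UNIV (\<lambda>y. ?K (x - y))"
        by (intro continuous_on_compose2[OF trig_poly_continuous[OF tK, of UNIV]] continuous_intros) auto
      have m: "torus_integral N (\<lambda>y. ?K (x - y)) = kern_mass N n"
        unfolding kern_mass_def by (rule torus_integral_shift[OF N tK])
      have "conv N g ?K x - g x * kern_mass N n = 1 * torus_integral N (\<lambda>y. g y * ?K (x - y)) + (- g x) * torus_integral N (\<lambda>y. ?K (x - y))"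
        by (simp add: conv_def m)
      also have "\<dots> = torus_integral N (\<lambda>y. 1 * (g y * ?K (x - y)) + (- g x) * ?K (x - y))"
        by (rule torus_integral_linear[symmetric]) (intro continuous_on_mult g cK)+
      finally have d: "conv N g ?K x - g x * kern_mass N n = torus_integral N (\<lambda>y. (g y - g x) * ?K (x - y))"
        by (simp add: algebra_simps)
      have cd: "continuous_on UNIV (\<lambda>y. (g y - g x) * ?K (x - y))"
        by (intro continuous_on_mult continuous_on_diff continuous_on_const g cK)
      have "\<bar>conv N g ?K x - g x * kern_mass N n\<bar> \<le> torus_integral N (\<lambda>y. \<bar>(g y - g x) * ?K (x - y)\<bar>)"
        unfolding d by (rule torus_integral_abs_le[OF cd])
      also have "\<dots> \<le> torus_integral N (\<lambda>y. \<epsilon> / 2 * ?K (x - y) + (2 * B * (1 - \<delta>) ^ n) * 1)"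
      proof (rule torus_integral_mono)
        show "continuous_on UNIV (\<lambda>y. \<bar>(g y - g x) * ?K (x - y)\<bar>)" by (rule continuous_on_rabs[OF cd])
        show "continuous_on UNIV (\<lambda>y. \<epsilon> / 2 * ?K (x - y) + (2 * B * (1 - \<delta>) ^ n) * 1)"
          by (intro continuous_on_add continuous_on_mult continuous_on_const cK)
        fix y
        have K0: "0 \<le> ?K (x - y)" using kern_bounds(1) by simp
        have tail: "0 \<le> 2 * B * (1 - \<delta>) ^ n" using B \<delta> by simp
        show "\<bar>(g y - g x) * ?K (x - y)\<bar> \<le> \<epsilon> / 2 * ?K (x - y) + (2 * B * (1 - \<delta>) ^ n) * 1"
        proof (cases "1 - \<delta> < kern N (x - y)")
          case True
          then have "\<bar>g y - g x\<bar> \<le> \<epsilon> / 2" using \<delta>(3)[of "x - y" x] by simp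
          then have "\<bar>(g y - g x) * ?K (x - y)\<bar> \<le> \<epsilon> / 2 * ?K (x - y)"
            unfolding abs_mult using K0 \<epsilon> by (intro mult_mono) auto
          then show ?thesis using tail by simp
        next
          case False
          then have "?K (x - y) \<le> (1 - \<delta>) ^ n" using kern_bounds(1) by (intro power_mono) auto
          moreover have "\<bar>g y - g x\<bar> \<le> 2 * B" using B(2)[of x] B(2)[of y] by linarith
          ultimately have "\<bar>(g y - g x) * ?K (x - y)\<bar> \<le> 2 * B * (1 - \<delta>) ^ n"
            unfolding abs_mult using K0 B by (intro mult_mono) auto
          then show ?thesis using K0 \<epsilon> by (simp add: add_increasing)
        qed
      qed
      also have "\<dots> = \<epsilon> / 2 * kern_mass N n + 2 * B * (1 - \<delta>) ^ n * ?A"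
        by (subst torus_integral_linear) (use cK in \<open>auto simp: m torus_integral_const\<close>)
      also have "\<dots> \<le> \<epsilon> * kern_mass N n" using small by (simp add: field_simps)
      finally show ?thesis using Z[of n] by (simp add: field_simps abs_le_iff)
    qed
    then show ?case using Z by blast
  qed
qed

text \<open>Differentiation commutes with the convolution, so one and the same kernel power
  approximates \<open>f\<close> and both partial derivatives; intersecting three eventual statements
  provides it. Derivatives must be included because distributions here are continuous in the
  \<open>C1\<close> norm.\<close>

lemma C1_approximation:
  assumes N: "1 \<le> N" and f: "f \<in> torus_Ck N 1" and \<epsilon>: "0 < \<epsilon>"
  obtains K c where "\<And>x. \<bar>(\<Sum>m\<in>box_modes K. c m * cas N m x) - f x\<bar> \<le> \<epsilon>"
    "\<And>x i. \<bar>partial i (\<lambda>x. \<Sum>m\<in>box_modes K. c m * cas N m x) x - partial i f x\<bar> \<le> \<epsilon>"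
proof -
  have c: "continuous_on UNIV f" "continuous_on UNIV (partial i f)" for i using torus_Ck_continuous[OF f] torus_Ck1_partial_continuous[OF f] by auto
  have per: "periodic N f" by (rule torus_Ck_periodic[OF f])
  have perp: "periodic N (partial i f)" for i
    unfolding periodic_def
  proof (intro allI)
    fix x j
    let ?a = "axis j (period N) :: plane"
    have D: "(f has_derivative frechet_derivative f (at (x + ?a))) (at (x + ?a))"
      using f by (auto simp: torus_Ck_def differentiable_on_def frechet_derivative_works)
    have "((\<lambda>x. x + ?a) has_derivative (\<lambda>h. h)) (at x)" by (auto intro!: derivative_eq_intros)
    from diff_chain_at[OF this D] have "((\<lambda>x. f (x + ?a)) has_derivative frechet_derivative f (at (x + ?a))) (at x)"
      by (simp add: comp_def)
    then have "(f has_derivative frechet_derivative f (at (x + ?a))) (at x)" using per by (simp add: periodic_def)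
    from partial_eqI[OF this] show "partial i f (x + ?a) = partial i f x" by (simp add: partial_def)
  qed
  have "\<forall>\<^sub>F n in sequentially. (0 < kern_mass N n \<and> (\<forall>x. \<bar>conv N f (\<lambda>u. kern N u ^ n) x / kern_mass N n - f x\<bar> \<le> \<epsilon>))
     \<and> (0 < kern_mass N n \<and> (\<forall>x. \<bar>conv N (partial 1 f) (\<lambda>u. kern N u ^ n) x / kern_mass N n - partial 1 f x\<bar> \<le> \<epsilon>))
     \<and> (0 < kern_mass N n \<and> (\<forall>x. \<bar>conv N (partial 2 f) (\<lambda>u. kern N u ^ n) x / kern_mass N n - partial 2 f x\<bar> \<le> \<epsilon>))"
    by (intro eventually_conj conv_kern_converges[OF N] c per perp \<epsilon>)
  then obtain n where n: "0 < kern_mass N n" "\<And>x. \<bar>conv N f (\<lambda>u. kern N u ^ n) x / kern_mass N n - f x\<bar> \<le> \<epsilon>"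
    "\<And>x. \<bar>conv N (partial 1 f) (\<lambda>u. kern N u ^ n) x / kern_mass N n - partial 1 f x\<bar> \<le> \<epsilon>"
    "\<And>x. \<bar>conv N (partial 2 f) (\<lambda>u. kern N u ^ n) x / kern_mass N n - partial 2 f x\<bar> \<le> \<epsilon>"
    by (auto dest!: eventually_happens)
  let ?K = "\<lambda>u. kern N u ^ n"
  have tK: "trig_poly N ?K" by (intro trig_poly_power trig_poly_kern)
  define p where "p x = 1 / kern_mass N n * conv N f ?K x" for x
  have tp: "trig_poly N p" unfolding p_def[abs_def] by (intro trig_poly_scale trig_poly_conv c tK)
  have pp: "partial i p x = conv N (partial i f) ?K x / kern_mass N n" for i x
  proof -
    have d: "conv N f ?K differentiable (at x)"
      using trig_poly_torus[OF N trig_poly_conv[OF c(1) tK], of 1] by (auto simp: torus_Ck_def differentiable_on_def)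
    show ?thesis using partial_linear[OF d d, of i "1 / kern_mass N n" 0]
      by (simp add: p_def[abs_def] partial_conv[OF N f tK])
  qed
  obtain K cc where pK: "p = (\<lambda>x. \<Sum>m\<in>box_modes K. cc m * cas N m x)" using trig_poly_cas_sum[OF tp] by blast
  show thesis
  proof (rule that)
    show "\<bar>(\<Sum>m\<in>box_modes K. cc m * cas N m x) - f x\<bar> \<le> \<epsilon>" for x
      using n(2)[of x] fun_cong[OF pK, of x] by (simp add: p_def)
    show "\<bar>partial i (\<lambda>x. \<Sum>m\<in>box_modes K. cc m * cas N m x) x - partial i f x\<bar> \<le> \<epsilon>" for x i
      unfolding pK[symmetric] pp using n(3)[of x] n(4)[of x] exhaust_2[of i] by auto
  qed
qed

section \<open>Compactly supported functions on the torus\<close>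

text \<open>If the cell of \<open>x\<close> is not \<open>z\<close>, then the wrapped point and the
  translated point both have a coordinate larger than \<open>r\<close>, and both sides vanish. Hence
  the periodisation is locally a single translate of \<open>g\<close>, even across the seam of the
  fundamental domain.\<close>

lemma to_torus_local:
  assumes N: "1 \<le> N" and r: "r < half_side N" and supp: "\<And>x. g x \<noteq> 0 \<Longrightarrow> norm x \<le> r"
    and x: "\<And>i. \<bar>x $ i - period N * of_int (z i)\<bar> < period N - r"
  shows "to_torus N g x = g (x - (\<chi> i. period N * of_int (z i)))"
proof (cases "\<forall>i. cell N x i = z i")
  case True
  then have "wrap N x = x - (\<chi> i. period N * of_int (z i))" by (simp add: wrap_def vec_eq_iff)
  then show ?thesis by (simp add: to_torus_wrap)
next
  case False
  then obtain i where i: "cell N x i \<noteq> z i" by blast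
  define y where "y = x $ i - period N * of_int (z i)"
  have w: "wrap N x $ i = y - period N * of_int (cell N x i - z i)" by (simp add: wrap_def y_def algebra_simps)
  have P: "0 < period N" "period N = 2 * half_side N" using N by auto
  have "1 \<le> \<bar>cell N x i - z i\<bar>" using i by simp
  then have "1 \<le> \<bar>of_int (cell N x i - z i) :: real\<bar>" by (metis of_int_1_le_iff of_int_abs)
  then have far: "period N \<le> \<bar>period N * of_int (cell N x i - z i)\<bar>"
  proof -
    have "period N * 1 \<le> period N * \<bar>of_int (cell N x i - z i)\<bar>"
      using \<open>1 \<le> \<bar>of_int (cell N x i - z i) :: real\<bar>\<close> P by (intro mult_left_mono) auto
    also have "\<dots> = \<bar>period N * of_int (cell N x i - z i)\<bar>" using P(1) by (metis abs_mult abs_of_pos)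
    finally show ?thesis by simp
  qed
  have "\<bar>wrap N x $ i\<bar> > r" using far x[of i] unfolding w y_def by linarith
  moreover have "\<bar>y\<bar> > r"
  proof -
    have "\<bar>wrap N x $ i\<bar> \<le> half_side N" using wrap_bounds[OF N, of x i] by linarith
    then show ?thesis using far w P r by linarith
  qed
  ultimately have "norm (wrap N x) > r" "norm (x - (\<chi> i. period N * of_int (z i))) > r"
    using component_le_norm_cart[of "wrap N x" i] component_le_norm_cart[of "x - (\<chi> i. period N * of_int (z i))" i]
    by (auto simp: y_def)
  then have "g (wrap N x) = 0" "g (x - (\<chi> i. period N * of_int (z i))) = 0" using supp by force+
  then show ?thesis by (simp add: to_torus_wrap)
qed

text \<open>Wrapped coordinates are at most half a period in size, and half a period is less than a
  period minus \<open>r\<close>; this strict inequality persists on an open set.\<close>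

lemma to_torus_neighbourhood:
  assumes N: "1 \<le> N" and r: "r < half_side N"
  shows "\<exists>U. open U \<and> x \<in> U \<and> (\<forall>g. (\<forall>x. g x \<noteq> 0 \<longrightarrow> norm x \<le> r) \<longrightarrow> (\<forall>y\<in>U. to_torus N g y = g (y - (\<chi> i. period N * of_int (cell N x i)))))"
proof -
  let ?c = "\<chi> i. period N * of_int (cell N x i)"
  define U where "U = {y :: plane. \<forall>i. \<bar>y $ i - period N * of_int (cell N x i)\<bar> < period N - r}"
  have "U = (\<Inter>i\<in>UNIV. {y. \<bar>y $ i - period N * of_int (cell N x i)\<bar> < period N - r})" by (auto simp: U_def)
  also have "open \<dots>" by (intro open_INT finite ballI open_Collect_less continuous_intros)
  finally have "open U" .
  moreover have "x \<in> U"
  proof -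
    have "\<bar>x $ i - period N * of_int (cell N x i)\<bar> < period N - r" for i
      using wrap_bounds[OF N, of x i] r by (simp add: wrap_def abs_le_iff abs_less_iff)
    then show ?thesis by (simp add: U_def)
  qed
  moreover have "to_torus N g y = g (y - ?c)" if "\<forall>x. g x \<noteq> 0 \<longrightarrow> norm x \<le> r" "y \<in> U" for g y
    by (rule to_torus_local[OF N r]) (use that in \<open>auto simp: U_def\<close>)
  ultimately show ?thesis by blast
qed

lemma wrap_eq_shift: "wrap N x = x - (\<chi> i. period N * of_int (cell N x i))"
  by (simp add: wrap_def vec_eq_iff)

lemma to_torus_continuous:
  assumes N: "1 \<le> N" and r: "r < half_side N" and supp: "\<And>x. g x \<noteq> 0 \<Longrightarrow> norm x \<le> r" and g: "continuous_on UNIV g"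
  shows "continuous_on UNIV (to_torus N g)"
proof -
  have "isCont (to_torus N g) x" for x
  proof -
    obtain U where U: "open U" "x \<in> U" "\<forall>g. (\<forall>x. g x \<noteq> 0 \<longrightarrow> norm x \<le> r) \<longrightarrow> (\<forall>y\<in>U. to_torus N g y = g (y - (\<chi> i. period N * of_int (cell N x i))))"
      using to_torus_neighbourhood[OF N r] by blast
    have "isCont (\<lambda>y. g (y - (\<chi> i. period N * of_int (cell N x i)))) x"
    proof -
      have "continuous_on UNIV (\<lambda>y. g (y - (\<chi> i. period N * of_int (cell N x i))))"
        by (rule continuous_on_compose2[OF g]) (auto intro!: continuous_on_diff)
      then show ?thesis by (simp add: continuous_on_eq_continuous_at)
    qed
    moreover have "\<forall>\<^sub>F y in nhds x. to_torus N g y = g (y - (\<chi> i. period N * of_int (cell N x i)))"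
      using U supp by (auto simp: eventually_nhds)
    ultimately show ?thesis by (simp only: isCont_cong)
  qed
  then show ?thesis by (simp add: continuous_on_eq_continuous_at)
qed

lemma to_torus_derivative:
  assumes N: "1 \<le> N" and r: "r < half_side N" and supp: "\<And>x. g x \<noteq> 0 \<Longrightarrow> norm x \<le> r" and g: "g differentiable_on UNIV"
  shows "(to_torus N g has_derivative frechet_derivative g (at (wrap N x))) (at x)"
proof -
  obtain U where U: "open U" "x \<in> U" "\<forall>g. (\<forall>x. g x \<noteq> 0 \<longrightarrow> norm x \<le> r) \<longrightarrow> (\<forall>y\<in>U. to_torus N g y = g (y - (\<chi> i. period N * of_int (cell N x i))))"
    using to_torus_neighbourhood[OF N r] by blast
  let ?c = "(\<chi> i. period N * of_int (cell N x i)) :: plane"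
  have D: "(g has_derivative frechet_derivative g (at (x - ?c))) (at (x - ?c))"
    using g by (auto simp: differentiable_on_def frechet_derivative_works)
  have "((\<lambda>y. y - ?c) has_derivative (\<lambda>h. h)) (at x)" by (auto intro!: derivative_eq_intros)
  from diff_chain_at[OF this D] have "((\<lambda>y. g (y - ?c)) has_derivative frechet_derivative g (at (x - ?c))) (at x)"
    by (simp add: comp_def)
  then show ?thesis unfolding wrap_eq_shift
    by (rule has_derivative_transform_within_open[OF _ U(1,2)]) (use U(3) supp in auto)
qed

lemma to_torus_test_function:
  assumes "test_function \<phi>"
  obtains N0 where "\<And>N. N0 \<le> N \<Longrightarrow> 1 \<le> N \<and> to_torus N \<phi> \<in> torus_Ck N 1"
proof -
  have C1: "Ck 1 \<phi>" and "bounded (closure {x. \<phi> x \<noteq> 0})"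
    using assms by (auto simp: test_function_def compact_imp_bounded)
  then have "bounded {x. \<phi> x \<noteq> 0}" by (meson bounded_subset closure_subset)
  then obtain r where r: "0 < r" "\<And>x. \<phi> x \<noteq> 0 \<Longrightarrow> norm x \<le> r" unfolding bounded_pos by auto
  have d: "\<phi> differentiable_on UNIV" and cp: "continuous_on UNIV (partial i \<phi>)" for i using C1 by auto
  \<comment> \<open>The partial derivatives vanish off the same ball, so the same \<open>r\<close>
    serves for periodising them.\<close>
  have rp: "norm x \<le> r" if "partial i \<phi> x \<noteq> 0" for i x
  proof (rule ccontr)
    assume "\<not> norm x \<le> r"
    then have "x \<in> {y. r < norm y}" by simp
    moreover have "open {y :: plane. r < norm y}" by (intro open_Collect_less continuous_intros)
    ultimately have "(\<phi> has_derivative (\<lambda>_. 0)) (at x)"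
      using r(2) by (intro has_derivative_transform_within_open[of "\<lambda>_. 0" "\<lambda>_. 0" x UNIV "{y. r < norm y}" \<phi>]) force+
    from partial_eqI[OF this] show False using that by simp
  qed
  obtain N0 :: nat where N0: "r < real N0" using reals_Archimedean2 by blast
  show thesis
  proof (rule that)
    fix N assume "max N0 1 \<le> N"
    then have N: "1 \<le> N" "N0 \<le> N" by auto
    have "real N \<le> half_side N" using mult_right_mono[of 1 pi "real N"] pi_gt3 by simp
    moreover have "real N0 \<le> real N" using N by simp
    ultimately have rN: "r < half_side N" using N0 by linarith
    have D: "(to_torus N \<phi> has_derivative frechet_derivative \<phi> (at (wrap N x))) (at x)" for x
      by (rule to_torus_derivative[OF N(1) rN r(2) d])
    have "partial i (to_torus N \<phi>) = to_torus N (partial i \<phi>)" for i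
      using partial_eqI[OF D] by (simp add: fun_eq_iff to_torus_wrap partial_def)
    moreover have "continuous_on UNIV (to_torus N (partial i \<phi>))" for i
      by (rule to_torus_continuous[OF N(1) rN rp cp])
    moreover have "to_torus N \<phi> differentiable_on UNIV"
      using D by (auto simp: differentiable_on_def differentiable_def)
    moreover have "to_torus N \<phi> (x + axis i (period N)) = to_torus N \<phi> x" for x i
    proof -
      have "cell N (x + axis i (period N)) j = cell N x j + (if j = i then 1 else 0)" for j
      proof -
        have "(x $ j + period N + half_side N) / period N = (x $ j + half_side N) / period N + 1"
          using N by (simp add: field_simps)
        then show ?thesis by (auto simp: cell_def axis_def)
      qed
      then have "wrap N (x + axis i (period N)) = wrap N x"
        by (auto simp: wrap_def vec_eq_iff axis_def algebra_simps)
      then show ?thesis by (simp add: to_torus_wrap)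
    qed
    ultimately show "1 \<le> N \<and> to_torus N \<phi> \<in> torus_Ck N 1"
      using N(1) by (simp add: torus_Ck_def)
  qed
qed

section \<open>Gaussian families\<close>

lemma centred_gaussian_props:
  assumes "prob_space M" and X: "centred_gaussian M X"
  shows "integrable M (\<lambda>\<omega>. (X \<omega>)\<^sup>2)"
    and "(LINT \<omega>|M. cos (X \<omega>)) = exp (- (LINT \<omega>|M. (X \<omega>)\<^sup>2) / 2)"
    and "(LINT \<omega>|M. sin (X \<omega>)) = 0"
proof -
  interpret prob_space M by fact
  have m[measurable]: "X \<in> borel_measurable M" using X by (simp add: centred_gaussian_def)
  consider "AE \<omega> in M. X \<omega> = 0" | \<sigma> where "\<sigma> > 0" "distributed M lborel X (normal_density 0 \<sigma>)"
    using X by (auto simp: centred_gaussian_def)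
  then have "integrable M (\<lambda>\<omega>. (X \<omega>)\<^sup>2) \<and> (LINT \<omega>|M. cos (X \<omega>)) = exp (- (LINT \<omega>|M. (X \<omega>)\<^sup>2) / 2) \<and> (LINT \<omega>|M. sin (X \<omega>)) = 0"
  proof cases
    case 1
    have "integrable M (\<lambda>\<omega>. (X \<omega>)\<^sup>2) \<longleftrightarrow> integrable M (\<lambda>_. 0 :: real)"
      by (rule integrable_cong_AE) (use 1 in auto)
    moreover have "(LINT \<omega>|M. (X \<omega>)\<^sup>2) = (LINT \<omega>|M. 0)" by (rule integral_cong_AE) (use 1 in auto)
    moreover have "(LINT \<omega>|M. cos (X \<omega>)) = (LINT \<omega>|M. 1)" by (rule integral_cong_AE) (use 1 in auto)
    moreover have "(LINT \<omega>|M. sin (X \<omega>)) = (LINT \<omega>|M. 0)" by (rule integral_cong_AE) (use 1 in auto)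
    ultimately show ?thesis by (simp add: prob_space)
  next
    case (2 \<sigma>)
    define Y where "Y \<omega> = X \<omega> / \<sigma>" for \<omega>
    have Y: "distributed M lborel Y std_normal_density"
      using normal_standard_normal_convert[OF 2(1), of X 0] 2(2) by (simp add: Y_def[abs_def])
    have XY: "X \<omega> = \<sigma> * Y \<omega>" for \<omega> using 2(1) by (simp add: Y_def)
    have E: "(LINT \<omega>|M. g (Y \<omega>)) = (LINT y|std_normal_distribution. g y)" if [measurable]: "g \<in> borel_measurable borel" for g :: "real \<Rightarrow> real"
      using distributed_integral[OF Y, of g] by (simp add: integral_density normal_density_nonneg)
    have i: "integrable M (\<lambda>\<omega>. (Y \<omega>)\<^sup>2)"
      using distributed_integrable[OF Y, of "\<lambda>y. y\<^sup>2"] integrable_std_normal_moment[of 2] by (simp add: normal_density_nonneg)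
    have v: "(LINT \<omega>|M. (Y \<omega>)\<^sup>2) = 1"
      using distributed_integral[OF Y, of "\<lambda>y. y\<^sup>2"] integral_std_normal_moment_even[of 1] by (simp add: normal_density_nonneg)
    show ?thesis unfolding XY power_mult_distrib
      using i v E[of "\<lambda>y. cos (\<sigma> * y)"] E[of "\<lambda>y. sin (\<sigma> * y)"] by (simp add: std_normal_char)
  qed
  then show "integrable M (\<lambda>\<omega>. (X \<omega>)\<^sup>2)" "(LINT \<omega>|M. cos (X \<omega>)) = exp (- (LINT \<omega>|M. (X \<omega>)\<^sup>2) / 2)"
    "(LINT \<omega>|M. sin (X \<omega>)) = 0" by auto
qed

text \<open>\<open>f\<close> may repeat members of the family, as happens when one noise increment
  begins at the time where another ends; the coefficients are first collected over equal members, as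
  the definition of a Gaussian family speaks of sets.\<close>

lemma centred_gaussian_family_sum:
  assumes "centred_gaussian_family M F Z" and S: "finite S" "f ` S \<subseteq> F"
  shows "centred_gaussian M (\<lambda>\<omega>. \<Sum>j\<in>S. a j * Z (f j) \<omega>)"
proof -
  define b where "b g = (\<Sum>j | j \<in> S \<and> f j = g. a j)" for g
  have "centred_gaussian M (\<lambda>\<omega>. \<Sum>g\<in>f ` S. b g * Z g \<omega>)"
    using assms unfolding centred_gaussian_family_def by blast
  also have "(\<lambda>\<omega>. \<Sum>g\<in>f ` S. b g * Z g \<omega>) = (\<lambda>\<omega>. \<Sum>j\<in>S. a j * Z (f j) \<omega>)"
  proof
    fix \<omega>
    have "(\<Sum>j\<in>S. a j * Z (f j) \<omega>) = (\<Sum>g\<in>f ` S. \<Sum>j | j \<in> S \<and> f j = g. a j * Z (f j) \<omega>)"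
      by (rule sum.group[symmetric]) (use S in auto)
    also have "\<dots> = (\<Sum>g\<in>f ` S. b g * Z g \<omega>)"
      unfolding b_def sum_distrib_right by (intro sum.cong refl) auto
    finally show "(\<Sum>g\<in>f ` S. b g * Z g \<omega>) = (\<Sum>j\<in>S. a j * Z (f j) \<omega>)" by simp
  qed
  finally show ?thesis .
qed

lemma centred_gaussian_family_measurable:
  assumes "centred_gaussian_family M F Z" "f \<in> F"
  shows "Z f \<in> borel_measurable M"
  using centred_gaussian_family_sum[OF assms(1), of "{f}" "\<lambda>x. x" "\<lambda>_. 1"] assms(2)
  by (simp add: centred_gaussian_def)

lemma centred_gaussian_family_prod_integrable:
  assumes "prob_space M" "centred_gaussian_family M F Z" "f \<in> F" "g \<in> F"
  shows "integrable M (\<lambda>\<omega>. Z f \<omega> * Z g \<omega>)"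
proof (rule Bochner_Integration.integrable_bound)
  have sq: "integrable M (\<lambda>\<omega>. (Z f \<omega>)\<^sup>2)" if "f \<in> F" for f
    using centred_gaussian_props(1)[OF assms(1) centred_gaussian_family_sum[OF assms(2), of "{f}" "\<lambda>x. x" "\<lambda>_. 1"]] that by simp
  show "integrable M (\<lambda>\<omega>. (Z f \<omega>)\<^sup>2 + (Z g \<omega>)\<^sup>2)" by (intro Bochner_Integration.integrable_add sq assms)
  show "(\<lambda>\<omega>. Z f \<omega> * Z g \<omega>) \<in> borel_measurable M"
    by (intro borel_measurable_times centred_gaussian_family_measurable[OF assms(2)] assms)
  have "\<bar>x * y\<bar> \<le> x\<^sup>2 + y\<^sup>2" for x y :: real
  proof -
    have "2 * (\<bar>x\<bar> * \<bar>y\<bar>) \<le> \<bar>x\<bar>\<^sup>2 + \<bar>y\<bar>\<^sup>2" using sum_squares_bound[of "\<bar>x\<bar>" "\<bar>y\<bar>"] by simp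
    moreover have "0 \<le> \<bar>x\<bar> * \<bar>y\<bar>" by simp
    ultimately show ?thesis unfolding abs_mult power2_abs by linarith
  qed
  then show "AE \<omega> in M. norm (Z f \<omega> * Z g \<omega>) \<le> norm ((Z f \<omega>)\<^sup>2 + (Z g \<omega>)\<^sup>2)" by simp
qed

lemma centred_gaussian_family_variance:
  assumes "prob_space M" "centred_gaussian_family M F Z" and S: "finite S" "f ` S \<subseteq> F"
  shows "(LINT \<omega>|M. (\<Sum>j\<in>S. a j * Z (f j) \<omega>)\<^sup>2) = (\<Sum>j\<in>S. \<Sum>k\<in>S. a j * a k * (LINT \<omega>|M. Z (f j) \<omega> * Z (f k) \<omega>))"
proof -
  have i: "integrable M (\<lambda>\<omega>. Z (f j) \<omega> * Z (f k) \<omega>)" if "j \<in> S" "k \<in> S" for j k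
    using that S by (intro centred_gaussian_family_prod_integrable[OF assms(1,2)]) auto
  have "(LINT \<omega>|M. (\<Sum>j\<in>S. a j * Z (f j) \<omega>)\<^sup>2) = (LINT \<omega>|M. (\<Sum>j\<in>S. \<Sum>k\<in>S. (a j * a k) * (Z (f j) \<omega> * Z (f k) \<omega>)))"
    by (simp add: power2_eq_square sum_product mult_ac)
  also have "\<dots> = (\<Sum>j\<in>S. \<Sum>k\<in>S. LINT \<omega>|M. (a j * a k) * (Z (f j) \<omega> * Z (f k) \<omega>))"
    using i by (subst Bochner_Integration.integral_sum; (intro Bochner_Integration.integrable_sum integrable_mult_right sum.cong refl Bochner_Integration.integral_sum)?) auto
  finally show ?thesis by simp
qed

lemma generated_events_sum:
  assumes "finite S" "f ` S \<subseteq> F" "B \<in> sets borel"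
  shows "(\<lambda>\<omega>. \<Sum>j\<in>S. a j * Z (f j) \<omega>) -` B \<inter> space M \<in> generated_events M F Z"
proof -
  let ?u = "\<lambda>z. \<Sum>j\<in>S. a j * z (f j)"
  have [measurable]: "(\<lambda>z. z (f j)) \<in> borel_measurable (PiM F (\<lambda>_. borel))" if "j \<in> S" for j
    using that assms(2) by (intro measurable_component_singleton) auto
  have u: "?u \<in> borel_measurable (PiM F (\<lambda>_. borel))" by measurable
  have e: "(\<Sum>j\<in>S. a j * Z (f j) \<omega>) = ?u (\<lambda>i\<in>F. Z i \<omega>)" for \<omega>
    using assms(2) by (intro sum.cong refl) auto
  have "(\<lambda>\<omega>. \<Sum>j\<in>S. a j * Z (f j) \<omega>) -` B \<inter> space M
    = (\<lambda>\<omega>. \<lambda>i\<in>F. Z i \<omega>) -` (?u -` B \<inter> space (PiM F (\<lambda>_. borel))) \<inter> space M"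
    unfolding e by (auto simp: space_PiM)
  also have "\<dots> \<in> generated_events M F Z"
    unfolding generated_events_def
    by (intro in_vimage_algebra measurable_sets[OF u assms(3)])
  finally show ?thesis .
qed

lemma generated_events_sigma: "sigma_algebra (space M) (generated_events M F Z)"
  unfolding generated_events_def
  using sets.sigma_algebra_axioms[of "vimage_algebra (space M) (\<lambda>\<omega>. \<lambda>i\<in>F. Z i \<omega>) (Pi\<^sub>M F (\<lambda>_. borel))"] by simp

text \<open>The addition formulas turn the expectations into products by independence, and every
  product containing a sine vanishes by centredness. This is how the joint law of initial datum and
  noise is obtained.\<close>

lemma independent_gaussian_char:
  fixes a1 :: "'i \<Rightarrow> real" and a2 :: "'k \<Rightarrow> real"
  assumes P: "prob_space M" and ind: "prob_space.indep_set M (generated_events M F1 Z1) (generated_events M F2 Z2)"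
    and Z: "centred_gaussian_family M F1 Z1" "centred_gaussian_family M F2 Z2"
    and S: "finite S1" "f1 ` S1 \<subseteq> F1" "finite S2" "f2 ` S2 \<subseteq> F2"
  defines "U \<equiv> \<lambda>\<omega>. \<Sum>j\<in>S1. a1 j * Z1 (f1 j) \<omega>" and "V \<equiv> \<lambda>\<omega>. \<Sum>j\<in>S2. a2 j * Z2 (f2 j) \<omega>"
  shows "(LINT \<omega>|M. cos (U \<omega> + V \<omega>)) = exp (- ((LINT \<omega>|M. (U \<omega>)\<^sup>2) + (LINT \<omega>|M. (V \<omega>)\<^sup>2)) / 2)"
    and "(LINT \<omega>|M. sin (U \<omega> + V \<omega>)) = 0"
proof -
  interpret prob_space M by (rule P)
  have UG: "centred_gaussian M U" and VG: "centred_gaussian M V"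
    unfolding U_def V_def by (intro centred_gaussian_family_sum[OF Z(1)] centred_gaussian_family_sum[OF Z(2)] S)+
  have [measurable]: "U \<in> borel_measurable M" "V \<in> borel_measurable M" using UG VG by (auto simp: centred_gaussian_def)
  have iv: "indep_var borel U borel V"
    unfolding indep_var_eq
  proof (intro conjI)
    have 1: "sigma_sets (space M) {U -` A \<inter> space M |A. A \<in> sets borel} \<subseteq> generated_events M F1 Z1"
      by (rule sigma_algebra.sigma_sets_subset[OF generated_events_sigma]) (use S in \<open>auto simp: U_def intro: generated_events_sum\<close>)
    have 2: "sigma_sets (space M) {V -` A \<inter> space M |A. A \<in> sets borel} \<subseteq> generated_events M F2 Z2"
      by (rule sigma_algebra.sigma_sets_subset[OF generated_events_sigma]) (use S in \<open>auto simp: V_def intro: generated_events_sum\<close>)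
    show "indep_set (sigma_sets (space M) {U -` A \<inter> space M |A. A \<in> sets borel}) (sigma_sets (space M) {V -` A \<inter> space M |A. A \<in> sets borel})"
      using ind unfolding indep_set_def
      by (rule indep_sets_mono_sets) (use 1 2 in \<open>auto split: bool.split\<close>)
  qed auto
  have E: "(LINT \<omega>|M. f (U \<omega>) * g (V \<omega>)) = (LINT \<omega>|M. f (U \<omega>)) * (LINT \<omega>|M. g (V \<omega>))"
    if [measurable]: "f \<in> borel_measurable borel" "g \<in> borel_measurable borel" and b: "\<And>x. \<bar>f x\<bar> \<le> 1" "\<And>x. \<bar>g x\<bar> \<le> 1" for f g :: "real \<Rightarrow> real"
  proof -
    have "indep_var borel (f \<circ> U) borel (g \<circ> V)" by (rule indep_var_compose[OF iv]) auto
    moreover have "integrable M (f \<circ> U)" "integrable M (g \<circ> V)"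
      using b by (auto intro!: integrable_const_bound[where B=1] simp: comp_def)
    ultimately show ?thesis using indep_var_lebesgue_integral[of "f \<circ> U" "g \<circ> V"] by (simp add: comp_def)
  qed
  have i: "integrable M (\<lambda>\<omega>. f (U \<omega>) * g (V \<omega>))"
    if [measurable]: "f \<in> borel_measurable borel" "g \<in> borel_measurable borel" and b: "\<And>x. \<bar>f x\<bar> \<le> 1" "\<And>x. \<bar>g x\<bar> \<le> 1" for f g :: "real \<Rightarrow> real"
  proof (rule integrable_const_bound[where B=1])
    show "AE \<omega> in M. norm (f (U \<omega>) * g (V \<omega>)) \<le> 1"
      using mult_mono[OF b(1) b(2)] by (auto simp: abs_mult)
  qed measurable
  note G = centred_gaussian_props[OF P UG] centred_gaussian_props[OF P VG]
  have "(LINT \<omega>|M. cos (U \<omega> + V \<omega>)) = (LINT \<omega>|M. cos (U \<omega>) * cos (V \<omega>)) - (LINT \<omega>|M. sin (U \<omega>) * sin (V \<omega>))"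
    unfolding cos_add by (rule Bochner_Integration.integral_diff) (auto intro!: i)
  also have "\<dots> = (LINT \<omega>|M. cos (U \<omega>)) * (LINT \<omega>|M. cos (V \<omega>))"
    using E[of cos cos] E[of sin sin] G by simp
  finally show "(LINT \<omega>|M. cos (U \<omega> + V \<omega>)) = exp (- ((LINT \<omega>|M. (U \<omega>)\<^sup>2) + (LINT \<omega>|M. (V \<omega>)\<^sup>2)) / 2)"
    unfolding G by (simp add: exp_add[symmetric] add_divide_distrib)
  have "(LINT \<omega>|M. sin (U \<omega> + V \<omega>)) = (LINT \<omega>|M. sin (U \<omega>) * cos (V \<omega>)) + (LINT \<omega>|M. cos (U \<omega>) * sin (V \<omega>))"
    unfolding sin_add by (rule Bochner_Integration.integral_add) (auto intro!: i)
  also have "\<dots> = 0" using E[of sin cos] E[of cos sin] G by simp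
  finally show "(LINT \<omega>|M. sin (U \<omega> + V \<omega>)) = 0" .
qed

section \<open>Algebra of the nonlinearity\<close>

definition wavenum :: "nat \<Rightarrow> int \<times> int \<Rightarrow> real" where "wavenum N m = norm (freq N m)"

lemma wavenum_pos: "1 \<le> N \<Longrightarrow> m \<noteq> 0 \<Longrightarrow> 0 < wavenum N m"
  by (simp add: wavenum_def freq_eq_0_iff)

lemma wavenum_uminus [simp]: "wavenum N (- m) = wavenum N m" by (simp add: wavenum_def)

lemma wavenum_sq: "(wavenum N m)\<^sup>2 = (freq N m $ 1)\<^sup>2 + (freq N m $ 2)\<^sup>2"
  unfolding wavenum_def norm_freq_sq by (simp add: power_divide add_divide_distrib)

text \<open>Interaction coefficient between unit-variance modes: the output is multiplied by its
  wave number over the root of the area, and each input is divided by its own wave number. Modes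
  beyond the cut-off and the zero mode do not interact.\<close>

definition akpz_coeff :: "real \<Rightarrow> nat \<Rightarrow> int \<times> int \<Rightarrow> int \<times> int \<Rightarrow> int \<times> int \<Rightarrow> real" where
  "akpz_coeff lam N i j k = (if i \<in> low_modes N 1 - {0} \<and> j \<in> low_modes N 1 - {0} \<and> k \<in> low_modes N 1 - {0}
     then lam * wavenum N i / sqrt (torus_area N) * (hyp (freq N j) (freq N k) / (wavenum N j * wavenum N k)) * triple (- j) (- k) i
     else 0)"

lemma triple_sym: "triple a b c = triple b a c"
  by (simp add: triple_def add_ac)

lemma hyp_sym: "hyp k l = hyp l k" by (simp add: hyp_def mult.commute)

lemma hyp_minus [simp]: "hyp (- k) l = - hyp k l" "hyp k (- l) = - hyp k l" by (simp_all add: hyp_def)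

lemma akpz_coeff_sym: "akpz_coeff lam N i j k = akpz_coeff lam N i k j"
  unfolding akpz_coeff_def using triple_sym[of "- j" "- k" i] hyp_sym[of "freq N j" "freq N k"] by auto

text \<open>This identity is why the nonlinearity conserves \<open>\<Sum> |k|\<^sup>2 |H\<^sub>k|\<^sup>2\<close>, triad by triad.\<close>

lemma hyp_energy:
  fixes p q :: plane
  shows "((p $ 1)\<^sup>2 + (p $ 2)\<^sup>2) * hyp q (p + q) + ((q $ 1)\<^sup>2 + (q $ 2)\<^sup>2) * hyp (p + q) p
    = (((p + q) $ 1)\<^sup>2 + ((p + q) $ 2)\<^sup>2) * hyp p q"
  unfolding hyp_def vector_add_component by algebra

text \<open>After a factor symmetric in the three indices is removed, each coefficient is the
  squared output wave number times \<open>hyp\<close> of the two inputs. For each of the four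
  frequency relations allowed by \<open>triple\<close>, the weighted sum is an instance of
  \<open>hyp_energy\<close>.\<close>

lemma akpz_coeff_cyclic:
  assumes N: "1 \<le> N"
  shows "akpz_coeff lam N i j k + akpz_coeff lam N j k i + akpz_coeff lam N k i j = 0"
proof (cases "i \<in> low_modes N 1 - {0} \<and> j \<in> low_modes N 1 - {0} \<and> k \<in> low_modes N 1 - {0}")
  case True
  let ?n = "wavenum N" and ?f = "freq N"
  have pos: "0 < ?n i" "0 < ?n j" "0 < ?n k" using True wavenum_pos[OF N] by auto
  define E where "E i j k = (?n i)\<^sup>2 * hyp (?f j) (?f k)" for i j k
  \<comment> \<open>Rewritten so that the relations are permuted by cyclic shifts; the minus sign
    sits on the relation in which the output is the sum of the inputs, and it is the sign that
    \<open>hyp_energy\<close> requires.\<close>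
  have T: "triple (- j) (- k) i = (of_bool (k = i + j) + of_bool (j = k + i) + of_bool (i + j + k = 0) - of_bool (i = j + k)) / 2" for i j k
  proof -
    have "(- j = - k + i) = (k = i + j)" "(- k = - j + i) = (j = k + i)" "(i = - j + - k) = (i + j + k = 0)" "(- j + - k + i = 0) = (i = j + k)"
      by (auto simp: algebra_simps eq_neg_iff_add_eq_0)
    then show ?thesis by (simp add: triple_def)
  qed
  have c: "akpz_coeff lam N i j k = lam / (sqrt (torus_area N) * (?n i * ?n j * ?n k)) * (E i j k * triple (- j) (- k) i)"
    if "i \<in> low_modes N 1 - {0} \<and> j \<in> low_modes N 1 - {0} \<and> k \<in> low_modes N 1 - {0}" for i j k
  proof -
    have "0 < ?n i" using that wavenum_pos[OF N] by auto
    then show ?thesis using that by (simp add: akpz_coeff_def E_def power2_eq_square)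
  qed
  have id1: "E i j k + E j k i - E k i j = 0" if "k = i + j" for i j k
    using hyp_energy[of "?f i" "?f j"] that unfolding E_def wavenum_sq by (simp del: freq_nth)
  have id2: "E i j k + E j k i + E k i j = 0" if "i + j + k = 0" for i j k
  proof -
    have "k = - (i + j)" using add.inverse_unique[OF that] by simp
    then have fk: "?f k = - (?f i + ?f j)" by simp
    show ?thesis using hyp_energy[of "?f i" "?f j"]
      unfolding E_def wavenum_sq fk hyp_minus vector_uminus_component power2_minus by linarith
  qed
  have "E i j k * triple (- j) (- k) i + E j k i * triple (- k) (- i) j + E k i j * triple (- i) (- j) k
    = (of_bool (k = i + j) * (E i j k + E j k i - E k i j) + of_bool (j = k + i) * (E k i j + E i j k - E j k i)
      + of_bool (i = j + k) * (E j k i + E k i j - E i j k) + of_bool (i + j + k = 0) * (E i j k + E j k i + E k i j)) / 2"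
  proof -
    have "(j + k + i = 0) = (i + j + k = 0)" "(k + i + j = 0) = (i + j + k = 0)" by (simp_all add: add_ac)
    then show ?thesis unfolding T by (simp add: algebra_simps add_divide_distrib diff_divide_distrib)
  qed
  also have "\<dots> = 0"
  proof -
    have m: "of_bool P * x = 0" if "P \<Longrightarrow> x = 0" for P and x :: real using that by auto
    have "of_bool (k = i + j) * (E i j k + E j k i - E k i j) = 0" "of_bool (j = k + i) * (E k i j + E i j k - E j k i) = 0"
      "of_bool (i = j + k) * (E j k i + E k i j - E i j k) = 0" "of_bool (i + j + k = 0) * (E i j k + E j k i + E k i j) = 0"
      by (rule m, rule id1 id2, assumption)+
    then show ?thesis by (simp only:) simp
  qed
  finally have z: "E i j k * triple (- j) (- k) i + E j k i * triple (- k) (- i) j + E k i j * triple (- i) (- j) k = 0" .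
  have "akpz_coeff lam N i j k + akpz_coeff lam N j k i + akpz_coeff lam N k i j
    = lam / (sqrt (torus_area N) * (?n i * ?n j * ?n k)) * (E i j k * triple (- j) (- k) i + E j k i * triple (- k) (- i) j + E k i j * triple (- i) (- j) k)"
    using True by (simp add: c mult_ac distrib_left)
  then show ?thesis by (simp add: z)
qed (auto simp: akpz_coeff_def)

text \<open>Reversing both occurrences of \<open>i\<close> leaves \<open>triple\<close> and the wave
  numbers unchanged while \<open>hyp\<close> changes sign once. Negation of frequencies is thus the
  pairing under which the divergence cancels.\<close>

lemma akpz_coeff_pair: "akpz_coeff lam N (- i) (- i) j = - akpz_coeff lam N i i j"
proof -
  have "triple (- (- i)) (- j) (- i) = triple (- i) (- j) i"
    by (auto simp: triple_def algebra_simps eq_neg_iff_add_eq_0)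
  then show ?thesis by (simp add: akpz_coeff_def low_modes_uminus)
qed

text \<open>With output \<open>i\<close> and one input \<open>i\<close>, the frequency relations
  allow only j = 2i or j = -2i as the other input.\<close>

lemma akpz_coeff_distinct:
  assumes "akpz_coeff lam N i i j \<noteq> 0"
  shows "i \<noteq> - i \<and> j \<noteq> i \<and> j \<noteq> - i"
proof -
  have nz: "i \<noteq> 0" "j \<noteq> 0" "triple (- i) (- j) i \<noteq> 0" using assms by (auto simp: akpz_coeff_def split: if_splits)
  then show ?thesis
    by (cases i; cases j) (auto simp: triple_def zero_prod_def of_bool_def split: if_splits)
qed

definition akpz_field :: "real \<Rightarrow> nat \<Rightarrow> (int \<times> int) set \<Rightarrow> (int \<times> int \<Rightarrow> real) \<Rightarrow> int \<times> int \<Rightarrow> real" where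
  "akpz_field lam N I y i = (\<Sum>j\<in>I. \<Sum>k\<in>I. akpz_coeff lam N i j k * y j * y k)"

text \<open>Indices are tagged with 0 because the splitting scheme shares its state space with noise
  coordinates of positive time index. Symmetry of \<open>I\<close> under negation makes the pairing
  an involution of \<open>I\<close>.\<close>

lemma admissible_akpz:
  assumes N: "1 \<le> N" and I: "finite I" "\<And>i. i \<in> I \<Longrightarrow> - i \<in> I"
  shows "admissible (Pair (0::nat) ` I) (\<lambda>z p. akpz_field lam N I (\<lambda>i. z (0, i)) (snd p))"
proof -
  let ?\<beta> = "\<lambda>p q r. akpz_coeff lam N (snd p) (snd q) (snd r)"
  have "admissible (Pair (0::nat) ` I) (\<lambda>z p. \<Sum>q\<in>Pair (0::nat) ` I. \<Sum>r\<in>Pair (0::nat) ` I. ?\<beta> p q r * z q * z r)"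
  proof (rule admissible_quadratic[where \<sigma>="\<lambda>p. (0, - snd p)"])
    show "?\<beta> p q r = ?\<beta> p r q" for p q r :: "nat \<times> int \<times> int" by (rule akpz_coeff_sym)
    show "?\<beta> p q r + ?\<beta> q r p + ?\<beta> r p q = 0" for p q r :: "nat \<times> int \<times> int" by (rule akpz_coeff_cyclic[OF N])
    show "?\<beta> (0::nat, - snd p) (0::nat, - snd p) q = - ?\<beta> p p q" for p q :: "nat \<times> int \<times> int" by (simp add: akpz_coeff_pair)
    show "p \<noteq> (0, - snd p) \<and> q \<noteq> p \<and> q \<noteq> (0, - snd p)" if "p \<in> Pair 0 ` I" "q \<in> Pair 0 ` I" "?\<beta> p p q \<noteq> 0" for p q :: "nat \<times> int \<times> int"
      using akpz_coeff_distinct[OF that(3)] that(1,2) by auto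
  qed (use I in auto)
  moreover have "inj_on (Pair (0::nat)) I" by (auto simp: inj_on_def)
  ultimately show ?thesis
    by (simp add: akpz_field_def sum.reindex)
qed

text \<open>The zero frequency drops out since \<open>hyp\<close> vanishes there, which makes
  division by wave numbers legitimate; the factor one over the area is shared equally between the
  two inputs.\<close>

lemma nonlin_mode_normalised:
  assumes N: "1 \<le> N"
  shows "nonlin_mode N h c = (\<Sum>a\<in>low_modes N 1 - {0}. \<Sum>b\<in>low_modes N 1 - {0}.
     hyp (freq N a) (freq N b) / (wavenum N a * wavenum N b) * triple (- a) (- b) c
       * (wavenum N a / sqrt (torus_area N) * h a) * (wavenum N b / sqrt (torus_area N) * h b))"
proof -
  let ?D = "low_modes N 1" and ?A = "torus_area N"
  have A: "0 < ?A" by (rule torus_area_pos[OF N])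
  have fD: "finite ?D" by (rule finite_low_modes[OF N])
  have z: "hyp (freq N 0) l = 0" "hyp l (freq N 0) = 0" for l by (simp_all add: hyp_def del: freq_nth)
  have "nonlin_mode N h c = (\<Sum>a\<in>?D. \<Sum>b\<in>?D. hyp (freq N a) (freq N b) * triple (- a) (- b) c * h a * h b / ?A)"
    by (simp add: nonlin_mode_def sum_divide_distrib)
  also have "\<dots> = (\<Sum>a\<in>?D - {0}. \<Sum>b\<in>?D. hyp (freq N a) (freq N b) * triple (- a) (- b) c * h a * h b / ?A)"
    by (rule sum.mono_neutral_right) (use fD in \<open>auto intro!: sum.neutral simp: z simp del: freq_simps(4)\<close>)
  also have "\<dots> = (\<Sum>a\<in>?D - {0}. \<Sum>b\<in>?D - {0}. hyp (freq N a) (freq N b) * triple (- a) (- b) c * h a * h b / ?A)"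
    by (intro sum.cong refl sum.mono_neutral_right) (use fD in \<open>auto simp: z simp del: freq_simps(4)\<close>)
  also have "\<dots> = (\<Sum>a\<in>?D - {0}. \<Sum>b\<in>?D - {0}.
     hyp (freq N a) (freq N b) / (wavenum N a * wavenum N b) * triple (- a) (- b) c
       * (wavenum N a / sqrt ?A * h a) * (wavenum N b / sqrt ?A * h b))"
  proof (intro sum.cong refl)
    fix a b assume "a \<in> ?D - {0}" "b \<in> ?D - {0}"
    then have "0 < wavenum N a" "0 < wavenum N b" using wavenum_pos[OF N] by auto
    then show "hyp (freq N a) (freq N b) * triple (- a) (- b) c * h a * h b / ?A = hyp (freq N a) (freq N b) / (wavenum N a * wavenum N b) * triple (- a) (- b) c
       * (wavenum N a / sqrt ?A * h a) * (wavenum N b / sqrt ?A * h b)"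
      using A by (simp add: field_simps)
  qed
  finally show ?thesis .
qed

lemma laplacian_wave: "laplacian (wave k \<alpha> \<beta>) = wave k (- (norm k)\<^sup>2 * \<alpha>) (- (norm k)\<^sup>2 * \<beta>)"
proof
  fix x
  have n: "(norm k)\<^sup>2 = k $ 1 * k $ 1 + k $ 2 * k $ 2"
    unfolding power2_norm_eq_inner inner_vec_def sum_2 by simp
  show "laplacian (wave k \<alpha> \<beta>) x = wave k (- (norm k)\<^sup>2 * \<alpha>) (- (norm k)\<^sup>2 * \<beta>) x"
    unfolding laplacian_def partial_wave sum_2 n by (simp add: wave_def algebra_simps)
qed

section \<open>White noise tested against time intervals\<close>

definition strip :: "real \<Rightarrow> (plane \<Rightarrow> real) \<Rightarrow> real \<times> plane \<Rightarrow> real" where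
  "strip t f = (\<lambda>(s, x). indicator {0..t} s * f x)"

lemma integral_product_lborel:
  fixes u :: "real \<Rightarrow> real" and v :: "plane \<Rightarrow> real"
  assumes u: "integrable lborel u" and v: "integrable lborel v"
  shows "integrable lborel (\<lambda>z. u (fst z) * v (snd z))"
    and "(LINT z|lborel. u (fst z) * v (snd z)) = (LINT r|lborel. u r) * (LINT x|lborel. v x)"
proof -
  have [measurable]: "u \<in> borel_measurable borel" "v \<in> borel_measurable borel"
    using u v by (auto dest: borel_measurable_integrable)
  have i: "integrable (lborel \<Otimes>\<^sub>M lborel) (\<lambda>z. u (fst z) * v (snd z))"
  proof (rule lborel_pair.Fubini_integrable)
    show "integrable lborel (\<lambda>r. \<integral>x. norm (u (fst (r, x)) * v (snd (r, x))) \<partial>lborel)"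
      using u by (simp add: abs_mult)
    show "AE r in lborel. integrable lborel (\<lambda>x. u (fst (r, x)) * v (snd (r, x)))"
      using v by simp
  qed measurable
  then show "integrable lborel (\<lambda>z. u (fst z) * v (snd z))" by (simp add: lborel_prod)
  have "(LINT z|lborel. u (fst z) * v (snd z)) = integral\<^sup>L (lborel \<Otimes>\<^sub>M lborel) (\<lambda>z. u (fst z) * v (snd z))"
    by (simp add: lborel_prod)
  also have "\<dots> = (\<integral>r. (\<integral>x. u (fst (r, x)) * v (snd (r, x)) \<partial>lborel) \<partial>lborel)"
    by (rule lborel_pair.integral_fst'[OF i, symmetric])
  finally show "(LINT z|lborel. u (fst z) * v (snd z)) = (LINT r|lborel. u r) * (LINT x|lborel. v x)" by simp
qed

lemma strip_product:
  assumes f: "continuous_on UNIV f" and g: "continuous_on UNIV g" and t: "0 \<le> t" "0 \<le> s"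
  shows "set_integrable lborel (space_time N) (\<lambda>z. strip t f z * strip s g z)"
    and "(LINT z:space_time N|lborel. strip t f z * strip s g z) = min t s * torus_integral N (\<lambda>x. f x * g x)"
proof -
  have e: "indicator (space_time N) z *\<^sub>R (strip t f z * strip s g z)
    = indicat_real {0..min t s} (fst z) * (indicator (torus_box N) (snd z) *\<^sub>R (f (snd z) * g (snd z)))" for z
    by (cases z) (auto simp: space_time_def strip_def indicator_def)
  have u: "integrable lborel (indicat_real {0..min t s})" by (rule integrable_real_indicator) (use t in auto)
  have v: "integrable lborel (\<lambda>x. indicator (torus_box N) x *\<^sub>R (f x * g x))"
    using torus_set_integrable[OF continuous_on_mult[OF f g]] by (simp add: set_integrable_def)
  show "set_integrable lborel (space_time N) (\<lambda>z. strip t f z * strip s g z)"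
    unfolding set_integrable_def e by (rule integral_product_lborel(1)[OF u v])
  show "(LINT z:space_time N|lborel. strip t f z * strip s g z) = min t s * torus_integral N (\<lambda>x. f x * g x)"
    unfolding set_lebesgue_integral_def e integral_product_lborel(2)[OF u v] torus_integral_def
    using t by simp
qed

lemma strip_L2:
  assumes f: "continuous_on UNIV f" and t: "0 \<le> t"
  shows "strip t f \<in> space_time_L2 N"
proof -
  have [measurable]: "f \<in> borel_measurable borel" by (rule borel_measurable_continuous_onI[OF f])
  have "strip t f = (\<lambda>z. indicator {0..t} (fst z) * f (snd z))" by (auto simp: strip_def fun_eq_iff)
  moreover have "(\<lambda>z. indicat_real {0..t} (fst z) * f (snd z)) \<in> borel_measurable (borel \<Otimes>\<^sub>M borel)" by measurable
  ultimately have "strip t f \<in> borel_measurable borel" by (simp add: borel_prod)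
  then show ?thesis using strip_product(1)[OF f f t t] by (simp add: space_time_L2_def power2_eq_square)
qed

lemma sum_times_square:
  "(\<Sum>p\<in>S \<times> B. \<Sum>q\<in>S \<times> B. F p q) = (\<Sum>p\<in>S. \<Sum>q\<in>S. \<Sum>b\<in>B. \<Sum>b'\<in>B. F (p, b) (q, b') :: real)"
proof -
  have "(\<Sum>p\<in>S \<times> B. \<Sum>q\<in>S \<times> B. F p q) = (\<Sum>p\<in>S. \<Sum>b\<in>B. \<Sum>q\<in>S. \<Sum>b'\<in>B. F (p, b) (q, b'))"
    by (simp add: sum.cartesian_product')
  also have "\<dots> = (\<Sum>p\<in>S. \<Sum>q\<in>S. \<Sum>b\<in>B. \<Sum>b'\<in>B. F (p, b) (q, b'))"
    by (intro sum.cong refl sum.swap)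
  finally show ?thesis .
qed

section \<open>The stationary solution\<close>

locale akpz =
  fixes lam :: real and N :: nat and M :: "'a measure"
    and \<xi> :: "(real \<times> plane \<Rightarrow> real) \<Rightarrow> 'a \<Rightarrow> real" and \<eta> :: "(plane \<Rightarrow> real) \<Rightarrow> 'a \<Rightarrow> real"
    and H :: "real \<Rightarrow> (plane \<Rightarrow> real) \<Rightarrow> 'a \<Rightarrow> real"
  assumes N: "1 \<le> N" and sol: "stationary_akpz_solution lam N M \<xi> \<eta> H"
begin

abbreviation "area \<equiv> torus_area N"
abbreviation "low \<equiv> low_modes N 1 - {0}"

lemma area_pos: "0 < area" by (rule torus_area_pos[OF N])

lemma P: "prob_space M" using sol by (simp add: stationary_akpz_solution_def)

lemma noise: "space_time_white_noise N M \<xi>" using sol by (simp add: stationary_akpz_solution_def)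
lemma gff: "gaussian_free_field N M \<eta>" using sol by (simp add: stationary_akpz_solution_def)

lemma indep: "prob_space.indep_set M (generated_events M (space_time_L2 N) \<xi>) (generated_events M (torus_Ck N 1) \<eta>)"
  using sol by (simp add: stationary_akpz_solution_def)

lemma H_measurable: "0 \<le> t \<Longrightarrow> f \<in> torus_Ck N 1 \<Longrightarrow> H t f \<in> borel_measurable M"
  using sol by (simp add: stationary_akpz_solution_def)

lemma H_dist: "AE \<omega> in M. \<forall>t\<ge>0. is_distribution N (\<lambda>f. H t f \<omega>)"
  using sol by (simp add: stationary_akpz_solution_def)

lemma H_cont: "AE \<omega> in M. \<forall>f\<in>torus_Ck N 1. continuous_on {0..} (\<lambda>t. H t f \<omega>)"
  using sol by (simp add: stationary_akpz_solution_def)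

lemma H_init: "f \<in> torus_Ck N 1 \<Longrightarrow> AE \<omega> in M. H 0 f \<omega> = \<eta> f \<omega>"
  using sol by (simp add: stationary_akpz_solution_def)

lemma H_eq: "f \<in> torus_Ck N 3 \<Longrightarrow> 0 \<le> t \<Longrightarrow> AE \<omega> in M.
        H t f \<omega> = \<eta> f \<omega>
          + integral {0..t} (\<lambda>s. 1 / 2 * H s (laplacian f) \<omega>
              + lam * distribution_of N (akpz_nonlinearity N (\<lambda>h. H s h \<omega>)) f)
          + \<xi> (strip t f) \<omega>"
  using sol by (simp add: stationary_akpz_solution_def strip_def)

lemma cas_C: "cas N m \<in> torus_Ck N n" by (rule wave_torus[OF N])

lemma xi_family: "centred_gaussian_family M (space_time_L2 N) \<xi>"
  using noise by (simp add: space_time_white_noise_def)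

lemma eta_family: "centred_gaussian_family M (torus_Ck N 1) \<eta>"
  using gff by (simp add: gaussian_free_field_def)

lemma xi_cov:
  assumes "continuous_on UNIV f" "continuous_on UNIV g" "0 \<le> t" "0 \<le> s"
  shows "(LINT \<omega>|M. \<xi> (strip t f) \<omega> * \<xi> (strip s g) \<omega>) = min t s * torus_integral N (\<lambda>x. f x * g x)"
  using noise strip_L2[OF assms(1,3)] strip_L2[OF assms(2,4)] strip_product(2)[OF assms]
  by (simp add: space_time_white_noise_def)

text \<open>A Hartley function of non-zero frequency is an eigenfunction of the Laplacian, so its
  inverse Laplacian is division by the squared wave number, and orthogonality does the rest.\<close>

lemma eta_cov:
  assumes "i \<noteq> 0" "j \<noteq> 0"
  shows "(LINT \<omega>|M. \<eta> (cas N i) \<omega> * \<eta> (cas N j) \<omega>) = (if i = j then area / (wavenum N i)\<^sup>2 else 0)"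
proof -
  let ?k = "wavenum N i"
  have k: "0 < ?k" by (rule wavenum_pos[OF N assms(1)])
  let ?u = "wave (freq N i) (1 / ?k\<^sup>2) (1 / ?k\<^sup>2)"
  have z: "zero_mean N (cas N m)" if "m \<noteq> 0" for m using that by (simp add: zero_mean_def torus_integral_wave[OF N])
  have "inv_neg_laplacian N (cas N i) ?u"
    unfolding inv_neg_laplacian_def laplacian_wave
    using wave_torus[OF N] k assms by (simp add: zero_mean_def torus_integral_wave[OF N] wavenum_def[symmetric]) (simp add: wave_def)
  then have "(LINT \<omega>|M. \<eta> (cas N i) \<omega> * \<eta> (cas N j) \<omega>) = torus_integral N (\<lambda>x. ?u x * cas N j x)"
    using gff cas_C z assms unfolding gaussian_free_field_def by blast
  also have "\<dots> = (if i = j then area / ?k\<^sup>2 else 0)"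
    unfolding torus_integral_wave2[OF N] by (auto simp: field_simps)
  finally show ?thesis .
qed

text \<open>The normalisation is the reciprocal standard deviation of the free field in this mode,
  as given by \<open>eta_cov\<close>.\<close>

definition mode :: "real \<Rightarrow> int \<times> int \<Rightarrow> 'a \<Rightarrow> real" where
  "mode t m \<omega> = wavenum N m / sqrt area * H t (cas N m) \<omega>"

text \<open>At time t its variance is t times the squared wave number: with damping equal to half
  the squared wave number, this is the balance built into \<open>normalised_noise\<close>.\<close>

definition mode_noise :: "real \<Rightarrow> int \<times> int \<Rightarrow> 'a \<Rightarrow> real" where
  "mode_noise t m \<omega> = wavenum N m / sqrt area * \<xi> (strip t (cas N m)) \<omega>"

lemma H_linear:
  assumes "is_distribution N (\<lambda>f. H t f \<omega>)"
  shows "trig_linear N (\<lambda>f. H t f \<omega>)"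
  by (rule is_distribution_trig_linear[OF N assms])

lemma nonlin_pairing:
  assumes "is_distribution N (\<lambda>f. H t f \<omega>)" "finite S"
  shows "distribution_of N (akpz_nonlinearity N (\<lambda>h. H t h \<omega>)) (\<lambda>x. \<Sum>e\<in>S. p e * cas N e x)
    = (\<Sum>e\<in>S. if e \<in> low_modes N 1 then p e * (\<Sum>a\<in>low. \<Sum>b\<in>low.
        hyp (freq N a) (freq N b) / (wavenum N a * wavenum N b) * triple (- a) (- b) e * mode t a \<omega> * mode t b \<omega>) else 0)"
  unfolding akpz_nonlinearity_pairing[OF N H_linear[OF assms(1)] assms(2)] nonlin_mode_normalised[OF N] mode_def[symmetric] ..

text \<open>\<open>I\<close> may be any finite set of non-zero modes containing the low ones: modes
  above the cut-off have zero interaction coefficients and evolve as independent Ornstein-Uhlenbeck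
  processes, so enlarging \<open>I\<close> keeps the system closed. Test functions with high
  frequencies use this freedom.\<close>

lemma mode_eq:
  assumes I: "finite I" "low \<subseteq> I" "0 \<notin> I" and t: "0 \<le> t" and i: "i \<in> I"
  shows "AE \<omega> in M. mode t i \<omega> = mode 0 i \<omega>
    + integral {0..t} (\<lambda>s. - ((wavenum N i)\<^sup>2 / 2) * mode s i \<omega> + akpz_field lam N I (\<lambda>j. mode s j \<omega>) i) + mode_noise t i \<omega>"
  using H_eq[OF cas_C t, of i] H_init[OF cas_C, of i] H_dist
proof eventually_elim
  fix \<omega>
  assume e: "H t (cas N i) \<omega> = \<eta> (cas N i) \<omega> + integral {0..t} (\<lambda>s. 1 / 2 * H s (laplacian (cas N i)) \<omega>
              + lam * distribution_of N (akpz_nonlinearity N (\<lambda>h. H s h \<omega>)) (cas N i)) + \<xi> (strip t (cas N i)) \<omega>"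
    and e0: "H 0 (cas N i) \<omega> = \<eta> (cas N i) \<omega>" and d: "\<forall>t\<ge>0. is_distribution N (\<lambda>f. H t f \<omega>)"
  let ?c = "wavenum N i / sqrt area"
  have eq: "?c * (1 / 2 * H s (laplacian (cas N i)) \<omega> + lam * distribution_of N (akpz_nonlinearity N (\<lambda>h. H s h \<omega>)) (cas N i))
    = - ((wavenum N i)\<^sup>2 / 2) * mode s i \<omega> + akpz_field lam N I (\<lambda>j. mode s j \<omega>) i" if s: "s \<in> {0..t}" for s
  proof -
    have ds: "is_distribution N (\<lambda>f. H s f \<omega>)" using d s by simp
    have "H s (laplacian (cas N i)) \<omega> = - (wavenum N i)\<^sup>2 * H s (cas N i) \<omega>"
      unfolding laplacian_wave wavenum_def[symmetric]
      using trig_linearD[OF H_linear[OF ds], of i "- (wavenum N i)\<^sup>2 * 1" "- (wavenum N i)\<^sup>2 * 1"] trig_linearD[OF H_linear[OF ds], of i 1 1]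
      by (simp add: algebra_simps)
    then have 1: "?c * (1 / 2 * H s (laplacian (cas N i)) \<omega>) = - ((wavenum N i)\<^sup>2 / 2) * mode s i \<omega>"
      by (simp add: mode_def mult_ac)
    have "distribution_of N (akpz_nonlinearity N (\<lambda>h. H s h \<omega>)) (cas N i) = distribution_of N (akpz_nonlinearity N (\<lambda>h. H s h \<omega>)) (\<lambda>x. \<Sum>e\<in>{i}. 1 * cas N e x)"
      by simp
    also have "\<dots> = (if i \<in> low_modes N 1 then (\<Sum>a\<in>low. \<Sum>b\<in>low.
        hyp (freq N a) (freq N b) / (wavenum N a * wavenum N b) * triple (- a) (- b) i * mode s a \<omega> * mode s b \<omega>) else 0)"
      by (subst nonlin_pairing[OF ds]) auto
    finally have nl: "distribution_of N (akpz_nonlinearity N (\<lambda>h. H s h \<omega>)) (cas N i) = \<dots>" .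
    have i0: "i \<noteq> 0" using I i by auto
    have "akpz_field lam N I (\<lambda>j. mode s j \<omega>) i = (\<Sum>j\<in>low. \<Sum>k\<in>low. akpz_coeff lam N i j k * mode s j \<omega> * mode s k \<omega>)"
    proof -
      have "akpz_field lam N I (\<lambda>j. mode s j \<omega>) i = (\<Sum>j\<in>low. \<Sum>k\<in>I. akpz_coeff lam N i j k * mode s j \<omega> * mode s k \<omega>)"
        unfolding akpz_field_def by (rule sum.mono_neutral_right) (use I in \<open>auto simp: akpz_coeff_def intro!: sum.neutral\<close>)
      also have "\<dots> = (\<Sum>j\<in>low. \<Sum>k\<in>low. akpz_coeff lam N i j k * mode s j \<omega> * mode s k \<omega>)"
        by (intro sum.cong refl sum.mono_neutral_right) (use I in \<open>auto simp: akpz_coeff_def\<close>)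
      finally show ?thesis .
    qed
    also have "\<dots> = ?c * (lam * distribution_of N (akpz_nonlinearity N (\<lambda>h. H s h \<omega>)) (cas N i))"
    proof (cases "i \<in> low_modes N 1")
      case True
      then have "i \<in> low" using i0 by simp
      then show ?thesis unfolding nl using True
        by (simp add: sum_distrib_left akpz_coeff_def mult_ac)
    next
      case False
      then show ?thesis unfolding nl by (auto simp: akpz_coeff_def)
    qed
    finally show ?thesis using 1 by (simp add: distrib_left)
  qed
  have "?c * integral {0..t} (\<lambda>s. 1 / 2 * H s (laplacian (cas N i)) \<omega>
              + lam * distribution_of N (akpz_nonlinearity N (\<lambda>h. H s h \<omega>)) (cas N i))
    = integral {0..t} (\<lambda>s. ?c * (1 / 2 * H s (laplacian (cas N i)) \<omega>
              + lam * distribution_of N (akpz_nonlinearity N (\<lambda>h. H s h \<omega>)) (cas N i)))" by simp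
  also have "\<dots> = integral {0..t} (\<lambda>s. - ((wavenum N i)\<^sup>2 / 2) * mode s i \<omega> + akpz_field lam N I (\<lambda>j. mode s j \<omega>) i)"
    by (rule Henstock_Kurzweil_Integration.integral_cong) (rule eq)
  finally have int: "?c * integral {0..t} (\<lambda>s. 1 / 2 * H s (laplacian (cas N i)) \<omega>
              + lam * distribution_of N (akpz_nonlinearity N (\<lambda>h. H s h \<omega>)) (cas N i))
    = integral {0..t} (\<lambda>s. - ((wavenum N i)\<^sup>2 / 2) * mode s i \<omega> + akpz_field lam N I (\<lambda>j. mode s j \<omega>) i)" .
  have "mode t i \<omega> = ?c * \<eta> (cas N i) \<omega> + ?c * integral {0..t} (\<lambda>s. 1 / 2 * H s (laplacian (cas N i)) \<omega>
              + lam * distribution_of N (akpz_nonlinearity N (\<lambda>h. H s h \<omega>)) (cas N i)) + ?c * \<xi> (strip t (cas N i)) \<omega>"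
    unfolding mode_def e by (simp add: distrib_left)
  then show "mode t i \<omega> = mode 0 i \<omega>
    + integral {0..t} (\<lambda>s. - ((wavenum N i)\<^sup>2 / 2) * mode s i \<omega> + akpz_field lam N I (\<lambda>j. mode s j \<omega>) i) + mode_noise t i \<omega>"
    unfolding int by (simp add: mode_def mode_noise_def e0)
qed

lemma mode_measurable: "0 \<le> t \<Longrightarrow> mode t m \<in> borel_measurable M"
  unfolding mode_def[abs_def] by (intro borel_measurable_times borel_measurable_const H_measurable cas_C)

lemma mode_noise_measurable: "0 \<le> t \<Longrightarrow> mode_noise t m \<in> borel_measurable M"
  unfolding mode_noise_def[abs_def]
  by (intro borel_measurable_times borel_measurable_const centred_gaussian_family_measurable[OF xi_family] strip_L2 continuous_wave)

lemma initial_variance: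
  assumes I: "finite I" "0 \<notin> I"
  shows "(LINT \<omega>|M. (\<Sum>i\<in>I. (c i * (wavenum N i / sqrt area)) * \<eta> (cas N i) \<omega>)\<^sup>2) = (\<Sum>i\<in>I. (c i)\<^sup>2)"
proof -
  have "(LINT \<omega>|M. (\<Sum>i\<in>I. (c i * (wavenum N i / sqrt area)) * \<eta> (cas N i) \<omega>)\<^sup>2)
    = (\<Sum>i\<in>I. \<Sum>j\<in>I. (c i * (wavenum N i / sqrt area)) * (c j * (wavenum N j / sqrt area)) * (LINT \<omega>|M. \<eta> (cas N i) \<omega> * \<eta> (cas N j) \<omega>))"
    by (rule centred_gaussian_family_variance[OF P eta_family I(1)]) (use cas_C in auto)
  also have "\<dots> = (\<Sum>i\<in>I. \<Sum>j\<in>I. if i = j then (c i)\<^sup>2 else 0)"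
  proof (intro sum.cong refl)
    fix i j assume ij: "i \<in> I" "j \<in> I"
    then have "i \<noteq> 0" "j \<noteq> 0" using I by auto
    moreover have "0 < wavenum N i" using wavenum_pos[OF N] \<open>i \<noteq> 0\<close> .
    ultimately show "(c i * (wavenum N i / sqrt area)) * (c j * (wavenum N j / sqrt area)) * (LINT \<omega>|M. \<eta> (cas N i) \<omega> * \<eta> (cas N j) \<omega>) = (if i = j then (c i)\<^sup>2 else 0)"
      using area_pos by (cases "i = j") (simp_all add: eta_cov field_simps power2_eq_square)
  qed
  finally show ?thesis using I by simp
qed

text \<open>An increment is the difference of the noise on two strips; the Boolean \<open>b\<close>
  selects the later (sign +) or the earlier (sign -) endpoint. Bilinearity then reduces the variance
  to a second difference of the covariance min t s.\<close>

lemma noise_variance: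
  fixes c :: "nat \<times> int \<times> int \<Rightarrow> real" and n :: nat
  assumes I: "finite I" and h: "0 < h"
  defines "f \<equiv> \<lambda>((k, i), b). strip ((real k + of_bool b) * h) (cas N i)"
  defines "d \<equiv> \<lambda>((k, i), b). c (k, i) / sqrt (area * h) * (if b then 1 else - 1)"
  shows "(LINT \<omega>|M. (\<Sum>p\<in>({..<n} \<times> I) \<times> UNIV. d p * \<xi> (f p) \<omega>)\<^sup>2) = (\<Sum>p\<in>{..<n} \<times> I. (c p)\<^sup>2)"
proof -
  let ?S = "({..<n} \<times> I)"
  have fin: "finite ?S" using I by simp
  have fL: "f p \<in> space_time_L2 N" for p
    unfolding f_def using h by (cases p; cases "fst p") (auto intro!: strip_L2 continuous_wave)
  have "(LINT \<omega>|M. (\<Sum>p\<in>?S \<times> UNIV. d p * \<xi> (f p) \<omega>)\<^sup>2) = (\<Sum>p\<in>?S \<times> UNIV. \<Sum>q\<in>?S \<times> UNIV. d p * d q * (LINT \<omega>|M. \<xi> (f p) \<omega> * \<xi> (f q) \<omega>))"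
    by (rule centred_gaussian_family_variance[OF P xi_family]) (use fin fL in auto)
  also have "\<dots> = (\<Sum>p\<in>?S. \<Sum>q\<in>?S. \<Sum>b\<in>UNIV. \<Sum>b'\<in>UNIV. d (p, b) * d (q, b') * (LINT \<omega>|M. \<xi> (f (p, b)) \<omega> * \<xi> (f (q, b')) \<omega>))"
    by (rule sum_times_square)
  also have "\<dots> = (\<Sum>p\<in>?S. \<Sum>q\<in>?S. if p = q then (c p)\<^sup>2 else 0)"
  proof (intro sum.cong refl)
    fix p q assume "p \<in> ?S" "q \<in> ?S"
    obtain k i l j where pq: "p = (k, i)" "q = (l, j)" by (cases p; cases q) auto
    have cov: "(LINT \<omega>|M. \<xi> (f (p, b)) \<omega> * \<xi> (f (q, b')) \<omega>) = min (real k + of_bool b) (real l + of_bool b') * h * (if i = j then area else 0)" for b b'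
    proof -
      have "(LINT \<omega>|M. \<xi> (f (p, b)) \<omega> * \<xi> (f (q, b')) \<omega>) = min ((real k + of_bool b) * h) ((real l + of_bool b') * h) * (if i = j then area else 0)"
        unfolding f_def pq using h by (simp add: xi_cov continuous_wave cas_orthogonal[OF N])
      also have "min ((real k + of_bool b) * h) ((real l + of_bool b') * h) = min (real k + of_bool b) (real l + of_bool b') * h"
        using h by (simp add: min_mult_distrib_right)
      finally show ?thesis .
    qed
    have sq: "c p / sqrt (area * h) * (c q / sqrt (area * h)) = c p * c q / (area * h)"
      using area_pos h by (simp add: real_sqrt_mult_self abs_of_pos)
    have dd: "d (p, b) * d (q, b') = c p * c q / (area * h) * ((if b then 1 else - 1) * (if b' then 1 else - 1))" for b b'
      unfolding sq[symmetric] by (simp add: d_def pq)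
    \<comment> \<open>The second difference of the minimum is the length of the overlap of the unit
      intervals starting at k and at l.\<close>
    have mm: "min (real k + 1) (real l + 1) - min (real k + 1) (real l) - min (real k) (real l + 1) + min (real k) (real l) = (if k = l then 1 else 0)"
      by (cases k l rule: linorder_cases) (auto simp: min_def)
    have "(\<Sum>b\<in>UNIV. \<Sum>b'\<in>UNIV. d (p, b) * d (q, b') * (LINT \<omega>|M. \<xi> (f (p, b)) \<omega> * \<xi> (f (q, b')) \<omega>))
      = c p * c q / (area * h) * (h * (if i = j then area else 0)) * (min (real k + 1) (real l + 1) - min (real k + 1) (real l) - min (real k) (real l + 1) + min (real k) (real l))"
      unfolding cov dd UNIV_bool by (simp add: algebra_simps)
    also have "\<dots> = (if p = q then (c p)\<^sup>2 else 0)"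
      unfolding mm using area_pos h by (auto simp: pq power2_eq_square)
    finally show "(\<Sum>b\<in>UNIV. \<Sum>b'\<in>UNIV. d (p, b) * d (q, b') * (LINT \<omega>|M. \<xi> (f (p, b)) \<omega> * \<xi> (f (q, b')) \<omega>)) = (if p = q then (c p)\<^sup>2 else 0)" .
  qed
  also have "\<dots> = (\<Sum>p\<in>?S. (c p)\<^sup>2)" using fin by simp
  finally show ?thesis .
qed

text \<open>A linear form in the normalised variables splits into a free-field part \<open>U\<close>
  and a white-noise part \<open>V\<close>; they are independent, and their variances are the two
  parts of the sum of squared coefficients.\<close>

lemma std_gauss_char_noise:
  assumes I: "finite I" "0 \<notin> I" and T: "0 < T" and n: "1 \<le> n"
  shows "std_gauss_char M ({0..n} \<times> I) (normalised_noise (\<lambda>i. (wavenum N i)\<^sup>2 / 2) (T / real n) (mode 0) mode_noise)"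
  unfolding std_gauss_char_def
proof
  fix c :: "nat \<times> int \<times> int \<Rightarrow> real"
  define h where "h = T / real n"
  have h: "0 < h" using T n by (simp add: h_def)
  let ?G = "normalised_noise (\<lambda>i. (wavenum N i)\<^sup>2 / 2) h (mode 0) mode_noise"
  define f where "f = (\<lambda>((k, i), b). strip ((real k + of_bool b) * h) (cas N i))"
  define d where "d = (\<lambda>((k, i), b). c (Suc k, i) / sqrt (area * h) * (if b then 1 else - 1 :: real))"
  define U where "U = (\<lambda>\<omega>. \<Sum>i\<in>I. (c (0, i) * (wavenum N i / sqrt area)) * \<eta> (cas N i) \<omega>)"
  define V where "V = (\<lambda>\<omega>. \<Sum>p\<in>({..<n} \<times> I) \<times> UNIV. d p * \<xi> (f p) \<omega>)"
  have EU: "(LINT \<omega>|M. (U \<omega>)\<^sup>2) = (\<Sum>i\<in>I. (c (0, i))\<^sup>2)"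
    unfolding U_def by (rule initial_variance[OF I])
  have EV: "(LINT \<omega>|M. (V \<omega>)\<^sup>2) = (\<Sum>p\<in>{..<n} \<times> I. (c (Suc (fst p), snd p))\<^sup>2)"
    using noise_variance[OF I(1) h, of "\<lambda>p. c (Suc (fst p), snd p)" n] unfolding V_def d_def f_def by (simp add: case_prod_unfold)
  have fL: "f p \<in> space_time_L2 N" for p
    unfolding f_def using h by (cases p; cases "fst p") (auto intro!: strip_L2 continuous_wave)
  have s0: "(\<Sum>p\<in>{0..n} \<times> I. g p) = (\<Sum>i\<in>I. g (0, i)) + (\<Sum>p\<in>{..<n} \<times> I. g (Suc (fst p), snd p))" for g :: "nat \<times> int \<times> int \<Rightarrow> real"
  proof -
    have "(\<Sum>p\<in>{0..n} \<times> I. g p) = (\<Sum>m\<le>n. \<Sum>i\<in>I. g (m, i))"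
      unfolding atLeast0AtMost by (simp add: sum.cartesian_product)
    also have "\<dots> = (\<Sum>i\<in>I. g (0, i)) + (\<Sum>k<n. \<Sum>i\<in>I. g (Suc k, i))" by (rule sum.atMost_shift)
    finally show ?thesis by (simp add: sum.cartesian_product case_prod_unfold)
  qed
  have sum_eq: "AE \<omega> in M. (\<Sum>p\<in>{0..n} \<times> I. c p * ?G p \<omega>) = V \<omega> + U \<omega>"
  proof -
    have "AE \<omega> in M. \<forall>i\<in>I. H 0 (cas N i) \<omega> = \<eta> (cas N i) \<omega>"
      by (intro AE_finite_allI I H_init cas_C)
    then show ?thesis
    proof eventually_elim
      case (elim \<omega>)
      have "(\<Sum>i\<in>I. c (0, i) * ?G (0, i) \<omega>) = U \<omega>"
        unfolding U_def using elim by (intro sum.cong refl) (simp add: normalised_noise_def mode_def)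
      moreover have "(\<Sum>p\<in>{..<n} \<times> I. c (Suc (fst p), snd p) * ?G (Suc (fst p), snd p) \<omega>) = V \<omega>"
      proof -
        have "V \<omega> = (\<Sum>p\<in>{..<n} \<times> I. \<Sum>b\<in>UNIV. d (p, b) * \<xi> (f (p, b)) \<omega>)"
          unfolding V_def by (simp add: sum.cartesian_product)
        also have "\<dots> = (\<Sum>p\<in>{..<n} \<times> I. c (Suc (fst p), snd p) * ?G (Suc (fst p), snd p) \<omega>)"
        proof (intro sum.cong refl)
          fix p assume p: "p \<in> {..<n} \<times> I"
          obtain k i where ki: "p = (k, i)" by (cases p)
          have "i \<noteq> 0" using p ki I by auto
          then have w: "0 < wavenum N i" by (rule wavenum_pos[OF N])
          \<comment> \<open>With damping equal to half the squared wave number, the normalisation 2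
            a h is the squared wave number times \<open>h\<close>, and the wave number cancels
            against the one in \<open>mode_noise\<close>.\<close>
          have sq: "sqrt (2 * ((wavenum N i)\<^sup>2 / 2) * h) = wavenum N i * sqrt h"
            using w by (simp add: real_sqrt_mult)
          show "(\<Sum>b\<in>UNIV. d (p, b) * \<xi> (f (p, b)) \<omega>) = c (Suc (fst p), snd p) * ?G (Suc (fst p), snd p) \<omega>"
            unfolding ki UNIV_bool using w area_pos h
            by (simp add: d_def f_def normalised_noise_def sq mode_noise_def real_sqrt_mult field_simps)
        qed
        finally show ?thesis by simp
      qed
      ultimately show ?case unfolding s0 by simp
    qed
  qed
  have ic: "(LINT \<omega>|M. cos (V \<omega> + U \<omega>)) = exp (- ((LINT \<omega>|M. (V \<omega>)\<^sup>2) + (LINT \<omega>|M. (U \<omega>)\<^sup>2)) / 2)"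
    "(LINT \<omega>|M. sin (V \<omega> + U \<omega>)) = 0"
    unfolding U_def V_def
    by (rule independent_gaussian_char[OF P indep xi_family eta_family]; use I fL cas_C in auto)+
  have var: "(\<Sum>p\<in>{0..n} \<times> I. (c p)\<^sup>2) = (LINT \<omega>|M. (V \<omega>)\<^sup>2) + (LINT \<omega>|M. (U \<omega>)\<^sup>2)"
    unfolding s0 EU EV by simp
  have Gm: "?G p \<in> borel_measurable M" if "p \<in> {0..n} \<times> I" for p
    using h by (cases p; cases "fst p") (auto simp: normalised_noise_def intro!: borel_measurable_divide borel_measurable_diff mode_noise_measurable mode_measurable)
  have m: "(\<lambda>\<omega>. \<Sum>p\<in>{0..n} \<times> I. c p * ?G p \<omega>) \<in> borel_measurable M"
    by (intro borel_measurable_sum borel_measurable_times borel_measurable_const Gm)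
  have UVm: "(\<lambda>\<omega>. V \<omega> + U \<omega>) \<in> borel_measurable M"
    unfolding U_def V_def
    by (intro borel_measurable_add borel_measurable_sum borel_measurable_times borel_measurable_const
        centred_gaussian_family_measurable[OF xi_family] centred_gaussian_family_measurable[OF eta_family] fL cas_C)
  have "(LINT \<omega>|M. cos (\<Sum>p\<in>{0..n} \<times> I. c p * ?G p \<omega>)) = (LINT \<omega>|M. cos (V \<omega> + U \<omega>))"
    by (rule integral_cong_AE) (use sum_eq m UVm in \<open>auto intro: measurable_compose[OF _ borel_measurable_cos]\<close>)
  moreover have "(LINT \<omega>|M. sin (\<Sum>p\<in>{0..n} \<times> I. c p * ?G p \<omega>)) = (LINT \<omega>|M. sin (V \<omega> + U \<omega>))"
    by (rule integral_cong_AE) (use sum_eq m UVm in \<open>auto intro: measurable_compose[OF _ borel_measurable_sin]\<close>)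
  ultimately show "(LINT \<omega>|M. cos (\<Sum>p\<in>{0..n} \<times> I. c p * normalised_noise (\<lambda>i. (wavenum N i)\<^sup>2 / 2) (T / real n) (mode 0) mode_noise p \<omega>))
      = exp (- (\<Sum>p\<in>{0..n} \<times> I. (c p)\<^sup>2) / 2) \<and>
     (LINT \<omega>|M. sin (\<Sum>p\<in>{0..n} \<times> I. c p * normalised_noise (\<lambda>i. (wavenum N i)\<^sup>2 / 2) (T / real n) (mode 0) mode_noise p \<omega>)) = 0"
    unfolding h_def[symmetric] var using ic by simp
qed

lemma std_gauss_char_initial:
  assumes I: "finite I" "0 \<notin> I"
  shows "std_gauss_char M I (mode 0)"
  unfolding std_gauss_char_def
proof
  fix c :: "int \<times> int \<Rightarrow> real"
  let ?U = "\<lambda>\<omega>. \<Sum>i\<in>I. (c i * (wavenum N i / sqrt area)) * \<eta> (cas N i) \<omega>"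
  have G: "centred_gaussian M ?U"
    by (rule centred_gaussian_family_sum[OF eta_family I(1)]) (use cas_C in auto)
  have "AE \<omega> in M. \<forall>i\<in>I. H 0 (cas N i) \<omega> = \<eta> (cas N i) \<omega>"
    by (intro AE_finite_allI I H_init cas_C)
  then have e: "AE \<omega> in M. (\<Sum>i\<in>I. c i * mode 0 i \<omega>) = ?U \<omega>"
    by eventually_elim (auto intro!: sum.cong simp: mode_def)
  have m: "(\<lambda>\<omega>. \<Sum>i\<in>I. c i * mode 0 i \<omega>) \<in> borel_measurable M"
    by (intro borel_measurable_sum borel_measurable_times borel_measurable_const mode_measurable) simp
  have Um: "?U \<in> borel_measurable M" using G by (simp add: centred_gaussian_def)
  have "(LINT \<omega>|M. cos (\<Sum>i\<in>I. c i * mode 0 i \<omega>)) = (LINT \<omega>|M. cos (?U \<omega>))"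
    by (rule integral_cong_AE) (use e m Um in \<open>auto intro: measurable_compose[OF _ borel_measurable_cos]\<close>)
  moreover have "(LINT \<omega>|M. sin (\<Sum>i\<in>I. c i * mode 0 i \<omega>)) = (LINT \<omega>|M. sin (?U \<omega>))"
    by (rule integral_cong_AE) (use e m Um in \<open>auto intro: measurable_compose[OF _ borel_measurable_sin]\<close>)
  ultimately show "(LINT \<omega>|M. cos (\<Sum>i\<in>I. c i * mode 0 i \<omega>)) = exp (- (\<Sum>i\<in>I. (c i)\<^sup>2) / 2) \<and> (LINT \<omega>|M. sin (\<Sum>i\<in>I. c i * mode 0 i \<omega>)) = 0"
    using centred_gaussian_props(2,3)[OF P G] initial_variance[OF I, of c] by simp
qed

theorem stationarity_bound:
  assumes I: "finite I" "low \<subseteq> I" "0 \<notin> I" "\<And>i. i \<in> I \<Longrightarrow> - i \<in> I" and T: "0 \<le> T"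
    and q: "q \<in> borel_measurable (PiM I (\<lambda>_. borel))"
    and qcont: "\<And>x y. (\<And>i. i \<in> I \<Longrightarrow> (\<lambda>n. x n i) \<longlonglongrightarrow> y i) \<Longrightarrow> (\<lambda>n. q (x n)) \<longlonglongrightarrow> (q y :: real)"
  shows "(\<integral>\<^sup>+\<omega>. ennreal (q (\<lambda>i\<in>I. mode T i \<omega>)) \<partial>M) \<le> (\<integral>\<^sup>+z. ennreal (q z) \<partial>std_gauss I)"
\<comment> \<open>At time zero the law is exactly Gaussian; the scheme, with step T / n, covers
  positive times.\<close>
proof (cases "T = 0")
  case True
  have "(\<integral>\<^sup>+\<omega>. ennreal (q (\<lambda>i\<in>I. mode 0 i \<omega>)) \<partial>M) = (\<integral>\<^sup>+z. ennreal (q z) \<partial>std_gauss I)"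
    by (rule nn_integral_gauss_law[OF I(1) P mode_measurable std_gauss_char_initial[OF I(1,3)]]) (use q in auto)
  then show ?thesis using True by simp
next
  case False
  then have T0: "0 < T" using T by simp
  show ?thesis
  proof (rule sde_gaussian_bound[OF P I(1) T0, where b="akpz_field lam N I" and a="\<lambda>i. (wavenum N i)\<^sup>2 / 2" and W=mode_noise])
    show "AE \<omega> in M. \<forall>i\<in>I. continuous_on {0..T} (\<lambda>s. mode s i \<omega>)"
      using H_cont
    proof eventually_elim
      case (elim \<omega>)
      then have "continuous_on {0..} (\<lambda>s. H s (cas N i) \<omega>)" for i using cas_C by blast
      then have "continuous_on {0..T} (\<lambda>s. H s (cas N i) \<omega>)" for i by (rule continuous_on_subset) auto
      then show ?case unfolding mode_def by (intro ballI continuous_on_mult continuous_on_const)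
    qed
    show "continuous_on {0..T} (\<lambda>s. akpz_field lam N I (x s) i)" if "\<And>j. j \<in> I \<Longrightarrow> continuous_on {0..T} (\<lambda>s. x s j)" for x i
      unfolding akpz_field_def using that by (intro continuous_intros) auto
    show "0 < (wavenum N i)\<^sup>2 / 2" if "i \<in> I" for i
    proof -
      have "i \<noteq> 0" using that I(3) by blast
      then show ?thesis using wavenum_pos[OF N, of i] by simp
    qed
    show "admissible (Pair (0::nat) ` I) (\<lambda>z p. akpz_field lam N I (\<lambda>i. z (0, i)) (snd p))"
      by (rule admissible_akpz[OF N I(1,4)])
    show "AE \<omega> in M. mode t i \<omega> = mode 0 i \<omega> + integral {0..t} (\<lambda>s. - ((wavenum N i)\<^sup>2 / 2) * mode s i \<omega> + akpz_field lam N I (\<lambda>j. mode s j \<omega>) i) + mode_noise t i \<omega>"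
      if "0 \<le> t" "i \<in> I" for t i by (rule mode_eq[OF I(1-3) that])
    show "std_gauss_char M ({0..n} \<times> I) (normalised_noise (\<lambda>i. (wavenum N i)\<^sup>2 / 2) (T / real n) (mode 0) mode_noise)" if "1 \<le> n" for n
      by (rule std_gauss_char_noise[OF I(1,3) T0 that])
    show "q \<in> borel_measurable (PiM I (\<lambda>_. borel))" by (rule q)
    show "(\<lambda>n. q (x n)) \<longlonglongrightarrow> q y" if "\<And>i. i \<in> I \<Longrightarrow> (\<lambda>n. x n i) \<longlonglongrightarrow> y i" for x y by (rule qcont[OF that])
  qed (use mode_measurable mode_noise_measurable in auto)
qed

end

section \<open>Second moments of time integrals\<close>

lemma riemann_sums_converge:
  fixes g :: "real \<Rightarrow> real"
  assumes t: "0 \<le> t" and g: "continuous_on {0..t} g"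
  shows "(\<lambda>n. t / real n * (\<Sum>j<n. g (real j * (t / real n)))) \<longlonglongrightarrow> integral {0..t} g"
proof (rule LIMSEQ_I)
  fix r :: real assume r: "0 < r"
  define e where "e = r / (2 * (t + 1))"
  have e: "0 < e" using r t by (simp add: e_def)
  obtain d where d: "0 < d" "\<And>x y. x \<in> {0..t} \<Longrightarrow> y \<in> {0..t} \<Longrightarrow> dist y x < d \<Longrightarrow> dist (g y) (g x) < e"
    using compact_uniformly_continuous[OF g] e unfolding uniformly_continuous_on_def by (metis compact_Icc)
  have "(\<lambda>n. t / real n) \<longlonglongrightarrow> 0" by (rule lim_const_over_n)
  then have "\<forall>\<^sub>F n in sequentially. t / real n < d" using d(1) by (rule order_tendstoD)
  then obtain n0 where n0: "\<And>n. n \<ge> n0 \<Longrightarrow> t / real n < d" unfolding eventually_sequentially by blast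
  show "\<exists>no. \<forall>n\<ge>no. norm (t / real n * (\<Sum>j<n. g (real j * (t / real n))) - integral {0..t} g) < r"
  proof (intro exI[of _ "max n0 1"] allI impI)
    fix n assume n: "max n0 1 \<le> n"
    define h where "h = t / real n"
    have h: "0 \<le> h" "h < d" "real n * h = t" using n n0[of n] t by (auto simp: h_def)
    have part: "\<bar>h * (\<Sum>j<m. g (real j * h)) - integral {0..real m * h} g\<bar> \<le> real m * h * e" if "m \<le> n" for m
      using that
    proof (induction m)
      case (Suc m)
      define a where "a = real m * h"
      define b where "b = real (Suc m) * h"
      have mh: "0 \<le> a" "a \<le> b" "b \<le> t" "b = a + h"
        using h Suc.prems mult_right_mono[of "real (Suc m)" "real n" h] by (auto simp: a_def b_def algebra_simps)
      have "{a..b} \<subseteq> {0..t}" "{0..b} \<subseteq> {0..t}" using mh by auto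
      then have c: "continuous_on {a..b} g" "continuous_on {0..b} g" by (auto intro: continuous_on_subset[OF g])
      have split: "integral {0..a} g + integral {a..b} g = integral {0..b} g"
        using mh by (intro Henstock_Kurzweil_Integration.integral_combine integrable_continuous_interval c) auto
      have "h * g a - integral {a..b} g = integral {a..b} (\<lambda>s. g a - g s)"
      proof -
        have "integral {a..b} (\<lambda>s. g a - g s) = integral {a..b} (\<lambda>s. g a) - integral {a..b} g"
          by (rule Henstock_Kurzweil_Integration.integral_diff[OF integrable_const_ivl integrable_continuous_interval[OF c(1)]])
        then show ?thesis using mh by simp
      qed
      also have "\<bar>\<dots>\<bar> \<le> e * h"
      proof -
        have "norm (integral {a..b} (\<lambda>s. g a - g s)) \<le> e * (b - a)"
        proof (rule integral_bound)
          show "continuous_on {a..b} (\<lambda>s. g a - g s)"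
            by (intro continuous_on_diff continuous_on_const c)
          fix s assume s: "s \<in> {a..b}"
          have "dist (g a) (g s) < e"
            using s mh h by (intro d(2)) (auto simp: dist_real_def)
          then show "norm (g a - g s) \<le> e" by (simp add: dist_real_def)
        qed (use mh in auto)
        then show ?thesis using mh by simp
      qed
      finally have "\<bar>h * g a - integral {a..b} g\<bar> \<le> e * h" .
      moreover have "\<bar>h * (\<Sum>j<m. g (real j * h)) - integral {0..a} g\<bar> \<le> real m * h * e" using Suc by (simp add: a_def)
      moreover have "h * (\<Sum>j<Suc m. g (real j * h)) - integral {0..b} g
        = (h * (\<Sum>j<m. g (real j * h)) - integral {0..a} g) + (h * g a - integral {a..b} g)"
        using split by (simp add: algebra_simps a_def)
      ultimately have "\<bar>h * (\<Sum>j<Suc m. g (real j * h)) - integral {0..b} g\<bar> \<le> real m * h * e + e * h" by linarith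
      then show ?case unfolding b_def by (simp add: algebra_simps)
    qed simp
    have "\<bar>h * (\<Sum>j<n. g (real j * h)) - integral {0..t} g\<bar> \<le> t * e" using part[of n] h by simp
    also have "t * e < r"
    proof -
      have "t * e \<le> (t + 1) * e" using e by simp
      also have "\<dots> = r / 2" using t by (simp add: e_def field_simps)
      finally show ?thesis using r by simp
    qed
    finally show "norm (t / real n * (\<Sum>j<n. g (real j * (t / real n))) - integral {0..t} g) < r"
      by (simp add: h_def)
  qed
qed

text \<open>Cauchy-Schwarz in time, through Riemann sums and Fatou's lemma so that no joint
  measurability is needed.\<close>

lemma nn_integral_time_integral_le:
  fixes G :: "real \<Rightarrow> 'a \<Rightarrow> real"
  assumes t: "0 \<le> t" and G[measurable]: "\<And>s. 0 \<le> s \<Longrightarrow> G s \<in> borel_measurable M"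
    and cont: "AE \<omega> in M. continuous_on {0..t} (\<lambda>s. G s \<omega>)"
    and B: "\<And>s. 0 \<le> s \<Longrightarrow> s \<le> t \<Longrightarrow> (\<integral>\<^sup>+\<omega>. ennreal ((G s \<omega>)\<^sup>2) \<partial>M) \<le> ennreal B" "0 \<le> B"
    and Y: "AE \<omega> in M. Y \<omega> = integral {0..t} (\<lambda>s. G s \<omega>)"
  shows "(\<integral>\<^sup>+\<omega>. ennreal ((Y \<omega>)\<^sup>2) \<partial>M) \<le> ennreal (t\<^sup>2 * B)"
proof -
  define R where "R n \<omega> = t / real n * (\<Sum>j<n. G (real j * (t / real n)) \<omega>)" for n \<omega>
  have s0: "0 \<le> real j * (t / real n)" for j n :: nat using t by simp
  have Rm[measurable]: "R n \<in> borel_measurable M" for n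
    unfolding R_def[abs_def] using s0 by measurable
  have RB: "(\<integral>\<^sup>+\<omega>. ennreal ((R n \<omega>)\<^sup>2) \<partial>M) \<le> ennreal (t\<^sup>2 * B)" for n
  proof (cases "n = 0")
    case True
    then show ?thesis by (simp add: R_def)
  next
    case False
    have "(R n \<omega>)\<^sup>2 \<le> t\<^sup>2 / real n * (\<Sum>j<n. (G (real j * (t / real n)) \<omega>)\<^sup>2)" for \<omega>
    proof -
      have "(R n \<omega>)\<^sup>2 \<le> (t / real n)\<^sup>2 * (real n * (\<Sum>j<n. (G (real j * (t / real n)) \<omega>)\<^sup>2))"
        unfolding R_def power_mult_distrib using sum_squared_le_sum_of_squares[of "\<lambda>j. G (real j * (t / real n)) \<omega>" "{..<n}"]
        by (intro mult_left_mono) (auto simp: mult.commute)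
      then show ?thesis using False by (simp add: power2_eq_square field_simps)
    qed
    then have "(\<integral>\<^sup>+\<omega>. ennreal ((R n \<omega>)\<^sup>2) \<partial>M) \<le> (\<integral>\<^sup>+\<omega>. ennreal (t\<^sup>2 / real n) * (\<Sum>j<n. ennreal ((G (real j * (t / real n)) \<omega>)\<^sup>2)) \<partial>M)"
      by (intro nn_integral_mono) (simp add: sum_ennreal ennreal_mult[symmetric] sum_nonneg ennreal_leI)
    also have "\<dots> = ennreal (t\<^sup>2 / real n) * (\<Sum>j<n. \<integral>\<^sup>+\<omega>. ennreal ((G (real j * (t / real n)) \<omega>)\<^sup>2) \<partial>M)"
    proof -
      have [measurable]: "G (real j * (t / real n)) \<in> borel_measurable M" for j by (rule G[OF s0])
      show ?thesis by (subst nn_integral_cmult, measurable) (subst nn_integral_sum, measurable)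
    qed
    also have "\<dots> \<le> ennreal (t\<^sup>2 / real n) * (\<Sum>j<n. ennreal B)"
    proof (intro mult_left_mono sum_mono B)
      fix j assume "j \<in> {..<n}"
      then have "real j * (t / real n) \<le> real n * (t / real n)" using t by (intro mult_right_mono) auto
      then show "real j * (t / real n) \<le> t" using False by simp
    qed (use s0 in auto)
    also have "\<dots> = ennreal (t\<^sup>2 / real n * (real n * B))"
      using B(2) t by (simp add: ennreal_of_nat_eq_real_of_nat ennreal_mult[symmetric])
    also have "t\<^sup>2 / real n * (real n * B) = t\<^sup>2 * B" using False by simp
    finally show ?thesis .
  qed
  have "(\<integral>\<^sup>+\<omega>. ennreal ((Y \<omega>)\<^sup>2) \<partial>M) = (\<integral>\<^sup>+\<omega>. liminf (\<lambda>n. ennreal ((R n \<omega>)\<^sup>2)) \<partial>M)"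
  proof (rule nn_integral_cong_AE)
    show "AE \<omega> in M. ennreal ((Y \<omega>)\<^sup>2) = liminf (\<lambda>n. ennreal ((R n \<omega>)\<^sup>2))"
      using cont Y
    proof eventually_elim
      case (elim \<omega>)
      have "(\<lambda>n. R n \<omega>) \<longlonglongrightarrow> Y \<omega>" unfolding R_def elim(2) by (rule riemann_sums_converge[OF t elim(1)])
      then have "(\<lambda>n. ennreal ((R n \<omega>)\<^sup>2)) \<longlonglongrightarrow> ennreal ((Y \<omega>)\<^sup>2)" by (intro tendsto_ennrealI tendsto_power)
      then show ?case by (rule lim_imp_Liminf[OF sequentially_bot, symmetric])
    qed
  qed
  also have "\<dots> \<le> liminf (\<lambda>n. \<integral>\<^sup>+\<omega>. ennreal ((R n \<omega>)\<^sup>2) \<partial>M)" by (rule nn_integral_liminf) measurable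
  also have "\<dots> \<le> ennreal (t\<^sup>2 * B)" by (rule Liminf_le) (auto simp: RB)
  finally show ?thesis .
qed

section \<open>Lattice sums\<close>

lemma card_box_modes: "0 \<le> K \<Longrightarrow> real (card (box_modes K)) = (2 * real_of_int K + 1)\<^sup>2"
  by (simp add: box_modes_def card_cartesian_product power2_eq_square)

lemma card_box_modes_le:
  assumes "1 \<le> K"
  shows "real (card (box_modes K)) \<le> 9 * (real_of_int K)\<^sup>2"
proof -
  have "(2 * real_of_int K + 1)\<^sup>2 \<le> (3 * real_of_int K)\<^sup>2" using assms by (intro power_mono) auto
  then show ?thesis using assms by (simp add: card_box_modes power_mult_distrib)
qed

lemma box_modes_mono: "K \<le> L \<Longrightarrow> box_modes K \<subseteq> box_modes L" by (auto simp: box_modes_def)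

definition sqlen :: "int \<times> int \<Rightarrow> real" where "sqlen m = (of_int (fst m))\<^sup>2 + (of_int (snd m))\<^sup>2"

lemma wavenum_sqlen: "(wavenum N m)\<^sup>2 = sqlen m / (real N)\<^sup>2"
  by (simp add: wavenum_def norm_freq_sq sqlen_def)

lemma sqlen_outside_box:
  assumes "0 \<le> K" "m \<notin> box_modes K"
  shows "(real_of_int K + 1)\<^sup>2 \<le> sqlen m"
proof -
  have "K + 1 \<le> \<bar>fst m\<bar> \<or> K + 1 \<le> \<bar>snd m\<bar>" using assms by (cases m) (auto simp: box_modes_def)
  then have "real_of_int (K + 1) \<le> real_of_int \<bar>fst m\<bar> \<or> real_of_int (K + 1) \<le> real_of_int \<bar>snd m\<bar>" by (simp only: of_int_le_iff)
  then have "real_of_int K + 1 \<le> \<bar>real_of_int (fst m)\<bar> \<or> real_of_int K + 1 \<le> \<bar>real_of_int (snd m)\<bar>" by simp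
  moreover have "(real_of_int K + 1)\<^sup>2 \<le> y\<^sup>2" if "real_of_int K + 1 \<le> \<bar>y\<bar>" for y :: real
  proof -
    have "\<bar>real_of_int K + 1\<bar> \<le> \<bar>y\<bar>" using that assms(1) by simp
    then show ?thesis by (simp only: abs_le_square_iff)
  qed
  ultimately show ?thesis unfolding sqlen_def by (auto intro: add_increasing add_increasing2)
qed

lemma sqlen_inside_box:
  assumes "m \<in> box_modes K"
  shows "sqlen m \<le> 2 * (real_of_int K)\<^sup>2"
proof -
  have "\<bar>fst m\<bar> \<le> K" "\<bar>snd m\<bar> \<le> K" using assms by (cases m; auto simp: box_modes_def)+
  then have "\<bar>real_of_int (fst m)\<bar> \<le> \<bar>real_of_int K\<bar>" "\<bar>real_of_int (snd m)\<bar> \<le> \<bar>real_of_int K\<bar>" by linarith+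
  then have "(real_of_int (fst m))\<^sup>2 \<le> (real_of_int K)\<^sup>2" "(real_of_int (snd m))\<^sup>2 \<le> (real_of_int K)\<^sup>2"
    by (simp_all add: abs_le_square_iff)
  then show ?thesis by (simp add: sqlen_def)
qed

text \<open>Summation over square shells: the shell at distance n + 1 has 8(n + 1) points, each with
  squared length at least (n + 1)^2, so it contributes at most 8/(n + 1), and 1/(n + 1) is at most
  ln((n + 1)/n).\<close>

lemma lattice_sum_log:
  fixes L n :: nat
  assumes L: "1 \<le> L" and "L \<le> n"
  shows "(\<Sum>m\<in>box_modes (int n) - box_modes (int L). 1 / sqlen m) \<le> 8 * ln (real n / real L)"
  using assms(2)
proof (induction n rule: dec_induct)
  case base
  then show ?case using L by simp
next
  case (step n)
  let ?S = "box_modes (int (Suc n)) - box_modes (int n)"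
  have split: "box_modes (int (Suc n)) - box_modes (int L) = (box_modes (int n) - box_modes (int L)) \<union> ?S"
    using box_modes_mono[of "int n" "int (Suc n)"] box_modes_mono[of "int L" "int n"] step by auto
  \<comment> \<open>(2n + 3)^2 - (2n + 1)^2 = 8(n + 1).\<close>
  have cS: "real (card ?S) = 8 * (real n + 1)"
  proof -
    have "card ?S = card (box_modes (int (Suc n))) - card (box_modes (int n))"
      by (rule card_Diff_subset) (auto simp: box_modes_def)
    moreover have "card (box_modes (int n)) \<le> card (box_modes (int (Suc n)))" by (intro card_mono box_modes_mono) auto
    ultimately have "real (card ?S) = real (card (box_modes (int (Suc n)))) - real (card (box_modes (int n)))" by simp
    then show ?thesis by (simp add: card_box_modes power2_eq_square algebra_simps)
  qed
  have "(\<Sum>m\<in>?S. 1 / sqlen m) \<le> (\<Sum>m\<in>?S. 1 / (real n + 1)\<^sup>2)"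
  proof (rule sum_mono)
    fix m assume "m \<in> ?S"
    then have "(real n + 1)\<^sup>2 \<le> sqlen m" using sqlen_outside_box[of "int n" m] by auto
    moreover have "0 < (real n + 1)\<^sup>2" by simp
    ultimately show "1 / sqlen m \<le> 1 / (real n + 1)\<^sup>2" by (intro divide_left_mono mult_pos_pos) linarith+
  qed
  also have "\<dots> = real (card ?S) * (1 / (real n + 1)\<^sup>2)" by (simp del: of_nat_Suc)
  also have "\<dots> = 8 / (real n + 1)" unfolding cS by (simp add: power2_eq_square divide_simps)
  also have "\<dots> \<le> 8 * (ln (real n + 1) - ln (real n))"
  proof -
    have n: "0 < real n" using step L by simp
    have "ln (real n / (real n + 1)) \<le> real n / (real n + 1) - 1" using n by (intro ln_le_minus_one) simp
    also have "\<dots> = - (1 / (real n + 1))" using n by (simp add: field_simps)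
    finally show ?thesis using n by (simp add: ln_div)
  qed
  finally have S: "(\<Sum>m\<in>?S. 1 / sqlen m) \<le> 8 * (ln (real n + 1) - ln (real n))" .
  have "(\<Sum>m\<in>box_modes (int (Suc n)) - box_modes (int L). 1 / sqlen m) = (\<Sum>m\<in>box_modes (int n) - box_modes (int L). 1 / sqlen m) + (\<Sum>m\<in>?S. 1 / sqlen m)"
    unfolding split by (rule sum.union_disjoint) auto
  also have "\<dots> \<le> 8 * ln (real n / real L) + 8 * (ln (real n + 1) - ln (real n))" using step.IH S by simp
  also have "\<dots> = 8 * ln (real (Suc n) / real L)"
    using L step by (simp add: ln_div add.commute)
  finally show ?case .
qed

section \<open>Trigonometric test functions\<close>

definition trig_sum :: "nat \<Rightarrow> (int \<times> int) set \<Rightarrow> (int \<times> int \<Rightarrow> real) \<Rightarrow> plane \<Rightarrow> real" where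
  "trig_sum N S c x = (\<Sum>m\<in>S. c m * cas N m x)"

lemma trig_sum_insert: "finite S \<Longrightarrow> m \<notin> S \<Longrightarrow> trig_sum N (insert m S) c = (\<lambda>x. c m * cas N m x + 1 * trig_sum N S c x)"
  by (simp add: trig_sum_def fun_eq_iff)

lemma trig_sum_empty: "trig_sum N {} c = wave (freq N 0) 0 0"
  by (simp add: trig_sum_def wave_def fun_eq_iff)

lemma trig_sum_torus:
  assumes "1 \<le> N" "finite S"
  shows "trig_sum N S c \<in> torus_Ck N n"
  using assms(2)
proof induction
  case empty
  then show ?case unfolding trig_sum_empty by (rule wave_torus[OF assms(1)])
next
  case (insert m S)
  then show ?case unfolding trig_sum_insert[OF insert(1,2)] by (intro torus_Ck_linear wave_torus[OF assms(1)] insert.IH)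
qed

lemma distribution_trig_sum:
  assumes "1 \<le> N" "finite S" and w: "is_distribution N w"
  shows "w (trig_sum N S c) = (\<Sum>m\<in>S. c m * w (cas N m))"
  using assms(2)
proof induction
  case empty
  have "w (trig_sum N {} c) = 0"
    using trig_linearD[OF is_distribution_trig_linear[OF assms(1) w], of 0 0 0] by (simp only: trig_sum_empty)
  then show ?case by simp
next
  case (insert m S)
  have "w (trig_sum N (insert m S) c) = c m * w (cas N m) + 1 * w (trig_sum N S c)"
    unfolding trig_sum_insert[OF insert(1,2)]
    by (rule is_distribution_linear[OF w wave_torus[OF assms(1)] trig_sum_torus[OF assms(1) insert(1)]])
  then show ?case using insert by simp
qed

lemma partial_wave_sum:
  assumes "finite S"
  shows "partial i (\<lambda>x. \<Sum>m\<in>S. wave (k m) (\<alpha> m) (\<beta> m) x) = (\<lambda>x. \<Sum>m\<in>S. wave (k m) (k m $ i * \<beta> m) (- (k m $ i * \<alpha> m)) x)"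
proof
  fix x
  have "((\<lambda>x. \<Sum>m\<in>S. wave (k m) (\<alpha> m) (\<beta> m) x) has_derivative (\<lambda>h. \<Sum>m\<in>S. (\<beta> m * cos (k m \<bullet> x) - \<alpha> m * sin (k m \<bullet> x)) * (k m \<bullet> h))) (at x)"
    by (intro has_derivative_sum wave_has_derivative)
  from partial_eqI[OF this] show "partial i (\<lambda>x. \<Sum>m\<in>S. wave (k m) (\<alpha> m) (\<beta> m) x) x = (\<Sum>m\<in>S. wave (k m) (k m $ i * \<beta> m) (- (k m $ i * \<alpha> m)) x)"
    by (simp add: wave_def inner_axis algebra_simps)
qed

lemma laplacian_trig_sum:
  assumes "finite S"
  shows "laplacian (trig_sum N S c) = trig_sum N S (\<lambda>m. - (wavenum N m)\<^sup>2 * c m)"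
proof
  fix x
  have e: "trig_sum N S c = (\<lambda>x. \<Sum>m\<in>S. wave (freq N m) (c m) (c m) x)"
    by (simp add: trig_sum_def wave_def distrib_left fun_eq_iff)
  show "laplacian (trig_sum N S c) x = trig_sum N S (\<lambda>m. - (wavenum N m)\<^sup>2 * c m) x"
    unfolding laplacian_def e partial_wave_sum[OF assms] sum_2 sum.distrib[symmetric] trig_sum_def wavenum_sq
    by (intro sum.cong refl) (simp add: wave_def power2_eq_square algebra_simps del: freq_nth)
qed

lemma trig_sum_product:
  assumes "1 \<le> N" "finite S"
  shows "torus_integral N (\<lambda>x. trig_sum N S c x * trig_sum N S d x) = torus_area N * (\<Sum>m\<in>S. c m * d m)"
proof -
  have "torus_integral N (\<lambda>x. trig_sum N S c x * trig_sum N S d x) = torus_integral N (\<lambda>x. \<Sum>m\<in>S. \<Sum>n\<in>S. (c m * d n) * (cas N m x * cas N n x))"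
    unfolding trig_sum_def sum_product by (simp add: mult_ac)
  also have "\<dots> = (\<Sum>m\<in>S. \<Sum>n\<in>S. torus_integral N (\<lambda>x. (c m * d n) * (cas N m x * cas N n x)))"
    by (subst torus_integral_sum; (intro continuous_intros continuous_wave)?)
        (intro sum.cong refl torus_integral_sum continuous_intros continuous_wave)
  also have "\<dots> = (\<Sum>m\<in>S. \<Sum>n\<in>S. if m = n then c m * d m * torus_area N else 0)"
    unfolding torus_integral_cmult cas_orthogonal[OF assms(1)] by (intro sum.cong refl) auto
  also have "\<dots> = torus_area N * (\<Sum>m\<in>S. c m * d m)"
    using assms(2) by (simp add: sum_distrib_left mult_ac)
  finally show ?thesis .
qed

lemma trig_sum_coeff:
  assumes "1 \<le> N" "finite S" "m \<in> S"
  shows "torus_integral N (\<lambda>x. trig_sum N S c x * cas N m x) = c m * torus_area N"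
proof -
  have "cas N m x = trig_sum N S (\<lambda>n. of_bool (n = m)) x" for x
  proof -
    have "trig_sum N S (\<lambda>n. of_bool (n = m)) x = (\<Sum>n\<in>S. if n = m then cas N n x else 0)"
      unfolding trig_sum_def by (intro sum.cong refl) auto
    then show ?thesis using assms by simp
  qed
  then have "torus_integral N (\<lambda>x. trig_sum N S c x * cas N m x) = torus_area N * (\<Sum>n\<in>S. c n * of_bool (n = m))"
    using trig_sum_product[OF assms(1,2), of c "\<lambda>n. of_bool (n = m)"] by simp
  also have "(\<Sum>n\<in>S. c n * of_bool (n = m)) = (\<Sum>n\<in>S. if n = m then c n else 0)" by (intro sum.cong refl) auto
  also have "\<dots> = c m" using assms by simp
  finally show ?thesis by simp
qed

lemma inj_sum_sq_le:
  fixes c :: "'i \<Rightarrow> real"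
  assumes "finite S" "finite E" "inj_on g S"
  shows "(\<Sum>b\<in>S. (if g b \<in> E then c (g b) else 0)\<^sup>2) \<le> (\<Sum>e\<in>E. (c e)\<^sup>2)"
proof -
  have "(\<Sum>b\<in>S. (if g b \<in> E then c (g b) else 0)\<^sup>2) = (\<Sum>x\<in>g ` S. (if x \<in> E then c x else 0)\<^sup>2)"
    by (simp add: sum.reindex[OF assms(3)])
  also have "\<dots> = (\<Sum>x\<in>g ` S \<inter> E. (c x)\<^sup>2)"
    using assms by (subst sum.inter_restrict) (auto intro!: sum.cong)
  also have "\<dots> \<le> (\<Sum>e\<in>E. (c e)\<^sup>2)" by (rule sum_mono2) (use assms in auto)
  finally show ?thesis .
qed

text \<open>The two-square identity: \<open>hyp\<close> is the real part of a product of complex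
  numbers whose modulus is the product of the wave numbers, and the other square is its imaginary
  part.\<close>

lemma abs_hyp_le: "\<bar>hyp (freq N a) (freq N b)\<bar> \<le> wavenum N a * wavenum N b"
proof -
  let ?x = "freq N a" and ?y = "freq N b"
  have "(hyp ?x ?y)\<^sup>2 + (?x $ 1 * ?y $ 2 + ?x $ 2 * ?y $ 1)\<^sup>2 = (wavenum N a)\<^sup>2 * (wavenum N b)\<^sup>2"
    unfolding wavenum_sq hyp_def by algebra
  then have "(hyp ?x ?y)\<^sup>2 \<le> (wavenum N a * wavenum N b)\<^sup>2"
    unfolding power_mult_distrib using zero_le_power2[of "?x $ 1 * ?y $ 2 + ?x $ 2 * ?y $ 1"] by linarith
  then show ?thesis by (rule abs_le_square_iff[THEN iffD2, THEN order_trans]) (simp add: wavenum_def)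
qed

text \<open>Matrix of the quadratic form obtained by testing the nonlinearity against the
  trigonometric polynomial with coefficients \<open>c\<close> on \<open>E\<close>, expressed in
  unit-variance modes.\<close>

definition quad_coeff :: "nat \<Rightarrow> (int \<times> int) set \<Rightarrow> (int \<times> int \<Rightarrow> real) \<Rightarrow> int \<times> int \<Rightarrow> int \<times> int \<Rightarrow> real" where
  "quad_coeff N E c a b = (if a \<in> low_modes N 1 - {0} \<and> b \<in> low_modes N 1 - {0} then
     hyp (freq N a) (freq N b) / (wavenum N a * wavenum N b) * (\<Sum>e\<in>E. c e * triple (- a) (- b) e) else 0)"

lemma quad_coeff_sym: "quad_coeff N E c a b = quad_coeff N E c b a"
  unfolding quad_coeff_def using hyp_sym[of "freq N a" "freq N b"] by (auto simp: triple_sym[of "- a" "- b"] mult.commute)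

text \<open>Two different symmetries are at work. For e \<noteq> 0 the diagonal term is odd under a
  -> -a; for e = 0 it reduces to the symbol a1^2 - a2^2, which is odd under exchange of the two
  coordinates. The trace is the Gaussian mean of the tested nonlinearity.\<close>

lemma quad_coeff_trace:
  assumes N: "1 \<le> N"
  shows "(\<Sum>a\<in>low_modes N 1 - {0}. quad_coeff N E c a a) = 0"
proof -
  let ?D = "low_modes N 1 - {0}"
  define r where "r a = hyp (freq N a) (freq N a) / (wavenum N a * wavenum N a)" for a
  have z: "(\<Sum>a\<in>?D. r a * triple (- a) (- a) e) = 0" for e
  proof (cases "e = 0")
    case False
    show ?thesis
    proof (rule sum_antisym_eq_0[where \<sigma>=uminus])
      fix a assume "a \<in> ?D"
      have "triple (- (- a)) (- (- a)) e = - triple (- a) (- a) e"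
        using False by (auto simp: triple_def eq_neg_iff_add_eq_0 of_bool_def algebra_simps)
      then show "r (- a) * triple (- (- a)) (- (- a)) e = - (r a * triple (- a) (- a) e)" by (simp add: r_def)
    qed (auto simp: low_modes_uminus)
  next
    case True
    \<comment> \<open>At e = 0 and equal inputs two of the relations hold, and the other two would
      force a = 0.\<close>
    have t: "triple (- a) (- a) e = 1" if "a \<noteq> 0" for a
      using that True by (cases a) (auto simp: triple_def zero_prod_def of_bool_def)
    have "(\<Sum>a\<in>?D. r a * triple (- a) (- a) e) = (\<Sum>a\<in>?D. r a)" by (intro sum.cong refl) (simp add: t)
    also have "\<dots> = 0"
    proof (rule sum_antisym_eq_0[where \<sigma>=prod.swap])
      fix a :: "int \<times> int" assume "a \<in> ?D"
      then show "prod.swap a \<in> ?D" by (cases a) (auto simp: low_modes_def zero_prod_def norm_eq_sqrt_inner inner_vec_def sum_2 add.commute)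
      show "r (prod.swap a) = - r a"
        unfolding r_def power2_eq_square[symmetric] wavenum_sq hyp_def
        by (cases a) (simp add: add.commute minus_divide_left)
    qed simp
    finally show ?thesis .
  qed
  have "(\<Sum>a\<in>?D. quad_coeff N E c a a) = (\<Sum>a\<in>?D. \<Sum>e\<in>E. c e * (r a * triple (- a) (- a) e))"
    by (intro sum.cong refl) (simp add: quad_coeff_def r_def sum_distrib_left sum_divide_distrib mult_ac)
  also have "\<dots> = (\<Sum>e\<in>E. c e * (\<Sum>a\<in>?D. r a * triple (- a) (- a) e))"
    by (subst sum.swap) (simp add: sum_distrib_left)
  finally show ?thesis by (simp add: z)
qed

text \<open>For fixed \<open>a\<close>, each of the four frequency relations determines e from b
  injectively, so a row of squares is at most four times the sum of the squared coefficients. There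
  are at most 9 N^2 rows, whence 36. The angular factor is at most 1 by
  \<open>abs_hyp_le\<close>.\<close>

lemma quad_coeff_sq_le:
  assumes N: "1 \<le> N" and E: "finite E"
  shows "(\<Sum>a\<in>low_modes N 1 - {0}. \<Sum>b\<in>low_modes N 1 - {0}. (quad_coeff N E c a b)\<^sup>2)
    \<le> 36 * (real N)\<^sup>2 * (\<Sum>e\<in>E. (c e)\<^sup>2)"
proof -
  let ?D = "low_modes N 1 - {0}"
  have fD: "finite ?D" using finite_low_modes[OF N] by simp
  define c' where "c' x = (if x \<in> E then c x else 0)" for x
  define C where "C = (\<Sum>e\<in>E. (c e)\<^sup>2)"
  have C0: "0 \<le> C" unfolding C_def by (intro sum_nonneg) simp
  \<comment> \<open>The sum over \<open>E\<close> collapses to four values of the extension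
    \<open>c'\<close> of \<open>c\<close> by zero, one for each frequency relation.\<close>
  have tr: "(\<Sum>e\<in>E. c e * triple (- a) (- b) e) = (c' (b - a) + c' (a - b) + c' (- a - b) - c' (a + b)) / 2" for a b
  proof -
    have s: "(\<Sum>e\<in>E. c e * of_bool (e = x)) = c' x" for x
    proof -
      have "(\<Sum>e\<in>E. c e * of_bool (e = x)) = (\<Sum>e\<in>E. if e = x then c e else 0)" by (intro sum.cong refl) auto
      then show ?thesis using E by (simp add: c'_def)
    qed
    have T: "triple (- a) (- b) e = (of_bool (e = b - a) + of_bool (e = a - b) + of_bool (e = - a - b) - of_bool (e = a + b)) / 2" for e
    proof -
      have "(- a = - b + e) = (e = b - a)" "(- b = - a + e) = (e = a - b)" "(e = - a + - b) = (e = - a - b)" "(- a + - b + e = 0) = (e = a + b)"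
        by (auto simp: algebra_simps)
      then show ?thesis by (simp only: triple_def)
    qed
    have "(\<Sum>e\<in>E. c e * triple (- a) (- b) e) = (\<Sum>e\<in>E. (c e * of_bool (e = b - a) + c e * of_bool (e = a - b) + c e * of_bool (e = - a - b) - c e * of_bool (e = a + b)) / 2)"
      unfolding T by (intro sum.cong refl) (simp only: times_divide_eq_right distrib_left right_diff_distrib)
    then show ?thesis by (simp only: sum_divide_distrib[symmetric] sum.distrib sum_subtractf s)
  qed
  have four: "((x + y + z - w) / 2)\<^sup>2 \<le> x\<^sup>2 + y\<^sup>2 + z\<^sup>2 + w\<^sup>2" for x y z w :: real
  proof -
    have "4 * (x\<^sup>2 + y\<^sup>2 + z\<^sup>2 + w\<^sup>2) - (x + y + z - w)\<^sup>2 = (x - y)\<^sup>2 + (x - z)\<^sup>2 + (x + w)\<^sup>2 + (y - z)\<^sup>2 + (y + w)\<^sup>2 + (z + w)\<^sup>2" by algebra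
    then have "(x + y + z - w)\<^sup>2 \<le> 4 * (x\<^sup>2 + y\<^sup>2 + z\<^sup>2 + w\<^sup>2)" by (smt (verit) zero_le_power2)
    then show ?thesis by (simp add: power_divide)
  qed
  have q: "(quad_coeff N E c a b)\<^sup>2 \<le> (c' (b - a))\<^sup>2 + (c' (a - b))\<^sup>2 + (c' (- a - b))\<^sup>2 + (c' (a + b))\<^sup>2" if "a \<in> ?D" "b \<in> ?D" for a b
  proof -
    let ?r = "hyp (freq N a) (freq N b) / (wavenum N a * wavenum N b)"
    have pos: "0 < wavenum N a * wavenum N b" using that wavenum_pos[OF N] by auto
    have "\<bar>?r\<bar> \<le> 1" using abs_hyp_le[of N a b] pos by (simp add: abs_divide)
    then have r: "?r\<^sup>2 \<le> 1" by (simp add: abs_square_le_1)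
    have "(quad_coeff N E c a b)\<^sup>2 = ?r\<^sup>2 * ((c' (b - a) + c' (a - b) + c' (- a - b) - c' (a + b)) / 2)\<^sup>2"
    proof -
      have "quad_coeff N E c a b = ?r * ((c' (b - a) + c' (a - b) + c' (- a - b) - c' (a + b)) / 2)"
        using that by (simp add: quad_coeff_def tr)
      then show ?thesis by (simp only: power_mult_distrib)
    qed
    also have "\<dots> \<le> 1 * ((c' (b - a) + c' (a - b) + c' (- a - b) - c' (a + b)) / 2)\<^sup>2" by (intro mult_right_mono r) simp
    also have "\<dots> \<le> (c' (b - a))\<^sup>2 + (c' (a - b))\<^sup>2 + (c' (- a - b))\<^sup>2 + (c' (a + b))\<^sup>2" using four by simp
    finally show ?thesis .
  qed
  have i: "(\<Sum>b\<in>?D. (c' (g b))\<^sup>2) \<le> C" if "inj_on g ?D" for g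
    unfolding c'_def C_def by (rule inj_sum_sq_le[OF fD E that])
  have "(\<Sum>a\<in>?D. \<Sum>b\<in>?D. (quad_coeff N E c a b)\<^sup>2) \<le> (\<Sum>a\<in>?D. \<Sum>b\<in>?D. (c' (b - a))\<^sup>2 + (c' (a - b))\<^sup>2 + (c' (- a - b))\<^sup>2 + (c' (a + b))\<^sup>2)"
    by (intro sum_mono q)
  also have "\<dots> = (\<Sum>a\<in>?D. (\<Sum>b\<in>?D. (c' (b - a))\<^sup>2) + (\<Sum>b\<in>?D. (c' (a - b))\<^sup>2) + (\<Sum>b\<in>?D. (c' (- a - b))\<^sup>2) + (\<Sum>b\<in>?D. (c' (a + b))\<^sup>2))"
    by (simp add: sum.distrib)
  also have "\<dots> \<le> (\<Sum>a\<in>?D. C + C + C + C)"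
    by (intro sum_mono add_mono i) (auto simp: inj_on_def)
  also have "\<dots> = real (card ?D) * (4 * C)" by simp
  also have "\<dots> \<le> (9 * (real N)\<^sup>2) * (4 * C)"
  proof (rule mult_right_mono)
    have "card ?D \<le> card (box_modes (int N))"
      by (rule card_mono) (use low_modes_subset_box[OF N] in auto)
    then have "real (card ?D) \<le> real (card (box_modes (int N)))" by simp
    also have "\<dots> \<le> 9 * (real N)\<^sup>2" using card_box_modes_le[of "int N"] N by simp
    finally show "real (card ?D) \<le> 9 * (real N)\<^sup>2" .
  qed (use C0 in simp)
  finally show ?thesis by (simp add: C_def)
qed

context akpz
begin

lemma linear_bound:
  assumes I: "finite I" "low \<subseteq> I" "0 \<notin> I" "\<And>i. i \<in> I \<Longrightarrow> - i \<in> I" and s: "0 \<le> s"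
  shows "(\<integral>\<^sup>+\<omega>. ennreal ((\<Sum>m\<in>I. w m * mode s m \<omega>)\<^sup>2) \<partial>M) \<le> ennreal (\<Sum>m\<in>I. (w m)\<^sup>2)"
proof -
  have "(\<integral>\<^sup>+\<omega>. ennreal ((\<Sum>m\<in>I. w m * mode s m \<omega>)\<^sup>2) \<partial>M) = (\<integral>\<^sup>+\<omega>. ennreal ((\<lambda>z. (\<Sum>m\<in>I. w m * z m)\<^sup>2) (\<lambda>m\<in>I. mode s m \<omega>)) \<partial>M)"
    by simp
  also have "\<dots> \<le> (\<integral>\<^sup>+z. ennreal ((\<Sum>m\<in>I. w m * z m)\<^sup>2) \<partial>std_gauss I)"
    by (rule stationarity_bound[OF I s]) (measurable, auto intro!: tendsto_intros)
  also have "\<dots> = ennreal (\<Sum>m\<in>I. (w m)\<^sup>2)" using std_gauss_linear_moment[OF I(1), of w 0] by simp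
  finally show ?thesis .
qed

text \<open>Because the trace vanishes, Wick's formula leaves only the Hilbert-Schmidt part.\<close>

lemma quadratic_bound:
  assumes I: "finite I" "low \<subseteq> I" "0 \<notin> I" "\<And>i. i \<in> I \<Longrightarrow> - i \<in> I" and s: "0 \<le> s"
    and Q: "\<And>a b. Q a b = Q b a" "(\<Sum>a\<in>I. Q a a) = 0"
  shows "(\<integral>\<^sup>+\<omega>. ennreal ((\<Sum>a\<in>I. \<Sum>b\<in>I. Q a b * mode s a \<omega> * mode s b \<omega>)\<^sup>2) \<partial>M) \<le> ennreal (2 * (\<Sum>a\<in>I. \<Sum>b\<in>I. (Q a b)\<^sup>2))"
proof -
  have "(\<integral>\<^sup>+\<omega>. ennreal ((\<Sum>a\<in>I. \<Sum>b\<in>I. Q a b * mode s a \<omega> * mode s b \<omega>)\<^sup>2) \<partial>M)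
    = (\<integral>\<^sup>+\<omega>. ennreal ((\<lambda>z. (\<Sum>a\<in>I. \<Sum>b\<in>I. Q a b * z a * z b)\<^sup>2) (\<lambda>m\<in>I. mode s m \<omega>)) \<partial>M)"
    by simp
  also have "\<dots> \<le> (\<integral>\<^sup>+z. ennreal ((\<Sum>a\<in>I. \<Sum>b\<in>I. Q a b * z a * z b)\<^sup>2) \<partial>std_gauss I)"
    by (rule stationarity_bound[OF I s]) (measurable, auto intro!: tendsto_intros)
  also have "\<dots> = ennreal (2 * (\<Sum>a\<in>I. \<Sum>b\<in>I. (Q a b)\<^sup>2))" using std_gauss_quadratic_moment[OF I(1) Q(1), where c=0] Q(2) by simp
  finally show ?thesis .
qed

lemma H_trig_sum:
  assumes "is_distribution N (\<lambda>f. H t f \<omega>)" "finite S" "0 \<notin> S"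
  shows "H t (trig_sum N S c) \<omega> = (\<Sum>m\<in>S. c m * (sqrt area / wavenum N m) * mode t m \<omega>)"
  unfolding distribution_trig_sum[OF N assms(2,1)]
proof (intro sum.cong refl)
  fix m assume "m \<in> S"
  then have "m \<noteq> 0" using assms by auto
  then have "0 < wavenum N m" by (rule wavenum_pos[OF N])
  then show "c m * H t (cas N m) \<omega> = c m * (sqrt area / wavenum N m) * mode t m \<omega>"
    using area_pos by (simp add: mode_def)
qed

lemma high_bound:
  assumes S: "finite S" "0 \<notin> S" and s: "0 \<le> s"
  shows "(\<integral>\<^sup>+\<omega>. ennreal ((H s (trig_sum N S c) \<omega>)\<^sup>2) \<partial>M) \<le> ennreal (\<Sum>m\<in>S. (c m)\<^sup>2 * area / (wavenum N m)\<^sup>2)"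
proof -
  \<comment> \<open>The smallest closed system containing \<open>S\<close>: symmetric under negation
    for the pairing, and including all interacting modes.\<close>
  define I where "I = S \<union> uminus ` S \<union> low"
  have I: "finite I" "low \<subseteq> I" "0 \<notin> I" "\<And>i. i \<in> I \<Longrightarrow> - i \<in> I" "S \<subseteq> I"
    using S finite_low_modes[OF N] by (auto simp: I_def low_modes_uminus zero_prod_def)
  define w where "w m = (if m \<in> S then c m * (sqrt area / wavenum N m) else 0)" for m
  have "(\<integral>\<^sup>+\<omega>. ennreal ((H s (trig_sum N S c) \<omega>)\<^sup>2) \<partial>M) = (\<integral>\<^sup>+\<omega>. ennreal ((\<Sum>m\<in>I. w m * mode s m \<omega>)\<^sup>2) \<partial>M)"
  proof (rule nn_integral_cong_AE)
    show "AE \<omega> in M. ennreal ((H s (trig_sum N S c) \<omega>)\<^sup>2) = ennreal ((\<Sum>m\<in>I. w m * mode s m \<omega>)\<^sup>2)"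
      using H_dist
    proof eventually_elim
      case (elim \<omega>)
      have "H s (trig_sum N S c) \<omega> = (\<Sum>m\<in>S. w m * mode s m \<omega>)"
        using H_trig_sum[of s \<omega> S c] elim s S by (simp add: w_def)
      also have "\<dots> = (\<Sum>m\<in>I. w m * mode s m \<omega>)"
        by (rule sum.mono_neutral_left) (use I in \<open>auto simp: w_def\<close>)
      finally show ?case by simp
    qed
  qed
  also have "\<dots> \<le> ennreal (\<Sum>m\<in>I. (w m)\<^sup>2)" by (rule linear_bound[OF I(1-4) s])
  also have "(\<Sum>m\<in>I. (w m)\<^sup>2) = (\<Sum>m\<in>S. (w m)\<^sup>2)"
    by (rule sum.mono_neutral_right) (use I in \<open>auto simp: w_def\<close>)
  also have "\<dots> = (\<Sum>m\<in>S. (c m)\<^sup>2 * area / (wavenum N m)\<^sup>2)"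
    using area_pos by (intro sum.cong refl) (simp add: w_def power_mult_distrib power_divide)
  finally show ?thesis .
qed

text \<open>On the low modes the equation itself is used; a crude Cauchy-Schwarz bound on the time integral
  of the drift is enough.\<close>

lemma low_bound:
  fixes c :: "int \<times> int \<Rightarrow> real"
  assumes S: "finite S" and t: "0 \<le> t"
    and k: "\<And>m. m \<in> S \<Longrightarrow> (wavenum N m)\<^sup>2 \<le> k2"
  defines "C \<equiv> (\<Sum>m\<in>S. (c m)\<^sup>2)"
  shows "\<exists>Y1 Y2. Y1 \<in> borel_measurable M \<and> Y2 \<in> borel_measurable M \<and>
    (AE \<omega> in M. H t (trig_sum N S c) \<omega> - H 0 (trig_sum N S c) \<omega> = Y1 \<omega> + Y2 \<omega>) \<and>
    (\<integral>\<^sup>+\<omega>. ennreal ((Y1 \<omega>)\<^sup>2) \<partial>M) \<le> ennreal (t\<^sup>2 * (k2 * area * C / 2 + 144 * lam\<^sup>2 * (real N)\<^sup>2 * C)) \<and>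
    (\<integral>\<^sup>+\<omega>. ennreal ((Y2 \<omega>)\<^sup>2) \<partial>M) \<le> ennreal (t * area * C)"
proof -
  let ?\<chi> = "trig_sum N S c"
  have \<chi>: "?\<chi> \<in> torus_Ck N n" for n by (rule trig_sum_torus[OF N S])
  have c\<chi>: "continuous_on UNIV ?\<chi>" using torus_Ck_continuous[OF \<chi>] .
  \<comment> \<open>The zero mode is excluded from the system, since it has no stationary law. It
    may still belong to \<open>S\<close>: its Laplacian term vanishes, while the nonlinearity and
    the noise act on it and are counted through \<open>E\<close> and \<open>Y2\<close>.\<close>
  define I where "I = S - {0} \<union> uminus ` (S - {0}) \<union> low"
  have I: "finite I" "low \<subseteq> I" "0 \<notin> I" "\<And>i. i \<in> I \<Longrightarrow> - i \<in> I" "S - {0} \<subseteq> I"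
    using S finite_low_modes[OF N] by (auto simp: I_def low_modes_uminus zero_prod_def)
  define E where "E = S \<inter> low_modes N 1"
  have E: "finite E" using S by (simp add: E_def)
  \<comment> \<open>Half the squared wave number from the Laplacian, times the root of the area over
    the wave number from undoing the normalisation of the mode.\<close>
  define w where "w m = (if m \<in> S - {0} then - (1/2) * c m * wavenum N m * sqrt area else 0)" for m
  define Q where "Q = quad_coeff N E c"
  define G where "G s \<omega> = (\<Sum>m\<in>I. w m * mode s m \<omega>) + lam * (\<Sum>a\<in>I. \<Sum>b\<in>I. Q a b * mode s a \<omega> * mode s b \<omega>)" for s \<omega>
  have QI: "(\<Sum>a\<in>I. \<Sum>b\<in>I. Q a b * x a b) = (\<Sum>a\<in>low. \<Sum>b\<in>low. Q a b * x a b)" for x :: "int \<times> int \<Rightarrow> int \<times> int \<Rightarrow> real"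
  proof -
    have "(\<Sum>a\<in>I. \<Sum>b\<in>I. Q a b * x a b) = (\<Sum>a\<in>low. \<Sum>b\<in>I. Q a b * x a b)"
      by (rule sum.mono_neutral_right) (use I in \<open>auto simp: Q_def quad_coeff_def intro!: sum.neutral\<close>)
    also have "\<dots> = (\<Sum>a\<in>low. \<Sum>b\<in>low. Q a b * x a b)"
      by (intro sum.cong refl sum.mono_neutral_right) (use I in \<open>auto simp: Q_def quad_coeff_def\<close>)
    finally show ?thesis .
  qed
  have Gm: "G s \<in> borel_measurable M" if "0 \<le> s" for s
    unfolding G_def[abs_def] using that
    by (intro borel_measurable_add borel_measurable_sum borel_measurable_times borel_measurable_const mode_measurable)
  have drift: "1 / 2 * H s (laplacian ?\<chi>) \<omega> + lam * distribution_of N (akpz_nonlinearity N (\<lambda>h. H s h \<omega>)) ?\<chi> = G s \<omega>"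
    if d: "is_distribution N (\<lambda>f. H s f \<omega>)" for s \<omega>
  proof -
    have "H s (laplacian ?\<chi>) \<omega> = (\<Sum>m\<in>S. - (wavenum N m)\<^sup>2 * c m * H s (cas N m) \<omega>)"
      unfolding laplacian_trig_sum[OF S] distribution_trig_sum[OF N S d] ..
    also have "\<dots> = (\<Sum>m\<in>S - {0}. - (wavenum N m)\<^sup>2 * c m * H s (cas N m) \<omega>)"
      by (rule sum.mono_neutral_right) (use S in \<open>auto simp: wavenum_def\<close>)
    also have "\<dots> = (\<Sum>m\<in>S - {0}. 2 * (w m * mode s m \<omega>))"
    proof (intro sum.cong refl)
      fix m assume "m \<in> S - {0}"
      then show "- (wavenum N m)\<^sup>2 * c m * H s (cas N m) \<omega> = 2 * (w m * mode s m \<omega>)"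
        using area_pos by (simp add: w_def mode_def power2_eq_square)
    qed
    also have "\<dots> = (\<Sum>m\<in>I. 2 * (w m * mode s m \<omega>))"
      by (rule sum.mono_neutral_left) (use I in \<open>auto simp: w_def\<close>)
    finally have 1: "1 / 2 * H s (laplacian ?\<chi>) \<omega> = (\<Sum>m\<in>I. w m * mode s m \<omega>)"
      by (simp add: sum_distrib_left[symmetric])
    have "distribution_of N (akpz_nonlinearity N (\<lambda>h. H s h \<omega>)) ?\<chi> = (\<Sum>e\<in>S. if e \<in> low_modes N 1 then c e * (\<Sum>a\<in>low. \<Sum>b\<in>low.
        hyp (freq N a) (freq N b) / (wavenum N a * wavenum N b) * triple (- a) (- b) e * mode s a \<omega> * mode s b \<omega>) else 0)"
      using nonlin_pairing[OF d S, of c] unfolding trig_sum_def[abs_def] .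
    also have "\<dots> = (\<Sum>e\<in>E. c e * (\<Sum>a\<in>low. \<Sum>b\<in>low.
        hyp (freq N a) (freq N b) / (wavenum N a * wavenum N b) * triple (- a) (- b) e * mode s a \<omega> * mode s b \<omega>))"
      unfolding E_def by (rule sum.inter_restrict[OF S, symmetric])
    also have "\<dots> = (\<Sum>e\<in>E. \<Sum>a\<in>low. \<Sum>b\<in>low. c e * (hyp (freq N a) (freq N b) / (wavenum N a * wavenum N b)
        * triple (- a) (- b) e * mode s a \<omega> * mode s b \<omega>))"
      by (simp only: sum_distrib_left)
    also have "\<dots> = (\<Sum>a\<in>low. \<Sum>b\<in>low. \<Sum>e\<in>E. c e * (hyp (freq N a) (freq N b) / (wavenum N a * wavenum N b)
        * triple (- a) (- b) e * mode s a \<omega> * mode s b \<omega>))"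
      by (subst sum.swap) (intro sum.cong refl sum.swap)
    also have "\<dots> = (\<Sum>a\<in>low. \<Sum>b\<in>low. Q a b * (mode s a \<omega> * mode s b \<omega>))"
      by (intro sum.cong refl) (simp add: Q_def quad_coeff_def sum_distrib_left sum_distrib_right sum_divide_distrib mult_ac)
    also have "\<dots> = (\<Sum>a\<in>I. \<Sum>b\<in>I. Q a b * mode s a \<omega> * mode s b \<omega>)"
      unfolding QI[symmetric] by (simp add: mult.assoc)
    finally show ?thesis unfolding G_def 1 by simp
  qed
  have EG: "(\<integral>\<^sup>+\<omega>. ennreal ((G s \<omega>)\<^sup>2) \<partial>M) \<le> ennreal (k2 * area * C / 2 + 144 * lam\<^sup>2 * (real N)\<^sup>2 * C)" if s: "0 \<le> s" for s
  proof -
    let ?l = "\<lambda>\<omega>. \<Sum>m\<in>I. w m * mode s m \<omega>" and ?n = "\<lambda>\<omega>. \<Sum>a\<in>I. \<Sum>b\<in>I. Q a b * mode s a \<omega> * mode s b \<omega>"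
    have lm: "?l \<in> borel_measurable M" "?n \<in> borel_measurable M"
      using s by (intro borel_measurable_sum borel_measurable_times borel_measurable_const mode_measurable; simp)+
    have "(G s \<omega>)\<^sup>2 \<le> 2 * (?l \<omega>)\<^sup>2 + 2 * lam\<^sup>2 * (?n \<omega>)\<^sup>2" for \<omega>
      unfolding G_def using sum_squares_bound[of "?l \<omega>" "lam * ?n \<omega>"] by (simp add: power2_sum power_mult_distrib mult.assoc)
    then have "(\<integral>\<^sup>+\<omega>. ennreal ((G s \<omega>)\<^sup>2) \<partial>M) \<le> (\<integral>\<^sup>+\<omega>. ennreal 2 * ennreal ((?l \<omega>)\<^sup>2) + ennreal (2 * lam\<^sup>2) * ennreal ((?n \<omega>)\<^sup>2) \<partial>M)"
      by (intro nn_integral_mono) (simp add: ennreal_mult[symmetric] ennreal_plus[symmetric] ennreal_leI del: ennreal_plus ennreal_numeral)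
    also have "\<dots> = ennreal 2 * (\<integral>\<^sup>+\<omega>. ennreal ((?l \<omega>)\<^sup>2) \<partial>M) + ennreal (2 * lam\<^sup>2) * (\<integral>\<^sup>+\<omega>. ennreal ((?n \<omega>)\<^sup>2) \<partial>M)"
    proof -
      have m: "(\<lambda>\<omega>. ennreal ((?l \<omega>)\<^sup>2)) \<in> borel_measurable M" "(\<lambda>\<omega>. ennreal ((?n \<omega>)\<^sup>2)) \<in> borel_measurable M"
        using lm by (auto intro!: measurable_compose[OF _ measurable_ennreal] borel_measurable_power)
      have "(\<lambda>\<omega>. ennreal 2 * ennreal ((?l \<omega>)\<^sup>2)) \<in> borel_measurable M" "(\<lambda>\<omega>. ennreal (2 * lam\<^sup>2) * ennreal ((?n \<omega>)\<^sup>2)) \<in> borel_measurable M"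
        by (rule borel_measurable_times_ennreal[OF _ m(1)], simp) (rule borel_measurable_times_ennreal[OF _ m(2)], simp)
      from nn_integral_add[OF this] show ?thesis
        by (simp only: nn_integral_cmult[OF m(1)] nn_integral_cmult[OF m(2)])
    qed
    \<comment> \<open>72 is twice the 36 of \<open>quad_coeff_sq_le\<close>, the 2 being that of
      Wick's formula; doubling once more for the square of a sum gives the 144 in the
      conclusion.\<close>
    also have "\<dots> \<le> ennreal 2 * ennreal (k2 * area * C / 4) + ennreal (2 * lam\<^sup>2) * ennreal (72 * (real N)\<^sup>2 * C)"
    proof (intro add_mono mult_left_mono)
      have "(\<integral>\<^sup>+\<omega>. ennreal ((?l \<omega>)\<^sup>2) \<partial>M) \<le> ennreal (\<Sum>m\<in>I. (w m)\<^sup>2)" by (rule linear_bound[OF I(1-4) s])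
      also have "(\<Sum>m\<in>I. (w m)\<^sup>2) \<le> k2 * area * C / 4"
      proof -
        have "(\<Sum>m\<in>I. (w m)\<^sup>2) = (\<Sum>m\<in>S - {0}. (w m)\<^sup>2)"
          by (rule sum.mono_neutral_right) (use I in \<open>auto simp: w_def\<close>)
        also have "\<dots> \<le> (\<Sum>m\<in>S - {0}. k2 * area / 4 * (c m)\<^sup>2)"
        proof (rule sum_mono)
          fix m assume m: "m \<in> S - {0}"
          have "(w m)\<^sup>2 = (wavenum N m)\<^sup>2 * (area / 4 * (c m)\<^sup>2)"
            using m area_pos by (simp add: w_def power_mult_distrib power_divide)
          also have "\<dots> \<le> k2 * (area / 4 * (c m)\<^sup>2)" using k m area_pos by (intro mult_right_mono) auto
          finally show "(w m)\<^sup>2 \<le> k2 * area / 4 * (c m)\<^sup>2" by simp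
        qed
        also have "\<dots> \<le> (\<Sum>m\<in>S. k2 * area / 4 * (c m)\<^sup>2)"
        proof (rule sum_mono2[OF S])
          fix m assume "m \<in> S - (S - {0})"
          then have "m \<in> S" by auto
          have "0 \<le> k2" using k[OF \<open>m \<in> S\<close>] zero_le_power2[of "wavenum N m"] by linarith
          then show "0 \<le> k2 * area / 4 * (c m)\<^sup>2" using area_pos by simp
        qed auto
        also have "\<dots> = k2 * area * C / 4" by (simp add: C_def sum_distrib_left sum_divide_distrib)
        finally show ?thesis .
      qed
      finally show "(\<integral>\<^sup>+\<omega>. ennreal ((?l \<omega>)\<^sup>2) \<partial>M) \<le> ennreal (k2 * area * C / 4)" by (simp add: ennreal_leI)
      have QQ: "(\<Sum>a\<in>I. \<Sum>b\<in>I. (Q a b)\<^sup>2) = (\<Sum>a\<in>low. \<Sum>b\<in>low. (Q a b)\<^sup>2)"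
        using QI[of Q] by (simp add: power2_eq_square)
      have tr: "(\<Sum>a\<in>I. Q a a) = 0"
      proof -
        have "(\<Sum>a\<in>I. Q a a) = (\<Sum>a\<in>low. Q a a)"
          by (rule sum.mono_neutral_right) (use I in \<open>auto simp: Q_def quad_coeff_def\<close>)
        then show ?thesis unfolding Q_def quad_coeff_trace[OF N] .
      qed
      have "(\<integral>\<^sup>+\<omega>. ennreal ((?n \<omega>)\<^sup>2) \<partial>M) \<le> ennreal (2 * (\<Sum>a\<in>I. \<Sum>b\<in>I. (Q a b)\<^sup>2))"
        by (rule quadratic_bound[where Q = Q, OF I(1-4) s _ tr]) (assumption, unfold Q_def, rule quad_coeff_sym)
      also have "\<dots> \<le> ennreal (72 * (real N)\<^sup>2 * C)"
      proof (rule ennreal_leI)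
        have "(\<Sum>e\<in>E. (c e)\<^sup>2) \<le> C" unfolding C_def by (rule sum_mono2[OF S]) (auto simp: E_def)
        then have "36 * (real N)\<^sup>2 * (\<Sum>e\<in>E. (c e)\<^sup>2) \<le> 36 * (real N)\<^sup>2 * C" by (intro mult_left_mono) auto
        then show "2 * (\<Sum>a\<in>I. \<Sum>b\<in>I. (Q a b)\<^sup>2) \<le> 72 * (real N)\<^sup>2 * C"
          unfolding QQ using quad_coeff_sq_le[OF N E, of c] unfolding Q_def by linarith
      qed
      finally show "(\<integral>\<^sup>+\<omega>. ennreal ((?n \<omega>)\<^sup>2) \<partial>M) \<le> ennreal (72 * (real N)\<^sup>2 * C)" .
    qed auto
    also have "\<dots> = ennreal (k2 * area * C / 2 + 144 * lam\<^sup>2 * (real N)\<^sup>2 * C)"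
    proof -
      have C0: "0 \<le> C" unfolding C_def by (intro sum_nonneg) simp
      have kC: "0 \<le> k2 * area * C"
      proof (cases "S = {}")
        case False
        then obtain m where "m \<in> S" by auto
        then have "0 \<le> k2" using k[of m] zero_le_power2[of "wavenum N m"] by linarith
        then show ?thesis using C0 area_pos by simp
      qed (simp add: C_def)
      have "ennreal 2 * ennreal (k2 * area * C / 4) + ennreal (2 * lam\<^sup>2) * ennreal (72 * (real N)\<^sup>2 * C)
        = ennreal (2 * (k2 * area * C / 4) + 2 * lam\<^sup>2 * (72 * (real N)\<^sup>2 * C))"
        proof -
        have n: "0 \<le> k2 * area * C / 4" "0 \<le> 72 * (real N)\<^sup>2 * C" using C0 kC by simp_all
        then show ?thesis
          unfolding ennreal_mult[of 2, OF _ n(1), simplified, symmetric] by (simp only: ennreal_mult'[symmetric] ennreal_plus mult_nonneg_nonneg zero_le_power2 zero_le_numeral)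
      qed
      also have "2 * (k2 * area * C / 4) + 2 * lam\<^sup>2 * (72 * (real N)\<^sup>2 * C) = k2 * area * C / 2 + 144 * lam\<^sup>2 * (real N)\<^sup>2 * C"
        by simp
      finally show ?thesis .
    qed
    finally show ?thesis .
  qed
  \<comment> \<open>\<open>Y2\<close> is the noise part. \<open>Y1\<close> is defined as what
    remains of the increment, which makes its measurability immediate; it equals the time integral
    of the drift almost surely.\<close>
  define Y2 where "Y2 = \<xi> (strip t ?\<chi>)"
  define Y1 where "Y1 \<omega> = H t ?\<chi> \<omega> - H 0 ?\<chi> \<omega> - Y2 \<omega>" for \<omega>
  have L2: "strip t ?\<chi> \<in> space_time_L2 N" by (rule strip_L2[OF c\<chi> t])
  have Y2m: "Y2 \<in> borel_measurable M" unfolding Y2_def by (rule centred_gaussian_family_measurable[OF xi_family L2])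
  have Y1m: "Y1 \<in> borel_measurable M" unfolding Y1_def[abs_def]
    by (intro borel_measurable_diff H_measurable t \<chi> Y2m) simp
  have Y1: "AE \<omega> in M. Y1 \<omega> = integral {0..t} (\<lambda>s. G s \<omega>)"
    using H_eq[OF \<chi> t] H_init[OF \<chi>] H_dist
  proof eventually_elim
    case (elim \<omega>)
    have "integral {0..t} (\<lambda>s. 1 / 2 * H s (laplacian ?\<chi>) \<omega> + lam * distribution_of N (akpz_nonlinearity N (\<lambda>h. H s h \<omega>)) ?\<chi>) = integral {0..t} (\<lambda>s. G s \<omega>)"
      by (rule Henstock_Kurzweil_Integration.integral_cong) (use elim(3) drift in auto)
    then show ?case using elim(1,2) by (simp add: Y1_def Y2_def)
  qed
  have Gc: "AE \<omega> in M. continuous_on {0..t} (\<lambda>s. G s \<omega>)"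
    using H_cont
  proof eventually_elim
    case (elim \<omega>)
    have "continuous_on {0..} (\<lambda>s. H s (cas N i) \<omega>)" for i using elim cas_C by blast
    then have "continuous_on {0..t} (\<lambda>s. H s (cas N i) \<omega>)" for i by (rule continuous_on_subset) auto
    then have "continuous_on {0..t} (\<lambda>s. mode s i \<omega>)" for i
      unfolding mode_def by (intro continuous_on_mult continuous_on_const)
    then show ?case unfolding G_def by (intro continuous_on_add continuous_on_sum continuous_on_mult continuous_on_const)
  qed
  have C0: "0 \<le> C" unfolding C_def by (intro sum_nonneg) simp
  have B0: "0 \<le> k2 * area * C / 2 + 144 * lam\<^sup>2 * (real N)\<^sup>2 * C"
  proof (cases "S = {}")
    case False
    then obtain m where "m \<in> S" by auto
    then have "0 \<le> k2" using k[of m] zero_le_power2[of "wavenum N m"] by linarith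
    then show ?thesis using C0 area_pos by simp
  qed (simp add: C_def)
  have b1: "(\<integral>\<^sup>+\<omega>. ennreal ((Y1 \<omega>)\<^sup>2) \<partial>M) \<le> ennreal (t\<^sup>2 * (k2 * area * C / 2 + 144 * lam\<^sup>2 * (real N)\<^sup>2 * C))"
    by (rule nn_integral_time_integral_le[OF t Gm Gc EG B0 Y1])
  have b2: "(\<integral>\<^sup>+\<omega>. ennreal ((Y2 \<omega>)\<^sup>2) \<partial>M) \<le> ennreal (t * area * C)"
  proof -
    have "integrable M (\<lambda>\<omega>. (Y2 \<omega>)\<^sup>2)"
      using centred_gaussian_family_prod_integrable[OF P xi_family L2 L2] by (simp add: Y2_def power2_eq_square)
    then have "(\<integral>\<^sup>+\<omega>. ennreal ((Y2 \<omega>)\<^sup>2) \<partial>M) = ennreal (LINT \<omega>|M. (Y2 \<omega>)\<^sup>2)" by (intro nn_integral_eq_integral) auto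
    also have "(LINT \<omega>|M. (Y2 \<omega>)\<^sup>2) = t * area * C"
      using xi_cov[OF c\<chi> c\<chi> t t] trig_sum_product[OF N S, of c c] by (simp add: Y2_def power2_eq_square C_def)
    finally show ?thesis by simp
  qed
  show ?thesis
    using Y1m Y2m b1 b2 by (intro exI[of _ Y1] exI[of _ Y2]) (simp add: Y1_def)
qed

end

section \<open>Increments\<close>

lemma nn_integral_square_sum4:
  fixes Y1 Y2 Y3 Y4 :: "'a \<Rightarrow> real"
  assumes m[measurable]: "Y1 \<in> borel_measurable M" "Y2 \<in> borel_measurable M" "Y3 \<in> borel_measurable M" "Y4 \<in> borel_measurable M"
    and D: "AE \<omega> in M. D \<omega> = Y1 \<omega> + Y2 \<omega> + Y3 \<omega> - Y4 \<omega>"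
    and b: "(\<integral>\<^sup>+\<omega>. ennreal ((Y1 \<omega>)\<^sup>2) \<partial>M) \<le> ennreal b1" "(\<integral>\<^sup>+\<omega>. ennreal ((Y2 \<omega>)\<^sup>2) \<partial>M) \<le> ennreal b2"
      "(\<integral>\<^sup>+\<omega>. ennreal ((Y3 \<omega>)\<^sup>2) \<partial>M) \<le> ennreal b3" "(\<integral>\<^sup>+\<omega>. ennreal ((Y4 \<omega>)\<^sup>2) \<partial>M) \<le> ennreal b4"
    and nn: "0 \<le> b1" "0 \<le> b2" "0 \<le> b3" "0 \<le> b4"
  shows "(\<integral>\<^sup>+\<omega>. ennreal ((D \<omega>)\<^sup>2) \<partial>M) \<le> ennreal (4 * (b1 + b2 + b3 + b4))"
proof -
  have sq: "(x + y + z - w)\<^sup>2 \<le> 4 * (x\<^sup>2 + y\<^sup>2 + z\<^sup>2 + w\<^sup>2)" for x y z w :: real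
  proof -
    have "4 * (x\<^sup>2 + y\<^sup>2 + z\<^sup>2 + w\<^sup>2) - (x + y + z - w)\<^sup>2 = (x - y)\<^sup>2 + (x - z)\<^sup>2 + (x + w)\<^sup>2 + (y - z)\<^sup>2 + (y + w)\<^sup>2 + (z + w)\<^sup>2" by algebra
    then show ?thesis by (smt (verit) zero_le_power2)
  qed
  have "(\<integral>\<^sup>+\<omega>. ennreal ((D \<omega>)\<^sup>2) \<partial>M) \<le> (\<integral>\<^sup>+\<omega>. ennreal 4 * (ennreal ((Y1 \<omega>)\<^sup>2) + ennreal ((Y2 \<omega>)\<^sup>2) + ennreal ((Y3 \<omega>)\<^sup>2) + ennreal ((Y4 \<omega>)\<^sup>2)) \<partial>M)"
  proof (rule nn_integral_mono_AE)
    show "AE \<omega> in M. ennreal ((D \<omega>)\<^sup>2) \<le> ennreal 4 * (ennreal ((Y1 \<omega>)\<^sup>2) + ennreal ((Y2 \<omega>)\<^sup>2) + ennreal ((Y3 \<omega>)\<^sup>2) + ennreal ((Y4 \<omega>)\<^sup>2))"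
      using D
    proof eventually_elim
      case (elim \<omega>)
      then show ?case using sq[of "Y1 \<omega>" "Y2 \<omega>" "Y3 \<omega>" "Y4 \<omega>"]
        by (simp add: ennreal_mult[symmetric] ennreal_plus[symmetric] ennreal_leI del: ennreal_plus ennreal_numeral)
    qed
  qed
  also have "\<dots> = ennreal 4 * ((\<integral>\<^sup>+\<omega>. ennreal ((Y1 \<omega>)\<^sup>2) \<partial>M) + (\<integral>\<^sup>+\<omega>. ennreal ((Y2 \<omega>)\<^sup>2) \<partial>M) + (\<integral>\<^sup>+\<omega>. ennreal ((Y3 \<omega>)\<^sup>2) \<partial>M) + (\<integral>\<^sup>+\<omega>. ennreal ((Y4 \<omega>)\<^sup>2) \<partial>M))"
    by (simp add: nn_integral_cmult nn_integral_add del: ennreal_numeral)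
  also have "\<dots> \<le> ennreal 4 * (ennreal b1 + ennreal b2 + ennreal b3 + ennreal b4)"
    by (intro mult_left_mono add_mono b) auto
  also have "\<dots> = ennreal (4 * (b1 + b2 + b3 + b4))"
    using nn by (simp add: ennreal_mult[symmetric] ennreal_plus[symmetric] del: ennreal_plus ennreal_numeral)
  finally show ?thesis .
qed

lemma torus_area_eq: "torus_area N = 4 * pi\<^sup>2 * (real N)\<^sup>2"
  by (simp add: torus_area_def power_mult_distrib)

text \<open>Numerical room for the constants: 36 N^2 is at most the area, which absorbs the mode
  count 9 N^2, and 144 * 9 = 16 * 81 \<le> 16 \<pi>^4, which absorbs the constant of the
  nonlinearity.\<close>

lemma pi_power_bounds: "36 \<le> 4 * pi\<^sup>2" "81 \<le> pi ^ 4"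
proof -
  have "3 ^ 2 \<le> pi ^ 2" "3 ^ 4 \<le> pi ^ 4" using pi_gt3 by (intro power_mono; simp)+
  then show "36 \<le> 4 * pi\<^sup>2" "81 \<le> pi ^ 4" by simp_all
qed

context akpz
begin

text \<open>Up to wave numbers of order 1 the coefficients are bounded uniformly, by
  \<open>C1\<close> over the area, and the lattice sum is logarithmic. Outside the box of half-side
  N the wave number is at least 1, and the square sum of the coefficients, that is, Parseval,
  suffices.\<close>

lemma high_sum:
  fixes c :: "int \<times> int \<Rightarrow> real" and L :: nat
  assumes fin: "finite S" and L: "1 \<le> L" "L \<le> N" and S: "S \<inter> box_modes (int L) = {}"
    and C1: "\<And>m. m \<in> S \<Longrightarrow> \<bar>c m\<bar> * area \<le> C1" and C2: "(\<Sum>m\<in>S. (c m)\<^sup>2) * area \<le> C2"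
  shows "(\<Sum>m\<in>S. (c m)\<^sup>2 * area / (wavenum N m)\<^sup>2) \<le> C1\<^sup>2 * ln (real N / real L) + C2"
proof -
  let ?B = "box_modes (int N)"
  have NL: "1 \<le> real N / real L" using L by simp
  have "(\<Sum>m\<in>S. (c m)\<^sup>2 * area / (wavenum N m)\<^sup>2) = (\<Sum>m\<in>S \<inter> ?B. (c m)\<^sup>2 * area / (wavenum N m)\<^sup>2) + (\<Sum>m\<in>S - ?B. (c m)\<^sup>2 * area / (wavenum N m)\<^sup>2)"
    by (rule sum.Int_Diff[OF fin])
  also have "(\<Sum>m\<in>S \<inter> ?B. (c m)\<^sup>2 * area / (wavenum N m)\<^sup>2) \<le> C1\<^sup>2 * ln (real N / real L)"
  proof -
    have pos: "0 < sqlen m" if "m \<in> S" for m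
    proof -
      have "m \<notin> box_modes (int L)" using that S by auto
      then have "(real L + 1)\<^sup>2 \<le> sqlen m" using sqlen_outside_box[of "int L" m] by simp
      moreover have "0 < (real L + 1)\<^sup>2" by simp
      ultimately show ?thesis by linarith
    qed
    \<comment> \<open>The 36 comes from comparing N^2 with the area; together with the 8 of the
      lattice sum it gives a factor 8/36, below 1.\<close>
    have "(\<Sum>m\<in>S \<inter> ?B. (c m)\<^sup>2 * area / (wavenum N m)\<^sup>2) \<le> (\<Sum>m\<in>S \<inter> ?B. C1\<^sup>2 / 36 * (1 / sqlen m))"
    proof (rule sum_mono)
      fix m assume m: "m \<in> S \<inter> ?B"
      have "(\<bar>c m\<bar> * area)\<^sup>2 \<le> C1\<^sup>2" using C1[of m] m area_pos by (intro power_mono) auto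
      then have c: "(c m)\<^sup>2 * area\<^sup>2 \<le> C1\<^sup>2" by (simp add: power_mult_distrib)
      have "36 * (real N)\<^sup>2 \<le> area" unfolding torus_area_eq using pi_power_bounds(1) by (intro mult_right_mono) auto
      then have N2: "(real N)\<^sup>2 / area \<le> 1 / 36" using area_pos by (simp add: field_simps)
      have "(c m)\<^sup>2 * area / (wavenum N m)\<^sup>2 = ((c m)\<^sup>2 * area\<^sup>2) * ((real N)\<^sup>2 / area) * (1 / sqlen m)"
        using pos[of m] m area_pos N by (simp add: wavenum_sqlen power2_eq_square[of area])
      also have "\<dots> \<le> C1\<^sup>2 * (1 / 36) * (1 / sqlen m)"
        using c N2 pos[of m] m area_pos by (intro mult_right_mono mult_mono) auto
      finally show "(c m)\<^sup>2 * area / (wavenum N m)\<^sup>2 \<le> C1\<^sup>2 / 36 * (1 / sqlen m)" by simp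
    qed
    also have "\<dots> = C1\<^sup>2 / 36 * (\<Sum>m\<in>S \<inter> ?B. 1 / sqlen m)" by (simp add: sum_distrib_left)
    also have "\<dots> \<le> C1\<^sup>2 / 36 * (\<Sum>m\<in>?B - box_modes (int L). 1 / sqlen m)"
      by (intro mult_left_mono sum_mono2) (use S in \<open>auto simp: sqlen_def\<close>)
    also have "\<dots> \<le> C1\<^sup>2 / 36 * (8 * ln (real N / real L))"
      by (intro mult_left_mono lattice_sum_log L) auto
    also have "\<dots> \<le> C1\<^sup>2 * ln (real N / real L)"
    proof -
      have "0 \<le> C1\<^sup>2 * ln (real N / real L)" using NL by simp
      then show ?thesis by (simp add: field_simps)
    qed
    finally show ?thesis .
  qed
  also have "(\<Sum>m\<in>S - ?B. (c m)\<^sup>2 * area / (wavenum N m)\<^sup>2) \<le> C2"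
  proof -
    have "(\<Sum>m\<in>S - ?B. (c m)\<^sup>2 * area / (wavenum N m)\<^sup>2) \<le> (\<Sum>m\<in>S - ?B. (c m)\<^sup>2 * area)"
    proof (rule sum_mono)
      fix m assume m: "m \<in> S - ?B"
      have "(real N)\<^sup>2 \<le> (real N + 1)\<^sup>2" by (intro power_mono) auto
      also have "\<dots> \<le> sqlen m" using sqlen_outside_box[of "int N" m] m by simp
      finally have "1 \<le> (wavenum N m)\<^sup>2" using N by (simp add: wavenum_sqlen)
      then show "(c m)\<^sup>2 * area / (wavenum N m)\<^sup>2 \<le> (c m)\<^sup>2 * area"
        using area_pos divide_left_mono[of 1 "(wavenum N m)\<^sup>2" "(c m)\<^sup>2 * area"] by (cases "wavenum N m = 0") auto
    qed
    also have "\<dots> \<le> (\<Sum>m\<in>S. (c m)\<^sup>2 * area)" by (rule sum_mono2) (use fin area_pos in auto)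
    also have "\<dots> \<le> C2" using C2 by (simp add: sum_distrib_right)
    finally show ?thesis .
  qed
  finally show ?thesis by simp
qed

text \<open>\<open>C1\<close> bounds the individual Fourier coefficients and \<open>C2\<close> the
  square norm of the test function, so the estimate depends on neither \<open>K\<close> nor
  \<open>N\<close>. A lattice square of half-side about N/R stands in for the disc of wave numbers
  below 1/R.\<close>

lemma increment_bound:
  fixes c :: "int \<times> int \<Rightarrow> real"
  assumes t: "0 \<le> t" "t \<le> R" and R: "1 \<le> R" "R \<le> real N"
    and C1: "\<And>m. m \<in> box_modes K \<Longrightarrow> \<bar>c m\<bar> * area \<le> C1" "0 \<le> C1" and C2: "(\<Sum>m\<in>box_modes K. (c m)\<^sup>2) * area \<le> C2"
  defines "p \<equiv> trig_sum N (box_modes K) c"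
  shows "(\<integral>\<^sup>+\<omega>. ennreal ((H t p \<omega> - H 0 p \<omega>)\<^sup>2) \<partial>M)
    \<le> ennreal (8 * C1\<^sup>2 + 4 * lam\<^sup>2 * C1\<^sup>2 + 8 * C1\<^sup>2 * ln (2 * R) + 8 * C2)"
proof -
  \<comment> \<open>\<open>L\<close> is the integer part of N/R. Since N/R \<ge> 1, rounding loses
    at most a factor 2; this is the 2 in ln(2R).\<close>
  define x where "x = real N / R"
  have x: "1 \<le> x" using R by (simp add: x_def)
  define L where "L = nat \<lfloor>x\<rfloor>"
  have L: "1 \<le> L" "real L \<le> x" "x / 2 \<le> real L"
  proof -
    have f1: "1 \<le> \<lfloor>x\<rfloor>" using x by simp
    then have f: "real L = of_int \<lfloor>x\<rfloor>" by (simp add: L_def)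
    show "1 \<le> L" using f1 unfolding L_def by linarith
    show "real L \<le> x" unfolding f by linarith
    have "1 \<le> real_of_int \<lfloor>x\<rfloor>" using f1 by simp
    then show "x / 2 \<le> real L" unfolding f by linarith
  qed
  have xN: "x \<le> real N" unfolding x_def using R by (simp add: field_simps)
  have LN: "L \<le> N" using L xN by linarith
  have NL: "real N / real L \<le> 2 * R"
  proof -
    have "0 < real L" using L(1) by simp
    moreover have "real N \<le> 2 * R * real L" using L(3) R by (simp add: x_def field_simps)
    ultimately show ?thesis by (simp add: divide_le_eq)
  qed
  define S1 where "S1 = box_modes K \<inter> box_modes (int L)"
  define S2 where "S2 = box_modes K - box_modes (int L)"
  have fin: "finite S1" "finite S2" by (auto simp: S1_def S2_def)
  have S2: "S2 \<inter> box_modes (int L) = {}" "0 \<notin> S2" by (auto simp: S2_def box_modes_def zero_prod_def)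
  have pe: "p = (\<lambda>x. 1 * trig_sum N S1 c x + 1 * trig_sum N S2 c x)"
    unfolding p_def S1_def S2_def trig_sum_def by (simp add: fun_eq_iff sum.Int_Diff[OF finite_box_modes, of _ K "box_modes (int L)"])
  define C where "C = (\<Sum>m\<in>S1. (c m)\<^sup>2)"
  have C0: "0 \<le> C" unfolding C_def by (intro sum_nonneg) simp
  \<comment> \<open>Uniform coefficient bound times the number of low modes, at most 9 L^2 \<le> 9
    x^2.\<close>
  have Cb: "C * area\<^sup>2 \<le> 9 * x\<^sup>2 * C1\<^sup>2"
  proof -
    have "C * area\<^sup>2 = (\<Sum>m\<in>S1. (\<bar>c m\<bar> * area)\<^sup>2)" by (simp add: C_def sum_distrib_right power_mult_distrib)
    also have "\<dots> \<le> (\<Sum>m\<in>S1. C1\<^sup>2)"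
      using C1 area_pos by (intro sum_mono power_mono) (auto simp: S1_def)
    also have "\<dots> = real (card S1) * C1\<^sup>2" by simp
    also have "\<dots> \<le> (9 * x\<^sup>2) * C1\<^sup>2"
    proof (rule mult_right_mono)
      have "card S1 \<le> card (box_modes (int L))" by (rule card_mono) (auto simp: S1_def)
      then have "real (card S1) \<le> real (card (box_modes (int L)))" by simp
      also have "\<dots> \<le> 9 * (real L)\<^sup>2" using card_box_modes_le[of "int L"] L by simp
      also have "\<dots> \<le> 9 * x\<^sup>2" using L(2) by (intro mult_left_mono power_mono) auto
      finally show "real (card S1) \<le> 9 * x\<^sup>2" .
    qed simp
    finally show ?thesis .
  qed
  have xR: "x\<^sup>2 * R\<^sup>2 = (real N)\<^sup>2" using R by (simp add: x_def power_divide)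
  have R2: "0 < R\<^sup>2" "1 \<le> R\<^sup>2" using R by (auto simp: one_le_power)
  have AC: "area * C * R\<^sup>2 \<le> C1\<^sup>2"
  proof -
    have "area * (area * C * R\<^sup>2) = (C * area\<^sup>2) * R\<^sup>2" by (simp add: power2_eq_square)
    also have "\<dots> \<le> (9 * x\<^sup>2 * C1\<^sup>2) * R\<^sup>2" using Cb by (intro mult_right_mono) auto
    also have "\<dots> = 9 * (real N)\<^sup>2 * C1\<^sup>2" unfolding xR[symmetric] by simp
    also have "\<dots> \<le> area * C1\<^sup>2" unfolding torus_area_eq using pi_power_bounds(1) by (intro mult_right_mono) auto
    finally show ?thesis using area_pos by simp
  qed
  \<comment> \<open>Here 144 * 9 is written as 16 * 81, and 16 \<pi>^4 N^4 is the square of the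
    area.\<close>
  have NC: "144 * (real N)\<^sup>2 * C * R\<^sup>2 \<le> C1\<^sup>2"
  proof -
    have "area\<^sup>2 * (144 * (real N)\<^sup>2 * C * R\<^sup>2) = 144 * (real N)\<^sup>2 * (C * area\<^sup>2) * R\<^sup>2" by simp
    also have "\<dots> \<le> 144 * (real N)\<^sup>2 * (9 * x\<^sup>2 * C1\<^sup>2) * R\<^sup>2" using Cb by (intro mult_right_mono mult_left_mono) auto
    also have "\<dots> = 16 * (real N)\<^sup>2 * (81 * (real N)\<^sup>2) * C1\<^sup>2" unfolding xR[symmetric] by simp
    also have "\<dots> \<le> 16 * (real N)\<^sup>2 * (pi ^ 4 * (real N)\<^sup>2) * C1\<^sup>2"
      using pi_power_bounds(2) by (intro mult_right_mono mult_left_mono) auto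
    also have "\<dots> = area\<^sup>2 * C1\<^sup>2" unfolding torus_area_eq by (simp add: power2_eq_square eval_nat_numeral)
    finally show ?thesis using area_pos by simp
  qed
  have k: "(wavenum N m)\<^sup>2 \<le> 2 / R\<^sup>2" if "m \<in> S1" for m
  proof -
    have "sqlen m \<le> 2 * (real L)\<^sup>2" using that sqlen_inside_box[of m "int L"] by (simp add: S1_def)
    also have "\<dots> \<le> 2 * x\<^sup>2" using L(2) by (intro mult_left_mono power_mono) auto
    finally have "sqlen m / (real N)\<^sup>2 \<le> 2 * x\<^sup>2 / (real N)\<^sup>2" by (intro divide_right_mono) auto
    also have "\<dots> = 2 / R\<^sup>2" unfolding xR[symmetric] using x R by simp
    finally show ?thesis by (simp add: wavenum_sqlen)
  qed
  have tR: "t\<^sup>2 \<le> R\<^sup>2" using t by (intro power_mono) auto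
  obtain Y1 Y2 where Y: "Y1 \<in> borel_measurable M" "Y2 \<in> borel_measurable M"
    "AE \<omega> in M. H t (trig_sum N S1 c) \<omega> - H 0 (trig_sum N S1 c) \<omega> = Y1 \<omega> + Y2 \<omega>"
    "(\<integral>\<^sup>+\<omega>. ennreal ((Y1 \<omega>)\<^sup>2) \<partial>M) \<le> ennreal (t\<^sup>2 * (2 / R\<^sup>2 * area * C / 2 + 144 * lam\<^sup>2 * (real N)\<^sup>2 * C))"
    "(\<integral>\<^sup>+\<omega>. ennreal ((Y2 \<omega>)\<^sup>2) \<partial>M) \<le> ennreal (t * area * C)"
    using low_bound[OF fin(1) t(1) k, of c] unfolding C_def by blast
  have b1: "t\<^sup>2 * (2 / R\<^sup>2 * area * C / 2 + 144 * lam\<^sup>2 * (real N)\<^sup>2 * C) \<le> C1\<^sup>2 + lam\<^sup>2 * C1\<^sup>2"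
  proof -
    have "t\<^sup>2 * (2 / R\<^sup>2 * area * C / 2 + 144 * lam\<^sup>2 * (real N)\<^sup>2 * C) \<le> R\<^sup>2 * (2 / R\<^sup>2 * area * C / 2 + 144 * lam\<^sup>2 * (real N)\<^sup>2 * C)"
      using tR C0 area_pos by (intro mult_right_mono) auto
    also have "\<dots> = area * C + lam\<^sup>2 * (144 * (real N)\<^sup>2 * C * R\<^sup>2)" using R2 by (simp add: distrib_left)
    also have "\<dots> \<le> C1\<^sup>2 + lam\<^sup>2 * C1\<^sup>2"
    proof (intro add_mono mult_left_mono NC)
      have "area * C * 1 \<le> area * C * R\<^sup>2" using R2 C0 area_pos by (intro mult_left_mono) auto
      then show "area * C \<le> C1\<^sup>2" using AC by simp
    qed simp
    finally show ?thesis .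
  qed
  \<comment> \<open>The noise costs only a factor t, and t \<le> R \<le> R^2.\<close>
  have b2: "t * area * C \<le> C1\<^sup>2"
  proof -
    have "t \<le> R\<^sup>2" using t R mult_left_mono[of 1 R R] unfolding power2_eq_square by linarith
    then have "t * (area * C) \<le> R\<^sup>2 * (area * C)" using C0 area_pos by (intro mult_right_mono) auto
    then show ?thesis using AC by (simp add: mult_ac)
  qed
  define h where "h = C1\<^sup>2 * ln (2 * R) + C2"
  have hs: "(\<Sum>m\<in>S2. (c m)\<^sup>2 * area / (wavenum N m)\<^sup>2) \<le> h"
  proof -
    have "(\<Sum>m\<in>S2. (c m)\<^sup>2) * area \<le> (\<Sum>m\<in>box_modes K. (c m)\<^sup>2) * area"
      using area_pos by (intro mult_right_mono sum_mono2) (auto simp: S2_def)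
    then have "(\<Sum>m\<in>S2. (c m)\<^sup>2 * area / (wavenum N m)\<^sup>2) \<le> C1\<^sup>2 * ln (real N / real L) + C2"
      using C1 C2 by (intro high_sum fin L(1) LN S2(1)) (auto simp: S2_def)
    also have "ln (real N / real L) \<le> ln (2 * R)" using NL N L(1) by (intro ln_mono) auto
    finally show ?thesis by (simp add: h_def mult_left_mono)
  qed
  have h0: "0 \<le> h" using hs by (rule order_trans[rotated]) (auto intro!: sum_nonneg simp: less_imp_le[OF area_pos])
  have hb: "(\<integral>\<^sup>+\<omega>. ennreal ((H s (trig_sum N S2 c) \<omega>)\<^sup>2) \<partial>M) \<le> ennreal h" if "0 \<le> s" for s
    using high_bound[OF fin(2) S2(2) that, of c] ennreal_leI[OF hs] by (rule order_trans)
  have "(\<integral>\<^sup>+\<omega>. ennreal ((H t p \<omega> - H 0 p \<omega>)\<^sup>2) \<partial>M) \<le> ennreal (4 * ((C1\<^sup>2 + lam\<^sup>2 * C1\<^sup>2) + C1\<^sup>2 + h + h))"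
  proof (rule nn_integral_square_sum4[OF Y(1,2)])
    show "H t (trig_sum N S2 c) \<in> borel_measurable M" "H 0 (trig_sum N S2 c) \<in> borel_measurable M"
      using t trig_sum_torus[OF N fin(2)] by (auto intro: H_measurable)
    show "AE \<omega> in M. H t p \<omega> - H 0 p \<omega> = Y1 \<omega> + Y2 \<omega> + H t (trig_sum N S2 c) \<omega> - H 0 (trig_sum N S2 c) \<omega>"
      using Y(3) H_dist
    proof eventually_elim
      case (elim \<omega>)
      have lin: "H s p \<omega> = H s (trig_sum N S1 c) \<omega> + H s (trig_sum N S2 c) \<omega>" if "0 \<le> s" for s
        unfolding pe using is_distribution_linear[OF elim(2)[rule_format, OF that] trig_sum_torus[OF N fin(1)] trig_sum_torus[OF N fin(2)], where a = 1 and b = 1] by simp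
      show ?case using elim(1) lin[OF t(1)] lin[of 0] by simp
    qed
    show "(\<integral>\<^sup>+\<omega>. ennreal ((Y1 \<omega>)\<^sup>2) \<partial>M) \<le> ennreal (C1\<^sup>2 + lam\<^sup>2 * C1\<^sup>2)"
      using Y(4) ennreal_leI[OF b1] by (rule order_trans)
    show "(\<integral>\<^sup>+\<omega>. ennreal ((Y2 \<omega>)\<^sup>2) \<partial>M) \<le> ennreal (C1\<^sup>2)"
      using Y(5) ennreal_leI[OF b2] by (rule order_trans)
  qed (use hb t h0 in auto)
  also have "4 * ((C1\<^sup>2 + lam\<^sup>2 * C1\<^sup>2) + C1\<^sup>2 + h + h) = 8 * C1\<^sup>2 + 4 * lam\<^sup>2 * C1\<^sup>2 + 8 * C1\<^sup>2 * ln (2 * R) + 8 * C2"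
    by (simp add: h_def algebra_simps)
  finally show ?thesis .
qed

text \<open>Trigonometric approximants of \<open>f\<close> in the \<open>C1\<close> norm satisfy
  \<open>increment_bound\<close> with constants depending only on integral norms of
  \<open>f\<close>. For almost every outcome the distribution is continuous in that norm, so the
  increments converge and Fatou's lemma transfers the bound to \<open>f\<close>.\<close>

lemma increment_bound_C1:
  assumes t: "0 \<le> t" "t \<le> R" and R: "1 \<le> R" "R \<le> real N" and f: "f \<in> torus_Ck N 1"
    and A: "torus_integral N (\<lambda>x. \<bar>f x\<bar>) \<le> A1" "torus_integral N (\<lambda>x. (f x)\<^sup>2) \<le> A2" "0 \<le> A1"
  defines "C1 \<equiv> 2 * (A1 + 1)" and "C2 \<equiv> 2 * A2 + 2"
  shows "(\<integral>\<^sup>+\<omega>. ennreal ((H t f \<omega> - H 0 f \<omega>)\<^sup>2) \<partial>M)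
    \<le> ennreal (8 * C1\<^sup>2 + 4 * lam\<^sup>2 * C1\<^sup>2 + 8 * C1\<^sup>2 * ln (2 * R) + 8 * C2)" (is "_ \<le> ?B")
proof -
  have fc: "continuous_on UNIV f" by (rule torus_Ck_continuous[OF f])
  have area1: "1 \<le> area"
  proof -
    have "1 \<le> (2 * pi * real N)" using N pi_gt3 mult_mono[of 1 "2 * pi" 1 "real N"] by simp
    then show ?thesis unfolding torus_area_def by (rule one_le_power)
  qed
  \<comment> \<open>Besides tending to zero, the precision must stay below one over the area, so
    that the integral norms of the approximants exceed those of \<open>f\<close> by bounded amounts
    whatever \<open>N\<close> is.\<close>
  define \<epsilon> where "\<epsilon> n = 1 / (area * (real n + 1))" for n :: nat
  have \<epsilon>: "0 < \<epsilon> n" "\<epsilon> n * area \<le> 1" "\<epsilon> n \<le> 1" for n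
  proof -
    show "0 < \<epsilon> n" using area_pos by (simp add: \<epsilon>_def)
    have "\<epsilon> n * area = 1 / (real n + 1)" using area_pos by (simp add: \<epsilon>_def)
    then show a: "\<epsilon> n * area \<le> 1" by simp
    have "\<epsilon> n * 1 \<le> \<epsilon> n * area" using \<open>0 < \<epsilon> n\<close> area1 by (intro mult_left_mono) auto
    then show "\<epsilon> n \<le> 1" using a by simp
  qed
  have "\<forall>n. \<exists>q. (\<forall>x. \<bar>trig_sum N (box_modes (fst q)) (snd q) x - f x\<bar> \<le> \<epsilon> n) \<and> (\<forall>x i. \<bar>partial i (trig_sum N (box_modes (fst q)) (snd q)) x - partial i f x\<bar> \<le> \<epsilon> n)"
  proof
    fix n
    obtain c K where "\<And>x. \<bar>(\<Sum>m\<in>box_modes K. c m * cas N m x) - f x\<bar> \<le> \<epsilon> n"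
      "\<And>x i. \<bar>partial i (\<lambda>x. \<Sum>m\<in>box_modes K. c m * cas N m x) x - partial i f x\<bar> \<le> \<epsilon> n"
      by (rule C1_approximation[OF N f \<epsilon>(1)[of n]]) (rule that)
    then show "\<exists>q. (\<forall>x. \<bar>trig_sum N (box_modes (fst q)) (snd q) x - f x\<bar> \<le> \<epsilon> n) \<and> (\<forall>x i. \<bar>partial i (trig_sum N (box_modes (fst q)) (snd q)) x - partial i f x\<bar> \<le> \<epsilon> n)"
      by (intro exI[of _ "(K, c)"]) (simp add: trig_sum_def[abs_def])
  qed
  from choice[OF this] obtain q where q: "\<forall>n. (\<forall>x. \<bar>trig_sum N (box_modes (fst (q n))) (snd (q n)) x - f x\<bar> \<le> \<epsilon> n) \<and> (\<forall>x i. \<bar>partial i (trig_sum N (box_modes (fst (q n))) (snd (q n))) x - partial i f x\<bar> \<le> \<epsilon> n)" ..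
  define K where "K n = fst (q n)" for n
  define c where "c n = snd (q n)" for n
  have Kc: "\<bar>trig_sum N (box_modes (K n)) (c n) x - f x\<bar> \<le> \<epsilon> n"
    "\<bar>partial i (trig_sum N (box_modes (K n)) (c n)) x - partial i f x\<bar> \<le> \<epsilon> n" for n x i
    using q by (auto simp: K_def c_def)
  define p where "p n = trig_sum N (box_modes (K n)) (c n)" for n
  have pC: "p n \<in> torus_Ck N k" for n k unfolding p_def by (rule trig_sum_torus[OF N finite_box_modes])
  have pc: "continuous_on UNIV (p n)" for n using torus_Ck_continuous[OF pC] .
  have PB: "(\<integral>\<^sup>+\<omega>. ennreal ((H t (p n) \<omega> - H 0 (p n) \<omega>)\<^sup>2) \<partial>M) \<le> ?B" for n
    unfolding p_def
  proof (rule increment_bound[OF t R])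
    show "\<bar>c n m\<bar> * area \<le> C1" if "m \<in> box_modes (K n)" for m
    proof -
      have "\<bar>c n m\<bar> * area = \<bar>torus_integral N (\<lambda>x. p n x * cas N m x)\<bar>"
        unfolding p_def trig_sum_coeff[OF N finite_box_modes that] using area_pos by (simp add: abs_mult)
      also have "\<dots> \<le> torus_integral N (\<lambda>x. \<bar>p n x * cas N m x\<bar>)"
        by (rule torus_integral_abs_le) (intro continuous_on_mult pc continuous_wave)
      also have "\<dots> \<le> torus_integral N (\<lambda>x. 2 * \<bar>f x\<bar> + (2 * \<epsilon> n) * 1)"
      proof (rule torus_integral_mono)
        show "continuous_on UNIV (\<lambda>x. \<bar>p n x * cas N m x\<bar>)" by (intro continuous_on_rabs continuous_on_mult pc continuous_wave)
        show "continuous_on UNIV (\<lambda>x. 2 * \<bar>f x\<bar> + (2 * \<epsilon> n) * 1)" by (intro continuous_intros fc)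
        fix x
        \<comment> \<open>The crude bound 2 on Hartley functions is the leading factor of
          \<open>C1\<close>; the 1 inside it is the approximation error integrated over the
          torus.\<close>
        have "\<bar>cas N m x\<bar> \<le> 2" unfolding wave_def using abs_cos_le_one[of "freq N m \<bullet> x"] abs_sin_le_one[of "freq N m \<bullet> x"] by linarith
        moreover have "\<bar>p n x\<bar> \<le> \<bar>f x\<bar> + \<epsilon> n" using Kc(1)[of n x] unfolding p_def by linarith
        ultimately have "\<bar>p n x * cas N m x\<bar> \<le> (\<bar>f x\<bar> + \<epsilon> n) * 2" unfolding abs_mult by (intro mult_mono) auto
        then show "\<bar>p n x * cas N m x\<bar> \<le> 2 * \<bar>f x\<bar> + (2 * \<epsilon> n) * 1" by simp
      qed
      also have "\<dots> = 2 * torus_integral N (\<lambda>x. \<bar>f x\<bar>) + 2 * (\<epsilon> n * area)"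
        by (subst torus_integral_linear) (auto intro!: continuous_intros fc simp: torus_integral_const)
      also have "\<dots> \<le> C1" using add_mono[OF A(1) \<epsilon>(2)[of n]] unfolding C1_def distrib_left[symmetric] by (rule mult_left_mono) simp
      finally show ?thesis .
    qed
    show "0 \<le> C1" using A(3) by (simp add: C1_def)
    have "(\<Sum>m\<in>box_modes (K n). (c n m)\<^sup>2) * area = torus_integral N (\<lambda>x. (p n x)\<^sup>2)"
      using trig_sum_product[OF N finite_box_modes, of "K n" "c n" "c n"] by (simp add: p_def power2_eq_square mult.commute)
    also have "\<dots> \<le> torus_integral N (\<lambda>x. 2 * (f x)\<^sup>2 + (2 * (\<epsilon> n)\<^sup>2) * 1)"
    proof (rule torus_integral_mono)
      show "continuous_on UNIV (\<lambda>x. (p n x)\<^sup>2)" by (intro continuous_on_power pc)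
      show "continuous_on UNIV (\<lambda>x. 2 * (f x)\<^sup>2 + (2 * (\<epsilon> n)\<^sup>2) * 1)" by (intro continuous_intros fc)
      fix x
      have "\<bar>p n x - f x\<bar> \<le> \<bar>\<epsilon> n\<bar>" using Kc(1)[of n x] \<epsilon>(1)[of n] unfolding p_def by simp
      then have d: "(p n x - f x)\<^sup>2 \<le> (\<epsilon> n)\<^sup>2" by (simp only: abs_le_square_iff)
      have "2 * (f x)\<^sup>2 + 2 * (p n x - f x)\<^sup>2 - (p n x)\<^sup>2 = (p n x - 2 * f x)\<^sup>2" by algebra
      then show "(p n x)\<^sup>2 \<le> 2 * (f x)\<^sup>2 + (2 * (\<epsilon> n)\<^sup>2) * 1" using d zero_le_power2[of "p n x - 2 * f x"] by linarith
    qed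
    also have "\<dots> = 2 * torus_integral N (\<lambda>x. (f x)\<^sup>2) + 2 * (\<epsilon> n * (\<epsilon> n * area))"
      by (subst torus_integral_linear) (auto intro!: continuous_intros fc simp: torus_integral_const power2_eq_square)
    also have "\<dots> \<le> C2"
    proof -
      have "\<epsilon> n * (\<epsilon> n * area) \<le> 1 * 1" using \<epsilon>[of n] area_pos by (intro mult_mono) auto
      then have "2 * torus_integral N (\<lambda>x. (f x)\<^sup>2) + 2 * (\<epsilon> n * (\<epsilon> n * area)) \<le> 2 * A2 + 2 * 1"
        by (intro add_mono mult_left_mono A) auto
      then show ?thesis by (simp add: C2_def)
    qed
    finally show "(\<Sum>m\<in>box_modes (K n). (c n m)\<^sup>2) * area \<le> C2" .
  qed
  have \<epsilon>0: "\<epsilon> \<longlonglongrightarrow> 0"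
  proof -
    have "(\<lambda>n. (1 / area) * inverse (real (Suc n))) \<longlonglongrightarrow> (1 / area) * 0"
      by (intro tendsto_mult tendsto_const LIMSEQ_inverse_real_of_nat)
    moreover have "\<epsilon> = (\<lambda>n. (1 / area) * inverse (real (Suc n)))" by (simp add: fun_eq_iff \<epsilon>_def field_simps)
    ultimately show ?thesis by simp
  qed
  have conv: "AE \<omega> in M. (\<lambda>n. H t (p n) \<omega> - H 0 (p n) \<omega>) \<longlonglongrightarrow> H t f \<omega> - H 0 f \<omega>"
    using H_dist
  proof eventually_elim
    case (elim \<omega>)
    have "(\<lambda>n. H s (p n) \<omega>) \<longlonglongrightarrow> H s f \<omega>" if s: "0 \<le> s" for s
    proof -
      have d: "is_distribution N (\<lambda>f. H s f \<omega>)" using elim s by simp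
      \<comment> \<open>The continuity constant depends on the outcome and on the time; this is
        harmless, since convergence is used only at times 0 and t for each fixed outcome.\<close>
      then obtain Cd where "\<forall>g\<in>torus_Ck N 1. \<forall>B. (\<forall>x. \<bar>g x\<bar> \<le> B \<and> (\<forall>i. \<bar>partial i g x\<bar> \<le> B)) \<longrightarrow> \<bar>H s g \<omega>\<bar> \<le> Cd * B"
        unfolding is_distribution_def by (elim conjE exE)
      then have Cd: "\<bar>H s g \<omega>\<bar> \<le> Cd * B" if "g \<in> torus_Ck N 1" "\<And>x. \<bar>g x\<bar> \<le> B" "\<And>x i. \<bar>partial i g x\<bar> \<le> B" for g B
        using that by simp
      have bound: "\<bar>H s (p n) \<omega> - H s f \<omega>\<bar> \<le> Cd * \<epsilon> n" for n
      proof -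
        let ?g = "\<lambda>x. 1 * p n x + (- 1) * f x"
        have gT: "?g \<in> torus_Ck N 1" by (rule torus_Ck_linear[OF pC f])
        have "H s ?g \<omega> = 1 * H s (p n) \<omega> + (- 1) * H s f \<omega>" by (rule is_distribution_linear[OF d pC f])
        moreover have "\<bar>H s ?g \<omega>\<bar> \<le> Cd * \<epsilon> n"
        proof (rule Cd[OF gT])
          show "\<bar>?g x\<bar> \<le> \<epsilon> n" for x using Kc(1)[of n x] by (simp add: p_def)
          show "\<bar>partial i ?g x\<bar> \<le> \<epsilon> n" for x i
          proof -
            have "p n differentiable (at x)" "f differentiable (at x)"
              using pC[of n 1] f by (auto simp: torus_Ck_def differentiable_on_def)
            from partial_linear[OF this, of i 1 "- 1"] show ?thesis using Kc(2)[of i n x] by (simp add: p_def)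
          qed
        qed
        ultimately show ?thesis by simp
      qed
      have "(\<lambda>n. Cd * \<epsilon> n) \<longlonglongrightarrow> 0" using tendsto_mult[OF tendsto_const \<epsilon>0, of Cd] by simp
      then have "(\<lambda>n. H s (p n) \<omega> - H s f \<omega>) \<longlonglongrightarrow> 0"
        by (rule Lim_null_comparison[rotated]) (use bound in auto)
      then show ?thesis by (rule LIM_zero_cancel)
    qed
    then show ?case using t by (intro tendsto_diff) auto
  qed
  have "(\<integral>\<^sup>+\<omega>. ennreal ((H t f \<omega> - H 0 f \<omega>)\<^sup>2) \<partial>M) = (\<integral>\<^sup>+\<omega>. liminf (\<lambda>n. ennreal ((H t (p n) \<omega> - H 0 (p n) \<omega>)\<^sup>2)) \<partial>M)"
  proof (rule nn_integral_cong_AE)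
    show "AE \<omega> in M. ennreal ((H t f \<omega> - H 0 f \<omega>)\<^sup>2) = liminf (\<lambda>n. ennreal ((H t (p n) \<omega> - H 0 (p n) \<omega>)\<^sup>2))"
      using conv
    proof eventually_elim
      case (elim \<omega>)
      have "(\<lambda>n. ennreal ((H t (p n) \<omega> - H 0 (p n) \<omega>)\<^sup>2)) \<longlonglongrightarrow> ennreal ((H t f \<omega> - H 0 f \<omega>)\<^sup>2)"
        by (intro tendsto_ennrealI tendsto_power elim)
      then show ?case by (rule lim_imp_Liminf[OF sequentially_bot, symmetric])
    qed
  qed
  also have "\<dots> \<le> liminf (\<lambda>n. \<integral>\<^sup>+\<omega>. ennreal ((H t (p n) \<omega> - H 0 (p n) \<omega>)\<^sup>2) \<partial>M)"
  proof (rule nn_integral_liminf)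
    have "H t (p n) \<in> borel_measurable M" "H 0 (p n) \<in> borel_measurable M" for n
      using t pC by (auto intro: H_measurable)
    then show "(\<lambda>\<omega>. ennreal ((H t (p n) \<omega> - H 0 (p n) \<omega>)\<^sup>2)) \<in> borel_measurable M" for n by measurable
  qed
  also have "\<dots> \<le> ?B" by (rule Liminf_le) (auto simp: PB)
  finally show ?thesis .
qed

end

text \<open>On the fundamental domain the periodised function is \<open>g\<close> itself, so its
  integral is a partial integral of a nonnegative function. The bound is uniform in
  \<open>N\<close>.\<close>

lemma torus_integral_to_torus_le:
  assumes N: "1 \<le> N" and g: "continuous_on UNIV g" "compact (closure {x. g x \<noteq> 0})" "\<And>x. 0 \<le> g x"
  shows "torus_integral N (to_torus N g) \<le> (LINT x|lborel. g x)"
proof -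
  have "integrable lborel (\<lambda>x. indicator (closure {x. g x \<noteq> 0}) x *\<^sub>R g x)"
    by (rule borel_integrable_compact[OF g(2)]) (rule continuous_on_subset[OF g(1)], simp)
  moreover have "(\<lambda>x. indicator (closure {x. g x \<noteq> 0}) x *\<^sub>R g x) = g"
    using closure_subset[of "{x. g x \<noteq> 0}"] by (auto simp: indicator_def fun_eq_iff)
  ultimately have i: "integrable lborel g" by simp
  have "torus_integral N (to_torus N g) = (LINT x|lborel. indicator (torus_box N) x *\<^sub>R g x)"
    unfolding torus_integral_def set_lebesgue_integral_def
    by (intro Bochner_Integration.integral_cong refl) (auto simp: indicator_def to_torus_wrap wrap_id[OF N])
  also have "\<dots> \<le> (LINT x|lborel. g x)"
  proof (rule integral_mono[OF _ i])
    show "integrable lborel (\<lambda>x. indicator (torus_box N) x *\<^sub>R g x)"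
      using integrable_mult_indicator[OF _ i, of "torus_box N"] by simp
    show "indicator (torus_box N) x *\<^sub>R g x \<le> g x" for x using g(3)[of x] by (auto simp: indicator_def)
  qed
  finally show ?thesis .
qed

theorem theorem1p5:
  fixes \<phi> :: "real^2 \<Rightarrow> real"
  assumes "test_function \<phi>"
  shows "\<exists>c>0. \<forall>lam>0. \<forall>(M :: nat \<Rightarrow> 'a measure) \<xi> \<eta> H.
     (\<forall>N\<ge>1. stationary_akpz_solution lam N (M N) (\<xi> N) (\<eta> N) (H N)) \<longrightarrow>
     (\<forall>t>0.
        limsup (\<lambda>N. \<integral>\<^sup>+\<omega>. ennreal ((H N t (to_torus N \<phi>) \<omega> - H N 0 (to_torus N \<phi>) \<omega>)\<^sup>2) \<partial>M N)
        \<le> ennreal (c * (1 + lam\<^sup>2) * max (ln t) 1))"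
proof -
  obtain N0 where N0: "\<And>N. N0 \<le> N \<Longrightarrow> 1 \<le> N \<and> to_torus N \<phi> \<in> torus_Ck N 1"
    using to_torus_test_function[OF assms] by blast
  have \<phi>: "continuous_on UNIV \<phi>" "compact (closure {x. \<phi> x \<noteq> 0})"
    using assms Ck_Suc_continuous by (auto simp: test_function_def simp del: Ck.simps)
  define A1 where "A1 = (LINT x|lborel. \<bar>\<phi> x\<bar>)"
  define A2 where "A2 = (LINT x|lborel. (\<phi> x)\<^sup>2)"
  have A: "0 \<le> A1" "0 \<le> A2" unfolding A1_def A2_def by (auto intro!: integral_nonneg_AE)
  define C1 where "C1 = 2 * (A1 + 1)"
  define C2 where "C2 = 2 * A2 + 2"
  \<comment> \<open>24 = 8 + 16: the 8 is the constant part of the bound and the 16 comes from 8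
    ln(2R) \<le> 16 max(ln t, 1). The remaining 4 \<lambda>^2 is absorbed by 24 \<lambda>^2.\<close>
  define c where "c = 24 * C1\<^sup>2 + 8 * C2"
  have c: "0 < c" using A by (simp add: c_def C2_def add_nonneg_pos)
  have L1: "torus_integral N (\<lambda>x. \<bar>to_torus N \<phi> x\<bar>) \<le> A1" if "1 \<le> N" for N
  proof -
    have "(\<lambda>x. \<bar>to_torus N \<phi> x\<bar>) = to_torus N (\<lambda>x. \<bar>\<phi> x\<bar>)" by (simp add: to_torus_wrap fun_eq_iff)
    moreover have "torus_integral N (to_torus N (\<lambda>x. \<bar>\<phi> x\<bar>)) \<le> A1"
      unfolding A1_def by (rule torus_integral_to_torus_le[OF that]) (use \<phi> in \<open>auto intro!: continuous_intros\<close>)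
    ultimately show ?thesis by simp
  qed
  have L2: "torus_integral N (\<lambda>x. (to_torus N \<phi> x)\<^sup>2) \<le> A2" if "1 \<le> N" for N
  proof -
    have "(\<lambda>x. (to_torus N \<phi> x)\<^sup>2) = to_torus N (\<lambda>x. (\<phi> x)\<^sup>2)" by (simp add: to_torus_wrap fun_eq_iff)
    moreover have "torus_integral N (to_torus N (\<lambda>x. (\<phi> x)\<^sup>2)) \<le> A2"
      unfolding A2_def by (rule torus_integral_to_torus_le[OF that]) (use \<phi> in \<open>auto intro!: continuous_intros\<close>)
    ultimately show ?thesis by simp
  qed
  show ?thesis
  proof (intro exI[of _ c] conjI allI impI c)
    fix lam t :: real and M :: "nat \<Rightarrow> 'a measure" and \<xi> \<eta> H
    assume sol: "\<forall>N\<ge>1. stationary_akpz_solution lam N (M N) (\<xi> N) (\<eta> N) (H N)" and t: "0 < t"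
    define R where "R = max t 1"
    define mx where "mx = max (ln t) 1"
    have R: "1 \<le> R" "t \<le> R" by (auto simp: R_def)
    \<comment> \<open>ln(2R) is at most 1 + max(ln t, 1), and the 1 is again at most the
      maximum.\<close>
    have lnR: "ln (2 * R) \<le> 2 * mx"
    proof -
      have "ln R \<le> mx"
      proof (cases "t \<le> 1")
        case True
        then have "R = 1" by (simp add: R_def)
        then show ?thesis by (simp add: mx_def)
      next
        case False
        then have "R = t" by (simp add: R_def)
        then show ?thesis by (simp add: mx_def)
      qed
      moreover have "ln 2 \<le> (1::real)" using ln_2_less_1 by simp
      moreover have "1 \<le> mx" by (simp add: mx_def)
      moreover have "ln (2 * R) = ln 2 + ln R" using R by (simp add: ln_mult)
      ultimately show ?thesis by linarith
    qed
    have final: "8 * C1\<^sup>2 + 4 * lam\<^sup>2 * C1\<^sup>2 + 8 * C1\<^sup>2 * ln (2 * R) + 8 * C2 \<le> c * (1 + lam\<^sup>2) * mx"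
    proof -
      have mx: "1 \<le> mx" by (simp add: mx_def)
      have nn: "0 \<le> C1\<^sup>2" "0 \<le> lam\<^sup>2 * C1\<^sup>2" "0 \<le> C2" "0 \<le> lam\<^sup>2 * C2" using A by (auto simp: C2_def)
      have "8 * C1\<^sup>2 * ln (2 * R) \<le> 8 * C1\<^sup>2 * (2 * mx)" using lnR by (intro mult_left_mono) auto
      then have "8 * C1\<^sup>2 + 4 * lam\<^sup>2 * C1\<^sup>2 + 8 * C1\<^sup>2 * ln (2 * R) + 8 * C2 \<le> (8 * C1\<^sup>2 + 4 * (lam\<^sup>2 * C1\<^sup>2) + 8 * C2) * 1 + 16 * C1\<^sup>2 * mx" by simp
      also have "\<dots> \<le> (8 * C1\<^sup>2 + 4 * (lam\<^sup>2 * C1\<^sup>2) + 8 * C2) * mx + 16 * C1\<^sup>2 * mx"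
        using mx nn by (intro add_right_mono mult_left_mono) auto
      also have "\<dots> = (24 * C1\<^sup>2 + 4 * (lam\<^sup>2 * C1\<^sup>2) + 8 * C2) * mx" by (simp add: algebra_simps)
      also have "\<dots> \<le> (24 * C1\<^sup>2 + 24 * (lam\<^sup>2 * C1\<^sup>2) + 8 * C2 + 8 * (lam\<^sup>2 * C2)) * mx"
        using mx nn by (intro mult_right_mono) auto
      also have "\<dots> = c * (1 + lam\<^sup>2) * mx" by (simp add: c_def algebra_simps)
      finally show ?thesis .
    qed
    show "limsup (\<lambda>N. \<integral>\<^sup>+\<omega>. ennreal ((H N t (to_torus N \<phi>) \<omega> - H N 0 (to_torus N \<phi>) \<omega>)\<^sup>2) \<partial>M N)
        \<le> ennreal (c * (1 + lam\<^sup>2) * max (ln t) 1)"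
    proof (rule Limsup_bounded)
      show "\<forall>\<^sub>F N in sequentially. (\<integral>\<^sup>+\<omega>. ennreal ((H N t (to_torus N \<phi>) \<omega> - H N 0 (to_torus N \<phi>) \<omega>)\<^sup>2) \<partial>M N)
        \<le> ennreal (c * (1 + lam\<^sup>2) * max (ln t) 1)"
        using eventually_ge_at_top[of N0] eventually_ge_at_top[of "nat \<lceil>R\<rceil>"]
      proof eventually_elim
        case (elim N)
        \<comment> \<open>Beyond N0 the periodised test function is of class \<open>C1\<close>, and
          beyond R the low-mode square has half-side at least 1.\<close>
        then have NN: "1 \<le> N" "to_torus N \<phi> \<in> torus_Ck N 1" "R \<le> real N" using N0 R by (auto simp: nat_ceiling_le_eq)
        interpret akpz lam N "M N" "\<xi> N" "\<eta> N" "H N"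
          by standard (use NN sol in auto)
        have "(\<integral>\<^sup>+\<omega>. ennreal ((H N t (to_torus N \<phi>) \<omega> - H N 0 (to_torus N \<phi>) \<omega>)\<^sup>2) \<partial>M N)
          \<le> ennreal (8 * C1\<^sup>2 + 4 * lam\<^sup>2 * C1\<^sup>2 + 8 * C1\<^sup>2 * ln (2 * R) + 8 * C2)"
          unfolding C1_def C2_def
          by (rule increment_bound_C1[OF _ R(2,1) NN(3) NN(2) L1[OF NN(1)] L2[OF NN(1)] A(1)]) (use t in simp)
        also have "\<dots> \<le> ennreal (c * (1 + lam\<^sup>2) * max (ln t) 1)"
          using final unfolding mx_def by (rule ennreal_leI)
        finally show ?case .
      qed
    qed
  qed
qed

end
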